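(* Let $\mathbb{K}$ be a commutative ring, $\mathbb{G}\subseteq\mathbb{R}$ a subgroup, $X$ a finite quasimetric space such that $d(x,y)\in\mathbb{G}\cup\{\infty\}$ for all points $x,y$, and $M$ a $\mathbb{G}$-graded distance module over $X$. Then for any $(n,\ell)\in\mathbb{Z}\times\mathbb{G}$ there are isomorphisms $$\mathrm{MH}_{n,\ell}(X,M)\cong\mathrm{Tor}^{\sigma X}_{n,\ell}(\bar M,S),\qquad \mathrm{MH}^{n,\ell}(X,M)\cong\mathrm{Ext}^{n,\ell}_{\sigma X}(S,\bar M).$$ In particular, $$\mathrm{MH}_{n,\ell}(X)\cong\mathrm{Tor}^{\sigma X}_{n,\ell}(S,S),\qquad \mathrm{MH}^{n,\ell}(X)\cong\mathrm{Ext}^{n,\ell}_{\sigma X}(S,S).$$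
   Context: Quasimetric space: a set $X$ with $d:X\times X\to[0,\infty]$ such that $d(x,y)+d(y,z)\ge d(x,z)$, and $d(x,y)=0$ iff $x=y$. Write $x\preccurlyeq y\preccurlyeq z$ if $d(x,y)+d(y,z)=d(x,z)$. Put $|x_0,\dots,x_n|=\sum_{i=0}^{n-1}d(x_i,x_{i+1})$. (Co)homology, Tor and Ext in negative degrees $n$ are zero. Graded modules: families $A=(A_g)_{g\in\mathbb{G}}$ of $\mathbb{K}$-modules; a morphism of degree $d$ is a family $A_g\to B_{g+d}$. Distance modules: a ($\mathbb{G}$-graded) distance module $M$ over $X$ consists of $\mathbb{G}$-graded $\mathbb{K}$-modules $M(x)$, $x\in X$, and morphisms $M(x,y):M(x)\to M(y)$ of degree $d(x,y)$ for each pair with $d(x,y)<\infty$, such that $M(x,x)=1$ and, whenever $d(x,y),d(y,z)<\infty$, $M(y,z)\circ M(x,y)=M(x,z)$ if $x\preccurlyeq y\preccurlyeq z$ and $=0$ otherwise. For $m\in M(x)$ write $m\cdot y:=M(x,y)(m)$. Distance algebra: $\sigma X$ is the $\mathbb{G}$-graded $\mathbb{K}$-algebra freely generated as a $\mathbb{K}$-module by pairs $(x,y)$ with $d(x,y)<\infty$, in degree $|(x,y)|=d(x,y)$, with product $(x,y)\cdot(y',z)=(x,z)$ if $y=y'$ and $x\preccurlyeq y\preccurlyeq z$, and $0$ otherwise; its unit is $\sum_x e_x$, $e_x=(x,x)$. $JX$ is the ideal generated by all pairs of positive degree, and $S=\sigma X/JX$, a graded left and right $\sigma X$-module. To $M$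 corresponds the graded right $\sigma X$-module $\bar M=\bigoplus_{x\in X}M(x)$ with $m\cdot(x,y)=m\cdot y$ for $m\in M(x)$, and $m\cdot(x,y)=0$ for $m\in M(x')$, $x'\ne x$. Bigraded Tor and Ext: for a $\mathbb{G}$-graded algebra $\Lambda$, right graded module $M$ and left graded module $N$, $(M\otimes_\Lambda N)_\ell$ is the quotient of $\bigoplus_{g+h=\ell}M_g\otimes N_h$ by the elements $ma\otimes n-m\otimes an$; for right graded modules $M,N$, $\mathrm{Hom}_\Lambda(M,N)_\ell$ is the module of $\Lambda$-linear families $M_g\to N_{g+\ell}$. $\mathrm{Tor}^\Lambda_{n,\ell}(M,N)=(L_n(-\otimes_\Lambda N))(M)_\ell$ and $\mathrm{Ext}_\Lambda^{n,\ell}(M,N)=((R^n\mathrm{Hom}_\Lambda(M,-))(N))_{-\ell}$, derived functors on the category of graded $\Lambda$-modules. In $\mathrm{Ext}$ above $S$ is a right module. Magnitude homology: $\mathrm{MH}_{n,\ell}(X,M)$ is the $n$-th homology of the simplicial $\mathbb{K}$-module $\widetilde{\mathrm{MC}}_{n,\ell}(X,M)=\bigoplus_{|x_0,\dots,x_n|<\infty}M(x_0)_{\ell-|x_0,\dots,x_n|}$, elements written $m\otimes(x_0,\dots,x_n)$, with faces: for $1\le i\le n-1$, $d_i(m\otimes(x_0,\dots,x_n))=m\otimes(x_0,\dots,\hat x_i,\dots,x_n)$ if $x_{i-1}\preccurlyeq x_i\preccurlyeq x_{i+1}$, else $0$; $d_0(m\otimes(x_0,\dots,x_n))=(m\cdot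 x_1)\otimes(x_1,\dots,x_n)$; $d_n(m\otimes(x_0,\dots,x_n))=m\otimes(x_0,\dots,x_{n-1})$ if $x_{n-1}=x_n$, else $0$; degeneracies double a point. Magnitude cohomology: $\mathrm{MH}^{n,\ell}(X,M)$ is the $n$-th cohomology of the cosimplicial module $\widetilde{\mathrm{MC}}^{n,\ell}(X,M)=\prod_{|x_0,\dots,x_n|<\infty}M(x_n)_{-\ell+|x_0,\dots,x_n|}$ with cofaces: for $0<i<n+1$, $d^i(\alpha)(x_0,\dots,x_{n+1})=\alpha(x_0,\dots,\hat x_i,\dots,x_{n+1})$ if $x_{i-1}\preccurlyeq x_i\preccurlyeq x_{i+1}$, else $0$; $d^0(\alpha)(x_0,\dots,x_{n+1})=\alpha(x_1,\dots,x_{n+1})$ if $x_0=x_1$, else $0$; $d^{n+1}(\alpha)(x_0,\dots,x_{n+1})=\alpha(x_0,\dots,x_n)\cdot x_{n+1}$; codegeneracies are dual to doubling a point. (Co)homology of a (co)simplicial module means that of its normalised, equivalently unnormalised, complex. Without coefficients: let $\widetilde{\mathrm{MC}}_{n,\ell}(X)$ be the free $\mathbb{K}$-module on tuples $(x_0,\dots,x_n)$ with $|x_0,\dots,x_n|=\ell$, with faces deleting the $i$-th point (tuples of length $<\ell$ are set to $0$) and degeneracies doubling a point; $\mathrm{MH}_{n,\ell}(X)$ is its homology and $\mathrm{MH}^{n,\ell}(X)$ the cohomology of $\mathrm{Hom}_{\mathbb{K}}(\widetilde{\mathrm{MC}}_{\bullet,\ell}(X),\mathbb{K})$. (These coincide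 with coefficients in the trivial distance module: $\mathbb{K}$ in degree $0$ at every point and zero maps for $x\neq y$.) *)

theory Defs
  imports
    "HOL-Algebra.AbelCoset"
    "HOL-Algebra.Module"
    "HOL-Library.Extended_Nonnegative_Real"
begin

section \<open>Modules over a commutative ring\<close>

text \<open>
  Modules are records of type \<^typ>\<open>('k, 'm) module\<close>. That record extends the record of rings;
  the locale \<^locale>\<open>Module.module\<close> says nothing about the multiplication and the unit, which are
  left undefined in the constructions below.
\<close>

definition K_linear ::
  "'k ring \<Rightarrow> ('k, 'a) module \<Rightarrow> ('k, 'b) module \<Rightarrow> ('a \<Rightarrow> 'b) \<Rightarrow> bool" where
  "K_linear K A B f \<longleftrightarrow>
     f \<in> carrier A \<rightarrow> carrier B \<and>
     (\<forall>x\<in>carrier A. \<forall>y\<in>carrier A. f (x \<oplus>\<^bsub>A\<^esub> y) = f x \<oplus>\<^bsub>B\<^esub> f y) \<and>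
     (\<forall>k\<in>carrier K. \<forall>x\<in>carrier A. f (k \<odot>\<^bsub>A\<^esub> x) = k \<odot>\<^bsub>B\<^esub> f x)"

definition mod_iso :: "'k ring \<Rightarrow> ('k, 'a) module \<Rightarrow> ('k, 'b) module \<Rightarrow> bool" where
  "mod_iso K A B \<longleftrightarrow> (\<exists>f. K_linear K A B f \<and> bij_betw f (carrier A) (carrier B))"

definition mod_span :: "'k ring \<Rightarrow> ('k, 'a) module \<Rightarrow> 'a set \<Rightarrow> 'a set" where
  "mod_span K A T = \<Inter> {H. submodule H K A \<and> T \<subseteq> H}"

definition quot_mod :: "('k, 'a) module \<Rightarrow> 'a set \<Rightarrow> ('k, 'a set) module" where
  "quot_mod A H =
     \<lparr>carrier = a_rcosets\<^bsub>A\<^esub> H, monoid.mult = undefined, one = undefined,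
      zero = H, add = (\<lambda>C D. C <+>\<^bsub>A\<^esub> D),
      smult = (\<lambda>k C. the_elem ((\<lambda>x. H +>\<^bsub>A\<^esub> (k \<odot>\<^bsub>A\<^esub> x)) ` C))\<rparr>"

text \<open>
  Products and direct sums follow \<open>product_group\<close> and \<open>sum_group\<close> of \<open>HOL-Algebra.Product_Groups\<close>:
  their elements are extensional functions on the index set.
\<close>

definition prod_mod :: "'i set \<Rightarrow> ('i \<Rightarrow> ('k, 'a) module) \<Rightarrow> ('k, 'i \<Rightarrow> 'a) module" where
  "prod_mod I A =
     \<lparr>carrier = (\<Pi>\<^sub>E i\<in>I. carrier (A i)), monoid.mult = undefined, one = undefined,
      zero = (\<lambda>i\<in>I. \<zero>\<^bsub>A i\<^esub>), add = (\<lambda>f g. \<lambda>i\<in>I. f i \<oplus>\<^bsub>A i\<^esub> g i),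
      smult = (\<lambda>k f. \<lambda>i\<in>I. k \<odot>\<^bsub>A i\<^esub> f i)\<rparr>"

definition sum_mod :: "'i set \<Rightarrow> ('i \<Rightarrow> ('k, 'a) module) \<Rightarrow> ('k, 'i \<Rightarrow> 'a) module" where
  "sum_mod I A =
     (prod_mod I A)\<lparr>carrier := {f \<in> (\<Pi>\<^sub>E i\<in>I. carrier (A i)). finite {i \<in> I. f i \<noteq> \<zero>\<^bsub>A i\<^esub>}}\<rparr>"

definition sum_incl :: "'i set \<Rightarrow> ('i \<Rightarrow> ('k, 'a) module) \<Rightarrow> 'i \<Rightarrow> 'a \<Rightarrow> 'i \<Rightarrow> 'a" where
  "sum_incl I A i a = (\<lambda>j\<in>I. if j = i then a else \<zero>\<^bsub>A j\<^esub>)"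

text \<open>The map out of \<^term>\<open>sum_mod I A\<close> into \<open>B\<close> that is given by \<open>\<phi> i\<close> on the summand \<open>i\<close>.\<close>

definition sum_ext ::
  "'i set \<Rightarrow> ('i \<Rightarrow> ('k, 'a) module) \<Rightarrow> ('k, 'b) module \<Rightarrow> ('i \<Rightarrow> 'a \<Rightarrow> 'b) \<Rightarrow> ('i \<Rightarrow> 'a) \<Rightarrow> 'b" where
  "sum_ext I A B \<phi> f = (\<Oplus>\<^bsub>B\<^esub> i\<in>{i \<in> I. f i \<noteq> \<zero>\<^bsub>A i\<^esub>}. \<phi> i (f i))"

definition ring_mod :: "'k ring \<Rightarrow> ('k, 'k) module" where
  "ring_mod K =
     \<lparr>carrier = carrier K, monoid.mult = monoid.mult K, one = \<one>\<^bsub>K\<^esub>,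
      zero = \<zero>\<^bsub>K\<^esub>, add = add K, smult = monoid.mult K\<rparr>"

definition free_mod :: "'k ring \<Rightarrow> 'i set \<Rightarrow> ('k, 'i \<Rightarrow> 'k) module" where
  "free_mod K I = sum_mod I (\<lambda>_. ring_mod K)"

definition basis_elt :: "'k ring \<Rightarrow> 'i set \<Rightarrow> 'i \<Rightarrow> 'i \<Rightarrow> 'k" where
  "basis_elt K I i = sum_incl I (\<lambda>_. ring_mod K) i \<one>\<^bsub>K\<^esub>"

definition lin_ext ::
  "'k ring \<Rightarrow> 'i set \<Rightarrow> ('k, 'b) module \<Rightarrow> ('i \<Rightarrow> 'b) \<Rightarrow> ('i \<Rightarrow> 'k) \<Rightarrow> 'b" where
  "lin_ext K I B \<phi> = sum_ext I (\<lambda>_. ring_mod K) B (\<lambda>i k. k \<odot>\<^bsub>B\<^esub> \<phi> i)"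

definition hom_mod :: "'k ring \<Rightarrow> ('k, 'a) module \<Rightarrow> ('k, 'b) module \<Rightarrow> ('k, 'a \<Rightarrow> 'b) module" where
  "hom_mod K A B =
     (prod_mod (carrier A) (\<lambda>_. B))
       \<lparr>carrier := {f \<in> carrier A \<rightarrow>\<^sub>E carrier B. K_linear K A B f}\<rparr>"

definition tensor_rel ::
  "'k ring \<Rightarrow> ('k, 'a) module \<Rightarrow> ('k, 'b) module \<Rightarrow> ('a \<times> 'b \<Rightarrow> 'k) set" where
  "tensor_rel K A B =
    (let F = free_mod K (carrier A \<times> carrier B);
         e = (\<lambda>a b. basis_elt K (carrier A \<times> carrier B) (a, b))
     in mod_span K F
      ({e (a \<oplus>\<^bsub>A\<^esub> a') b \<ominus>\<^bsub>F\<^esub> (e a b \<oplus>\<^bsub>F\<^esub> e a' b) | a a' b.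
          a \<in> carrier A \<and> a' \<in> carrier A \<and> b \<in> carrier B} \<union>
       {e a (b \<oplus>\<^bsub>B\<^esub> b') \<ominus>\<^bsub>F\<^esub> (e a b \<oplus>\<^bsub>F\<^esub> e a b') | a b b'.
          a \<in> carrier A \<and> b \<in> carrier B \<and> b' \<in> carrier B} \<union>
       {e (k \<odot>\<^bsub>A\<^esub> a) b \<ominus>\<^bsub>F\<^esub> (k \<odot>\<^bsub>F\<^esub> e a b) | k a b.
          k \<in> carrier K \<and> a \<in> carrier A \<and> b \<in> carrier B} \<union>
       {e a (k \<odot>\<^bsub>B\<^esub> b) \<ominus>\<^bsub>F\<^esub> (k \<odot>\<^bsub>F\<^esub> e a b) | k a b.
          k \<in> carrier K \<and> a \<in> carrier A \<and> b \<in> carrier B}))"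

definition tensor ::
  "'k ring \<Rightarrow> ('k, 'a) module \<Rightarrow> ('k, 'b) module \<Rightarrow> ('k, ('a \<times> 'b \<Rightarrow> 'k) set) module" where
  "tensor K A B = quot_mod (free_mod K (carrier A \<times> carrier B)) (tensor_rel K A B)"

definition pure_tensor ::
  "'k ring \<Rightarrow> ('k, 'a) module \<Rightarrow> ('k, 'b) module \<Rightarrow> 'a \<Rightarrow> 'b \<Rightarrow> ('a \<times> 'b \<Rightarrow> 'k) set" where
  "pure_tensor K A B a b =
     tensor_rel K A B +>\<^bsub>free_mod K (carrier A \<times> carrier B)\<^esub>
       basis_elt K (carrier A \<times> carrier B) (a, b)"

text \<open>The map \<open>A \<otimes> B \<rightarrow> A' \<otimes> B\<close> induced by a \<open>K\<close>-linear map \<open>\<phi> : A \<rightarrow> A'\<close>.\<close>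

definition tensor_map ::
  "'k ring \<Rightarrow> ('k, 'a) module \<Rightarrow> ('k, 'c) module \<Rightarrow> ('k, 'b) module \<Rightarrow> ('a \<Rightarrow> 'c) \<Rightarrow>
   ('a \<times> 'b \<Rightarrow> 'k) set \<Rightarrow> ('c \<times> 'b \<Rightarrow> 'k) set" where
  "tensor_map K A A' B \<phi> C =
     the_elem (lin_ext K (carrier A \<times> carrier B) (tensor K A' B)
                 (\<lambda>(a, b). pure_tensor K A' B (\<phi> a) b) ` C)"


section \<open>Homology and cohomology\<close>

text \<open>Here \<open>bd k\<close> maps \<open>C (k + 1)\<close> to \<open>C k\<close>, and \<open>cobd k\<close> maps \<open>C k\<close> to \<open>C (k + 1)\<close>.\<close>

definition cycles :: "(nat \<Rightarrow> ('k, 'c) module) \<Rightarrow> (nat \<Rightarrow> 'c \<Rightarrow> 'c) \<Rightarrow> nat \<Rightarrow> 'c set" where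
  "cycles C bd k =
     (case k of 0 \<Rightarrow> carrier (C 0) | Suc j \<Rightarrow> {c \<in> carrier (C k). bd j c = \<zero>\<^bsub>C j\<^esub>})"

definition homology ::
  "(nat \<Rightarrow> ('k, 'c) module) \<Rightarrow> (nat \<Rightarrow> 'c \<Rightarrow> 'c) \<Rightarrow> int \<Rightarrow> ('k, 'c set) module" where
  "homology C bd n =
     (if n < 0 then quot_mod (C 0) (carrier (C 0))
      else quot_mod ((C (nat n))\<lparr>carrier := cycles C bd (nat n)\<rparr>)
             (bd (nat n) ` carrier (C (Suc (nat n)))))"

definition coboundaries :: "(nat \<Rightarrow> ('k, 'c) module) \<Rightarrow> (nat \<Rightarrow> 'c \<Rightarrow> 'c) \<Rightarrow> nat \<Rightarrow> 'c set" where
  "coboundaries C cobd k =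
     (case k of 0 \<Rightarrow> {\<zero>\<^bsub>C 0\<^esub>} | Suc j \<Rightarrow> cobd j ` carrier (C j))"

definition cohomology ::
  "(nat \<Rightarrow> ('k, 'c) module) \<Rightarrow> (nat \<Rightarrow> 'c \<Rightarrow> 'c) \<Rightarrow> int \<Rightarrow> ('k, 'c set) module" where
  "cohomology C cobd n =
     (if n < 0 then quot_mod (C 0) (carrier (C 0))
      else quot_mod ((C (nat n))\<lparr>carrier :=
                 {c \<in> carrier (C (nat n)). cobd (nat n) c = \<zero>\<^bsub>C (Suc (nat n))\<^esub>}\<rparr>)
             (coboundaries C cobd (nat n)))"

text \<open>The alternating sum of the faces of a simplicial (or cosimplicial) module.\<close>

definition alt_sum :: "('k, 'a) module \<Rightarrow> nat \<Rightarrow> (nat \<Rightarrow> 'a) \<Rightarrow> 'a" where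
  "alt_sum A n f = (\<Oplus>\<^bsub>A\<^esub> i\<in>{..n}. if even i then f i else \<ominus>\<^bsub>A\<^esub> (f i))"


section \<open>Graded algebras and graded modules\<close>

text \<open>
  The grading group \<open>G\<close> is a subgroup of the additive group of reals. Graded objects are families
  indexed by all reals, of which only the members with index in \<open>G\<close> matter. Homogeneous elements
  of different degrees may have the same representation; so the operations take the degrees of
  their arguments as parameters.
\<close>

definition real_group :: "real monoid" where
  "real_group = \<lparr>carrier = UNIV, monoid.mult = (+), one = 0\<rparr>"

record ('k, 'l) graded_algebra =
  ga_comp :: "real \<Rightarrow> ('k, 'l) module"
  ga_mult :: "real \<Rightarrow> real \<Rightarrow> 'l \<Rightarrow> 'l \<Rightarrow> 'l"
  ga_one :: 'l

text \<open>
  For \<open>m\<close> of degree \<open>g\<close> and \<open>a\<close> of degree \<open>h\<close>, \<open>gm_act M g h m a\<close> is \<open>m a\<close> if \<open>M\<close> is a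
  right module, and \<open>a m\<close> if \<open>M\<close> is a left module.
\<close>

record ('k, 'l, 'm) graded_module =
  gm_comp :: "real \<Rightarrow> ('k, 'm) module"
  gm_act :: "real \<Rightarrow> real \<Rightarrow> 'm \<Rightarrow> 'l \<Rightarrow> 'm"

definition right_graded_module ::
  "'k ring \<Rightarrow> real set \<Rightarrow> ('k, 'l) graded_algebra \<Rightarrow> ('k, 'l, 'm) graded_module \<Rightarrow> bool" where
  "right_graded_module K G L M \<longleftrightarrow>
     (\<forall>g\<in>G. Module.module K (gm_comp M g)) \<and>
     (\<forall>g\<in>G. \<forall>h\<in>G. \<forall>a\<in>carrier (ga_comp L h).
        K_linear K (gm_comp M g) (gm_comp M (g + h)) (\<lambda>m. gm_act M g h m a)) \<and>
     (\<forall>g\<in>G. \<forall>h\<in>G. \<forall>m\<in>carrier (gm_comp M g).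
        K_linear K (ga_comp L h) (gm_comp M (g + h)) (\<lambda>a. gm_act M g h m a)) \<and>
     (\<forall>g\<in>G. \<forall>m\<in>carrier (gm_comp M g). gm_act M g 0 m (ga_one L) = m) \<and>
     (\<forall>g\<in>G. \<forall>h\<in>G. \<forall>k\<in>G. \<forall>m\<in>carrier (gm_comp M g).
        \<forall>a\<in>carrier (ga_comp L h). \<forall>b\<in>carrier (ga_comp L k).
          gm_act M (g + h) k (gm_act M g h m a) b = gm_act M g (h + k) m (ga_mult L h k a b))"

definition graded_hom ::
  "'k ring \<Rightarrow> real set \<Rightarrow> ('k, 'l) graded_algebra \<Rightarrow> real \<Rightarrow>
   ('k, 'l, 'm) graded_module \<Rightarrow> ('k, 'l, 'n) graded_module \<Rightarrow> (real \<Rightarrow> 'm \<Rightarrow> 'n) \<Rightarrow> bool" where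
  "graded_hom K G L l M N \<phi> \<longleftrightarrow>
     (\<forall>g\<in>G. K_linear K (gm_comp M g) (gm_comp N (g + l)) (\<phi> g)) \<and>
     (\<forall>g\<in>G. \<forall>h\<in>G. \<forall>m\<in>carrier (gm_comp M g). \<forall>a\<in>carrier (ga_comp L h).
        \<phi> (g + h) (gm_act M g h m a) = gm_act N (g + l) h (\<phi> g m) a)"

definition graded_ideal ::
  "'k ring \<Rightarrow> real set \<Rightarrow> ('k, 'l) graded_algebra \<Rightarrow> (real \<Rightarrow> 'l set) \<Rightarrow> bool" where
  "graded_ideal K G L I \<longleftrightarrow>
     (\<forall>g\<in>G. submodule (I g) K (ga_comp L g)) \<and>
     (\<forall>g\<in>G. \<forall>h\<in>G. \<forall>a\<in>carrier (ga_comp L g). \<forall>b\<in>I h.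
        ga_mult L g h a b \<in> I (g + h) \<and> ga_mult L h g b a \<in> I (h + g))"

definition gen_graded_ideal ::
  "'k ring \<Rightarrow> real set \<Rightarrow> ('k, 'l) graded_algebra \<Rightarrow> (real \<Rightarrow> 'l set) \<Rightarrow> real \<Rightarrow> 'l set" where
  "gen_graded_ideal K G L T g =
     \<Inter> {I g | I. graded_ideal K G L I \<and> (\<forall>h\<in>G. T h \<subseteq> I h)}"

definition right_quot ::
  "('k, 'l) graded_algebra \<Rightarrow> (real \<Rightarrow> 'l set) \<Rightarrow> ('k, 'l, 'l set) graded_module" where
  "right_quot L J =
     \<lparr>gm_comp = (\<lambda>g. quot_mod (ga_comp L g) (J g)),
      gm_act = (\<lambda>g h C a.
        the_elem ((\<lambda>s. J (g + h) +>\<^bsub>ga_comp L (g + h)\<^esub> ga_mult L g h s a) ` C))\<rparr>"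

definition left_quot ::
  "('k, 'l) graded_algebra \<Rightarrow> (real \<Rightarrow> 'l set) \<Rightarrow> ('k, 'l, 'l set) graded_module" where
  "left_quot L J =
     \<lparr>gm_comp = (\<lambda>g. quot_mod (ga_comp L g) (J g)),
      gm_act = (\<lambda>g h C a.
        the_elem ((\<lambda>s. J (h + g) +>\<^bsub>ga_comp L (h + g)\<^esub> ga_mult L h g a s) ` C))\<rparr>"


subsection \<open>Graded Hom and tensor product\<close>

definition graded_Hom ::
  "'k ring \<Rightarrow> real set \<Rightarrow> ('k, 'l) graded_algebra \<Rightarrow> ('k, 'l, 'm) graded_module \<Rightarrow>
   ('k, 'l, 'n) graded_module \<Rightarrow> real \<Rightarrow> ('k, real \<Rightarrow> 'm \<Rightarrow> 'n) module" where
  "graded_Hom K G L M N l =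
     (prod_mod G (\<lambda>g. hom_mod K (gm_comp M g) (gm_comp N (g + l))))
       \<lparr>carrier := {\<phi> \<in> (\<Pi>\<^sub>E g\<in>G. carrier (hom_mod K (gm_comp M g) (gm_comp N (g + l)))).
                     graded_hom K G L l M N \<phi>}\<rparr>"

text \<open>Composition with a morphism \<open>\<psi>\<close> of degree \<open>0\<close>, on the homomorphisms of degree \<open>l\<close>.\<close>

definition graded_Hom_map ::
  "real set \<Rightarrow> ('k, 'l, 'm) graded_module \<Rightarrow> real \<Rightarrow> (real \<Rightarrow> 'n \<Rightarrow> 'o) \<Rightarrow>
   (real \<Rightarrow> 'm \<Rightarrow> 'n) \<Rightarrow> (real \<Rightarrow> 'm \<Rightarrow> 'o)" where
  "graded_Hom_map G M l \<psi> \<phi> = (\<lambda>g\<in>G. \<lambda>m\<in>carrier (gm_comp M g). \<psi> (g + l) (\<phi> g m))"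

definition deg_pairs :: "real set \<Rightarrow> real \<Rightarrow> (real \<times> real) set" where
  "deg_pairs G l = {(g, h). g \<in> G \<and> h \<in> G \<and> g + h = l}"

abbreviation tensor_parts ::
  "'k ring \<Rightarrow> ('k, 'l, 'm) graded_module \<Rightarrow> ('k, 'l, 'n) graded_module \<Rightarrow>
   real \<times> real \<Rightarrow> ('k, ('m \<times> 'n \<Rightarrow> 'k) set) module" where
  "tensor_parts K M N \<equiv> (\<lambda>(g, h). tensor K (gm_comp M g) (gm_comp N h))"

text \<open>The direct sum of all \<open>M\<^sub>g \<otimes>\<^sub>K N\<^sub>h\<close> with \<open>g + h = l\<close>.\<close>

definition graded_tensor_sum ::
  "'k ring \<Rightarrow> real set \<Rightarrow> ('k, 'l, 'm) graded_module \<Rightarrow> ('k, 'l, 'n) graded_module \<Rightarrow> real \<Rightarrow>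
   ('k, real \<times> real \<Rightarrow> ('m \<times> 'n \<Rightarrow> 'k) set) module" where
  "graded_tensor_sum K G M N l = sum_mod (deg_pairs G l) (tensor_parts K M N)"

definition graded_tensor_rel ::
  "'k ring \<Rightarrow> real set \<Rightarrow> ('k, 'l) graded_algebra \<Rightarrow> ('k, 'l, 'm) graded_module \<Rightarrow>
   ('k, 'l, 'n) graded_module \<Rightarrow> real \<Rightarrow> (real \<times> real \<Rightarrow> ('m \<times> 'n \<Rightarrow> 'k) set) set" where
  "graded_tensor_rel K G L M N l =
     mod_span K (graded_tensor_sum K G M N l)
      {sum_incl (deg_pairs G l) (tensor_parts K M N) (g + h, k)
         (pure_tensor K (gm_comp M (g + h)) (gm_comp N k) (gm_act M g h m a) n)
       \<ominus>\<^bsub>graded_tensor_sum K G M N l\<^esub>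
       sum_incl (deg_pairs G l) (tensor_parts K M N) (g, h + k)
         (pure_tensor K (gm_comp M g) (gm_comp N (h + k)) m (gm_act N k h n a)) | g h k m a n.
       g \<in> G \<and> h \<in> G \<and> k \<in> G \<and> g + h + k = l \<and>
       m \<in> carrier (gm_comp M g) \<and> a \<in> carrier (ga_comp L h) \<and> n \<in> carrier (gm_comp N k)}"

text \<open>\<open>(M \<otimes> N)\<^sub>l\<close> for a right module \<open>M\<close> and a left module \<open>N\<close> over \<open>L\<close>.\<close>

definition graded_tensor ::
  "'k ring \<Rightarrow> real set \<Rightarrow> ('k, 'l) graded_algebra \<Rightarrow> ('k, 'l, 'm) graded_module \<Rightarrow>
   ('k, 'l, 'n) graded_module \<Rightarrow> real \<Rightarrow>
   ('k, (real \<times> real \<Rightarrow> ('m \<times> 'n \<Rightarrow> 'k) set) set) module" where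
  "graded_tensor K G L M N l =
     quot_mod (graded_tensor_sum K G M N l) (graded_tensor_rel K G L M N l)"

definition graded_tensor_map ::
  "'k ring \<Rightarrow> real set \<Rightarrow> ('k, 'l) graded_algebra \<Rightarrow> ('k, 'l, 'm) graded_module \<Rightarrow>
   ('k, 'l, 'o) graded_module \<Rightarrow> ('k, 'l, 'n) graded_module \<Rightarrow> real \<Rightarrow> (real \<Rightarrow> 'm \<Rightarrow> 'o) \<Rightarrow>
   (real \<times> real \<Rightarrow> ('m \<times> 'n \<Rightarrow> 'k) set) set \<Rightarrow> (real \<times> real \<Rightarrow> ('o \<times> 'n \<Rightarrow> 'k) set) set" where
  "graded_tensor_map K G L M M' N l \<phi> C =
     the_elem ((\<lambda>u. graded_tensor_rel K G L M' N l +>\<^bsub>graded_tensor_sum K G M' N l\<^esub>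
        (\<lambda>(g, h)\<in>deg_pairs G l.
           tensor_map K (gm_comp M g) (gm_comp M' g) (gm_comp N h) (\<phi> g) (u (g, h)))) ` C)"


subsection \<open>Projective and injective resolutions\<close>

text \<open>
  Projectivity and injectivity are the usual lifting properties in the category of graded right
  \<open>L\<close>-modules and morphisms of degree \<open>0\<close>. A formula of HOL cannot quantify over types; so the
  elements of the test modules \<open>A\<close> and \<open>B\<close> are taken from types depending on those of \<open>L\<close> and of
  the module tested. They are large enough for the lifting property against all modules of any type:

  \<^item> The type \<^typ>\<open>real \<times> 'p \<Rightarrow> 'l\<close> hosts the free graded module on the homogeneous
    elements of \<open>P\<close>. Lifting the identity of \<open>P\<close> to it makes \<open>P\<close> a direct summand of a free module.

  \<^item> The type \<^typ>\<open>real \<times> 'i \<Rightarrow> 'l\<close> also hosts all shifts of \<open>L\<close> and their graded right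
    ideals, to which Baer's criterion reduces injectivity.
\<close>

definition graded_projective ::
  "'k ring \<Rightarrow> real set \<Rightarrow> ('k, 'l) graded_algebra \<Rightarrow> ('k, 'l, 'p) graded_module \<Rightarrow> bool" where
  "graded_projective K G L P \<longleftrightarrow> right_graded_module K G L P \<and>
     (\<forall>(A :: ('k, 'l, real \<times> 'p \<Rightarrow> 'l) graded_module) (B :: ('k, 'l, 'p) graded_module) e f.
        right_graded_module K G L A \<and> right_graded_module K G L B \<and>
        graded_hom K G L 0 A B e \<and>
        (\<forall>g\<in>G. e g ` carrier (gm_comp A g) = carrier (gm_comp B g)) \<and>
        graded_hom K G L 0 P B f \<longrightarrow>
        (\<exists>s. graded_hom K G L 0 P A s \<and>
             (\<forall>g\<in>G. \<forall>p\<in>carrier (gm_comp P g). e g (s g p) = f g p)))"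

definition graded_injective ::
  "'k ring \<Rightarrow> real set \<Rightarrow> ('k, 'l) graded_algebra \<Rightarrow> ('k, 'l, 'i) graded_module \<Rightarrow> bool" where
  "graded_injective K G L I \<longleftrightarrow> right_graded_module K G L I \<and>
     (\<forall>(A :: ('k, 'l, real \<times> 'i \<Rightarrow> 'l) graded_module)
       (B :: ('k, 'l, real \<times> 'i \<Rightarrow> 'l) graded_module) e f.
        right_graded_module K G L A \<and> right_graded_module K G L B \<and>
        graded_hom K G L 0 A B e \<and>
        (\<forall>g\<in>G. inj_on (e g) (carrier (gm_comp A g))) \<and>
        graded_hom K G L 0 A I f \<longrightarrow>
        (\<exists>s. graded_hom K G L 0 B I s \<and>
             (\<forall>g\<in>G. \<forall>a\<in>carrier (gm_comp A g). s g (e g a) = f g a)))"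

text \<open>\<open>\<cdots> \<rightarrow> P 1 \<rightarrow> P 0 \<rightarrow> M \<rightarrow> 0\<close>, with maps \<open>bd k : P (k + 1) \<rightarrow> P k\<close> and \<open>aug : P 0 \<rightarrow> M\<close>.\<close>

definition projective_resolution ::
  "'k ring \<Rightarrow> real set \<Rightarrow> ('k, 'l) graded_algebra \<Rightarrow> ('k, 'l, 'm) graded_module \<Rightarrow>
   (nat \<Rightarrow> ('k, 'l, 'p) graded_module) \<Rightarrow> (nat \<Rightarrow> real \<Rightarrow> 'p \<Rightarrow> 'p) \<Rightarrow> (real \<Rightarrow> 'p \<Rightarrow> 'm) \<Rightarrow> bool"
  where
  "projective_resolution K G L M P bd aug \<longleftrightarrow>
     (\<forall>k. graded_projective K G L (P k)) \<and>
     (\<forall>k. graded_hom K G L 0 (P (Suc k)) (P k) (bd k)) \<and>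
     graded_hom K G L 0 (P 0) M aug \<and>
     (\<forall>g\<in>G. aug g ` carrier (gm_comp (P 0) g) = carrier (gm_comp M g)) \<and>
     (\<forall>g\<in>G. bd 0 g ` carrier (gm_comp (P 1) g)
        = {p \<in> carrier (gm_comp (P 0) g). aug g p = \<zero>\<^bsub>gm_comp M g\<^esub>}) \<and>
     (\<forall>k. \<forall>g\<in>G. bd (Suc k) g ` carrier (gm_comp (P (Suc (Suc k))) g)
        = {p \<in> carrier (gm_comp (P (Suc k)) g). bd k g p = \<zero>\<^bsub>gm_comp (P k) g\<^esub>})"

text \<open>\<open>0 \<rightarrow> M \<rightarrow> I 0 \<rightarrow> I 1 \<rightarrow> \<cdots>\<close>, with maps \<open>cobd k : I k \<rightarrow> I (k + 1)\<close> and \<open>coaug : M \<rightarrow> I 0\<close>.\<close>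

definition injective_resolution ::
  "'k ring \<Rightarrow> real set \<Rightarrow> ('k, 'l) graded_algebra \<Rightarrow> ('k, 'l, 'm) graded_module \<Rightarrow>
   (nat \<Rightarrow> ('k, 'l, 'i) graded_module) \<Rightarrow> (nat \<Rightarrow> real \<Rightarrow> 'i \<Rightarrow> 'i) \<Rightarrow> (real \<Rightarrow> 'm \<Rightarrow> 'i) \<Rightarrow> bool"
  where
  "injective_resolution K G L M I cobd coaug \<longleftrightarrow>
     (\<forall>k. graded_injective K G L (I k)) \<and>
     (\<forall>k. graded_hom K G L 0 (I k) (I (Suc k)) (cobd k)) \<and>
     graded_hom K G L 0 M (I 0) coaug \<and>
     (\<forall>g\<in>G. inj_on (coaug g) (carrier (gm_comp M g))) \<and>
     (\<forall>g\<in>G. coaug g ` carrier (gm_comp M g)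
        = {p \<in> carrier (gm_comp (I 0) g). cobd 0 g p = \<zero>\<^bsub>gm_comp (I 1) g\<^esub>}) \<and>
     (\<forall>k. \<forall>g\<in>G. cobd k g ` carrier (gm_comp (I k) g)
        = {p \<in> carrier (gm_comp (I (Suc k)) g).
             cobd (Suc k) g p = \<zero>\<^bsub>gm_comp (I (Suc (Suc k))) g\<^esub>})"

text \<open>
  Tor in bidegree \<open>(n, l)\<close>, computed with a projective resolution \<open>(P, bd)\<close> of the right module,
  and Ext in bidegree \<open>(n, l)\<close>, computed with an injective resolution \<open>(I, cobd)\<close> of the second
  argument. Ext in bidegree \<open>(n, l)\<close> is the part of degree \<open>- l\<close> of the \<open>n\<close>-th derived functor.
  The values do not depend on the resolution up to isomorphism; statements about Tor and Ext are to
  be made for all resolutions.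
\<close>

definition Tor_via ::
  "'k ring \<Rightarrow> real set \<Rightarrow> ('k, 'l) graded_algebra \<Rightarrow> (nat \<Rightarrow> ('k, 'l, 'p) graded_module) \<Rightarrow>
   (nat \<Rightarrow> real \<Rightarrow> 'p \<Rightarrow> 'p) \<Rightarrow> ('k, 'l, 'n) graded_module \<Rightarrow> int \<Rightarrow> real \<Rightarrow>
   ('k, (real \<times> real \<Rightarrow> ('p \<times> 'n \<Rightarrow> 'k) set) set set) module" where
  "Tor_via K G L P bd N n l =
     homology (\<lambda>k. graded_tensor K G L (P k) N l)
       (\<lambda>k. graded_tensor_map K G L (P (Suc k)) (P k) N l (bd k)) n"

definition Ext_via ::
  "'k ring \<Rightarrow> real set \<Rightarrow> ('k, 'l) graded_algebra \<Rightarrow> ('k, 'l, 'm) graded_module \<Rightarrow>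
   (nat \<Rightarrow> ('k, 'l, 'i) graded_module) \<Rightarrow> (nat \<Rightarrow> real \<Rightarrow> 'i \<Rightarrow> 'i) \<Rightarrow> int \<Rightarrow> real \<Rightarrow>
   ('k, (real \<Rightarrow> 'm \<Rightarrow> 'i) set) module" where
  "Ext_via K G L M I cobd n l =
     cohomology (\<lambda>k. graded_Hom K G L M (I k) (- l))
       (\<lambda>k. graded_Hom_map G M (- l) (cobd k)) n"


section \<open>Quasimetric spaces and distance modules\<close>

definition quasimetric :: "'x set \<Rightarrow> ('x \<Rightarrow> 'x \<Rightarrow> ennreal) \<Rightarrow> bool" where
  "quasimetric X d \<longleftrightarrow>
     (\<forall>x\<in>X. \<forall>y\<in>X. \<forall>z\<in>X. d x z \<le> d x y + d y z) \<and>
     (\<forall>x\<in>X. \<forall>y\<in>X. d x y = 0 \<longleftrightarrow> x = y)"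

definition between :: "('x \<Rightarrow> 'x \<Rightarrow> ennreal) \<Rightarrow> 'x \<Rightarrow> 'x \<Rightarrow> 'x \<Rightarrow> bool" where
  "between d x y z \<longleftrightarrow> d x y + d y z = d x z"

record ('x, 'k, 'm) dist_module =
  dm_comp :: "'x \<Rightarrow> real \<Rightarrow> ('k, 'm) module"
  dm_map :: "'x \<Rightarrow> 'x \<Rightarrow> real \<Rightarrow> 'm \<Rightarrow> 'm"

text \<open>\<open>dm_map M x y g\<close> is the part of \<open>M(x, y)\<close> in degree \<open>g\<close>.\<close>

definition distance_module ::
  "'k ring \<Rightarrow> real set \<Rightarrow> 'x set \<Rightarrow> ('x \<Rightarrow> 'x \<Rightarrow> ennreal) \<Rightarrow> ('x, 'k, 'm) dist_module \<Rightarrow> bool" where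
  "distance_module K G X d M \<longleftrightarrow>
     (\<forall>x\<in>X. \<forall>g\<in>G. Module.module K (dm_comp M x g)) \<and>
     (\<forall>x\<in>X. \<forall>y\<in>X. d x y < \<infinity> \<longrightarrow>
        (\<forall>g\<in>G. K_linear K (dm_comp M x g) (dm_comp M y (g + enn2real (d x y))) (dm_map M x y g))) \<and>
     (\<forall>x\<in>X. \<forall>g\<in>G. \<forall>m\<in>carrier (dm_comp M x g). dm_map M x x g m = m) \<and>
     (\<forall>x\<in>X. \<forall>y\<in>X. \<forall>z\<in>X. d x y < \<infinity> \<and> d y z < \<infinity> \<longrightarrow>
        (\<forall>g\<in>G. \<forall>m\<in>carrier (dm_comp M x g).
           dm_map M y z (g + enn2real (d x y)) (dm_map M x y g m) =
             (if between d x y z then dm_map M x z g m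
              else \<zero>\<^bsub>dm_comp M z (g + enn2real (d x y) + enn2real (d y z))\<^esub>)))"


subsection \<open>The distance algebra\<close>

definition pairs :: "'x set \<Rightarrow> ('x \<Rightarrow> 'x \<Rightarrow> ennreal) \<Rightarrow> real \<Rightarrow> ('x \<times> 'x) set" where
  "pairs X d g = {(x, y). x \<in> X \<and> y \<in> X \<and> d x y < \<infinity> \<and> enn2real (d x y) = g}"

definition pair_mult ::
  "'k ring \<Rightarrow> 'x set \<Rightarrow> ('x \<Rightarrow> 'x \<Rightarrow> ennreal) \<Rightarrow> real \<Rightarrow> 'x \<times> 'x \<Rightarrow> 'x \<times> 'x \<Rightarrow> 'x \<times> 'x \<Rightarrow> 'k" where
  "pair_mult K X d g p q =
     (if snd p = fst q \<and> between d (fst p) (snd p) (snd q)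
      then basis_elt K (pairs X d g) (fst p, snd q)
      else \<zero>\<^bsub>free_mod K (pairs X d g)\<^esub>)"

definition dist_algebra ::
  "'k ring \<Rightarrow> 'x set \<Rightarrow> ('x \<Rightarrow> 'x \<Rightarrow> ennreal) \<Rightarrow> ('k, 'x \<times> 'x \<Rightarrow> 'k) graded_algebra" where
  "dist_algebra K X d =
     \<lparr>ga_comp = (\<lambda>g. free_mod K (pairs X d g)),
      ga_mult = (\<lambda>g h a b.
        lin_ext K (pairs X d g) (free_mod K (pairs X d (g + h)))
          (\<lambda>p. lin_ext K (pairs X d h) (free_mod K (pairs X d (g + h)))
             (\<lambda>q. pair_mult K X d (g + h) p q) b) a),
      ga_one = (\<Oplus>\<^bsub>free_mod K (pairs X d 0)\<^esub> x\<in>X. basis_elt K (pairs X d 0) (x, x))\<rparr>"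

definition dist_ideal ::
  "'k ring \<Rightarrow> real set \<Rightarrow> 'x set \<Rightarrow> ('x \<Rightarrow> 'x \<Rightarrow> ennreal) \<Rightarrow> real \<Rightarrow> ('x \<times> 'x \<Rightarrow> 'k) set" where
  "dist_ideal K G X d =
     gen_graded_ideal K G (dist_algebra K X d)
       (\<lambda>g. if g > 0 then basis_elt K (pairs X d g) ` pairs X d g else {})"

abbreviation S_right ::
  "'k ring \<Rightarrow> real set \<Rightarrow> 'x set \<Rightarrow> ('x \<Rightarrow> 'x \<Rightarrow> ennreal) \<Rightarrow>
   ('k, 'x \<times> 'x \<Rightarrow> 'k, ('x \<times> 'x \<Rightarrow> 'k) set) graded_module" where
  "S_right K G X d \<equiv> right_quot (dist_algebra K X d) (dist_ideal K G X d)"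

abbreviation S_left ::
  "'k ring \<Rightarrow> real set \<Rightarrow> 'x set \<Rightarrow> ('x \<Rightarrow> 'x \<Rightarrow> ennreal) \<Rightarrow>
   ('k, 'x \<times> 'x \<Rightarrow> 'k, ('x \<times> 'x \<Rightarrow> 'k) set) graded_module" where
  "S_left K G X d \<equiv> left_quot (dist_algebra K X d) (dist_ideal K G X d)"

definition bar_module ::
  "'k ring \<Rightarrow> 'x set \<Rightarrow> ('x \<Rightarrow> 'x \<Rightarrow> ennreal) \<Rightarrow> ('x, 'k, 'm) dist_module \<Rightarrow>
   ('k, 'x \<times> 'x \<Rightarrow> 'k, 'x \<Rightarrow> 'm) graded_module" where
  "bar_module K X d M =
     \<lparr>gm_comp = (\<lambda>g. sum_mod X (\<lambda>x. dm_comp M x g)),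
      gm_act = (\<lambda>g h m a.
        lin_ext K (pairs X d h) (sum_mod X (\<lambda>x. dm_comp M x (g + h)))
          (\<lambda>(x, y). sum_incl X (\<lambda>x. dm_comp M x (g + h)) y (dm_map M x y g (m x))) a)\<rparr>"


section \<open>Magnitude homology and cohomology\<close>

text \<open>
  The point \<open>x\<^sub>i\<close> of a tuple \<open>xs = (x\<^sub>0, \<dots>, x\<^sub>n)\<close> is \<open>xs ! i\<close>. (Co)homology is that of the
  unnormalised complex, with the alternating sum of the (co)faces as differential; it does not
  involve the (co)degeneracies.
\<close>

definition path_length :: "('x \<Rightarrow> 'x \<Rightarrow> ennreal) \<Rightarrow> 'x list \<Rightarrow> ennreal" where
  "path_length d xs = (\<Sum>i<length xs - 1. d (xs ! i) (xs ! Suc i))"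

abbreviation path_deg :: "('x \<Rightarrow> 'x \<Rightarrow> ennreal) \<Rightarrow> 'x list \<Rightarrow> real" where
  "path_deg d xs \<equiv> enn2real (path_length d xs)"

definition tuples :: "'x set \<Rightarrow> ('x \<Rightarrow> 'x \<Rightarrow> ennreal) \<Rightarrow> nat \<Rightarrow> 'x list set" where
  "tuples X d n = {xs. length xs = Suc n \<and> set xs \<subseteq> X \<and> path_length d xs < \<infinity>}"

definition omit :: "nat \<Rightarrow> 'x list \<Rightarrow> 'x list" where
  "omit i xs = take i xs @ drop (Suc i) xs"


subsection \<open>Homology with coefficients\<close>

abbreviation MC_part ::
  "('x \<Rightarrow> 'x \<Rightarrow> ennreal) \<Rightarrow> ('x, 'k, 'm) dist_module \<Rightarrow> real \<Rightarrow> 'x list \<Rightarrow> ('k, 'm) module" where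
  "MC_part d M l xs \<equiv> dm_comp M (xs ! 0) (l - path_deg d xs)"

definition MC ::
  "'x set \<Rightarrow> ('x \<Rightarrow> 'x \<Rightarrow> ennreal) \<Rightarrow> ('x, 'k, 'm) dist_module \<Rightarrow> real \<Rightarrow> nat \<Rightarrow>
   ('k, 'x list \<Rightarrow> 'm) module" where
  "MC X d M l n = sum_mod (tuples X d n) (MC_part d M l)"

text \<open>The face \<open>d\<^sub>i(m \<otimes> xs)\<close>, where \<open>xs\<close> has \<open>n + 2\<close> points.\<close>

definition MC_face ::
  "'x set \<Rightarrow> ('x \<Rightarrow> 'x \<Rightarrow> ennreal) \<Rightarrow> ('x, 'k, 'm) dist_module \<Rightarrow> real \<Rightarrow> nat \<Rightarrow> nat \<Rightarrow>
   'x list \<Rightarrow> 'm \<Rightarrow> 'x list \<Rightarrow> 'm" where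
  "MC_face X d M l n i xs m =
     (let elt = sum_incl (tuples X d n) (MC_part d M l) in
      if i = 0 then elt (omit 0 xs) (dm_map M (xs ! 0) (xs ! 1) (l - path_deg d xs) m)
      else if i \<le> n then
        (if between d (xs ! (i - 1)) (xs ! i) (xs ! (i + 1)) then elt (omit i xs) m
         else \<zero>\<^bsub>MC X d M l n\<^esub>)
      else (if xs ! n = xs ! (n + 1) then elt (omit (n + 1) xs) m else \<zero>\<^bsub>MC X d M l n\<^esub>))"

definition MC_bd ::
  "'x set \<Rightarrow> ('x \<Rightarrow> 'x \<Rightarrow> ennreal) \<Rightarrow> ('x, 'k, 'm) dist_module \<Rightarrow> real \<Rightarrow> nat \<Rightarrow>
   ('x list \<Rightarrow> 'm) \<Rightarrow> 'x list \<Rightarrow> 'm" where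
  "MC_bd X d M l n c =
     alt_sum (MC X d M l n) (Suc n)
       (\<lambda>i. sum_ext (tuples X d (Suc n)) (MC_part d M l) (MC X d M l n) (MC_face X d M l n i) c)"

definition MH ::
  "'x set \<Rightarrow> ('x \<Rightarrow> 'x \<Rightarrow> ennreal) \<Rightarrow> ('x, 'k, 'm) dist_module \<Rightarrow> int \<Rightarrow> real \<Rightarrow>
   ('k, ('x list \<Rightarrow> 'm) set) module" where
  "MH X d M n l = homology (MC X d M l) (MC_bd X d M l) n"


subsection \<open>Cohomology with coefficients\<close>

abbreviation coMC_part ::
  "('x \<Rightarrow> 'x \<Rightarrow> ennreal) \<Rightarrow> ('x, 'k, 'm) dist_module \<Rightarrow> real \<Rightarrow> 'x list \<Rightarrow> ('k, 'm) module" where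
  "coMC_part d M l xs \<equiv> dm_comp M (last xs) (- l + path_deg d xs)"

definition coMC ::
  "'x set \<Rightarrow> ('x \<Rightarrow> 'x \<Rightarrow> ennreal) \<Rightarrow> ('x, 'k, 'm) dist_module \<Rightarrow> real \<Rightarrow> nat \<Rightarrow>
   ('k, 'x list \<Rightarrow> 'm) module" where
  "coMC X d M l n = prod_mod (tuples X d n) (coMC_part d M l)"

definition coMC_coface ::
  "'x set \<Rightarrow> ('x \<Rightarrow> 'x \<Rightarrow> ennreal) \<Rightarrow> ('x, 'k, 'm) dist_module \<Rightarrow> real \<Rightarrow> nat \<Rightarrow> nat \<Rightarrow>
   ('x list \<Rightarrow> 'm) \<Rightarrow> 'x list \<Rightarrow> 'm" where
  "coMC_coface X d M l n i \<alpha> =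
     (\<lambda>xs\<in>tuples X d (Suc n).
        if i = 0 then (if xs ! 0 = xs ! 1 then \<alpha> (omit 0 xs) else \<zero>\<^bsub>coMC_part d M l xs\<^esub>)
        else if i \<le> n then
          (if between d (xs ! (i - 1)) (xs ! i) (xs ! (i + 1)) then \<alpha> (omit i xs)
           else \<zero>\<^bsub>coMC_part d M l xs\<^esub>)
        else dm_map M (xs ! n) (xs ! (n + 1)) (- l + path_deg d (omit (n + 1) xs))
               (\<alpha> (omit (n + 1) xs)))"

definition coMC_cobd ::
  "'x set \<Rightarrow> ('x \<Rightarrow> 'x \<Rightarrow> ennreal) \<Rightarrow> ('x, 'k, 'm) dist_module \<Rightarrow> real \<Rightarrow> nat \<Rightarrow>
   ('x list \<Rightarrow> 'm) \<Rightarrow> 'x list \<Rightarrow> 'm" where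
  "coMC_cobd X d M l n \<alpha> =
     alt_sum (coMC X d M l (Suc n)) (Suc n) (\<lambda>i. coMC_coface X d M l n i \<alpha>)"

definition coMH ::
  "'x set \<Rightarrow> ('x \<Rightarrow> 'x \<Rightarrow> ennreal) \<Rightarrow> ('x, 'k, 'm) dist_module \<Rightarrow> int \<Rightarrow> real \<Rightarrow>
   ('k, ('x list \<Rightarrow> 'm) set) module" where
  "coMH X d M n l = cohomology (coMC X d M l) (coMC_cobd X d M l) n"


subsection \<open>Without coefficients\<close>

definition tuples_of_length :: "'x set \<Rightarrow> ('x \<Rightarrow> 'x \<Rightarrow> ennreal) \<Rightarrow> real \<Rightarrow> nat \<Rightarrow> 'x list set" where
  "tuples_of_length X d l n = {xs \<in> tuples X d n. path_deg d xs = l}"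

definition MC0 ::
  "'k ring \<Rightarrow> 'x set \<Rightarrow> ('x \<Rightarrow> 'x \<Rightarrow> ennreal) \<Rightarrow> real \<Rightarrow> nat \<Rightarrow> ('k, 'x list \<Rightarrow> 'k) module" where
  "MC0 K X d l n = free_mod K (tuples_of_length X d l n)"

definition MC0_face ::
  "'k ring \<Rightarrow> 'x set \<Rightarrow> ('x \<Rightarrow> 'x \<Rightarrow> ennreal) \<Rightarrow> real \<Rightarrow> nat \<Rightarrow> nat \<Rightarrow> 'x list \<Rightarrow> 'x list \<Rightarrow> 'k" where
  "MC0_face K X d l n i xs =
     (if path_length d (omit i xs) < path_length d xs then \<zero>\<^bsub>MC0 K X d l n\<^esub>
      else basis_elt K (tuples_of_length X d l n) (omit i xs))"

definition MC0_bd ::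
  "'k ring \<Rightarrow> 'x set \<Rightarrow> ('x \<Rightarrow> 'x \<Rightarrow> ennreal) \<Rightarrow> real \<Rightarrow> nat \<Rightarrow> ('x list \<Rightarrow> 'k) \<Rightarrow> 'x list \<Rightarrow> 'k" where
  "MC0_bd K X d l n c =
     alt_sum (MC0 K X d l n) (Suc n)
       (\<lambda>i. lin_ext K (tuples_of_length X d l (Suc n)) (MC0 K X d l n) (MC0_face K X d l n i) c)"

definition MH0 ::
  "'k ring \<Rightarrow> 'x set \<Rightarrow> ('x \<Rightarrow> 'x \<Rightarrow> ennreal) \<Rightarrow> int \<Rightarrow> real \<Rightarrow> ('k, ('x list \<Rightarrow> 'k) set) module" where
  "MH0 K X d n l = homology (MC0 K X d l) (MC0_bd K X d l) n"

definition coMH0 ::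
  "'k ring \<Rightarrow> 'x set \<Rightarrow> ('x \<Rightarrow> 'x \<Rightarrow> ennreal) \<Rightarrow> int \<Rightarrow> real \<Rightarrow>
   ('k, (('x list \<Rightarrow> 'k) \<Rightarrow> 'k) set) module" where
  "coMH0 K X d n l =
     cohomology (\<lambda>k. hom_mod K (MC0 K X d l k) (ring_mod K))
       (\<lambda>k f. \<lambda>c\<in>carrier (MC0 K X d l (Suc k)). f (MC0_bd K X d l k c)) n"

end

theory Submission imports Defs
begin

text \<open>
  A distance module is the same thing as a graded right module over the distance algebra: \<open>\<oplus>\<^sub>x M(x)\<close> one
  way, \<open>P \<mapsto> (P e\<^sub>x)\<^sub>x\<close> the other. So a projective resolution of the module of \<open>M\<close> is a resolution \<open>P\<^sub>k\<close>
  of \<open>M\<close> by distance modules. Magnitude chains are exact in the coefficients. If \<open>P\<close> is projective, a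
  section of the action map \<open>\<Oplus>\<^sub>y P(y) \<otimes> (y, x) \<rightarrow> P(x)\<close> gives a contraction of its magnitude
  complex in positive degrees, and in degree \<open>0\<close> the homology is \<open>P \<otimes> S\<close>, because the boundary of
  \<open>p \<otimes> (x, y)\<close> is \<open>p (x, y)\<close> for \<open>x \<noteq> y\<close>. Hence the double complex of the magnitude chains of all \<open>P\<^sub>k\<close>
  computes both magnitude homology and Tor. The dual argument, with coinduced modules and
  \<open>Hom(S, I) = {i. i J = 0}\<close>, gives Ext. Without coefficients, take the trivial distance module, whose
  right module is \<open>S\<close>.
\<close>

text \<open>Tor and Ext are to be computed with whatever resolution is given, on whatever type its
  elements have. So the double complex is built from the given resolution, without comparing it with
  a convenient one. What is needed of a projective \<open>P\<close> is that it splits off the module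
  induced from its components \<open>P e_x\<close>, which means lifting the identity along one
  surjection. The elements of that induced module are functions \<open>'x => 'x => 'p\<close>,
  whereas projectivity tests only modules on one fixed type; hence the transport along an injection
  of types, available as soon as \<open>'k\<close> has two elements. With one element, every module
  is zero.

  The double complex is never totalised. Its two edges are joined by spans of linear maps, each
  moving a subquotient one place along a diagonal, so that no lifts are chosen.

  The role of \<open>S\<close> rests on one fact: a pair has degree 0 only if its points coincide.
  So \<open>JX\<close> is zero in degree 0 and everything in the other degrees.\<close>

abbreviation carrier_mem :: "'a => ('a, 'b) partial_object_scheme => bool" (infix "\<in>." 50) where
 "x \<in>. A \<equiv> x \<in> carrier A"

section \<open>Modules, subquotients and linear maps\<close>

text \<open>Closure under negatives comes from multiplication by \<open>\<ominus> \<one>\<close>;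
  the remaining conditions are the ones that images, preimages and spans supply directly.\<close>

lemma (in Module.module) submoduleI':
 assumes "H \<subseteq> carrier M" "zero M \<in> H"
  and "!!a b. a \<in> H ==> b \<in> H ==> a \<oplus>\<^bsub>M\<^esub> b \<in> H"
  and smult: "!!k a. k \<in>. R ==> a \<in> H ==> k \<odot>\<^bsub>M\<^esub> a \<in> H"
 shows "submodule H R M"
proof (rule submoduleI)
 fix a assume "a \<in> H"
 then have "\<ominus>\<^bsub>M\<^esub> a = (\<ominus> \<one>) \<odot>\<^bsub>M\<^esub> a"
  using assms(1) by (simp add: smult_l_minus subset_eq)
 then show "\<ominus>\<^bsub>M\<^esub> a \<in> H"
  using smult[OF _ \<open>a \<in> H\<close>] by simp
qed (use assms in auto)

lemma submodule_module: "Module.module K A ==> submodule U K A ==> Module.module K (A\<lparr>carrier := U\<rparr>)"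
 by (rule submodule.submodule_is_module)

lemma (in Module.module) minus_zero [simp]: "\<ominus>\<^bsub>M\<^esub> (zero M) = zero M"
 by (rule M.minus_equality) simp_all

section \<open>Linear maps with their images, preimages and kernels\<close>

locale linear_map = dom: Module.module K A + cod: Module.module K B
 for K :: "'k ring" and A :: "('k, 'a) module" and B :: "('k, 'b) module" +
 fixes f :: "'a => 'b"
 assumes linear: "K_linear K A B f"
begin

lemma closed: "x \<in>. A ==> f x \<in>. B"
 using linear by (auto simp: K_linear_def)

lemma add: "x \<in>. A ==> y \<in>. A ==> f (x \<oplus>\<^bsub>A\<^esub> y) = f x \<oplus>\<^bsub>B\<^esub> f y"
 using linear by (auto simp: K_linear_def)

lemma smult: "k \<in>. K ==> x \<in>. A ==> f (k \<odot>\<^bsub>A\<^esub> x) = k \<odot>\<^bsub>B\<^esub> f x"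
 using linear by (auto simp: K_linear_def)

lemma zero: "f (zero A) = zero B"
 using add[of "zero A" "zero A"] closed[of "zero A"]
 by (metis cod.M.add.l_cancel_one' dom.M.l_zero dom.M.zero_closed)

lemma minus: "x \<in>. A ==> f (\<ominus>\<^bsub>A\<^esub> x) = \<ominus>\<^bsub>B\<^esub> f x"
 by (metis add closed cod.M.minus_equality dom.M.a_inv_closed dom.M.l_neg zero)

lemma diff: "x \<in>. A ==> y \<in>. A ==> f (x \<ominus>\<^bsub>A\<^esub> y) = f x \<ominus>\<^bsub>B\<^esub> f y"
 by (simp add: a_minus_def add minus)

lemma finsum:
 assumes "g \<in> S \<rightarrow> carrier A"
 shows "f (finsum A g S) = finsum B (%i. f (g i)) S"
 using assms
proof (induction S rule: infinite_finite_induct)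
 case (insert i S)
 moreover have "(%i. f (g i)) \<in> S \<rightarrow> carrier B" using insert closed by auto
 ultimately show ?case
  using closed by (simp add: add dom.M.finsum_closed Pi_iff)
qed (simp_all add: zero)

lemma image_submodule: "submodule U K A ==> submodule (f ` U) K B"
proof (rule cod.submoduleI')
 assume U: "submodule U K A"
 note sub = dom.submoduleE[OF U]
 have z: "zero A \<in> U" using U by (simp add: submodule_def subgroup_def)
 show "f ` U \<subseteq> carrier B" using sub(1) closed by auto
 show "zero B \<in> f ` U" using z zero by (metis imageI)
 show "a \<oplus>\<^bsub>B\<^esub> b \<in> f ` U" if ab: "a \<in> f ` U" "b \<in> f ` U" for a b
 proof -
  obtain x y where xy: "x \<in> U" "y \<in> U" "a = f x" "b = f y" using ab by auto
  then have "x \<in>. A" "y \<in>. A" using sub(1) by auto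
  then have "a \<oplus>\<^bsub>B\<^esub> b = f (x \<oplus>\<^bsub>A\<^esub> y)" using add xy by simp
  then show ?thesis using sub(5) xy by blast
 qed
 show "k \<odot>\<^bsub>B\<^esub> a \<in> f ` U" if ka: "k \<in>. K" "a \<in> f ` U" for k a
 proof -
  obtain x where x: "x \<in> U" "a = f x" using ka by auto
  then have "x \<in>. A" using sub(1) by auto
  then have "k \<odot>\<^bsub>B\<^esub> a = f (k \<odot>\<^bsub>A\<^esub> x)" using smult ka x by simp
  then show ?thesis using sub(4) x ka by blast
 qed
qed

lemma vimage_submodule: "submodule V K B ==> submodule {x \<in> carrier A. f x \<in> V} K A"
proof (rule dom.submoduleI')
 assume V: "submodule V K B"
 note sub = cod.submoduleE[OF V]
 have z: "zero B \<in> V" using V by (simp add: submodule_def subgroup_def)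
 show "zero A \<in> {x \<in> carrier A. f x \<in> V}" using z zero by simp
qed (auto simp: cod.submoduleE add smult)

end

lemma submodule_zero: "Module.module K A ==> submodule {(zero A)} K A"
proof -
 assume "Module.module K A"
 then interpret Module.module K A .
 show ?thesis by (rule submoduleI') auto
qed

lemma (in linear_map) kernel_submodule: "submodule {x \<in> carrier A. f x = zero B} K A"
 using vimage_submodule[OF submodule_zero[OF cod.module_axioms]] by simp

lemma submodule_Int:
 assumes "Module.module K A" "submodule U K A" "submodule V K A"
 shows "submodule (U \<inter> V) K A"
proof -
 interpret Module.module K A by fact
 show ?thesis
  using assms(2,3) submoduleE[OF assms(2)] submoduleE[OF assms(3)]
  by (intro submoduleI') (auto simp: submodule_def subgroup_def)
qed

text \<open>Homology is a quotient of the record whose carrier is cut down to the cycles, so the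
  boundaries have to be a submodule of that record.\<close>

lemma submodule_restrict:
 assumes "Module.module K A" "submodule H K A" "submodule U K A" "H \<subseteq> U"
 shows "submodule H K (A\<lparr>carrier := U\<rparr>)"
proof -
 interpret Module.module K "A\<lparr>carrier := U\<rparr>" using assms by (simp add: submodule_module)
 show ?thesis
  using assms(2,4) Module.module.submoduleE[OF assms(1,2)]
  by (intro submoduleI') (auto simp: submodule_def subgroup_def)
qed


subsection \<open>Quotients\<close>

locale quotient_module = Module.module K A for K :: "'k ring" and A :: "('k, 'a) module" +
 fixes H :: "'a set"
 assumes sub: "submodule H K A"
begin

lemmas subE = submoduleE[OF sub]

lemma abelian_subgroup: "abelian_subgroup H A"
 using sub by (intro abelian_subgroupI3 additive_subgroup.intro)
  (auto simp: submodule_def M.abelian_group_axioms)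

sublocale H: abelian_subgroup H A by (rule abelian_subgroup)

lemma coset_eq_iff:
 assumes "x \<in>. A" "y \<in>. A"
 shows "H +>\<^bsub>A\<^esub> x = H +>\<^bsub>A\<^esub> y \<longleftrightarrow> x \<ominus>\<^bsub>A\<^esub> y \<in> H"
proof -
 have "H +>\<^bsub>A\<^esub> x = H +>\<^bsub>A\<^esub> y \<longleftrightarrow> x \<in> H +>\<^bsub>A\<^esub> y"
  using assms H.a_rcos_self H.a_repr_independence' by blast
 also have "... \<longleftrightarrow> x \<oplus>\<^bsub>A\<^esub> \<ominus>\<^bsub>A\<^esub> y \<in> H"
  using assms H.a_rcos_module by blast
 finally show ?thesis by (simp add: a_minus_def)
qed


lemma mem_coset_iff:
 assumes "x \<in>. A"
 shows "y \<in> H +>\<^bsub>A\<^esub> x \<longleftrightarrow> y \<in>. A & y \<ominus>\<^bsub>A\<^esub> x \<in> H"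
proof
 assume y: "y \<in> H +>\<^bsub>A\<^esub> x"
 then have "y \<in>. A" using H.a_elemrcos_carrier assms by blast
 then show "y \<in>. A & y \<ominus>\<^bsub>A\<^esub> x \<in> H"
  using y assms H.a_rcos_module by (simp add: a_minus_def)
next
 assume "y \<in>. A & y \<ominus>\<^bsub>A\<^esub> x \<in> H"
 then show "y \<in> H +>\<^bsub>A\<^esub> x" using assms H.a_rcos_module by (simp add: a_minus_def)
qed

text \<open>All maps out of quotients are defined as \<open>the_elem\<close> of an image of a coset;
  this evaluates them once the map is seen to be constant on the coset.\<close>

lemma the_elem_coset:
 assumes "x \<in>. A" and "!!y. y \<in>. A ==> y \<ominus>\<^bsub>A\<^esub> x \<in> H ==> F y = F x"
 shows "the_elem (F ` (H +>\<^bsub>A\<^esub> x)) = F x"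
proof -
 have "F ` (H +>\<^bsub>A\<^esub> x) = {F x}"
 proof (intro equalityI subsetI)
  fix z assume "z \<in> F ` (H +>\<^bsub>A\<^esub> x)"
  then obtain y where "z = F y" "y \<in> H +>\<^bsub>A\<^esub> x" by blast
  then show "z \<in> {F x}" using assms(2) mem_coset_iff[OF assms(1)] by simp
 qed (use H.a_rcos_self[OF assms(1)] in blast)
 then show ?thesis by simp
qed

lemma quot_carrier: "carrier (quot_mod A H) = (%x. H +>\<^bsub>A\<^esub> x) ` carrier A"
 by (auto simp: quot_mod_def A_RCOSETS_def')

lemma quot_add:
 "x \<in>. A ==> y \<in>. A ==>
  (H +>\<^bsub>A\<^esub> x) \<oplus>\<^bsub>quot_mod A H\<^esub> (H +>\<^bsub>A\<^esub> y) = H +>\<^bsub>A\<^esub> (x \<oplus>\<^bsub>A\<^esub> y)"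
 by (simp add: quot_mod_def H.a_rcos_sum)

lemma quot_zero: "zero (quot_mod A H) = H +>\<^bsub>A\<^esub> (zero A)"
 by (simp add: quot_mod_def H.a_subset)

lemma coset_zero_iff: "x \<in>. A ==> H +>\<^bsub>A\<^esub> x = zero (quot_mod A H) \<longleftrightarrow> x \<in> H"
 by (simp add: quot_zero coset_eq_iff a_minus_def)

lemma quot_smult:
 assumes "k \<in>. K" "x \<in>. A"
 shows "k \<odot>\<^bsub>quot_mod A H\<^esub> (H +>\<^bsub>A\<^esub> x) = H +>\<^bsub>A\<^esub> (k \<odot>\<^bsub>A\<^esub> x)"
proof -
 have "H +>\<^bsub>A\<^esub> (k \<odot>\<^bsub>A\<^esub> y) = H +>\<^bsub>A\<^esub> (k \<odot>\<^bsub>A\<^esub> x)"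
  if y: "y \<in>. A" "y \<ominus>\<^bsub>A\<^esub> x \<in> H" for y
 proof -
  have "k \<odot>\<^bsub>A\<^esub> y \<ominus>\<^bsub>A\<^esub> k \<odot>\<^bsub>A\<^esub> x = k \<odot>\<^bsub>A\<^esub> (y \<ominus>\<^bsub>A\<^esub> x)"
   using assms y by (simp add: a_minus_def smult_r_distr smult_r_minus)
  then show ?thesis using subE(4)[OF assms(1) y(2)] assms y by (simp add: coset_eq_iff)
 qed
 then show ?thesis
  using the_elem_coset[OF assms(2), of "%x. H +>\<^bsub>A\<^esub> (k \<odot>\<^bsub>A\<^esub> x)"] by (simp add: quot_mod_def)
qed

lemma module_quot: "Module.module K (quot_mod A H)"
proof (rule moduleI)
 show "cring K" by (rule R.is_cring)
 show "abelian_group (quot_mod A H)"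
 proof (rule abelian_groupI)
  fix C assume "C \<in>. quot_mod A H"
  then obtain x where x: "x \<in>. A" "C = H +>\<^bsub>A\<^esub> x" by (auto simp: quot_carrier)
  then show "\<exists>D\<in>carrier (quot_mod A H). D \<oplus>\<^bsub>quot_mod A H\<^esub> C = zero (quot_mod A H)"
   by (intro bexI[of _ "H +>\<^bsub>A\<^esub> (\<ominus>\<^bsub>A\<^esub> x)"])
    (auto simp: quot_carrier quot_add quot_zero M.l_neg)
 qed (auto simp: quot_carrier quot_add quot_zero M.a_ac)
qed (auto simp: quot_carrier quot_add quot_zero quot_smult smult_l_distr smult_r_distr smult_assoc1)

lemma linear_coset: "K_linear K A (quot_mod A H) (%x. H +>\<^bsub>A\<^esub> x)"
 by (auto simp: K_linear_def quot_carrier quot_add quot_smult)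

end

lemma quotient_moduleI: "Module.module K A ==> submodule H K A ==> quotient_module K A H"
 by (simp add: quotient_module_def quotient_module_axioms_def)

text \<open>
 Linear relations inducing an isomorphism of quotients; they compose like the additive
 relations of diagram chasing, so that no choices of lifts have to be named.
\<close>

definition subquot_corr ::
 "'k ring => ('k, 'a) module => 'a set => ('k, 'b) module => 'b set => bool" where
 "subquot_corr K A H B L \<longleftrightarrow> (\<exists>R.
   (\<forall>u\<in>carrier A. \<exists>v\<in>carrier B. R u v) & (\<forall>v\<in>carrier B. \<exists>u\<in>carrier A. R u v) &
   (\<forall>u\<in>carrier A. \<forall>v\<in>carrier B. \<forall>u'\<in>carrier A. \<forall>v'\<in>carrier B.
    R u v \<longrightarrow> R u' v' \<longrightarrow> R (u \<oplus>\<^bsub>A\<^esub> u') (v \<oplus>\<^bsub>B\<^esub> v')) &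
   (\<forall>k\<in>carrier K. \<forall>u\<in>carrier A. \<forall>v\<in>carrier B. R u v \<longrightarrow> R (k \<odot>\<^bsub>A\<^esub> u) (k \<odot>\<^bsub>B\<^esub> v)) &
   (\<forall>u\<in>carrier A. \<forall>v\<in>carrier B. R u v \<longrightarrow> (u \<in> H \<longleftrightarrow> v \<in> L)))"

lemma subquot_corrI:
 assumes "!!u. u \<in>. A ==> \<exists>v\<in>carrier B. R u v"
  and "!!v. v \<in>. B ==> \<exists>u\<in>carrier A. R u v"
  and "!!u v u' v'. [|u \<in>. A; v \<in>. B; u' \<in>. A; v' \<in>. B; R u v; R u' v'|]
      ==> R (u \<oplus>\<^bsub>A\<^esub> u') (v \<oplus>\<^bsub>B\<^esub> v')"
  and "!!k u v. [|k \<in>. K; u \<in>. A; v \<in>. B; R u v|]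
      ==> R (k \<odot>\<^bsub>A\<^esub> u) (k \<odot>\<^bsub>B\<^esub> v)"
  and "!!u v. [|u \<in>. A; v \<in>. B; R u v; u \<in> H|] ==> v \<in> L"
  and "!!u v. [|u \<in>. A; v \<in>. B; R u v; v \<in> L|] ==> u \<in> H"
 shows "subquot_corr K A H B L"
 unfolding subquot_corr_def
 by (rule exI[of _ R], intro conjI ballI impI iffI) (use assms in auto)

lemma subquot_corrE:
 assumes "subquot_corr K A H B L"
 obtains R where "!!u. u\<in>carrier A ==> \<exists>v\<in>carrier B. R u v" "!!v. v\<in>carrier B ==> \<exists>u\<in>carrier A. R u v"
  "!!u v u' v'. [|u \<in>. A; v \<in>. B; u' \<in>. A; v' \<in>. B; R u v; R u' v'|]
      ==> R (u \<oplus>\<^bsub>A\<^esub> u') (v \<oplus>\<^bsub>B\<^esub> v')"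
  "!!k u v. [|k \<in>. K; u \<in>. A; v \<in>. B; R u v|]
      ==> R (k \<odot>\<^bsub>A\<^esub> u) (k \<odot>\<^bsub>B\<^esub> v)"
  "!!u v. [|u \<in>. A; v \<in>. B; R u v|] ==> u \<in> H \<longleftrightarrow> v \<in> L"
proof -
 obtain R where
  "\<forall>u\<in>carrier A. \<exists>v\<in>carrier B. R u v" "\<forall>v\<in>carrier B. \<exists>u\<in>carrier A. R u v"
  "\<forall>u\<in>carrier A. \<forall>v\<in>carrier B. \<forall>u'\<in>carrier A. \<forall>v'\<in>carrier B.
    R u v \<longrightarrow> R u' v' \<longrightarrow> R (u \<oplus>\<^bsub>A\<^esub> u') (v \<oplus>\<^bsub>B\<^esub> v')"
  "\<forall>k\<in>carrier K. \<forall>u\<in>carrier A. \<forall>v\<in>carrier B. R u v \<longrightarrow> R (k \<odot>\<^bsub>A\<^esub> u) (k \<odot>\<^bsub>B\<^esub> v)"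
  "\<forall>u\<in>carrier A. \<forall>v\<in>carrier B. R u v \<longrightarrow> (u \<in> H \<longleftrightarrow> v \<in> L)"
  using assms unfolding subquot_corr_def by (elim exE conjE)
 then show thesis by (intro that[of R]) simp_all
qed

text \<open>Relational composition: the sum of two intermediate witnesses is again a witness, for
  which the middle module has to be closed under the operations.\<close>

lemma subquot_corr_trans:
 assumes "Module.module K B" "subquot_corr K A H B L" "subquot_corr K B L C N"
 shows "subquot_corr K A H C N"
proof -
 interpret B: Module.module K B by fact
 obtain R where R: "!!u. u\<in>carrier A ==> \<exists>v\<in>carrier B. R u v" "!!v. v\<in>carrier B ==> \<exists>u\<in>carrier A. R u v"
  and Ra: "!!u v u' v'. [|u \<in>. A; v \<in>. B; u' \<in>. A; v' \<in>. B; R u v; R u' v'|]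
      ==> R (u \<oplus>\<^bsub>A\<^esub> u') (v \<oplus>\<^bsub>B\<^esub> v')"
  and Rs: "!!k u v. [|k \<in>. K; u \<in>. A; v \<in>. B; R u v|]
      ==> R (k \<odot>\<^bsub>A\<^esub> u) (k \<odot>\<^bsub>B\<^esub> v)"
  and Ri: "!!u v. [|u \<in>. A; v \<in>. B; R u v|] ==> u \<in> H \<longleftrightarrow> v \<in> L"
  by (rule subquot_corrE[OF assms(2)]) (rule that)
 obtain S where S: "!!u. u\<in>carrier B ==> \<exists>v\<in>carrier C. S u v" "!!v. v\<in>carrier C ==> \<exists>u\<in>carrier B. S u v"
  and Sa: "!!u v u' v'. [|u \<in>. B; v \<in>. C; u' \<in>. B; v' \<in>. C; S u v; S u' v'|]
      ==> S (u \<oplus>\<^bsub>B\<^esub> u') (v \<oplus>\<^bsub>C\<^esub> v')"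
  and Ss: "!!k u v. [|k \<in>. K; u \<in>. B; v \<in>. C; S u v|]
      ==> S (k \<odot>\<^bsub>B\<^esub> u) (k \<odot>\<^bsub>C\<^esub> v)"
  and Si: "!!u v. [|u \<in>. B; v \<in>. C; S u v|] ==> u \<in> L \<longleftrightarrow> v \<in> N"
  by (rule subquot_corrE[OF assms(3)]) (rule that)
 let ?T = "%u w. \<exists>v\<in>carrier B. R u v & S v w"
 show ?thesis
 proof (rule subquot_corrI[where R = ?T])
  show "\<exists>w\<in>carrier C. ?T u w" if "u \<in>. A" for u using R(1) S(1) that by meson
  show "\<exists>u\<in>carrier A. ?T u w" if "w \<in>. C" for w using R(2) S(2) that by meson
  show "?T (u \<oplus>\<^bsub>A\<^esub> u') (w \<oplus>\<^bsub>C\<^esub> w')"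
   if uw: "u \<in>. A" "w \<in>. C" "u' \<in>. A" "w' \<in>. C"
    and T: "?T u w" "?T u' w'" for u w u' w'
  proof -
   obtain v v' where v: "v \<in>. B" "R u v" "S v w" "v' \<in>. B" "R u' v'" "S v' w'"
    using T by blast
   show ?thesis
    using Ra[of u v u' v'] Sa[of v w v' w'] uw v by (intro bexI[of _ "v \<oplus>\<^bsub>B\<^esub> v'"] conjI B.a_closed) blast+
  qed
  show "?T (k \<odot>\<^bsub>A\<^esub> u) (k \<odot>\<^bsub>C\<^esub> w)"
   if k: "k \<in>. K" "u \<in>. A" "w \<in>. C" and T: "?T u w" for k u w
  proof -
   obtain v where v: "v \<in>. B" "R u v" "S v w" using T by blast
   show ?thesis using Rs[of k u v] Ss[of k v w] k v by (intro bexI[of _ "k \<odot>\<^bsub>B\<^esub> v"]) simp_all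
  qed
 qed (use Ri Si in blast)+
qed

text \<open>A linear relation that is total on both sides and matches \<open>H\<close> with
  \<open>L\<close> sends differences to differences. So two elements are congruent modulo
  \<open>H\<close> exactly if their partners are congruent modulo \<open>L\<close>.\<close>

lemma mod_iso_subquot:
 assumes "quotient_module K A H" "quotient_module K B L" "subquot_corr K A H B L"
 shows "mod_iso K (quot_mod A H) (quot_mod B L)"
proof -
 interpret A: quotient_module K A H by fact
 interpret B: quotient_module K B L by fact
 obtain R where R: "!!u. u\<in>carrier A ==> \<exists>v\<in>carrier B. R u v" "!!v. v\<in>carrier B ==> \<exists>u\<in>carrier A. R u v"
  and Ra: "!!u v u' v'. [|u \<in>. A; v \<in>. B; u' \<in>. A; v' \<in>. B; R u v; R u' v'|]
      ==> R (u \<oplus>\<^bsub>A\<^esub> u') (v \<oplus>\<^bsub>B\<^esub> v')"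
  and Rs: "!!k u v. [|k \<in>. K; u \<in>. A; v \<in>. B; R u v|]
      ==> R (k \<odot>\<^bsub>A\<^esub> u) (k \<odot>\<^bsub>B\<^esub> v)"
  and Ri: "!!u v. [|u \<in>. A; v \<in>. B; R u v|] ==> u \<in> H \<longleftrightarrow> v \<in> L"
  by (rule subquot_corrE[OF assms(3)]) (rule that)
 \<comment> \<open>The relation is only known to respect sums and multiples; subtraction is addition
   of the multiple by \<open>-1\<close>.\<close>
 have minus: "R (u \<ominus>\<^bsub>A\<^esub> u') (v \<ominus>\<^bsub>B\<^esub> v')"
  if uv: "u \<in>. A" "v \<in>. B" "u' \<in>. A" "v' \<in>. B" "R u v" "R u' v'" for u v u' v'
 proof -
  have "R (u \<oplus>\<^bsub>A\<^esub> (\<ominus>\<^bsub>K\<^esub> \<one>\<^bsub>K\<^esub>) \<odot>\<^bsub>A\<^esub> u') (v \<oplus>\<^bsub>B\<^esub> (\<ominus>\<^bsub>K\<^esub> \<one>\<^bsub>K\<^esub>) \<odot>\<^bsub>B\<^esub> v')"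
   using uv by (intro Ra Rs) auto
  then show ?thesis using uv by (simp add: a_minus_def A.smult_l_minus B.smult_l_minus)
 qed
 \<comment> \<open>Read in one direction this is well-definedness of the induced map, read in the
   other its injectivity.\<close>
 have eq: "H +>\<^bsub>A\<^esub> u = H +>\<^bsub>A\<^esub> u' \<longleftrightarrow> L +>\<^bsub>B\<^esub> v = L +>\<^bsub>B\<^esub> v'"
  if uv: "u \<in>. A" "v \<in>. B" "u' \<in>. A" "v' \<in>. B" "R u v" "R u' v'" for u v u' v'
  using Ri[OF _ _ minus[OF uv]] uv by (simp add: A.coset_eq_iff B.coset_eq_iff)
 \<comment> \<open>Any partner of any member of the coset will do, since by \<open>eq\<close> its
   class does not depend on the choice.\<close>
 define f where "f C = L +>\<^bsub>B\<^esub> (SOME v. v \<in>. B & (\<exists>u\<in>C. R u v))" for C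
 have f: "f (H +>\<^bsub>A\<^esub> u) = L +>\<^bsub>B\<^esub> v" if uv: "u \<in>. A" "v \<in>. B" "R u v" for u v
 proof -
  let ?P = "%v. v \<in>. B & (\<exists>u'\<in>H +>\<^bsub>A\<^esub> u. R u' v)"
  have "?P (SOME v. ?P v)"
   by (rule someI[of ?P v]) (use uv A.H.a_rcos_self in auto)
  then obtain u' where u': "u' \<in> H +>\<^bsub>A\<^esub> u" "R u' (SOME v. ?P v)" "(SOME v. ?P v) \<in>. B"
   by blast
  then have "u' \<in>. A" "H +>\<^bsub>A\<^esub> u' = H +>\<^bsub>A\<^esub> u"
   using A.mem_coset_iff[OF uv(1)] uv by (auto simp: A.coset_eq_iff)
  then show ?thesis using eq[of u' _ u v] u' uv unfolding f_def by blast
 qed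
 have fu: "\<exists>v\<in>carrier B. R u v & f (H +>\<^bsub>A\<^esub> u) = L +>\<^bsub>B\<^esub> v" if "u \<in>. A" for u
  using R(1)[OF that] f that by blast
 have "K_linear K (quot_mod A H) (quot_mod B L) f"
  unfolding K_linear_def
 proof (intro conjI ballI funcsetI)
  fix C assume "C \<in>. quot_mod A H"
  then obtain u where u: "u \<in>. A" "C = H +>\<^bsub>A\<^esub> u" by (auto simp: A.quot_carrier)
  obtain v where v: "v \<in>. B" "R u v" "f C = L +>\<^bsub>B\<^esub> v" using fu[OF u(1)] u by auto
  then show "f C \<in>. quot_mod B L" by (auto simp: B.quot_carrier)
  show "f (k \<odot>\<^bsub>quot_mod A H\<^esub> C) = k \<odot>\<^bsub>quot_mod B L\<^esub> f C" if k: "k \<in>. K" for k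
   using f[OF _ _ Rs[OF k u(1) v(1,2)]] u v k by (simp add: A.quot_smult B.quot_smult)
  fix D assume "D \<in>. quot_mod A H"
  then obtain u' where u': "u' \<in>. A" "D = H +>\<^bsub>A\<^esub> u'" by (auto simp: A.quot_carrier)
  obtain v' where v': "v' \<in>. B" "R u' v'" "f D = L +>\<^bsub>B\<^esub> v'" using fu[OF u'(1)] u' by auto
  show "f (C \<oplus>\<^bsub>quot_mod A H\<^esub> D) = f C \<oplus>\<^bsub>quot_mod B L\<^esub> f D"
   using f[OF _ _ Ra[OF u(1) v(1) u'(1) v'(1) v(2) v'(2)]] u v u' v'
   by (simp add: A.quot_add B.quot_add)
 qed
 moreover have "inj_on f (carrier (quot_mod A H))"
 proof (rule inj_onI)
  fix C D assume "C \<in>. quot_mod A H" "D \<in>. quot_mod A H" "f C = f D"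
  then obtain u u' where "u \<in>. A" "C = H +>\<^bsub>A\<^esub> u" "u' \<in>. A" "D = H +>\<^bsub>A\<^esub> u'"
   by (auto simp: A.quot_carrier)
  then show "C = D" using fu[of u] fu[of u'] eq[of u _ u'] \<open>f C = f D\<close> by metis
 qed
 moreover have "f ` carrier (quot_mod A H) = carrier (quot_mod B L)"
 proof (intro equalityI subsetI)
  fix D assume "D \<in> f ` carrier (quot_mod A H)"
  then show "D \<in>. quot_mod B L" using fu by (fastforce simp: A.quot_carrier B.quot_carrier)
 next
  fix D assume "D \<in>. quot_mod B L"
  then obtain v where v: "v \<in>. B" "D = L +>\<^bsub>B\<^esub> v" by (auto simp: B.quot_carrier)
  then obtain u where "u \<in>. A" "R u v" using R(2) by blast
  then show "D \<in> f ` carrier (quot_mod A H)" using f v by (auto simp: A.quot_carrier)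
 qed
 ultimately show ?thesis unfolding mod_iso_def bij_betw_def by blast
qed

subsection \<open>Products, sums and free modules\<close>

lemma K_linear_closed: "K_linear K A B f ==> x \<in>. A ==> f x \<in>. B"
 by (auto simp: K_linear_def)

lemma K_linear_comp:
 "K_linear K A B f ==> K_linear K B C g ==> K_linear K A C (%x. g (f x))"
 by (auto simp: K_linear_def Pi_iff)

lemma K_linear_cong:
 "(!!x. x \<in>. A ==> f x = g x) ==> Module.module K A ==> K_linear K A B f ==> K_linear K A B g"
proof -
 assume "Module.module K A" and *: "!!x. x \<in>. A ==> f x = g x" "K_linear K A B f"
 then interpret Module.module K A by simp
 show ?thesis using * by (auto simp: K_linear_def Pi_iff)
qed

lemma K_linear_zero_map: "Module.module K M ==> K_linear K A M (%x. (zero M))"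
proof -
 assume "Module.module K M"
 then interpret Module.module K M .
 show ?thesis by (auto simp: K_linear_def)
qed

lemma K_linear_add_map:
 "Module.module K M ==> K_linear K A M f ==> K_linear K A M g ==> K_linear K A M (%x. f x \<oplus>\<^bsub>M\<^esub> g x)"
proof -
 assume "Module.module K M" and *: "K_linear K A M f" "K_linear K A M g"
 then interpret Module.module K M by simp
 show ?thesis using * by (auto simp: K_linear_def smult_r_distr M.a_ac Pi_iff)
qed

lemma K_linear_minus_map:
 "Module.module K M ==> K_linear K A M f ==> K_linear K A M (%x. \<ominus>\<^bsub>M\<^esub> f x)"
proof -
 assume "Module.module K M" and *: "K_linear K A M f"
 then interpret Module.module K M by simp
 show ?thesis using * by (auto simp: K_linear_def smult_r_minus M.minus_add Pi_iff)
qed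

lemma K_linear_smult_map:
 "Module.module K M ==> k \<in>. K ==> K_linear K A M f ==> K_linear K A M (%x. k \<odot>\<^bsub>M\<^esub> f x)"
proof -
 assume "Module.module K M" and k: "k \<in>. K" and f: "K_linear K A M f"
 then interpret Module.module K M by simp
 have "k \<odot>\<^bsub>M\<^esub> (c \<odot>\<^bsub>M\<^esub> x) = c \<odot>\<^bsub>M\<^esub> (k \<odot>\<^bsub>M\<^esub> x)" if "c \<in>. K" "x \<in>. M" for c x
  using k that by (metis R.m_comm smult_assoc1)
 then show ?thesis using k f by (auto simp: K_linear_def smult_r_distr Pi_iff)
qed

lemma K_linear_finsum_map:
 assumes "Module.module K A" "Module.module K M" "!!i. i \<in> S ==> K_linear K A M (\<phi> i)"
 shows "K_linear K A M (%x. \<Oplus>\<^bsub>M\<^esub>i\<in>S. \<phi> i x)"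
 using assms(3)
proof (induction S rule: infinite_finite_induct)
 case (insert i S)
 interpret Module.module K M by (rule assms)
 have cl: "\<phi> j x \<in>. M" if "j \<in> insert i S" "x \<in>. A" for j x
  using insert.prems[OF that(1)] that(2) by (auto simp: K_linear_def)
 have "K_linear K A M (%x. \<phi> i x \<oplus>\<^bsub>M\<^esub> (\<Oplus>\<^bsub>M\<^esub>i\<in>S. \<phi> i x))"
  by (rule K_linear_add_map[OF assms(2)]) (use insert in auto)
 then show ?case
 proof (rule K_linear_cong[rotated 2])
  fix x assume x: "x \<in>. A"
  show "\<phi> i x \<oplus>\<^bsub>M\<^esub> (\<Oplus>\<^bsub>M\<^esub>i\<in>S. \<phi> i x) = (\<Oplus>\<^bsub>M\<^esub>i\<in>insert i S. \<phi> i x)"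
   using insert(1,2) cl[OF _ x] by (intro M.finsum_insert[symmetric]) auto
 qed (rule assms)
next
 case (infinite S)
 interpret Module.module K M by (rule assms)
 show ?case using infinite by (simp add: K_linear_zero_map assms)
next
 case empty
 interpret Module.module K M by (rule assms)
 show ?case by (simp add: K_linear_zero_map assms)
qed

lemma linear_mapI:
 "Module.module K A ==> Module.module K B ==> K_linear K A B f ==> linear_map K A B f"
 by (simp add: linear_map_def linear_map_axioms_def)

lemma prod_mod_simps:
 "carrier (prod_mod I A) = (\<Pi>\<^sub>E i\<in>I. carrier (A i))"
 "zero (prod_mod I A) = (\<lambda>i\<in>I. (zero (A i)))"
 "f \<oplus>\<^bsub>prod_mod I A\<^esub> g = (\<lambda>i\<in>I. f i \<oplus>\<^bsub>A i\<^esub> g i)"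
 "k \<odot>\<^bsub>prod_mod I A\<^esub> f = (\<lambda>i\<in>I. k \<odot>\<^bsub>A i\<^esub> f i)"
 by (simp_all add: prod_mod_def)

lemma sum_mod_simps:
 "carrier (sum_mod I A) = {f \<in> (\<Pi>\<^sub>E i\<in>I. carrier (A i)). finite {i \<in> I. f i \<noteq> (zero (A i))}}"
 "zero (sum_mod I A) = (\<lambda>i\<in>I. (zero (A i)))"
 "f \<oplus>\<^bsub>sum_mod I A\<^esub> g = (\<lambda>i\<in>I. f i \<oplus>\<^bsub>A i\<^esub> g i)"
 "k \<odot>\<^bsub>sum_mod I A\<^esub> f = (\<lambda>i\<in>I. k \<odot>\<^bsub>A i\<^esub> f i)"
 by (simp_all add: sum_mod_def prod_mod_def)

lemma sum_mod_finite: "finite I ==> sum_mod I A = prod_mod I A"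
 by (simp add: sum_mod_def prod_mod_def)

lemma extensional_eqI:
 "f \<in> extensional I ==> g \<in> extensional I ==> (!!i. i \<in> I ==> f i = g i) ==> f = g"
 by (rule extensionalityI)

text \<open>The source of exactness of chains and cochains in the coefficients: images and kernels
  of a map that acts componentwise on a product are computed componentwise, preimages being chosen
  index by index.\<close>

lemma PiE_image_eq:
 assumes "!!i. i \<in> I ==> f i ` A i = {b \<in> B i. z i b}"
 shows "(%a. \<lambda>i\<in>I. f i (a i)) ` Pi\<^sub>E I A = {b \<in> Pi\<^sub>E I B. \<forall>i\<in>I. z i (b i)}"
proof (intro subset_antisym subsetI)
 fix b assume b: "b \<in> {b \<in> Pi\<^sub>E I B. \<forall>i\<in>I. z i (b i)}"
 have bi: "b i \<in> f i ` A i" if "i \<in> I" for i unfolding assms[OF that] using b that by auto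
 let ?a = "\<lambda>i\<in>I. inv_into (A i) (f i) (b i)"
 have "b = (\<lambda>i\<in>I. f i (?a i))"
  using b f_inv_into_f[OF bi] by (intro extensional_eqI[of _ I]) (auto simp: PiE_iff)
 moreover have "?a \<in> Pi\<^sub>E I A" using inv_into_into[OF bi] by auto
 ultimately show "b \<in> (%a. \<lambda>i\<in>I. f i (a i)) ` Pi\<^sub>E I A" by blast
qed (use assms in fastforce)

locale module_family =
 fixes K :: "'k ring" and I :: "'i set" and A :: "'i => ('k, 'a) module"
 assumes cring: "cring K" and fam: "!!i. i \<in> I ==> Module.module K (A i)"
begin

lemma module_prod: "Module.module K (prod_mod I A)"
proof (rule moduleI)
 show "abelian_group (prod_mod I A)"
 proof (rule abelian_groupI)
  fix f g h assume f: "f \<in>. prod_mod I A"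
  show "\<exists>g\<in>carrier (prod_mod I A). g \<oplus>\<^bsub>prod_mod I A\<^esub> f = zero (prod_mod I A)"
  proof (rule bexI[of _ "\<lambda>i\<in>I. \<ominus>\<^bsub>A i\<^esub> f i"])
   show "(\<lambda>i\<in>I. \<ominus>\<^bsub>A i\<^esub> f i) \<in>. prod_mod I A"
   proof -
    have "\<ominus>\<^bsub>A i\<^esub> f i \<in>. A i" if "i \<in> I" for i
    proof -
     interpret Module.module K "A i" using fam that .
     show ?thesis using f that by (auto simp: prod_mod_simps)
    qed
    then show ?thesis by (auto simp: prod_mod_simps)
   qed
   show "(\<lambda>i\<in>I. \<ominus>\<^bsub>A i\<^esub> f i) \<oplus>\<^bsub>prod_mod I A\<^esub> f = zero (prod_mod I A)"
    unfolding prod_mod_simps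
   proof (rule restrict_ext)
    fix i assume i: "i \<in> I"
    interpret Module.module K "A i" using fam i .
    show "(\<lambda>i\<in>I. \<ominus>\<^bsub>A i\<^esub> f i) i \<oplus>\<^bsub>A i\<^esub> f i = zero (A i)"
     using f i PiE_mem[of f I "%i. carrier (A i)" i] by (simp add: prod_mod_simps M.l_neg)
   qed
  qed
  assume g: "g \<in>. prod_mod I A"
  have "f i \<oplus>\<^bsub>A i\<^esub> g i \<in>. A i & f i \<oplus>\<^bsub>A i\<^esub> g i = g i \<oplus>\<^bsub>A i\<^esub> f i" if "i \<in> I" for i
  proof -
   interpret Module.module K "A i" using fam that .
   have "f i \<in>. A i" "g i \<in>. A i" using f g that by (auto simp: prod_mod_simps)
   then show ?thesis using M.a_comm[of "f i" "g i"] by simp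
  qed
  then show "f \<oplus>\<^bsub>prod_mod I A\<^esub> g \<in>. prod_mod I A"
   "f \<oplus>\<^bsub>prod_mod I A\<^esub> g = g \<oplus>\<^bsub>prod_mod I A\<^esub> f"
   by (auto simp: prod_mod_simps intro!: restrict_ext)
  assume h: "h \<in>. prod_mod I A"
  show "f \<oplus>\<^bsub>prod_mod I A\<^esub> g \<oplus>\<^bsub>prod_mod I A\<^esub> h = f \<oplus>\<^bsub>prod_mod I A\<^esub> (g \<oplus>\<^bsub>prod_mod I A\<^esub> h)"
   unfolding prod_mod_simps
  proof (rule restrict_ext)
   fix i assume i: "i \<in> I"
   interpret Module.module K "A i" using fam i .
   show "(\<lambda>i\<in>I. f i \<oplus>\<^bsub>A i\<^esub> g i) i \<oplus>\<^bsub>A i\<^esub> h i = f i \<oplus>\<^bsub>A i\<^esub> (\<lambda>i\<in>I. g i \<oplus>\<^bsub>A i\<^esub> h i) i"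
    using f g h i PiE_mem[of _ I "%i. carrier (A i)" i] by (simp add: prod_mod_simps M.a_assoc)
  qed
 next
  show "zero (prod_mod I A) \<in>. prod_mod I A"
   using fam abelian_monoid.zero_closed abelian_group.axioms(1) module.axioms(2)
   by (fastforce simp: prod_mod_simps)
  fix f assume f: "f \<in>. prod_mod I A"
  show "zero (prod_mod I A) \<oplus>\<^bsub>prod_mod I A\<^esub> f = f"
  proof (rule extensional_eqI[of _ I])
   fix i assume i: "i \<in> I"
   interpret Module.module K "A i" using fam i .
   show "((zero (prod_mod I A)) \<oplus>\<^bsub>prod_mod I A\<^esub> f) i = f i"
    using f i PiE_mem[of f I "%i. carrier (A i)" i] by (simp add: prod_mod_simps)
  qed (use f in "auto simp: prod_mod_simps PiE_iff")
 qed
next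
 fix k l f g assume k: "k \<in>. K" and f: "f \<in>. prod_mod I A"
 have "k \<odot>\<^bsub>A i\<^esub> f i \<in>. A i" if "i \<in> I" for i
 proof -
  interpret Module.module K "A i" using fam that .
  show ?thesis using k f that by (simp add: prod_mod_simps PiE_mem[of f I "%i. carrier (A i)" i])
 qed
 then show "k \<odot>\<^bsub>prod_mod I A\<^esub> f \<in>. prod_mod I A" by (auto simp: prod_mod_simps)
 assume l: "l \<in>. K"
 have "(k \<oplus>\<^bsub>K\<^esub> l) \<odot>\<^bsub>A i\<^esub> f i = k \<odot>\<^bsub>A i\<^esub> f i \<oplus>\<^bsub>A i\<^esub> l \<odot>\<^bsub>A i\<^esub> f i &
   (k \<otimes>\<^bsub>K\<^esub> l) \<odot>\<^bsub>A i\<^esub> f i = k \<odot>\<^bsub>A i\<^esub> (l \<odot>\<^bsub>A i\<^esub> f i)" if "i \<in> I" for i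
 proof -
  interpret Module.module K "A i" using fam that .
  show ?thesis using k l f that by (simp add: prod_mod_simps PiE_mem[of f I "%i. carrier (A i)" i] smult_l_distr smult_assoc1)
 qed
 then show "(k \<oplus>\<^bsub>K\<^esub> l) \<odot>\<^bsub>prod_mod I A\<^esub> f = k \<odot>\<^bsub>prod_mod I A\<^esub> f \<oplus>\<^bsub>prod_mod I A\<^esub> l \<odot>\<^bsub>prod_mod I A\<^esub> f"
  "(k \<otimes>\<^bsub>K\<^esub> l) \<odot>\<^bsub>prod_mod I A\<^esub> f = k \<odot>\<^bsub>prod_mod I A\<^esub> (l \<odot>\<^bsub>prod_mod I A\<^esub> f)"
  by (auto simp: prod_mod_simps intro!: restrict_ext)
next
 fix k f g assume k: "k \<in>. K" and fg: "f \<in>. prod_mod I A" "g \<in>. prod_mod I A"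
 have "k \<odot>\<^bsub>A i\<^esub> (f i \<oplus>\<^bsub>A i\<^esub> g i) = k \<odot>\<^bsub>A i\<^esub> f i \<oplus>\<^bsub>A i\<^esub> k \<odot>\<^bsub>A i\<^esub> g i" if "i \<in> I" for i
 proof -
  interpret Module.module K "A i" using fam that .
  show ?thesis using k fg that by (simp add: prod_mod_simps PiE_mem[of _ I "%i. carrier (A i)" i] smult_r_distr)
 qed
 then show "k \<odot>\<^bsub>prod_mod I A\<^esub> (f \<oplus>\<^bsub>prod_mod I A\<^esub> g) = k \<odot>\<^bsub>prod_mod I A\<^esub> f \<oplus>\<^bsub>prod_mod I A\<^esub> k \<odot>\<^bsub>prod_mod I A\<^esub> g"
  by (auto simp: prod_mod_simps intro!: restrict_ext)
next
 fix f assume f: "f \<in>. prod_mod I A"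
 have "\<one>\<^bsub>K\<^esub> \<odot>\<^bsub>A i\<^esub> f i = f i" if "i \<in> I" for i
 proof -
  interpret Module.module K "A i" using fam that .
  show ?thesis using f that by (simp add: prod_mod_simps PiE_mem[of f I "%i. carrier (A i)" i])
 qed
 then show "\<one>\<^bsub>K\<^esub> \<odot>\<^bsub>prod_mod I A\<^esub> f = f"
  using f by (intro extensional_eqI[of _ I]) (auto simp: prod_mod_simps PiE_iff)
qed (rule cring)

lemma zero_closed_fam: "i \<in> I ==> (zero (A i)) \<in>. A i"
 using fam abelian_monoid.zero_closed abelian_group.axioms(1) module.axioms(2) by metis

lemma submodule_sum: "submodule (carrier (sum_mod I A)) K (prod_mod I A)"
proof -
 interpret P: Module.module K "prod_mod I A" by (rule module_prod)
 show ?thesis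
 proof (rule P.submoduleI')
  show "carrier (sum_mod I A) \<subseteq> carrier (prod_mod I A)"
   by (auto simp: sum_mod_simps prod_mod_simps)
  show "zero (prod_mod I A) \<in>. sum_mod I A"
   using zero_closed_fam by (auto simp: sum_mod_simps prod_mod_simps)
  fix f g assume f: "f \<in>. sum_mod I A"
  then have fP: "f \<in>. prod_mod I A" by (auto simp: sum_mod_simps prod_mod_simps)
  show "k \<odot>\<^bsub>prod_mod I A\<^esub> f \<in>. sum_mod I A" if k: "k \<in>. K" for k
  proof -
   have "{i \<in> I. (k \<odot>\<^bsub>prod_mod I A\<^esub> f) i \<noteq> (zero (A i))} \<subseteq> {i \<in> I. f i \<noteq> (zero (A i))}"
   proof clarsimp
    fix i assume i: "i \<in> I" "f i = zero (A i)" "(k \<odot>\<^bsub>prod_mod I A\<^esub> f) i \<noteq> (zero (A i))"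
    interpret Module.module K "A i" using fam i(1) .
    show False using i k by (simp add: prod_mod_simps)
   qed
   then have "finite {i \<in> I. (k \<odot>\<^bsub>prod_mod I A\<^esub> f) i \<noteq> (zero (A i))}"
    by (rule finite_subset) (use f in "simp add: sum_mod_simps")
   then show ?thesis
    using P.smult_closed[OF k fP] by (simp add: sum_mod_simps prod_mod_simps)
  qed
  assume g: "g \<in>. sum_mod I A"
  then have gP: "g \<in>. prod_mod I A" by (auto simp: sum_mod_simps prod_mod_simps)
  have "{i \<in> I. (f \<oplus>\<^bsub>prod_mod I A\<^esub> g) i \<noteq> (zero (A i))} \<subseteq> {i \<in> I. f i \<noteq> (zero (A i))} \<union> {i \<in> I. g i \<noteq> (zero (A i))}"
  proof clarsimp
   fix i assume i: "i \<in> I" "f i = zero (A i)" "g i = zero (A i)" "(f \<oplus>\<^bsub>prod_mod I A\<^esub> g) i \<noteq> (zero (A i))"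
   interpret Module.module K "A i" using fam i(1) .
   show False using i by (simp add: prod_mod_simps)
  qed
  moreover have "finite ({i \<in> I. f i \<noteq> (zero (A i))} \<union> {i \<in> I. g i \<noteq> (zero (A i))})"
   using f g by (simp add: sum_mod_simps)
  ultimately have "finite {i \<in> I. (f \<oplus>\<^bsub>prod_mod I A\<^esub> g) i \<noteq> (zero (A i))}" by (rule finite_subset)
  then show "f \<oplus>\<^bsub>prod_mod I A\<^esub> g \<in>. sum_mod I A"
   using P.a_closed[OF fP gP] by (simp add: sum_mod_simps prod_mod_simps)
 qed
qed

lemma module_sum: "Module.module K (sum_mod I A)"
 using submodule_module[OF module_prod submodule_sum] by (simp add: sum_mod_def)

lemma linear_prod_proj: "i \<in> I ==> K_linear K (prod_mod I A) (A i) (%f. f i)"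
 by (auto simp: K_linear_def prod_mod_simps)

lemma linear_sum_proj: "i \<in> I ==> K_linear K (sum_mod I A) (A i) (%f. f i)"
 by (auto simp: K_linear_def sum_mod_simps)

lemma linear_map_proj: "i \<in> I ==> linear_map K (prod_mod I A) (A i) (%f. f i)"
 by (intro linear_mapI module_prod fam linear_prod_proj)

lemma linear_map_sum_proj: "i \<in> I ==> linear_map K (sum_mod I A) (A i) (%f. f i)"
 by (intro linear_mapI module_sum fam linear_sum_proj)

lemma linear_incl:
 assumes i: "i \<in> I" shows "K_linear K (A i) (sum_mod I A) (sum_incl I A i)"
proof -
 have fin: "finite {j \<in> I. sum_incl I A i a j \<noteq> (zero (A j))}" for a
  by (rule finite_subset[of _ "{i}"]) (auto simp: sum_incl_def)
 have "sum_incl I A i (a \<oplus>\<^bsub>A i\<^esub> b) j = sum_incl I A i a j \<oplus>\<^bsub>A j\<^esub> sum_incl I A i b j &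
   (k \<in>. K \<longrightarrow> sum_incl I A i (k \<odot>\<^bsub>A i\<^esub> a) j = k \<odot>\<^bsub>A j\<^esub> sum_incl I A i a j)"
  if "a \<in>. A i" "b \<in>. A i" "j \<in> I" for a b j k
 proof -
  interpret Module.module K "A j" using fam that(3) .
  show ?thesis using that by (auto simp: sum_incl_def)
 qed
 moreover have "sum_incl I A i a \<in> (\<Pi>\<^sub>E i\<in>I. carrier (A i))" if "a \<in>. A i" for a
  using that zero_closed_fam by (auto simp: sum_incl_def)
 ultimately show ?thesis
  using fin by (auto simp: K_linear_def sum_mod_simps sum_incl_def intro!: ext)
qed

lemma incl_closed: "i \<in> I ==> a \<in>. A i ==> sum_incl I A i a \<in>. sum_mod I A"
 using linear_incl K_linear_closed by metis

lemma linear_map_incl: "i \<in> I ==> linear_map K (A i) (sum_mod I A) (sum_incl I A i)"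
 by (intro linear_mapI module_sum fam linear_incl)

lemma sum_decomp:
 assumes f: "f \<in>. sum_mod I A"
 shows "f = (\<Oplus>\<^bsub>sum_mod I A\<^esub>i\<in>{i \<in> I. f i \<noteq> (zero (A i))}. sum_incl I A i (f i))"
proof -
 interpret S: Module.module K "sum_mod I A" by (rule module_sum)
 let ?S = "{i \<in> I. f i \<noteq> (zero (A i))}"
 have fi: "f i \<in>. A i" if "i \<in> I" for i using f that by (auto simp: sum_mod_simps)
 have fin: "finite ?S" using f by (simp add: sum_mod_simps)
 have cl: "(%i. sum_incl I A i (f i)) \<in> ?S \<rightarrow> carrier (sum_mod I A)"
  using fi incl_closed by auto
 show ?thesis
 proof (rule extensional_eqI[of _ I])
  show "f \<in> extensional I" using f by (auto simp: sum_mod_simps PiE_iff)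
  show "(\<Oplus>\<^bsub>sum_mod I A\<^esub>i\<in>?S. sum_incl I A i (f i)) \<in> extensional I"
   using S.finsum_closed[OF cl] by (auto simp: sum_mod_simps PiE_iff)
  fix j assume j: "j \<in> I"
  interpret j: linear_map K "sum_mod I A" "A j" "%f. f j" by (rule linear_map_sum_proj[OF j])
  have "(\<Oplus>\<^bsub>sum_mod I A\<^esub>i\<in>?S. sum_incl I A i (f i)) j = (\<Oplus>\<^bsub>A j\<^esub>i\<in>?S. sum_incl I A i (f i) j)"
   using j.finsum[OF cl] .
  also have "... = (\<Oplus>\<^bsub>A j\<^esub>i\<in>?S. if j = i then f j else zero (A j))"
   using j fi by (intro j.cod.M.finsum_cong') (auto simp: sum_incl_def)
  also have "... = f j"
  proof (cases "j \<in> ?S")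
   case True
   then show ?thesis using j.cod.M.finsum_singleton[of j ?S "%_. f j"] fin fi[OF j] by auto
  next
   case False
   then have "(\<Oplus>\<^bsub>A j\<^esub>i\<in>?S. if j = i then f j else zero (A j)) = (\<Oplus>\<^bsub>A j\<^esub>i\<in>?S. (zero (A j)))"
    by (intro j.cod.M.finsum_cong') auto
   then show ?thesis using False j by simp
  qed
  finally show "f j = (\<Oplus>\<^bsub>sum_mod I A\<^esub>i\<in>?S. sum_incl I A i (f i)) j" by simp
 qed
qed

text \<open>This is how identities between faces, contractions and induced maps are reduced to
  elements \<open>m \<otimes> xs\<close> supported on a single tuple.\<close>

lemma sum_linear_eqI:
 assumes B: "Module.module K B" and F: "K_linear K (sum_mod I A) B F" and G: "K_linear K (sum_mod I A) B G"
  and eq: "!!i a. i \<in> I ==> a \<in>. A i ==> F (sum_incl I A i a) = G (sum_incl I A i a)"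
  and f: "f \<in>. sum_mod I A"
 shows "F f = G f"
proof -
 interpret F: linear_map K "sum_mod I A" B F by (intro linear_mapI module_sum B F)
 interpret G: linear_map K "sum_mod I A" B G by (intro linear_mapI module_sum B G)
 let ?S = "{i \<in> I. f i \<noteq> (zero (A i))}"
 have fi: "f i \<in>. A i" if "i \<in> I" for i using f that by (auto simp: sum_mod_simps)
 have cl: "(%i. sum_incl I A i (f i)) \<in> ?S \<rightarrow> carrier (sum_mod I A)"
  using fi incl_closed by auto
 have "F f = F (\<Oplus>\<^bsub>sum_mod I A\<^esub>i\<in>?S. sum_incl I A i (f i))" using sum_decomp[OF f] by simp
 also have "... = (\<Oplus>\<^bsub>B\<^esub>i\<in>?S. F (sum_incl I A i (f i)))" using F.finsum[OF cl] .
 also have "... = (\<Oplus>\<^bsub>B\<^esub>i\<in>?S. G (sum_incl I A i (f i)))"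
  using eq fi G.closed incl_closed by (intro F.cod.M.finsum_cong') auto
 also have "... = G (\<Oplus>\<^bsub>sum_mod I A\<^esub>i\<in>?S. sum_incl I A i (f i))" using G.finsum[OF cl] by simp
 also have "... = G f" using sum_decomp[OF f] by simp
 finally show ?thesis .
qed

text \<open>\<open>sum_ext\<close> sums over the support of its argument, which changes under
  addition and scaling. Comparing values needs a common finite index set; the added terms are values
  of linear maps at zero.\<close>

lemma sum_ext_superset:
 assumes B: "Module.module K B" and \<phi>: "!!i. i \<in> I ==> K_linear K (A i) B (\<phi> i)"
  and f: "f \<in>. sum_mod I A"
  and S: "finite S" "S \<subseteq> I" "{i \<in> I. f i \<noteq> (zero (A i))} \<subseteq> S"
 shows "sum_ext I A B \<phi> f = (\<Oplus>\<^bsub>B\<^esub>i\<in>S. \<phi> i (f i))"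
proof -
 interpret B: Module.module K B by fact
 have fi: "f i \<in>. A i" if "i \<in> I" for i using f that by (auto simp: sum_mod_simps)
 have z: "\<phi> i (zero (A i)) = zero B" if "i \<in> I" for i
  using linear_map.zero[OF linear_mapI[OF fam B \<phi>]] that by blast
 have cl: "\<phi> i (f i) \<in>. B" if "i \<in> I" for i
  using \<phi>[OF that] fi[OF that] by (auto simp: K_linear_def)
 show ?thesis
  unfolding sum_ext_def
 proof (rule B.add.finprod_mono_neutral_cong_left)
  fix i assume "i \<in> S - {i \<in> I. f i \<noteq> (zero (A i))}"
  then have "i \<in> I" "f i = zero (A i)" using S(2) by auto
  then show "\<phi> i (f i) = zero B" using z by simp
 qed (use S cl in auto)
qed

lemma linear_sum_ext:
 assumes B: "Module.module K B" and \<phi>: "!!i. i \<in> I ==> K_linear K (A i) B (\<phi> i)"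
 shows "K_linear K (sum_mod I A) B (sum_ext I A B \<phi>)"
proof -
 interpret B: Module.module K B by fact
 interpret S: Module.module K "sum_mod I A" by (rule module_sum)
 have fi: "f i \<in>. A i" if "i \<in> I" "f \<in>. sum_mod I A" for i f
  using that by (auto simp: sum_mod_simps)
 have cl: "\<phi> i (f i) \<in>. B" if "i \<in> I" "f \<in>. sum_mod I A" for i f
  using K_linear_closed[OF \<phi>[OF that(1)] fi[OF that]] .
 have ad: "\<phi> i ((f \<oplus>\<^bsub>sum_mod I A\<^esub> g) i) = \<phi> i (f i) \<oplus>\<^bsub>B\<^esub> \<phi> i (g i)"
  if "i \<in> I" "f \<in>. sum_mod I A" "g \<in>. sum_mod I A" for i f g
  using \<phi>[OF that(1)] that(1) fi[OF that(1,2)] fi[OF that(1,3)] by (simp add: K_linear_def sum_mod_simps)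
 have sm: "\<phi> i ((k \<odot>\<^bsub>sum_mod I A\<^esub> f) i) = k \<odot>\<^bsub>B\<^esub> \<phi> i (f i)"
  if "i \<in> I" "f \<in>. sum_mod I A" "k \<in>. K" for i f k
  using \<phi>[OF that(1)] that(1,3) fi[OF that(1,2)] by (simp add: K_linear_def sum_mod_simps)
 show ?thesis
  unfolding K_linear_def
 proof (intro conjI ballI funcsetI)
  fix f assume f: "f \<in>. sum_mod I A"
  let ?S = "{i \<in> I. f i \<noteq> (zero (A i))}"
  have fin: "finite ?S" using f by (simp add: sum_mod_simps)
  show "sum_ext I A B \<phi> f \<in>. B"
   unfolding sum_ext_def using cl[OF _ f] by (intro B.finsum_closed) blast
  fix g assume g: "g \<in>. sum_mod I A"
  let ?T = "?S \<union> {i \<in> I. g i \<noteq> (zero (A i))}"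
  have T: "finite ?T" "?T \<subseteq> I" using fin g by (auto simp: sum_mod_simps)
  have fg: "f \<oplus>\<^bsub>sum_mod I A\<^esub> g \<in>. sum_mod I A" using f g by simp
  have "(f \<oplus>\<^bsub>sum_mod I A\<^esub> g) i = zero (A i)" if "i \<in> I" "i \<notin> ?T" for i
  proof -
   interpret Module.module K "A i" using fam that(1) .
   show ?thesis using that by (auto simp: sum_mod_simps)
  qed
  then have sub: "{i \<in> I. (f \<oplus>\<^bsub>sum_mod I A\<^esub> g) i \<noteq> (zero (A i))} \<subseteq> ?T" by blast
  have "sum_ext I A B \<phi> (f \<oplus>\<^bsub>sum_mod I A\<^esub> g) = (\<Oplus>\<^bsub>B\<^esub>i\<in>?T. \<phi> i ((f \<oplus>\<^bsub>sum_mod I A\<^esub> g) i))"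
   by (rule sum_ext_superset[OF B \<phi> fg T sub])
  also have "... = (\<Oplus>\<^bsub>B\<^esub>i\<in>?T. \<phi> i (f i) \<oplus>\<^bsub>B\<^esub> \<phi> i (g i))"
   using ad[OF _ f g] cl[OF _ f] cl[OF _ g] by (intro B.finsum_cong') auto
  also have "... = (\<Oplus>\<^bsub>B\<^esub>i\<in>?T. \<phi> i (f i)) \<oplus>\<^bsub>B\<^esub> (\<Oplus>\<^bsub>B\<^esub>i\<in>?T. \<phi> i (g i))"
   using cl[OF _ f] cl[OF _ g] by (intro B.finsum_addf) auto
  also have "... = sum_ext I A B \<phi> f \<oplus>\<^bsub>B\<^esub> sum_ext I A B \<phi> g"
   using sum_ext_superset[OF B \<phi> f T] sum_ext_superset[OF B \<phi> g T] by simp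
  finally show "sum_ext I A B \<phi> (f \<oplus>\<^bsub>sum_mod I A\<^esub> g) = sum_ext I A B \<phi> f \<oplus>\<^bsub>B\<^esub> sum_ext I A B \<phi> g" .
 next
  fix k f assume k: "k \<in>. K" and f: "f \<in>. sum_mod I A"
  let ?S = "{i \<in> I. f i \<noteq> (zero (A i))}"
  have S: "finite ?S" "?S \<subseteq> I" using f by (auto simp: sum_mod_simps)
  have kf: "k \<odot>\<^bsub>sum_mod I A\<^esub> f \<in>. sum_mod I A" using k f by simp
  have "(k \<odot>\<^bsub>sum_mod I A\<^esub> f) i = zero (A i)" if "i \<in> I" "i \<notin> ?S" for i
  proof -
   interpret Module.module K "A i" using fam that(1) .
   show ?thesis using k that by (auto simp: sum_mod_simps)
  qed
  then have sub: "{i \<in> I. (k \<odot>\<^bsub>sum_mod I A\<^esub> f) i \<noteq> (zero (A i))} \<subseteq> ?S" by blast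
  have "sum_ext I A B \<phi> (k \<odot>\<^bsub>sum_mod I A\<^esub> f) = (\<Oplus>\<^bsub>B\<^esub>i\<in>?S. \<phi> i ((k \<odot>\<^bsub>sum_mod I A\<^esub> f) i))"
   by (rule sum_ext_superset[OF B \<phi> kf S sub])
  also have "... = (\<Oplus>\<^bsub>B\<^esub>i\<in>?S. k \<odot>\<^bsub>B\<^esub> \<phi> i (f i))"
   using sm[OF _ f k] cl[OF _ f] k by (intro B.finsum_cong') auto
  also have "... = k \<odot>\<^bsub>B\<^esub> sum_ext I A B \<phi> f"
   unfolding sum_ext_def using cl[OF _ f] k S(1)
   by (intro B.finsum_smult_ldistr[symmetric]) auto
  finally show "sum_ext I A B \<phi> (k \<odot>\<^bsub>sum_mod I A\<^esub> f) = k \<odot>\<^bsub>B\<^esub> sum_ext I A B \<phi> f" .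
 qed
qed

lemma sum_ext_incl:
 assumes B: "Module.module K B" and \<phi>: "!!i. i \<in> I ==> K_linear K (A i) B (\<phi> i)"
  and i: "i \<in> I" and a: "a \<in>. A i"
 shows "sum_ext I A B \<phi> (sum_incl I A i a) = \<phi> i a"
proof -
 interpret B: Module.module K B by fact
 have "sum_ext I A B \<phi> (sum_incl I A i a) = (\<Oplus>\<^bsub>B\<^esub>j\<in>{i}. \<phi> j (sum_incl I A i a j))"
  by (rule sum_ext_superset[OF B \<phi> incl_closed[OF i a]]) (use i in "auto simp: sum_incl_def")
 then show ?thesis using \<phi>[OF i] i a by (auto simp: sum_incl_def K_linear_def Pi_iff)
qed

lemma linear_map_sum_ext:
 assumes "Module.module K B" "!!i. i \<in> I ==> K_linear K (A i) B (\<phi> i)"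
 shows "linear_map K (sum_mod I A) B (sum_ext I A B \<phi>)"
 by (intro linear_mapI module_sum linear_sum_ext assms)

end


section \<open>Free modules and spans\<close>

lemma module_ring_mod: "cring K ==> Module.module K (ring_mod K)"
proof -
 assume "cring K"
 then interpret cring K .
 show ?thesis
 proof (rule moduleI)
  show "abelian_group (ring_mod K)"
   by (rule abelian_groupI) (auto simp: ring_mod_def a_ac intro: exI l_neg bexI[of _ "\<ominus>\<^bsub>K\<^esub> _"])
 qed (auto simp: ring_mod_def l_distr r_distr m_assoc is_cring)
qed

lemma ring_mod_simps:
 "carrier (ring_mod K) = carrier K" "zero (ring_mod K) = zero K"
 "x \<oplus>\<^bsub>ring_mod K\<^esub> y = x \<oplus>\<^bsub>K\<^esub> y" "k \<odot>\<^bsub>ring_mod K\<^esub> x = k \<otimes>\<^bsub>K\<^esub> x"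
 by (simp_all add: ring_mod_def)

locale free_module = cring K for K :: "'k ring" + fixes I :: "'i set"
begin

sublocale fm: module_family K I "%_. ring_mod K"
 by (simp add: module_family_def is_cring module_ring_mod)

lemma module_free: "Module.module K (free_mod K I)"
 unfolding free_mod_def by (rule fm.module_sum)

lemma basis_closed: "i \<in> I ==> basis_elt K I i \<in>. free_mod K I"
 unfolding basis_elt_def free_mod_def by (rule fm.incl_closed) (auto simp: ring_mod_simps)

lemma incl_eq_basis: "i \<in> I ==> k \<in>. K ==>
  sum_incl I (%_. ring_mod K) i k = k \<odot>\<^bsub>free_mod K I\<^esub> basis_elt K I i"
 unfolding free_mod_def basis_elt_def sum_mod_simps by (auto simp: sum_incl_def ring_mod_simps)

lemma linear_scale: "Module.module K B ==> b \<in>. B ==> K_linear K (ring_mod K) B (%k. k \<odot>\<^bsub>B\<^esub> b)"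
proof -
 assume "Module.module K B" and b: "b \<in>. B"
 then interpret B: Module.module K B by simp
 show ?thesis using b by (auto simp: K_linear_def ring_mod_simps B.smult_l_distr B.smult_assoc1)
qed

lemma linear_lin_ext:
 "Module.module K B ==> (!!i. i \<in> I ==> \<phi> i \<in>. B) ==> K_linear K (free_mod K I) B (lin_ext K I B \<phi>)"
 unfolding lin_ext_def free_mod_def by (intro fm.linear_sum_ext linear_scale) auto

lemma lin_ext_basis:
 assumes B: "Module.module K B" and \<phi>: "!!i. i \<in> I ==> \<phi> i \<in>. B" and i: "i \<in> I"
 shows "lin_ext K I B \<phi> (basis_elt K I i) = \<phi> i"
proof -
 interpret B: Module.module K B by fact
 have "lin_ext K I B \<phi> (basis_elt K I i) = \<one>\<^bsub>K\<^esub> \<odot>\<^bsub>B\<^esub> \<phi> i"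
  unfolding lin_ext_def basis_elt_def
  by (rule fm.sum_ext_incl[OF B]) (use B \<phi> i in "auto simp: ring_mod_simps intro!: linear_scale")
 then show ?thesis using \<phi>[OF i] by simp
qed

lemma free_linear_eqI:
 assumes B: "Module.module K B" and F: "K_linear K (free_mod K I) B F" and G: "K_linear K (free_mod K I) B G"
  and eq: "!!i. i \<in> I ==> F (basis_elt K I i) = G (basis_elt K I i)"
  and f: "f \<in>. free_mod K I"
 shows "F f = G f"
proof (rule fm.sum_linear_eqI[OF B, of F G])
 fix i k assume i: "i \<in> I" and k: "k \<in>. ring_mod K"
 then have k: "k \<in>. K" by (simp add: ring_mod_simps)
 show "F (sum_incl I (%_. ring_mod K) i k) = G (sum_incl I (%_. ring_mod K) i k)"
  using F G eq[OF i] basis_closed[OF i] k by (simp add: incl_eq_basis[OF i k] K_linear_def)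
qed (use F G f in "simp_all add: free_mod_def")

text \<open>For a fixed coefficient vector, \<open>lin_ext\<close> is a finite combination of the
  maps \<open>\<phi> i\<close>. Together with \<open>linear_lin_ext\<close> this makes operations
  bilinear that are given on pairs of basis elements, such as the product of the distance algebra
  and its action on modules.\<close>

lemma linear_lin_ext_param:
 assumes C: "Module.module K C" and B: "Module.module K B" and \<phi>: "!!i. i \<in> I ==> K_linear K C B (\<phi> i)"
  and f: "f \<in>. free_mod K I"
 shows "K_linear K C B (%c. lin_ext K I B (%i. \<phi> i c) f)"
 unfolding lin_ext_def sum_ext_def
 by (rule K_linear_finsum_map[OF C B], rule K_linear_smult_map[OF B])
  (use f \<phi> in "auto simp: free_mod_def sum_mod_simps ring_mod_simps")

end

lemma submodule_mod_span:
 assumes "Module.module K A" "T \<subseteq> carrier A"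
 shows "submodule (mod_span K A T) K A" "T \<subseteq> mod_span K A T"
proof -
 interpret Module.module K A by fact
 have ex: "submodule (carrier A) K A" by (rule carrier_is_submodule)
 have "a \<in>. A" if "a \<in> mod_span K A T" for a using ex assms(2) that by (auto simp: mod_span_def)
 moreover have "zero A \<in> mod_span K A T"
  by (auto simp: mod_span_def submodule_def subgroup_def)
 moreover have "a \<oplus>\<^bsub>A\<^esub> b \<in> mod_span K A T" if "a \<in> mod_span K A T" "b \<in> mod_span K A T" for a b
  unfolding mod_span_def using that submoduleE(5)[of _ a b] by (simp add: mod_span_def)
 moreover have "k \<odot>\<^bsub>A\<^esub> a \<in> mod_span K A T" if "k \<in>. K" "a \<in> mod_span K A T" for k a
  unfolding mod_span_def using that submoduleE(4)[of _ k a] by (simp add: mod_span_def)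
 ultimately show "submodule (mod_span K A T) K A" by (intro submoduleI') blast+
 show "T \<subseteq> mod_span K A T" by (auto simp: mod_span_def)
qed

lemma mod_span_subset: "submodule H K A ==> T \<subseteq> H ==> mod_span K A T \<subseteq> H"
 by (auto simp: mod_span_def)


subsection \<open>Alternating sums\<close>

context Module.module
begin

definition alt_term :: "nat => 'c => 'c" where
 "alt_term i x = (if even i then x else \<ominus>\<^bsub>M\<^esub> x)"

lemma alt_term_closed [simp]: "x \<in>. M ==> alt_term i x \<in>. M"
 by (simp add: alt_term_def)

lemma alt_term_add:
 "x \<in>. M ==> y \<in>. M ==> alt_term i (x \<oplus>\<^bsub>M\<^esub> y) = alt_term i x \<oplus>\<^bsub>M\<^esub> alt_term i y"
 by (simp add: alt_term_def M.minus_add)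

lemma alt_term_Suc: "x \<in>. M ==> alt_term (Suc i) x = \<ominus>\<^bsub>M\<^esub> alt_term i x"
 by (simp add: alt_term_def)

end

locale alt_module = Module.module K A for K :: "'k ring" and A :: "('k, 'a) module"
begin

lemma alt_sum_eq: "alt_sum A n f = (\<Oplus>\<^bsub>A\<^esub>i\<in>{..n}. alt_term i (f i))"
 by (simp add: alt_sum_def alt_term_def)

lemma alt_sum_closed: "(!!i. i <= n ==> f i \<in>. A) ==> alt_sum A n f \<in>. A"
 unfolding alt_sum_eq by (rule M.finsum_closed) auto

lemma alt_sum_cong:
 "(!!i. i <= n ==> f i = g i) ==> (!!i. i <= n ==> g i \<in>. A) ==> alt_sum A n f = alt_sum A n g"
 unfolding alt_sum_eq by (rule M.finsum_cong') auto

lemma alt_sum_0: "f 0 \<in>. A ==> alt_sum A 0 f = f 0"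
 by (simp add: alt_sum_eq alt_term_def)

lemma alt_sum_Suc:
 "(!!i. i <= Suc n ==> f i \<in>. A) ==>
  alt_sum A (Suc n) f = alt_term (Suc n) (f (Suc n)) \<oplus>\<^bsub>A\<^esub> alt_sum A n f"
 unfolding alt_sum_eq by (rule M.finsum_Suc) auto

lemma alt_sum_add:
 "(!!i. i <= n ==> f i \<in>. A) ==> (!!i. i <= n ==> g i \<in>. A) ==>
  alt_sum A n (%i. f i \<oplus>\<^bsub>A\<^esub> g i) = alt_sum A n f \<oplus>\<^bsub>A\<^esub> alt_sum A n g"
proof -
 assume f: "!!i. i <= n ==> f i \<in>. A" and g: "!!i. i <= n ==> g i \<in>. A"
 have "alt_sum A n (%i. f i \<oplus>\<^bsub>A\<^esub> g i) = (\<Oplus>\<^bsub>A\<^esub>i\<in>{..n}. alt_term i (f i) \<oplus>\<^bsub>A\<^esub> alt_term i (g i))"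
  unfolding alt_sum_eq by (rule M.finsum_cong') (use f g in "auto simp: alt_term_add")
 also have "... = alt_sum A n f \<oplus>\<^bsub>A\<^esub> alt_sum A n g"
  unfolding alt_sum_eq by (rule M.finsum_addf) (use f g in auto)
 finally show ?thesis .
qed

lemma alt_sum_minus:
 "(!!i. i <= n ==> f i \<in>. A) ==> alt_sum A n (%i. \<ominus>\<^bsub>A\<^esub> f i) = \<ominus>\<^bsub>A\<^esub> alt_sum A n f"
proof (induction n)
 case 0
 then show ?case by (simp add: alt_sum_0)
next
 case (Suc n)
 then have "alt_sum A n f \<in>. A" by (intro alt_sum_closed) auto
 then show ?case using Suc by (simp add: alt_sum_Suc alt_term_def M.minus_add)
qed

lemma alt_sum_alt_term:
 "(!!i. i <= n ==> f i \<in>. A) ==> alt_sum A n (%i. alt_term k (f i)) = alt_term k (alt_sum A n f)"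
 by (auto simp: alt_term_def alt_sum_minus)

text \<open>Splits off the face of index 0; the shift of the other indices accounts for the minus
  sign. A contraction that adds a point in front of a tuple relates face \<open>Suc i\<close> to
  face \<open>i\<close> and so needs the sum in this shape.\<close>

lemma alt_sum_Suc2:
 assumes "!!i. i <= Suc n ==> f i \<in>. A"
 shows "alt_sum A (Suc n) f = f 0 \<ominus>\<^bsub>A\<^esub> alt_sum A n (%i. f (Suc i))"
proof -
 have "alt_sum A (Suc n) f = (\<Oplus>\<^bsub>A\<^esub>i\<in>{..n}. alt_term (Suc i) (f (Suc i))) \<oplus>\<^bsub>A\<^esub> alt_term 0 (f 0)"
  unfolding alt_sum_eq by (rule M.finsum_Suc2) (use assms in auto)
 also have "(\<Oplus>\<^bsub>A\<^esub>i\<in>{..n}. alt_term (Suc i) (f (Suc i))) = alt_sum A n (%i. \<ominus>\<^bsub>A\<^esub> f (Suc i))"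
  unfolding alt_sum_eq by (rule M.finsum_cong') (use assms in "auto simp: alt_term_def")
 also have "... = \<ominus>\<^bsub>A\<^esub> alt_sum A n (%i. f (Suc i))"
  using assms by (intro alt_sum_minus) auto
 finally show ?thesis
  using assms alt_sum_closed[of n "%i. f (Suc i)"]
  by (simp add: a_minus_def alt_term_def M.a_comm)
qed

text \<open>The hypothesis is the shape that the (co)simplicial identities take on a fixed element.\<close>

lemma alt_sum_alt_sum:
 assumes "!!p q. p <= n ==> q <= Suc n ==> a p q \<in>. A"
  and "!!p q. p < q ==> q <= Suc n ==> a p q = a (q - 1) p"
 shows "alt_sum A n (%p. alt_sum A (Suc n) (a p)) = zero A"
 using assms
proof (induction n)
 case 0
 have "a 0 1 = a 0 0" using 0(2)[of 0 1] by simp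
 moreover have "a 0 0 \<in>. A" using 0(1) by simp
 moreover have cl: "a 0 i \<in>. A" if "i <= Suc 0" for i using that 0(1) by simp
 ultimately have "alt_sum A (Suc 0) (a 0) = zero A"
  by (simp add: alt_sum_0 alt_sum_Suc alt_term_def M.l_neg)
 then show ?case by (simp add: alt_sum_0)
next
 case (Suc n)
 note cl = Suc.prems(1)
 \<comment> \<open>The last row and the last column are split off. Up to sign both reduce to
   \<open>y\<close>, and the signs are opposite.\<close>
 define y where "y = alt_sum A n (a (Suc n))"
 have y: "y \<in>. A" unfolding y_def using cl by (intro alt_sum_closed) auto
 have y2: "alt_sum A n (%p. a p (Suc (Suc n))) = y"
  unfolding y_def
  by (rule alt_sum_cong) (use Suc.prems in auto)
 have x: "a (Suc n) (Suc (Suc n)) = a (Suc n) (Suc n)" "a (Suc n) (Suc n) \<in>. A"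
  using Suc.prems(2)[of "Suc n" "Suc (Suc n)"] cl by simp_all
 \<comment> \<open>The last two entries of this row are equal by the hypothesis and have opposite
   signs.\<close>
 have row: "alt_sum A (Suc (Suc n)) (a (Suc n)) = y"
  using x y cl by (simp add: alt_sum_Suc y_def[symmetric] alt_term_def M.l_neg M.r_neg M.a_assoc[symmetric])
 have inner: "alt_sum A (Suc (Suc n)) (a p) \<in>. A" if "p <= Suc n" for p
  using that cl by (intro alt_sum_closed) auto
 have inner': "alt_sum A (Suc n) (a p) \<in>. A" if "p <= Suc n" for p
  using that cl by (intro alt_sum_closed) auto
 have "alt_sum A (Suc n) (%p. alt_sum A (Suc (Suc n)) (a p)) =
   alt_term (Suc n) y \<oplus>\<^bsub>A\<^esub> alt_sum A n (%p. alt_sum A (Suc (Suc n)) (a p))"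
  using inner row by (simp add: alt_sum_Suc[of n])
 also have "alt_sum A n (%p. alt_sum A (Suc (Suc n)) (a p)) =
   alt_sum A n (%p. alt_term (Suc (Suc n)) (a p (Suc (Suc n))) \<oplus>\<^bsub>A\<^esub> alt_sum A (Suc n) (a p))"
  by (rule alt_sum_cong) (use cl inner' in \<open>auto simp: alt_sum_Suc[of "Suc n"]\<close>)
 also have "... = alt_sum A n (%p. alt_term (Suc (Suc n)) (a p (Suc (Suc n)))) \<oplus>\<^bsub>A\<^esub>
   alt_sum A n (%p. alt_sum A (Suc n) (a p))"
  by (rule alt_sum_add) (use cl inner' in auto)
 also have "alt_sum A n (%p. alt_sum A (Suc n) (a p)) = zero A"
  by (rule Suc.IH) (use Suc.prems in auto)
 also have "alt_sum A n (%p. alt_term (Suc (Suc n)) (a p (Suc (Suc n)))) = alt_term (Suc (Suc n)) y"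
  using cl y2 by (subst alt_sum_alt_term) auto
 finally show ?case using y by (simp add: alt_term_Suc M.l_neg M.r_neg)
qed

end

lemma (in linear_map) alt_sum:
 assumes "!!i. i <= n ==> g i \<in>. A"
 shows "f (alt_sum A n g) = alt_sum B n (%i. f (g i))"
proof -
 interpret alt_module K B by (simp add: alt_module_def cod.module_axioms)
 have "f (alt_sum A n g) = (\<Oplus>\<^bsub>B\<^esub>i\<in>{..n}. f (if even i then g i else \<ominus>\<^bsub>A\<^esub> g i))"
  unfolding alt_sum_def by (rule finsum) (use assms in auto)
 also have "... = alt_sum B n (%i. f (g i))"
  unfolding alt_sum_def by (rule cod.M.finsum_cong') (use assms closed minus in auto)
 finally show ?thesis .
qed

lemma K_linear_alt_sum_map:
 assumes "Module.module K A" "Module.module K B" "!!i. i <= n ==> K_linear K A B (\<phi> i)"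
 shows "K_linear K A B (%x. alt_sum B n (%i. \<phi> i x))"
 unfolding alt_sum_def
proof (rule K_linear_finsum_map[OF assms(1,2)])
 fix i assume "i \<in> {..n}"
 then show "K_linear K A B (%x. if even i then \<phi> i x else \<ominus>\<^bsub>B\<^esub> \<phi> i x)"
  using assms(3)[of i] K_linear_minus_map[OF assms(2), of A "\<phi> i"] by (cases "even i") auto
qed

section \<open>Homological algebra\<close>

lemma subquot_corr_sym: "subquot_corr K A H B L ==> subquot_corr K B L A H"
proof -
 assume *: "subquot_corr K A H B L"
 show ?thesis
 proof (rule subquot_corrE[OF *])
  fix R assume R: "!!u. u\<in>carrier A ==> \<exists>v\<in>carrier B. R u v" "!!v. v\<in>carrier B ==> \<exists>u\<in>carrier A. R u v"
   "!!u v u' v'. [|u \<in>. A; v \<in>. B; u' \<in>. A; v' \<in>. B; R u v; R u' v'|]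
      ==> R (u \<oplus>\<^bsub>A\<^esub> u') (v \<oplus>\<^bsub>B\<^esub> v')"
   "!!k u v. [|k \<in>. K; u \<in>. A; v \<in>. B; R u v|]
      ==> R (k \<odot>\<^bsub>A\<^esub> u) (k \<odot>\<^bsub>B\<^esub> v)"
   "!!u v. [|u \<in>. A; v \<in>. B; R u v|] ==> u \<in> H \<longleftrightarrow> v \<in> L"
  show ?thesis
   by (rule subquot_corrI[where R = "%v u. R u v"]) (simp_all add: R)
 qed
qed

text \<open>A span of two linear maps with common domain \<open>P\<close> is a linear relation
  between the images. All the links of the diagram chases below have this form.\<close>

lemma subquot_corr_surj:
 assumes A: "linear_map K D A f" and B: "linear_map K D B g" and P: "submodule P K D"
  and H: "!!p. p \<in> P ==> f p \<in> H \<longleftrightarrow> g p \<in> L"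
 shows "subquot_corr K (A\<lparr>carrier := f ` P\<rparr>) H (B\<lparr>carrier := g ` P\<rparr>) L"
proof -
 interpret f: linear_map K D A f by fact
 interpret g: linear_map K D B g by fact
 note P' = f.dom.submoduleE[OF P]
 have PD: "p \<in>. D" if "p \<in> P" for p using P'(1) that by blast
 show ?thesis
 proof (rule subquot_corrI[where R = "%a b. \<exists>p\<in>P. f p = a & g p = b"])
  fix a b a' b' assume "\<exists>p\<in>P. f p = a & g p = b" "\<exists>p\<in>P. f p = a' & g p = b'"
  then obtain p p' where "p \<in> P" "f p = a" "g p = b" "p' \<in> P" "f p' = a'" "g p' = b'" by blast
  then show "\<exists>p\<in>P. f p = a \<oplus>\<^bsub>A\<lparr>carrier := f ` P\<rparr>\<^esub> a' & g p = b \<oplus>\<^bsub>B\<lparr>carrier := g ` P\<rparr>\<^esub> b'"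
   using PD P'(5) f.add g.add by (intro bexI[of _ "p \<oplus>\<^bsub>D\<^esub> p'"]) auto
 next
  fix k a b assume "k \<in>. K" "\<exists>p\<in>P. f p = a & g p = b"
  then obtain p where "p \<in> P" "f p = a" "g p = b" by blast
  then show "\<exists>p\<in>P. f p = k \<odot>\<^bsub>A\<lparr>carrier := f ` P\<rparr>\<^esub> a & g p = k \<odot>\<^bsub>B\<lparr>carrier := g ` P\<rparr>\<^esub> b"
   using \<open>k \<in>. K\<close> PD P'(4) f.smult g.smult by (intro bexI[of _ "k \<odot>\<^bsub>D\<^esub> p"]) auto
 qed (use H in "auto, metis+")
qed

text \<open>The span whose first leg is the identity; it carries a subquotient along an
  embedding.\<close>

lemma subquot_corr_inj:
 assumes f: "linear_map K A B f" and inj: "inj_on f (carrier A)"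
  and U: "submodule U K A" and H: "H \<subseteq> U"
 shows "subquot_corr K (A\<lparr>carrier := U\<rparr>) H (B\<lparr>carrier := f ` U\<rparr>) (f ` H)"
proof -
 interpret f: linear_map K A B f by fact
 have id: "linear_map K A A (%x. x)"
  by (intro linear_mapI f.dom.module_axioms) (auto simp: K_linear_def)
 have UA: "U \<subseteq> carrier A" using f.dom.submoduleE[OF U] by simp
 have "subquot_corr K (A\<lparr>carrier := (%x. x) ` U\<rparr>) H (B\<lparr>carrier := f ` U\<rparr>) (f ` H)"
 proof (rule subquot_corr_surj[OF id f U])
  fix p assume "p \<in> U"
  then show "p \<in> H \<longleftrightarrow> f p \<in> f ` H" using UA H inj_on_image_mem_iff[OF inj, of p H] by auto
 qed
 then show ?thesis by simp
qed

text \<open>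
 Dimension shifting for homology: \<open>d\<close> links a cycle of \<open>E\<close> with a boundary of \<open>D\<close> as in the
 connecting homomorphism.
\<close>

lemma connecting_corr:
 assumes "linear_map K E1 E0 e1" "linear_map K E2 E1 e2" "linear_map K D1 D0 d1" "linear_map K D2 D1 d2"
  "linear_map K D0 E0 f0" "linear_map K D1 E1 f1" "linear_map K D2 E2 f2"
  and comm: "!!x. x \<in>. D1 ==> f0 (d1 x) = e1 (f1 x)" "!!x. x \<in>. D2 ==> f1 (d2 x) = e2 (f2 x)"
  and dd: "!!x. x \<in>. D2 ==> d1 (d2 x) = zero D0"
  and ex: "!!x. x \<in>. D1 ==> d1 x = zero D0 ==> \<exists>y\<in>carrier D2. d2 y = x"
 shows "subquot_corr K (E1\<lparr>carrier := {c \<in> f1 ` carrier D1. e1 c = zero E0}\<rparr>) (e2 ` f2 ` carrier D2)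
  (D0\<lparr>carrier := {x \<in> d1 ` carrier D1. f0 x = zero E0}\<rparr>) (d1 ` {x \<in> carrier D1. f1 x = zero E1})"
proof -
 interpret e1: linear_map K E1 E0 e1 by fact
 interpret e2: linear_map K E2 E1 e2 by fact
 interpret d1: linear_map K D1 D0 d1 by fact
 interpret d2: linear_map K D2 D1 d2 by fact
 interpret f0: linear_map K D0 E0 f0 by fact
 interpret f1: linear_map K D1 E1 f1 by fact
 interpret f2: linear_map K D2 E2 f2 by fact
 \<comment> \<open>The common domain of the span: its image under \<open>f1\<close> consists of
   cycles of \<open>E\<close>, and its image under \<open>d1\<close> of boundaries of
   \<open>D\<close> that are killed by \<open>f0\<close>.\<close>
 let ?P = "{x \<in> carrier D1. f0 (d1 x) = zero E0}"
 have comp: "linear_map K D1 E0 (%x. f0 (d1 x))"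
  by (intro linear_mapI d1.dom.module_axioms e1.cod.module_axioms K_linear_comp[OF d1.linear f0.linear])
 have P: "submodule ?P K D1" using linear_map.kernel_submodule[OF comp] .
 have "{c \<in> f1 ` carrier D1. e1 c = zero E0} = f1 ` ?P"
  "{x \<in> d1 ` carrier D1. f0 x = zero E0} = d1 ` ?P"
  using comm(1) by auto
 moreover have "subquot_corr K (E1\<lparr>carrier := f1 ` ?P\<rparr>) (e2 ` f2 ` carrier D2)
  (D0\<lparr>carrier := d1 ` ?P\<rparr>) (d1 ` {x \<in> carrier D1. f1 x = zero E1})"
 proof (rule subquot_corr_surj[OF \<open>linear_map K D1 E1 f1\<close> \<open>linear_map K D1 D0 d1\<close> P])
  fix p assume "p \<in> ?P"
  then have p: "p \<in>. D1" by simp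
  show "f1 p \<in> e2 ` f2 ` carrier D2 \<longleftrightarrow> d1 p \<in> d1 ` {x \<in> carrier D1. f1 x = zero E1}"
  proof
   assume "f1 p \<in> e2 ` f2 ` carrier D2"
   then obtain y where y: "y \<in>. D2" "f1 p = e2 (f2 y)" by auto
   \<comment> \<open>Subtracting the boundary of \<open>y\<close> makes the element vanish under
     \<open>f1\<close> and leaves its image under \<open>d1\<close> unchanged.\<close>
   define x where "x = p \<ominus>\<^bsub>D1\<^esub> d2 y"
   have x: "x \<in>. D1" using p y d2.closed by (simp add: x_def)
   have "f1 x = zero E1"
    using p y d2.closed f1.closed comm(2) by (simp add: x_def f1.diff a_minus_def e1.dom.M.r_neg f1.minus f1.add flip: y(2))
   moreover have "d1 x = d1 p"
    using p y d2.closed d1.closed dd by (simp add: x_def d1.add d1.minus a_minus_def)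
   ultimately show "d1 p \<in> d1 ` {x \<in> carrier D1. f1 x = zero E1}" using x by (metis (mono_tags, lifting) image_eqI mem_Collect_eq)
  next
   assume "d1 p \<in> d1 ` {x \<in> carrier D1. f1 x = zero E1}"
   then obtain x where x: "x \<in>. D1" "f1 x = zero E1" "d1 p = d1 x" by auto
   have "d1 (p \<ominus>\<^bsub>D1\<^esub> x) = zero D0" using p x d1.closed by (simp add: d1.diff d1.cod.M.r_neg a_minus_def d1.add d1.minus)
   then obtain y where y: "y \<in>. D2" "d2 y = p \<ominus>\<^bsub>D1\<^esub> x" using ex p x by (meson d1.dom.M.minus_closed)
   have "f1 p = f1 (p \<ominus>\<^bsub>D1\<^esub> x)" using p x f1.closed by (simp add: f1.diff a_minus_def f1.add f1.minus)
   also have "... = e2 (f2 y)" using comm(2)[OF y(1)] y(2) by simp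
   finally show "f1 p \<in> e2 ` f2 ` carrier D2" using y by blast
  qed
 qed
 ultimately show ?thesis by simp
qed

text \<open>The analogue of \<open>connecting_corr\<close> at the foot of the diagonal:
  \<open>g\<close> takes the place of \<open>d1\<close>, and exactness is replaced by the condition
  that the kernel of \<open>g\<close> is the image of the boundary map \<open>d1\<close>.\<close>

lemma connecting_corr_base:
 assumes "linear_map K E1 E0 e1" "linear_map K D1 D0 d1" "linear_map K D0 E0 f0" "linear_map K D1 E1 f1"
  "linear_map K D0 T g" and P: "submodule P K D0"
  and comm: "!!x. x \<in>. D1 ==> f0 (d1 x) = e1 (f1 x)"
  and ex: "!!x. x \<in>. D0 ==> g x = zero T \<longleftrightarrow> (\<exists>y\<in>carrier D1. d1 y = x)"
 shows "subquot_corr K (E0\<lparr>carrier := f0 ` P\<rparr>) (e1 ` f1 ` carrier D1)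
  (T\<lparr>carrier := g ` P\<rparr>) (g ` {x \<in> carrier D0. f0 x = zero E0})"
proof -
 interpret e1: linear_map K E1 E0 e1 by fact
 interpret d1: linear_map K D1 D0 d1 by fact
 interpret f0: linear_map K D0 E0 f0 by fact
 interpret f1: linear_map K D1 E1 f1 by fact
 interpret g: linear_map K D0 T g by fact
 show ?thesis
 proof (rule subquot_corr_surj[OF \<open>linear_map K D0 E0 f0\<close> \<open>linear_map K D0 T g\<close> P])
  fix p assume "p \<in> P"
  then have p: "p \<in>. D0" using d1.cod.submoduleE(1)[OF P] by blast
  show "f0 p \<in> e1 ` f1 ` carrier D1 \<longleftrightarrow> g p \<in> g ` {x \<in> carrier D0. f0 x = zero E0}"
  proof
   assume "f0 p \<in> e1 ` f1 ` carrier D1"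
   then obtain y where y: "y \<in>. D1" "f0 p = e1 (f1 y)" by auto
   define x where "x = p \<ominus>\<^bsub>D0\<^esub> d1 y"
   have x: "x \<in>. D0" using p y d1.closed by (simp add: x_def)
   have "f0 x = zero E0"
    using p y d1.closed f0.closed comm by (simp add: x_def f0.diff a_minus_def e1.cod.M.r_neg f0.minus f0.add flip: y(2))
   moreover have "g x = g p"
   proof -
    have "g (d1 y) = zero T" using ex[OF d1.closed[OF y(1)]] y by blast
    then show ?thesis using p y d1.closed g.closed by (simp add: x_def g.add g.minus a_minus_def)
   qed
   ultimately show "g p \<in> g ` {x \<in> carrier D0. f0 x = zero E0}" using x by (metis (mono_tags, lifting) image_eqI mem_Collect_eq)
  next
   assume "g p \<in> g ` {x \<in> carrier D0. f0 x = zero E0}"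
   then obtain x where x: "x \<in>. D0" "f0 x = zero E0" "g p = g x" by auto
   have "g (p \<ominus>\<^bsub>D0\<^esub> x) = zero T" using p x g.closed by (simp add: g.diff g.cod.M.r_neg a_minus_def g.add g.minus)
   then obtain y where y: "y \<in>. D1" "d1 y = p \<ominus>\<^bsub>D0\<^esub> x" using ex p x by (meson d1.cod.M.minus_closed)
   have "f0 p = f0 (p \<ominus>\<^bsub>D0\<^esub> x)" using p x f0.closed by (simp add: f0.diff a_minus_def f0.add f0.minus)
   also have "... = e1 (f1 y)" using comm[OF y(1)] y(2) by simp
   finally show "f0 p \<in> e1 ` f1 ` carrier D1" using y by blast
  qed
 qed
qed

section \<open>The homology of the two edges of a double complex\<close>

lemma quotient_module_homology:
 assumes "linear_map K C D f" "linear_map K B C g" "!!x. x \<in>. B ==> f (g x) = zero D"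
 shows "quotient_module K (C\<lparr>carrier := {x \<in> carrier C. f x = zero D}\<rparr>) (g ` carrier B)"
proof -
 interpret f: linear_map K C D f by fact
 interpret g: linear_map K B C g by fact
 have "submodule (g ` carrier B) K C" by (rule g.image_submodule[OF g.dom.carrier_is_submodule])
 then show ?thesis
  using assms(3) g.closed
  by (intro quotient_moduleI submodule_module submodule_restrict f.kernel_submodule f.dom.module_axioms) auto
qed

lemma mod_iso_trivial:
 assumes "Module.module K A" "Module.module K B"
 shows "mod_iso K (quot_mod A (carrier A)) (quot_mod B (carrier B))"
proof (rule mod_iso_subquot)
 interpret A: Module.module K A by fact
 interpret B: Module.module K B by fact
 show "quotient_module K A (carrier A)" "quotient_module K B (carrier B)"
  by (simp_all add: quotient_moduleI assms A.carrier_is_submodule B.carrier_is_submodule)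
 show "subquot_corr K A (carrier A) B (carrier B)"
  by (rule subquot_corrI[where R = "%_ _. True"]) (auto intro: A.M.zero_closed B.M.zero_closed)
qed

text \<open>In \<open>D k m\<close>, the index \<open>k\<close> is the degree in the resolution and
  \<open>m\<close> that of the chains. The maps \<open>F\<close> are exact throughout, with cokernel
  \<open>C\<close> via \<open>eps\<close>; the maps \<open>bD\<close> are exact in positive chain
  degree only, with cokernel \<open>T\<close> via \<open>kap\<close> in degree 0.\<close>

locale double_complex =
 fixes K :: "'k ring" and C :: "nat => ('k, 'c) module" and bC
  and D :: "nat => nat => ('k, 'd) module" and bD and eps and F
  and T :: "nat => ('k, 't) module" and bT and kap
 assumes bC: "!!m. linear_map K (C (Suc m)) (C m) (bC m)"
  and bD: "!!k m. linear_map K (D k (Suc m)) (D k m) (bD k m)"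
  and bT: "!!k. linear_map K (T (Suc k)) (T k) (bT k)"
  and eps: "!!m. linear_map K (D 0 m) (C m) (eps m)"
  and F: "!!k m. linear_map K (D (Suc k) m) (D k m) (F k m)"
  and kap: "!!k. linear_map K (D k 0) (T k) (kap k)"
  and bC_bC: "!!m x. x \<in>. C (Suc (Suc m)) ==> bC m (bC (Suc m) x) = zero (C m)"
  and bD_bD: "!!k m x. x \<in>. D k (Suc (Suc m)) ==> bD k m (bD k (Suc m) x) = zero (D k m)"
  and acyclic: "!!k m x. x \<in>. D k (Suc m) ==> bD k m x = zero (D k m) ==>
     \<exists>y\<in>carrier (D k (Suc (Suc m))). bD k (Suc m) y = x"
  and eps_comm: "!!m x. x \<in>. D 0 (Suc m) ==> eps m (bD 0 m x) = bC m (eps (Suc m) x)"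
  and F_comm: "!!k m x. x \<in>. D (Suc k) (Suc m) ==> F k m (bD (Suc k) m x) = bD k m (F k (Suc m) x)"
  and kap_comm: "!!k x. x \<in>. D (Suc k) 0 ==> kap k (F k 0 x) = bT k (kap (Suc k) x)"
  and eps_surj: "!!m. eps m ` carrier (D 0 m) = carrier (C m)"
  and eps_exact: "!!m. F 0 m ` carrier (D 1 m) = {x \<in> carrier (D 0 m). eps m x = zero (C m)}"
  and F_exact: "!!k m. F (Suc k) m ` carrier (D (Suc (Suc k)) m) = {x \<in> carrier (D (Suc k) m). F k m x = zero (D k m)}"
  and kap_surj: "!!k. kap k ` carrier (D k 0) = carrier (T k)"
  and kap_ker: "!!k x. x \<in>. D k 0 ==> kap k x = zero (T k) \<longleftrightarrow> (\<exists>y\<in>carrier (D k 1). bD k 0 y = x)"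
begin

lemma module_C: "Module.module K (C m)" and module_D: "Module.module K (D k m)" and module_T: "Module.module K (T k)"
 using bC[of m] bD[of k m] bT[of k] by (simp_all add: linear_map_def)

abbreviation "N k m \<equiv> F k m ` carrier (D (Suc k) m)"

text \<open>\<open>Zc k m\<close> is the intersection of the images of both differentials in
  \<open>D k m\<close>, and \<open>Bd k m\<close> the image of their composite. The quotients
  \<open>Zc k m / Bd k m\<close> agree along each diagonal \<open>k + m = N\<close>, and at either
  end they are the homology of \<open>C\<close> and of \<open>T\<close> in degree
  \<open>N + 1\<close>.\<close>

definition "Zc k m = {x \<in> bD k m ` carrier (D k (Suc m)). x \<in> N k m}"

definition "Bd k m = bD k m ` N k (Suc m)"

lemma N_closed: "x \<in> N k m ==> x \<in>. D k m"
 using linear_map.closed[OF F] by blast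

lemma Zc_submodule: "submodule (Zc k m) K (D k m)"
proof -
 have "submodule (bD k m ` carrier (D k (Suc m))) K (D k m)"
  by (intro linear_map.image_submodule[OF bD] module.carrier_is_submodule module_D)
 moreover have "submodule (N k m) K (D k m)"
  by (intro linear_map.image_submodule[OF F] module.carrier_is_submodule module_D)
 moreover have "Zc k m = bD k m ` carrier (D k (Suc m)) \<inter> N k m" by (auto simp: Zc_def)
 ultimately show ?thesis by (simp add: submodule_Int module_D)
qed

lemma step_C:
 "subquot_corr K (C (Suc m)\<lparr>carrier := {c \<in> carrier (C (Suc m)). bC m c = zero (C m)}\<rparr>)
   (bC (Suc m) ` carrier (C (Suc (Suc m)))) (D 0 m\<lparr>carrier := Zc 0 m\<rparr>) (Bd 0 m)"
proof -
 have "Zc 0 m = {x \<in> bD 0 m ` carrier (D 0 (Suc m)). eps m x = zero (C m)}"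
  using eps_exact[of m] linear_map.closed[OF bD, of _ 0 m] by (auto simp: Zc_def)
 moreover have "Bd 0 m = bD 0 m ` {x \<in> carrier (D 0 (Suc m)). eps (Suc m) x = zero (C (Suc m))}"
  using eps_exact[of "Suc m"] by (simp add: Bd_def)
 moreover have "subquot_corr K (C (Suc m)\<lparr>carrier := {c \<in> eps (Suc m) ` carrier (D 0 (Suc m)). bC m c = zero (C m)}\<rparr>)
   (bC (Suc m) ` eps (Suc (Suc m)) ` carrier (D 0 (Suc (Suc m))))
   (D 0 m\<lparr>carrier := {x \<in> bD 0 m ` carrier (D 0 (Suc m)). eps m x = zero (C m)}\<rparr>)
   (bD 0 m ` {x \<in> carrier (D 0 (Suc m)). eps (Suc m) x = zero (C (Suc m))})"
  by (rule connecting_corr[OF bC bC bD bD eps eps eps eps_comm eps_comm bD_bD acyclic])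
 ultimately show ?thesis unfolding eps_surj by simp
qed

text \<open>An instance of \<open>connecting_corr\<close> for the rows \<open>k\<close> and
  \<open>Suc k\<close>. In positive chain degree \<open>acyclic\<close> makes cycles the same as
  boundaries, which turns \<open>Zc k (Suc m)\<close> into the module of cycles that occurs
  there.\<close>

lemma step_D:
 "subquot_corr K (D k (Suc m)\<lparr>carrier := Zc k (Suc m)\<rparr>) (Bd k (Suc m)) (D (Suc k) m\<lparr>carrier := Zc (Suc k) m\<rparr>) (Bd (Suc k) m)"
proof -
 have "Zc (Suc k) m = {x \<in> bD (Suc k) m ` carrier (D (Suc k) (Suc m)). F k m x = zero (D k m)}"
  using F_exact[of k m] linear_map.closed[OF bD, of _ "Suc k" m] by (auto simp: Zc_def)
 moreover have "Zc k (Suc m) = {x \<in> N k (Suc m). bD k m x = zero (D k m)}"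
 proof (intro equalityI subsetI)
  fix x assume "x \<in> {x \<in> N k (Suc m). bD k m x = zero (D k m)}"
  then have "x \<in> N k (Suc m)" "\<exists>y\<in>carrier (D k (Suc (Suc m))). bD k (Suc m) y = x"
   using acyclic[OF N_closed] by simp_all
  then show "x \<in> Zc k (Suc m)" unfolding Zc_def by (elim bexE) (auto intro: rev_image_eqI)
 qed (use bD_bD in "auto simp: Zc_def")
 moreover have "Bd (Suc k) m = bD (Suc k) m ` {x \<in> carrier (D (Suc k) (Suc m)). F k (Suc m) x = zero (D k (Suc m))}"
  using F_exact[of k "Suc m"] by (simp add: Bd_def)
 moreover have "subquot_corr K (D k (Suc m)\<lparr>carrier := {c \<in> N k (Suc m). bD k m c = zero (D k m)}\<rparr>)
   (bD k (Suc m) ` N k (Suc (Suc m)))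
   (D (Suc k) m\<lparr>carrier := {x \<in> bD (Suc k) m ` carrier (D (Suc k) (Suc m)). F k m x = zero (D k m)}\<rparr>)
   (bD (Suc k) m ` {x \<in> carrier (D (Suc k) (Suc m)). F k (Suc m) x = zero (D k (Suc m))})"
  by (rule connecting_corr[OF bD bD bD bD F F F F_comm F_comm bD_bD acyclic])
 ultimately show ?thesis by (simp add: Bd_def)
qed

lemma chain: "subquot_corr K (C (Suc m)\<lparr>carrier := {c \<in> carrier (C (Suc m)). bC m c = zero (C m)}\<rparr>)
   (bC (Suc m) ` carrier (C (Suc (Suc m)))) (D m 0\<lparr>carrier := Zc m 0\<rparr>) (Bd m 0)"
proof -
 have "subquot_corr K (C (Suc m)\<lparr>carrier := {c \<in> carrier (C (Suc m)). bC m c = zero (C m)}\<rparr>)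
   (bC (Suc m) ` carrier (C (Suc (Suc m)))) (D k (m - k)\<lparr>carrier := Zc k (m - k)\<rparr>) (Bd k (m - k))"
  if "k <= m" for k
  using that
 proof (induction k)
  case 0
  show ?case using step_C[of m] by simp
 next
  case (Suc k)
  then have e: "m - k = Suc (m - Suc k)" "k <= m" by simp_all
  have 1: "Module.module K (D k (m - k)\<lparr>carrier := Zc k (m - k)\<rparr>)"
   by (intro submodule_module module_D Zc_submodule)
  show ?case
   using subquot_corr_trans[OF 1 Suc.IH[OF e(2)]] step_D[of k "m - Suc k"] unfolding e(1) by blast
 qed
 from this[of m] show ?thesis by simp
qed

text \<open>Inherited from the composite of consecutive maps \<open>F\<close> through the
  surjections \<open>kap\<close>.\<close>

lemma bT_bT: "x \<in>. T (Suc (Suc k)) ==> bT k (bT (Suc k) x) = zero (T k)"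
proof -
 assume "x \<in>. T (Suc (Suc k))"
 then obtain y where y: "y \<in>. D (Suc (Suc k)) 0" "x = kap (Suc (Suc k)) y" using kap_surj by blast
 have 1: "F (Suc k) 0 y \<in>. D (Suc k) 0" "F k 0 (F (Suc k) 0 y) = zero (D k 0)"
  using F_exact[of k 0] y(1) by auto
 have "bT k (bT (Suc k) x) = kap k (F k 0 (F (Suc k) 0 y))"
  using y kap_comm[OF y(1)] kap_comm[OF 1(1)] by simp
 then show ?thesis using 1(2) linear_map.zero[OF kap] by simp
qed

text \<open>The links along the diagonal lead from the homology of \<open>C\<close> in degree
  \<open>Suc k\<close> to the subquotient at \<open>D k 0\<close>; one further span through
  \<open>D (Suc k) 0\<close> leads from there to the homology of \<open>T\<close>. Degree 0 needs a
  single span only.\<close>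

theorem homology_iso: "mod_iso K (homology C bC n) (homology T bT n)"
proof (cases "n < 0")
 case True
 then show ?thesis by (simp add: homology_def mod_iso_trivial module_C module_T)
next
 case n: False
 show ?thesis
 proof (cases "nat n")
  case 0
  \<comment> \<open>In degree 0 both homologies are the quotient of \<open>D 0 0\<close> by the
    images of \<open>F 0 0\<close> and \<open>bD 0 0\<close> together.\<close>
  have c: "subquot_corr K (C 0\<lparr>carrier := eps 0 ` carrier (D 0 0)\<rparr>) (bC 0 ` eps 1 ` carrier (D 0 1))
   (T 0\<lparr>carrier := kap 0 ` carrier (D 0 0)\<rparr>) (kap 0 ` {x \<in> carrier (D 0 0). eps 0 x = zero (C 0)})"
   using connecting_corr_base[OF bC bD eps eps kap _ eps_comm kap_ker[unfolded One_nat_def]]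
    module.carrier_is_submodule[OF module_D] by simp
  have "kap 0 ` F 0 0 ` carrier (D 1 0) = bT 0 ` kap 1 ` carrier (D 1 0)"
   using kap_comm[of _ 0] by (force simp: image_image)
  then have "subquot_corr K (C 0) (bC 0 ` carrier (C 1)) (T 0) (bT 0 ` carrier (T 1))"
   using c eps_exact[of 0] by (simp add: eps_surj kap_surj)
  moreover have "quotient_module K (C 0) (bC 0 ` carrier (C 1))" "quotient_module K (T 0) (bT 0 ` carrier (T 1))"
   using linear_map.image_submodule[OF bC[of 0] module.carrier_is_submodule[OF module_C]]
    linear_map.image_submodule[OF bT[of 0] module.carrier_is_submodule[OF module_T]]
   by (simp_all add: quotient_moduleI module_C module_T)
  ultimately show ?thesis using n 0 mod_iso_subquot by (simp add: homology_def cycles_def)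
 next
  case (Suc k)
  \<comment> \<open>The domain of the last span: \<open>F\<close> maps it onto
    \<open>Zc k 0\<close>, and \<open>kap\<close> maps it onto the cycles of \<open>T\<close>,
    because \<open>kap\<close> vanishes exactly on the image of \<open>bD k 0\<close>.\<close>
  let ?P = "{p \<in> carrier (D (Suc k) 0). F k 0 p \<in> bD k 0 ` carrier (D k 1)}"
  have "submodule (bD k 0 ` carrier (D k 1)) K (D k 0)"
   using linear_map.image_submodule[OF bD[of k 0] module.carrier_is_submodule[OF module_D]] by simp
  then have P: "submodule ?P K (D (Suc k) 0)" by (rule linear_map.vimage_submodule[OF F])
  have im: "F k 0 ` ?P = Zc k 0"
  proof (intro equalityI subsetI)
   fix x assume "x \<in> Zc k 0"
   then obtain p where "p \<in>. D (Suc k) 0" "x = F k 0 p" "x \<in> bD k 0 ` carrier (D k 1)"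
    unfolding Zc_def One_nat_def by blast
   then show "x \<in> F k 0 ` ?P" by blast
  qed (auto simp: Zc_def)
  have kim: "kap (Suc k) ` ?P = {x \<in> carrier (T (Suc k)). bT k x = zero (T k)}"
  proof (intro equalityI subsetI)
   fix x assume "x \<in> kap (Suc k) ` ?P"
   then obtain p where p: "p \<in> ?P" "x = kap (Suc k) p" by blast
   then have "bT k x = kap k (F k 0 p)" "F k 0 p \<in>. D k 0" using kap_comm N_closed by auto
   then show "x \<in> {x \<in> carrier (T (Suc k)). bT k x = zero (T k)}"
    using p kap_ker[of "F k 0 p" k] linear_map.closed[OF kap[of "Suc k"]] by auto
  next
   fix x assume x: "x \<in> {x \<in> carrier (T (Suc k)). bT k x = zero (T k)}"
   then obtain p where p: "p \<in>. D (Suc k) 0" "x = kap (Suc k) p"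
    using kap_surj[of "Suc k"] by blast
   then have "kap k (F k 0 p) = zero (T k)" "F k 0 p \<in>. D k 0"
    using x kap_comm N_closed by auto
   then have "p \<in> ?P" using kap_ker[of "F k 0 p" k] p by (auto intro: rev_image_eqI)
   then show "x \<in> kap (Suc k) ` ?P" using p by blast
  qed
  have kb: "kap (Suc k) ` F (Suc k) 0 ` carrier (D (Suc (Suc k)) 0) = bT (Suc k) ` carrier (T (Suc (Suc k)))"
   unfolding kap_surj[symmetric] using kap_comm[of _ "Suc k"] by (force simp: image_image)
  have "subquot_corr K (D k 0\<lparr>carrier := Zc k 0\<rparr>) (Bd k 0)
   (T (Suc k)\<lparr>carrier := {x \<in> carrier (T (Suc k)). bT k x = zero (T k)}\<rparr>) (bT (Suc k) ` carrier (T (Suc (Suc k))))"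
   using connecting_corr_base[OF bD bD F F kap P F_comm kap_ker[unfolded One_nat_def]]
   unfolding im kim F_exact[symmetric] kb Bd_def by simp
  moreover have "Module.module K (D k 0\<lparr>carrier := Zc k 0\<rparr>)"
   by (intro submodule_module module_D Zc_submodule)
  ultimately have "subquot_corr K (C (Suc k)\<lparr>carrier := {c \<in> carrier (C (Suc k)). bC k c = zero (C k)}\<rparr>)
   (bC (Suc k) ` carrier (C (Suc (Suc k))))
   (T (Suc k)\<lparr>carrier := {x \<in> carrier (T (Suc k)). bT k x = zero (T k)}\<rparr>) (bT (Suc k) ` carrier (T (Suc (Suc k))))"
   using subquot_corr_trans[OF _ chain] by blast
  then show ?thesis
   using mod_iso_subquot[OF quotient_module_homology[OF bC bC bC_bC] quotient_module_homology[OF bT bT bT_bT]] n Suc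
   by (simp add: homology_def cycles_def)
 qed
qed

end

text \<open>Dual to \<open>connecting_corr\<close>: now the span starts at \<open>D0\<close>, and
  exactness at \<open>D1\<close> is what makes \<open>d0\<close> reach every element killed by both
  \<open>f1\<close> and \<open>d1\<close>. Matching the denominators is symmetric: an element is
  corrected by one of the kernel of the first or of the second leg.\<close>

lemma connecting_cocorr:
 assumes "linear_map K D0 D1 d0" "linear_map K D1 D2 d1" "linear_map K E0 E1 e0"
  "linear_map K D0 E0 f0" "linear_map K D1 E1 f1"
  and comm: "!!x. x \<in>. D0 ==> f1 (d0 x) = e0 (f0 x)"
  and dd: "!!x. x \<in>. D0 ==> d1 (d0 x) = zero D2"
  and ex: "!!x. x \<in>. D1 ==> d1 x = zero D2 ==> \<exists>y\<in>carrier D0. d0 y = x"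
 shows "subquot_corr K (D1\<lparr>carrier := {x \<in> carrier D1. f1 x = zero E1 & d1 x = zero D2}\<rparr>)
   (d0 ` {x \<in> carrier D0. f0 x = zero E0})
  (E0\<lparr>carrier := {x \<in> f0 ` carrier D0. e0 x = zero E1}\<rparr>) (f0 ` {x \<in> carrier D0. d0 x = zero D1})"
proof -
 interpret d0: linear_map K D0 D1 d0 by fact
 interpret d1: linear_map K D1 D2 d1 by fact
 interpret e0: linear_map K E0 E1 e0 by fact
 interpret f0: linear_map K D0 E0 f0 by fact
 interpret f1: linear_map K D1 E1 f1 by fact
 let ?P = "{x \<in> carrier D0. e0 (f0 x) = zero E1}"
 have "linear_map K D0 E1 (%x. e0 (f0 x))"
  by (intro linear_mapI d0.dom.module_axioms e0.cod.module_axioms K_linear_comp[OF f0.linear e0.linear])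
 then have P: "submodule ?P K D0" by (rule linear_map.kernel_submodule)
 have 1: "{x \<in> carrier D1. f1 x = zero E1 & d1 x = zero D2} = d0 ` ?P"
 proof (intro equalityI subsetI)
  fix x assume x: "x \<in> {x \<in> carrier D1. f1 x = zero E1 & d1 x = zero D2}"
  then obtain y where y: "y \<in>. D0" "d0 y = x" using ex by blast
  then show "x \<in> d0 ` ?P" using comm x by auto
 qed (use comm dd d0.closed in auto)
 have 2: "{x \<in> f0 ` carrier D0. e0 x = zero E1} = f0 ` ?P" by auto
 have d_f: "d0 p \<in> d0 ` {x \<in> carrier D0. f0 x = zero E0} \<longleftrightarrow> f0 p \<in> f0 ` {x \<in> carrier D0. d0 x = zero D1}"
  if p: "p \<in>. D0" for p
 proof
  assume "d0 p \<in> d0 ` {x \<in> carrier D0. f0 x = zero E0}"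
  then obtain x where x: "x \<in>. D0" "f0 x = zero E0" "d0 p = d0 x" by blast
  have "d0 (p \<ominus>\<^bsub>D0\<^esub> x) = zero D1" using x p d0.closed by (simp add: d0.add d0.minus a_minus_def d0.cod.M.r_neg)
  moreover have "f0 (p \<ominus>\<^bsub>D0\<^esub> x) = f0 p" using x p f0.closed by (simp add: f0.add f0.minus a_minus_def)
  ultimately show "f0 p \<in> f0 ` {x \<in> carrier D0. d0 x = zero D1}"
   using x p by (intro rev_image_eqI[of "p \<ominus>\<^bsub>D0\<^esub> x"]) auto
 next
  assume "f0 p \<in> f0 ` {x \<in> carrier D0. d0 x = zero D1}"
  then obtain x where x: "x \<in>. D0" "d0 x = zero D1" "f0 p = f0 x" by blast
  have "f0 (p \<ominus>\<^bsub>D0\<^esub> x) = zero E0" using x p f0.closed by (simp add: f0.add f0.minus a_minus_def e0.dom.M.r_neg)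
  moreover have "d0 (p \<ominus>\<^bsub>D0\<^esub> x) = d0 p" using x p d0.closed by (simp add: d0.add d0.minus a_minus_def)
  ultimately show "d0 p \<in> d0 ` {x \<in> carrier D0. f0 x = zero E0}"
   using x p by (intro rev_image_eqI[of "p \<ominus>\<^bsub>D0\<^esub> x"]) auto
 qed
 show ?thesis
  unfolding 1 2
  by (rule subquot_corr_surj[OF \<open>linear_map K D0 D1 d0\<close> \<open>linear_map K D0 E0 f0\<close> P]) (simp add: d_f)
qed

section \<open>The dual double complex, whose edges are kernels\<close>

locale double_cocomplex =
 fixes K :: "'k ring" and C :: "nat => ('k, 'c) module" and bC
  and D :: "nat => nat => ('k, 'd) module" and bD and eta and F
  and T :: "nat => ('k, 't) module" and bT and kap
 assumes bC: "!!m. linear_map K (C m) (C (Suc m)) (bC m)"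
  and bD: "!!k m. linear_map K (D k m) (D k (Suc m)) (bD k m)"
  and bT: "!!k. linear_map K (T k) (T (Suc k)) (bT k)"
  and eta: "!!m. linear_map K (C m) (D 0 m) (eta m)"
  and F: "!!k m. linear_map K (D k m) (D (Suc k) m) (F k m)"
  and kap: "!!k. linear_map K (T k) (D k 0) (kap k)"
  and bC_bC: "!!m x. x \<in>. C m ==> bC (Suc m) (bC m x) = zero (C (Suc (Suc m)))"
  and bD_bD: "!!k m x. x \<in>. D k m ==> bD k (Suc m) (bD k m x) = zero (D k (Suc (Suc m)))"
  and acyclic: "!!k m x. x \<in>. D k (Suc m) ==> bD k (Suc m) x = zero (D k (Suc (Suc m))) ==>
     \<exists>y\<in>carrier (D k m). bD k m y = x"
  and eta_comm: "!!m x. x \<in>. C m ==> bD 0 m (eta m x) = eta (Suc m) (bC m x)"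
  and F_comm: "!!k m x. x \<in>. D k m ==> F k (Suc m) (bD k m x) = bD (Suc k) m (F k m x)"
  and kap_comm: "!!k x. x \<in>. T k ==> kap (Suc k) (bT k x) = F k 0 (kap k x)"
  and eta_inj: "!!m. inj_on (eta m) (carrier (C m))"
  and eta_exact: "!!m. eta m ` carrier (C m) = {x \<in> carrier (D 0 m). F 0 m x = zero (D 1 m)}"
  and F_exact: "!!k m. F k m ` carrier (D k m) = {x \<in> carrier (D (Suc k) m). F (Suc k) m x = zero (D (Suc (Suc k)) m)}"
  and kap_inj: "!!k. inj_on (kap k) (carrier (T k))"
  and kap_im: "!!k. kap k ` carrier (T k) = {x \<in> carrier (D k 0). bD k 0 x = zero (D k 1)}"
begin

lemma module_C: "Module.module K (C m)" and module_D: "Module.module K (D k m)" and module_T: "Module.module K (T k)"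
 using bC[of m] bD[of k m] bT[of k] by (simp_all add: linear_map_def)

definition "Zc k m = {x \<in> carrier (D k m). F k m x = zero (D (Suc k) m) & bD k m x = zero (D k (Suc m))}"

text \<open>At the start of the diagonal the denominator comes from \<open>C\<close>; further on it
  is the image under \<open>F\<close> of the cocycles one row before.\<close>

definition "Bd k m = (case k of 0 => eta m ` coboundaries C bC m
  | Suc j => F j m ` {x \<in> carrier (D j m). bD j m x = zero (D j (Suc m))})"

lemma Zc_submodule: "submodule (Zc k m) K (D k m)"
proof -
 have "Zc k m = {x \<in> carrier (D k m). F k m x = zero (D (Suc k) m)} \<inter> {x \<in> carrier (D k m). bD k m x = zero (D k (Suc m))}"
  by (auto simp: Zc_def)
 then show ?thesis
  by (simp add: submodule_Int module_D linear_map.kernel_submodule[OF F] linear_map.kernel_submodule[OF bD])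
qed

text \<open>The denominator seen from the other differential. \<open>connecting_cocorr\<close>
  yields this form on its left side and the defining form on its right side; the lemma glues
  consecutive links.\<close>

lemma Bd_Suc: "Bd k (Suc m) = bD k m ` {x \<in> carrier (D k m). F k m x = zero (D (Suc k) m)}"
proof (cases k)
 case 0
 have "Bd k (Suc m) = bD 0 m ` eta m ` carrier (C m)"
  unfolding 0 Bd_def coboundaries_def using eta_comm[of _ m] by (simp add: image_image)
 then show ?thesis using eta_exact[of m] 0 by simp
next
 case (Suc j)
 have "{x \<in> carrier (D j (Suc m)). bD j (Suc m) x = zero (D j (Suc (Suc m)))} = bD j m ` carrier (D j m)"
  using acyclic[of _ j m] bD_bD[of _ j m] linear_map.closed[OF bD[of j m]] by (fastforce intro: rev_image_eqI)
 then have "Bd k (Suc m) = bD k m ` F j m ` carrier (D j m)"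
  unfolding Suc Bd_def using F_comm[of _ j m] by (simp add: image_image)
 then show ?thesis using F_exact[of j m] Suc by simp
qed

lemma step_D:
 "subquot_corr K (D k (Suc m)\<lparr>carrier := Zc k (Suc m)\<rparr>) (Bd k (Suc m)) (D (Suc k) m\<lparr>carrier := Zc (Suc k) m\<rparr>) (Bd (Suc k) m)"
proof -
 have "Zc (Suc k) m = {x \<in> F k m ` carrier (D k m). bD (Suc k) m x = zero (D (Suc k) (Suc m))}"
  unfolding F_exact Zc_def by auto
 moreover have "subquot_corr K (D k (Suc m)\<lparr>carrier := Zc k (Suc m)\<rparr>) (bD k m ` {x \<in> carrier (D k m). F k m x = zero (D (Suc k) m)})
  (D (Suc k) m\<lparr>carrier := {x \<in> F k m ` carrier (D k m). bD (Suc k) m x = zero (D (Suc k) (Suc m))}\<rparr>)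
  (F k m ` {x \<in> carrier (D k m). bD k m x = zero (D k (Suc m))})"
  unfolding Zc_def by (rule connecting_cocorr[OF bD bD bD F F F_comm bD_bD acyclic])
 moreover have "Bd (Suc k) m = F k m ` {x \<in> carrier (D k m). bD k m x = zero (D k (Suc m))}"
  by (simp add: Bd_def)
 ultimately show ?thesis by (simp add: Bd_Suc)
qed

lemma chain: "subquot_corr K (D 0 m\<lparr>carrier := Zc 0 m\<rparr>) (Bd 0 m) (D m 0\<lparr>carrier := Zc m 0\<rparr>) (Bd m 0)"
proof -
 have "subquot_corr K (D 0 m\<lparr>carrier := Zc 0 m\<rparr>) (Bd 0 m) (D k (m - k)\<lparr>carrier := Zc k (m - k)\<rparr>) (Bd k (m - k))"
  if "k <= m" for k
  using that
 proof (induction k)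
  case 0
  show ?case by (rule subquot_corrI[where R = "(=)"]) auto
 next
  case (Suc k)
  then have e: "m - k = Suc (m - Suc k)" "k <= m" by simp_all
  have 1: "Module.module K (D k (m - k)\<lparr>carrier := Zc k (m - k)\<rparr>)"
   by (intro submodule_module module_D Zc_submodule)
  show ?case
   using subquot_corr_trans[OF 1 Suc.IH[OF e(2)]] step_D[of k "m - Suc k"] unfolding e(1) by blast
 qed
 from this[of m] show ?thesis by simp
qed

text \<open>Inherited from the composite of consecutive maps \<open>F\<close> through the injections
  \<open>kap\<close>.\<close>

lemma bT_bT: "x \<in>. T k ==> bT (Suc k) (bT k x) = zero (T (Suc (Suc k)))"
proof -
 assume x: "x \<in>. T k"
 have 1: "bT k x \<in>. T (Suc k)" "bT (Suc k) (bT k x) \<in>. T (Suc (Suc k))"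
  using x linear_map.closed[OF bT] by blast+
 have "F k 0 (kap k x) \<in> F k 0 ` carrier (D k 0)" using x linear_map.closed[OF kap] by blast
 then have "F (Suc k) 0 (F k 0 (kap k x)) = zero (D (Suc (Suc k)) 0)" unfolding F_exact by simp
 then have "kap (Suc (Suc k)) (bT (Suc k) (bT k x)) = kap (Suc (Suc k)) (zero (T (Suc (Suc k))))"
  using x 1 kap_comm linear_map.zero[OF kap] by simp
 then show ?thesis
  using inj_onD[OF kap_inj] 1 abelian_monoid.zero_closed[OF abelian_group.axioms(1)[OF module.axioms(2)[OF module_T]]]
  by blast
qed

lemma coboundaries_submodule:
 assumes "!!m. linear_map K (A m) (A (Suc m)) (f m)"
 shows "submodule (coboundaries A f m) K (A m)"
proof (cases m)
 case 0
 then show ?thesis using assms[of 0] by (simp add: coboundaries_def submodule_zero linear_map_def)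
next
 case (Suc j)
 then show ?thesis
  using linear_map.image_submodule[OF assms[of j] module.carrier_is_submodule] assms[of j]
  by (simp add: coboundaries_def linear_map_def)
qed

lemma quotient_module_cohomology:
 assumes f: "!!m. linear_map K (A m) (A (Suc m)) (f m)"
  and ff: "!!m x. x \<in>. A m ==> f (Suc m) (f m x) = zero (A (Suc (Suc m)))"
 shows "quotient_module K (A m\<lparr>carrier := {x \<in> carrier (A m). f m x = zero (A (Suc m))}\<rparr>) (coboundaries A f m)"
proof -
 interpret f: linear_map K "A m" "A (Suc m)" "f m" by (rule f)
 have "coboundaries A f m \<subseteq> {x \<in> carrier (A m). f m x = zero (A (Suc m))}"
  using f.zero f.dom.M.zero_closed ff linear_map.closed[OF f] by (cases m) (auto simp: coboundaries_def)
 then show ?thesis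
  by (intro quotient_moduleI submodule_module submodule_restrict f.kernel_submodule f.dom.module_axioms
   coboundaries_submodule f)
qed

text \<open>Since \<open>eta\<close> and \<open>kap\<close> are embeddings, cohomology of
  \<open>C\<close> and of \<open>T\<close> in degree \<open>m\<close> sits directly at the two ends
  of the diagonal \<open>k + m' = m\<close>; in contrast to homology, no shift by one
  occurs.\<close>

theorem cohomology_iso: "mod_iso K (cohomology C bC n) (cohomology T bT n)"
proof (cases "n < 0")
 case True
 then show ?thesis by (simp add: cohomology_def mod_iso_trivial module_C module_T)
next
 case n: False
 define m where "m = nat n"
 let ?C = "{x \<in> carrier (C m). bC m x = zero (C (Suc m))}"
 let ?T = "{x \<in> carrier (T m). bT m x = zero (T (Suc m))}"
 have qC: "quotient_module K (C m\<lparr>carrier := ?C\<rparr>) (coboundaries C bC m)"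
  by (rule quotient_module_cohomology[where A = C and f = bC, OF bC bC_bC])
 have qT: "quotient_module K (T m\<lparr>carrier := ?T\<rparr>) (coboundaries T bT m)"
  by (rule quotient_module_cohomology[where A = T and f = bT, OF bT bT_bT])
 \<comment> \<open>Injectivity of \<open>eta\<close> allows the cocycle condition in
   \<open>C\<close> to be tested inside \<open>D 0\<close>.\<close>
 have bC_zero: "bD 0 m (eta m x) = zero (D 0 (Suc m)) \<longleftrightarrow> bC m x = zero (C (Suc m))" if "x \<in>. C m" for x
  using eta_comm[OF that] inj_onD[OF eta_inj[of "Suc m"], of "bC m x" "zero (C (Suc m))"] linear_map.zero[OF eta]
   linear_map.closed[OF bC that] linear_map.closed[OF bC]
   abelian_monoid.zero_closed[OF abelian_group.axioms(1)[OF module.axioms(2)[OF module_C]]] by metis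
 have bT_zero: "F m 0 (kap m x) = zero (D (Suc m) 0) \<longleftrightarrow> bT m x = zero (T (Suc m))" if "x \<in>. T m" for x
  using kap_comm[OF that] inj_onD[OF kap_inj[of "Suc m"], of "bT m x" "zero (T (Suc m))"] linear_map.zero[OF kap]
   linear_map.closed[OF bT that]
   abelian_monoid.zero_closed[OF abelian_group.axioms(1)[OF module.axioms(2)[OF module_T]]] by metis
 have imC: "eta m ` ?C = Zc 0 m"
 proof -
  have "eta m ` ?C = {x \<in> eta m ` carrier (C m). bD 0 m x = zero (D 0 (Suc m))}"
   using bC_zero by auto
  then show ?thesis unfolding eta_exact Zc_def by auto
 qed
 have imT: "kap m ` ?T = Zc m 0"
 proof -
  have "kap m ` ?T = {x \<in> kap m ` carrier (T m). F m 0 x = zero (D (Suc m) 0)}"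
   using bT_zero by auto
  then show ?thesis unfolding kap_im Zc_def by auto
 qed
 have bdT: "kap m ` coboundaries T bT m = Bd m 0"
 proof (cases m)
  case 0
  then show ?thesis using linear_map.zero[OF kap[of 0]] linear_map.zero[OF eta[of 0]]
   by (simp add: Bd_def coboundaries_def)
 next
  case (Suc j)
  then have "kap m ` coboundaries T bT m = F j 0 ` kap j ` carrier (T j)"
   using kap_comm[of _ j] by (simp add: coboundaries_def image_image)
  then show ?thesis unfolding kap_im by (simp add: Bd_def Suc)
 qed
 have "submodule ?C K (C m)" "submodule ?T K (T m)"
  by (simp_all add: linear_map.kernel_submodule[OF bC] linear_map.kernel_submodule[OF bT])
 moreover have "coboundaries C bC m \<subseteq> ?C" "coboundaries T bT m \<subseteq> ?T"
  using module.submoduleE(1)[OF quotient_module.axioms(1)[OF qC] quotient_module.sub[OF qC]]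
   module.submoduleE(1)[OF quotient_module.axioms(1)[OF qT] quotient_module.sub[OF qT]] by simp_all
 ultimately have "subquot_corr K (C m\<lparr>carrier := ?C\<rparr>) (coboundaries C bC m) (D 0 m\<lparr>carrier := eta m ` ?C\<rparr>) (eta m ` coboundaries C bC m)"
  "subquot_corr K (T m\<lparr>carrier := ?T\<rparr>) (coboundaries T bT m) (D m 0\<lparr>carrier := kap m ` ?T\<rparr>) (kap m ` coboundaries T bT m)"
  by (simp_all add: subquot_corr_inj[OF eta eta_inj] subquot_corr_inj[OF kap kap_inj])
 then have 1: "subquot_corr K (C m\<lparr>carrier := ?C\<rparr>) (coboundaries C bC m) (D 0 m\<lparr>carrier := Zc 0 m\<rparr>) (Bd 0 m)"
  and 2: "subquot_corr K (D m 0\<lparr>carrier := Zc m 0\<rparr>) (Bd m 0) (T m\<lparr>carrier := ?T\<rparr>) (coboundaries T bT m)"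
  unfolding imC imT bdT by (simp_all add: Bd_def subquot_corr_sym)
 have 3: "Module.module K (D k m'\<lparr>carrier := Zc k m'\<rparr>)" for k m'
  by (intro submodule_module module_D Zc_submodule)
 have "subquot_corr K (C m\<lparr>carrier := ?C\<rparr>) (coboundaries C bC m) (T m\<lparr>carrier := ?T\<rparr>) (coboundaries T bT m)"
  by (rule subquot_corr_trans[OF 3 1 subquot_corr_trans[OF 3 chain 2]])
 then show ?thesis using mod_iso_subquot[OF qC qT] n by (simp add: cohomology_def m_def)
qed

end

section \<open>Tuples and their lengths\<close>

lemma path_length_Nil [simp]: "path_length d [] = 0"
 and path_length_single [simp]: "path_length d [x] = 0"
 by (simp_all add: path_length_def)

lemma path_length_Cons [simp]: "path_length d (x # y # ys) = d x y + path_length d (y # ys)"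
proof -
 have "(\<Sum>i<Suc (length ys). d ((x # y # ys) ! i) ((x # y # ys) ! Suc i))
   = d x y + (\<Sum>i<length ys. d ((y # ys) ! i) ((y # ys) ! Suc i))"
  by (subst sum.lessThan_Suc_shift) simp
 then show ?thesis by (simp add: path_length_def)
qed

lemma path_length_append: "path_length d (xs @ x # ys) = path_length d (xs @ [x]) + path_length d (x # ys)"
proof (induction xs)
 case (Cons a xs)
 then show ?case by (cases xs) (simp_all add: add.assoc)
qed simp

lemma omit_0 [simp]: "omit 0 (x # xs) = xs" and omit_Suc [simp]: "omit (Suc i) (x # xs) = x # omit i xs"
 by (simp_all add: omit_def)

lemma length_omit [simp]: "i < length xs ==> length (omit i xs) = length xs - 1"
 by (simp add: omit_def)

lemma set_omit: "set (omit i xs) \<subseteq> set xs"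
 by (auto simp: omit_def dest: in_set_takeD in_set_dropD)

lemma omit_omit: "i < j ==> j < length xs ==> omit i (omit j xs) = omit (j - 1) (omit i xs)"
proof (induction xs arbitrary: i j)
 case (Cons x xs)
 then obtain j' where j: "j = Suc j'" by (cases j) auto
 show ?case
 proof (cases i)
  case (Suc i')
  then obtain j'' where "j' = Suc j''" using j Cons.prems by (cases j') auto
  then show ?thesis using Cons j Suc by simp
 qed (simp add: j)
qed simp

lemma omit_nth_0: "0 < i ==> i < length xs ==> omit i xs ! 0 = xs ! 0"
 by (cases xs; cases i) auto

lemma omit_append: "i < length xs ==> omit i (xs @ ys) = omit i xs @ ys"
 by (simp add: omit_def)

lemma omit_last: "omit (length xs) (xs @ [y]) = xs"
 by (simp add: omit_def)

section \<open>Lengths in a quasimetric space and their change under omission of a point\<close>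

locale dist_space =
 fixes K :: "'k ring" and G :: "real set" and X :: "'x set" and d :: "'x => 'x => ennreal"
 assumes cring_K: "cring K" and subgroup_G: "subgroup G real_group" and finite_X: "finite X"
  and quasi: "quasimetric X d"
  and dist_G: "!!x y. x \<in> X ==> y \<in> X ==> d x y < \<infinity> ==> enn2real (d x y) \<in> G"
begin

abbreviation dr :: "'x => 'x => real" where "dr x y \<equiv> enn2real (d x y)"
abbreviation fin :: "'x => 'x => bool" where "fin x y \<equiv> d x y < \<infinity>"
abbreviation In :: "'x => 'x set" where "In x \<equiv> {y \<in> X. d y x < \<infinity>}"
abbreviation Out :: "'x => 'x set" where "Out x \<equiv> {y \<in> X. d x y < \<infinity>}"
abbreviation "tup \<equiv> tuples X d"
abbreviation "tol \<equiv> tuples_of_length X d"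
abbreviation "pdeg \<equiv> path_deg d"
abbreviation "prs \<equiv> pairs X d"
abbreviation "MCp M l xs \<equiv> MC_part d M l xs"
abbreviation "coMCp M l xs \<equiv> coMC_part d M l xs"
abbreviation "Ch \<equiv> MC X d"
abbreviation "face \<equiv> MC_face X d"
abbreviation "del \<equiv> MC_bd X d"
abbreviation "CoCh \<equiv> coMC X d"
abbreviation "coface \<equiv> coMC_coface X d"
abbreviation "codel \<equiv> coMC_cobd X d"
abbreviation "Ch0 \<equiv> MC0 K X d"
abbreviation "face0 \<equiv> MC0_face K X d"
abbreviation "del0 \<equiv> MC0_bd K X d"
abbreviation "JX \<equiv> dist_ideal K G X d"

lemma group_real: "group real_group"
 by (rule groupI) (auto simp: real_group_def intro: exI[of _ "- x" for x] left_minus)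

lemma G_0: "0 \<in> G" using subgroup.one_closed[OF subgroup_G] by (simp add: real_group_def)

lemma G_add: "g \<in> G ==> h \<in> G ==> g + h \<in> G"
 using subgroup.m_closed[OF subgroup_G] by (simp add: real_group_def)

lemma G_uminus: "g \<in> G ==> - g \<in> G"
proof -
 assume g: "g \<in> G"
 have "inv\<^bsub>real_group\<^esub> g = - g"
  by (rule group.inv_equality[OF group_real]) (auto simp: real_group_def)
 then show ?thesis using subgroup.m_inv_closed[OF subgroup_G g] by simp
qed

lemma G_diff: "g \<in> G ==> h \<in> G ==> g - h \<in> G"
 using G_add[of g "- h"] G_uminus by simp

lemma dist_self: "x \<in> X ==> d x x = 0"
 and dist_eq_0: "x \<in> X ==> y \<in> X ==> d x y = 0 \<longleftrightarrow> x = y"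
 and triangle: "x \<in> X ==> y \<in> X ==> z \<in> X ==> d x z <= d x y + d y z"
 using quasi by (auto simp: quasimetric_def)

lemma dist_finite_trans: "x \<in> X ==> y \<in> X ==> z \<in> X ==> fin x y ==> fin y z ==> fin x z"
 using triangle[of x y z] by (metis ennreal_add_less_top infinity_ennreal_def order_le_less_trans)

text \<open>The triangle inequality at an inner point; at either end a summand disappears.\<close>

lemma path_length_omit_le: "set xs \<subseteq> X ==> path_length d (omit i xs) <= path_length d xs"
proof (induction xs arbitrary: i)
 case Nil
 then show ?case by (simp add: omit_def)
next
 case (Cons x xs)
 show ?case
 proof (cases i)
  case 0
  then show ?thesis by (cases xs) auto
 next
  case (Suc j)
  show ?thesis
  proof (cases xs)
   case Nil
   then show ?thesis using Suc by (simp add: omit_def)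
  next
   case xs: (Cons y ys)
   show ?thesis
   proof (cases j)
    case 0
    show ?thesis
    proof (cases ys)
     case ys: (Cons z zs)
     have "d x z + path_length d (z # zs) <= (d x y + d y z) + path_length d (z # zs)"
      using Cons.prems xs ys by (intro add_right_mono triangle) auto
     then show ?thesis using Suc 0 xs ys by (simp add: add.assoc)
    qed (use Suc 0 xs in simp)
   next
    case (Suc j')
    then show ?thesis using \<open>i = Suc j\<close> xs Cons.IH[of j] Cons.prems by (simp add: add_left_mono)
   qed
  qed
 qed
qed

text \<open>The various conditions in the faces (betweenness for inner points, equality with the
  neighbour at an end) are all the condition that omission does not change the length. In this
  uniform shape the simplicial identities become statements about lengths.\<close>

definition keep :: "nat => 'x list => bool" where
 "keep i xs \<longleftrightarrow> path_length d (omit i xs) = path_length d xs"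

lemma keep_Suc_Cons:
 assumes "path_length d (x # xs) < \<infinity>" "0 < i" "i < length xs"
 shows "keep (Suc i) (x # xs) \<longleftrightarrow> keep i xs"
proof -
 obtain y ys where xs: "xs = y # ys" using assms by (cases xs) auto
 obtain j where i: "i = Suc j" using assms by (cases i) auto
 have "d x y \<noteq> \<infinity>" using assms(1) xs by auto
 then show ?thesis by (simp add: keep_def xs i ennreal_add_left_cancel)
qed

text \<open>The lengths away from the omitted point cancel on both sides. In extended reals this is
  legitimate only because the tuple has finite length.\<close>

lemma keep_inner:
 assumes "path_length d xs < \<infinity>" "0 < i" "i + 1 < length xs"
 shows "keep i xs \<longleftrightarrow> between d (xs ! (i - 1)) (xs ! i) (xs ! (i + 1))"
 using assms
proof (induction xs arbitrary: i)
 case (Cons x xs)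
 obtain j where i: "i = Suc j" using Cons.prems by (cases i) auto
 show ?case
 proof (cases j)
  case 0
  then obtain y z zs where xs: "xs = y # z # zs"
   using Cons.prems i by (cases xs; cases "tl xs") auto
  have fin: "path_length d (z # zs) \<noteq> \<infinity>" using Cons.prems(1) xs by auto
  have "keep i (x # xs) \<longleftrightarrow> path_length d (z # zs) + d x z = path_length d (z # zs) + (d x y + d y z)"
   by (simp add: keep_def xs i 0 add_ac)
  then show ?thesis using fin by (auto simp: ennreal_add_left_cancel between_def xs i 0)
 next
  case (Suc j')
  have "path_length d xs < \<infinity>" using Cons.prems by (cases xs) (auto simp: ennreal_add_less_top)
  then show ?thesis using Cons.IH[of j] Cons.prems i Suc keep_Suc_Cons[of x xs j] by simp
 qed
qed simp

text \<open>Dropping the last point drops the last distance, which is zero only between equal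
  points.\<close>

lemma keep_last:
 assumes "path_length d xs < \<infinity>" "set xs \<subseteq> X" "length xs = Suc (Suc n)"
 shows "keep (Suc n) xs \<longleftrightarrow> xs ! n = xs ! Suc n"
 using assms
proof (induction xs arbitrary: n)
 case (Cons x xs)
 show ?case
 proof (cases n)
  case 0
  then obtain y where "xs = [y]" using Cons.prems by (cases xs) auto
  then show ?thesis using Cons.prems 0 dist_eq_0[of x y] by (auto simp: keep_def)
 next
  case (Suc m)
  have "path_length d xs < \<infinity>" using Cons.prems by (cases xs) (auto simp: ennreal_add_less_top)
  then show ?thesis using Cons.IH[of m] Cons.prems Suc keep_Suc_Cons[of x xs "Suc m"] by simp
 qed
qed simp

lemma keep_first:
 assumes "path_length d xs < \<infinity>" "set xs \<subseteq> X" "2 <= length xs"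
 shows "keep 0 xs \<longleftrightarrow> xs ! 0 = xs ! 1"
proof -
 obtain x y ys where xs: "xs = x # y # ys" using assms by (cases xs; cases "tl xs") auto
 have fin: "path_length d (y # ys) \<noteq> \<infinity>" using assms(1) xs by auto
 have "keep 0 xs \<longleftrightarrow> path_length d (y # ys) + 0 = path_length d (y # ys) + d x y"
  by (simp add: keep_def xs add.commute)
 then show ?thesis using fin dist_eq_0[of x y] assms(2) unfolding ennreal_add_left_cancel by (auto simp: xs)
qed

lemma keep_snoc:
 assumes "path_length d (xs @ [y]) < \<infinity>" "i + 1 < length xs"
 shows "keep i (xs @ [y]) \<longleftrightarrow> keep i xs"
proof -
 obtain ys x where xs: "xs = ys @ [x]" using assms(2) by (cases xs rule: rev_cases) auto
 have i: "i < length ys" using assms xs by simp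
 have "d x y \<noteq> \<infinity>" using assms(1) path_length_append[of d ys x "[y]"] xs by auto
 moreover have "keep i (xs @ [y]) \<longleftrightarrow> d x y + path_length d (omit i ys @ [x]) = d x y + path_length d (ys @ [x])"
  using i path_length_append[of d "omit i ys" x "[y]"] path_length_append[of d ys x "[y]"]
  by (simp add: keep_def xs omit_append add.commute)
 ultimately show ?thesis using i by (simp add: keep_def ennreal_add_left_cancel xs omit_append)
qed

text \<open>Both sides say that omitting both points leaves the length unchanged: omission never
  increases length, so equality after two omissions forces it after each.\<close>

lemma keep_keep_commute:
 assumes "set xs \<subseteq> X" "i < j" "j < length xs"
 shows "keep j xs & keep i (omit j xs) \<longleftrightarrow> keep i xs & keep (j - 1) (omit i xs)"
proof -
 have s: "set (omit i xs) \<subseteq> X" "set (omit j xs) \<subseteq> X" using order_trans[OF set_omit assms(1)] by simp_all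
 note le = path_length_omit_le[OF assms(1), of i] path_length_omit_le[OF assms(1), of j]
  path_length_omit_le[OF s(1), of "j - 1"] path_length_omit_le[OF s(2), of i]
 show ?thesis
  using le unfolding keep_def omit_omit[OF assms(2,3)] by (metis order_antisym)
qed

section \<open>Tuples of finite length and their degrees\<close>

lemma tuplesD:
 assumes "xs \<in> tup n"
 shows "length xs = Suc n" "set xs \<subseteq> X" "path_length d xs < \<infinity>"
 using assms by (auto simp: tuples_def)

lemma tuples_nth: "xs \<in> tup n ==> i <= n ==> xs ! i \<in> X"
 using tuplesD[of xs n] by (metis less_Suc_eq_le nth_mem subsetD)

lemma omit_tuples: "xs \<in> tup (Suc n) ==> i <= Suc n ==> omit i xs \<in> tup n"
 using set_omit[of i xs] path_length_omit_le[of xs i] unfolding tuples_def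
 by (auto simp: le_less_trans)

lemma finite_tuples: "finite (tup n)"
 by (rule finite_subset[OF _ finite_lists_length_eq[OF finite_X, of "Suc n"]]) (auto simp: tuples_def)

lemma tuples_Cons_iff:
 "x # y # ys \<in> tup (Suc n) \<longleftrightarrow> x \<in> X & fin x y & y # ys \<in> tup n"
 by (auto simp: tuples_def ennreal_add_less_top)

lemma tuples_0: "tup 0 = (%x. [x]) ` X"
 by (auto simp: tuples_def length_Suc_conv)

lemma tuples_SucE:
 assumes "xs \<in> tup (Suc n)"
 obtains x y ys where "xs = x # y # ys" "x \<in> X" "y \<in> X" "fin x y" "y # ys \<in> tup n"
proof -
 obtain x y ys where xs: "xs = x # y # ys" using tuplesD(1)[OF assms] by (auto simp: length_Suc_conv)
 then show thesis using that[of x y ys] assms tuplesD(2)[OF assms] tuples_Cons_iff by simp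
qed

text \<open>Passing from extended to ordinary reals is additive on finite values only, hence the two
  finiteness conditions.\<close>

lemma path_deg_Cons: "fin x y ==> path_length d (y # ys) < \<infinity> ==>
  pdeg (x # y # ys) = dr x y + pdeg (y # ys)"
proof -
 assume "fin x y" "path_length d (y # ys) < \<infinity>"
 then obtain a b where "0 <= a" "d x y = ennreal a" "0 <= b" "path_length d (y # ys) = ennreal b"
  by (cases "d x y"; cases "path_length d (y # ys)") auto
 then show ?thesis by (simp flip: ennreal_plus)
qed

text \<open>Keeps all degrees in which coefficients are taken inside \<open>G\<close>, where the
  axioms of a distance module are available.\<close>

lemma path_deg_G: "xs \<in> tup n ==> pdeg xs \<in> G"
proof (induction n arbitrary: xs)
 case 0
 then show ?case by (auto simp: tuples_0 G_0)
next
 case (Suc n)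
 from Suc.prems show ?case
 proof (cases rule: tuples_SucE)
  case (1 x y ys)
  then show ?thesis
   using Suc.IH[of "y # ys"] path_deg_Cons[of x y ys] tuplesD(3)[of "y # ys" n] dist_G[of x y]
   by (simp add: G_add)
 qed
qed

lemma keep_deg: "keep i xs ==> pdeg (omit i xs) = pdeg xs"
 by (simp add: keep_def)

end

section \<open>Magnitude complexes\<close>

locale dist_mod = dist_space K G X d
 for K :: "'k ring" and G :: "real set" and X :: "'x set" and d :: "'x => 'x => ennreal" +
 fixes M :: "('x, 'k, 'm) dist_module"
 assumes dist_module: "distance_module K G X d M"
begin

abbreviation "Mc \<equiv> dm_comp M"
abbreviation "Mm \<equiv> dm_map M"

lemma dm_module: "x \<in> X ==> g \<in> G ==> Module.module K (Mc x g)"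
 and dm_linear: "x \<in> X ==> y \<in> X ==> fin x y ==> g \<in> G ==>
   K_linear K (Mc x g) (Mc y (g + dr x y)) (Mm x y g)"
 and dm_id: "x \<in> X ==> g \<in> G ==> m \<in>. Mc x g ==> Mm x x g m = m"
 and dm_comp_map: "x \<in> X ==> y \<in> X ==> z \<in> X ==> fin x y ==> fin y z ==> g \<in> G ==>
   m \<in>. Mc x g ==>
   Mm y z (g + dr x y) (Mm x y g m) =
    (if between d x y z then Mm x z g m
    else zero (Mc z (g + dr x y + dr y z)))"
 using dist_module unfolding distance_module_def by blast+

lemma dm_linear_map: "x \<in> X ==> y \<in> X ==> fin x y ==> g \<in> G ==>
   linear_map K (Mc x g) (Mc y (g + dr x y)) (Mm x y g)"
 by (intro linear_mapI dm_module dm_linear G_add dist_G)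

lemma MC_family: "l \<in> G ==> module_family K (tup n) (MCp M l)"
 by (simp add: module_family_def cring_K dm_module tuples_nth G_diff path_deg_G)

lemma module_MC: "l \<in> G ==> Module.module K (Ch M l n)"
 unfolding MC_def by (rule module_family.module_sum[OF MC_family])

abbreviation elt :: "real => nat => 'x list => 'm => 'x list => 'm" where
 "elt l n \<equiv> sum_incl (tup n) (MCp M l)"

lemma linear_elt: "l \<in> G ==> xs \<in> tup n ==> K_linear K (MCp M l xs) (Ch M l n) (elt l n xs)"
 unfolding MC_def by (rule module_family.linear_incl[OF MC_family])

lemma elt_zero: "elt l n xs (zero (MCp M l xs)) = zero (Ch M l n)"
 by (auto simp: sum_incl_def MC_def sum_mod_simps)

lemma MC_linear_eqI:
 assumes "l \<in> G" "Module.module K B" "K_linear K (Ch M l n) B F" "K_linear K (Ch M l n) B H"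
  and "!!xs m. xs \<in> tup n ==> m \<in>. MCp M l xs ==> F (elt l n xs m) = H (elt l n xs m)"
  and "c \<in>. Ch M l n"
 shows "F c = H c"
 using module_family.sum_linear_eqI[OF MC_family[OF assms(1)] assms(2)] assms(3-) unfolding MC_def by blast

lemma MC_face_0:
 "face M l n 0 xs m = elt l n (omit 0 xs) (Mm (xs ! 0) (xs ! 1) (l - pdeg xs) m)"
 by (simp add: MC_face_def)

text \<open>Away from index 0 all faces obey one rule, as \<open>keep\<close> covers inner points
  and the last point alike.\<close>

lemma MC_face_pos:
 assumes xs: "xs \<in> tup (Suc n)" and i: "0 < i" "i <= Suc n"
 shows "face M l n i xs m = (if keep i xs then elt l n (omit i xs) m else zero (Ch M l n))"
proof (cases "i <= n")
 case True
 then show ?thesis using keep_inner[of xs i] tuplesD[OF xs] i by (simp add: MC_face_def)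
next
 case False
 then have "i = Suc n" using i by simp
 then show ?thesis using keep_last[of xs n] tuplesD[OF xs] by (simp add: MC_face_def)
qed

text \<open>A face that does not vanish preserves the degree and the first point, so the coefficient
  lies in the same module before and after.\<close>

lemma MC_part_omit:
 assumes "xs \<in> tup (Suc n)" "0 < i" "i <= Suc n" "keep i xs"
 shows "MCp M l (omit i xs) = MCp M l xs"
 using assms omit_nth_0[of i xs] tuplesD(1)[OF assms(1)] by (simp add: keep_deg)

lemma path_deg_tl:
 assumes "xs \<in> tup (Suc n)"
 shows "pdeg xs = dr (xs ! 0) (xs ! 1) + pdeg (omit 0 xs)"
 using assms
proof (cases rule: tuples_SucE)
 case (1 x y ys)
 then show ?thesis
  using path_deg_Cons[of x y ys] tuplesD(3)[of "y # ys" n] by (simp del: path_length_Cons)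
qed

lemma MC_part_tl:
 assumes "xs \<in> tup (Suc n)"
 shows "MCp M l (omit 0 xs) = Mc (xs ! 1) (l - pdeg xs + dr (xs ! 0) (xs ! 1))"
proof -
 have "omit 0 xs ! 0 = xs ! 1" using assms by (cases rule: tuples_SucE) simp
 then show ?thesis by (simp add: path_deg_tl[OF assms])
qed

lemma tuples_dist_fin:
 assumes "xs \<in> tup (Suc n)"
 shows "fin (xs ! 0) (xs ! 1)"
 using assms by (cases rule: tuples_SucE) simp

lemma linear_MC_face:
 assumes l: "l \<in> G" and xs: "xs \<in> tup (Suc n)" and i: "i <= Suc n"
 shows "K_linear K (MCp M l xs) (Ch M l n) (face M l n i xs)"
proof (cases "i = 0")
 case True
 have "K_linear K (MCp M l xs) (MCp M l (omit 0 xs)) (Mm (xs ! 0) (xs ! 1) (l - pdeg xs))"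
  unfolding MC_part_tl[OF xs]
  by (rule dm_linear) (use xs l tuples_dist_fin in "auto simp: tuples_nth G_diff path_deg_G")
 then show ?thesis
  using K_linear_comp[OF _ linear_elt[OF l omit_tuples[OF xs, of 0]]] True by (simp add: MC_face_0[abs_def])
next
 case False
 then have "face M l n i xs = (%m. if keep i xs then elt l n (omit i xs) m else zero (Ch M l n))"
  using MC_face_pos[OF xs _ i] by (simp add: fun_eq_iff)
 then show ?thesis
  using linear_elt[OF l omit_tuples[OF xs i]] K_linear_zero_map[OF module_MC[OF l]] MC_part_omit[OF xs _ i] False
  by (cases "keep i xs") auto
qed

definition Face :: "real => nat => nat => ('x list => 'm) => 'x list => 'm" where
 "Face l n i = sum_ext (tup (Suc n)) (MCp M l) (Ch M l n) (face M l n i)"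

lemma MC_bd_eq: "del M l n c = alt_sum (Ch M l n) (Suc n) (%i. Face l n i c)"
 by (simp add: MC_bd_def Face_def)

lemma linear_Face: "l \<in> G ==> i <= Suc n ==> K_linear K (Ch M l (Suc n)) (Ch M l n) (Face l n i)"
 unfolding Face_def MC_def[of X d M l "Suc n"]
 by (rule module_family.linear_sum_ext[OF MC_family]) (auto intro: module_MC linear_MC_face)

lemma linear_map_Face: "l \<in> G ==> i <= Suc n ==> linear_map K (Ch M l (Suc n)) (Ch M l n) (Face l n i)"
 by (intro linear_mapI module_MC linear_Face)

lemma Face_elt:
 "l \<in> G ==> i <= Suc n ==> xs \<in> tup (Suc n) ==> m \<in>. MCp M l xs ==>
  Face l n i (elt l (Suc n) xs m) = face M l n i xs m"
 unfolding Face_def by (rule module_family.sum_ext_incl[OF MC_family]) (auto intro: module_MC linear_MC_face)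

lemma linear_MC_bd: "l \<in> G ==> K_linear K (Ch M l (Suc n)) (Ch M l n) (del M l n)"
 unfolding MC_bd_eq[abs_def] by (intro K_linear_alt_sum_map module_MC linear_Face)

lemma linear_map_MC_bd: "l \<in> G ==> linear_map K (Ch M l (Suc n)) (Ch M l n) (del M l n)"
 by (intro linear_mapI module_MC linear_MC_bd)

lemma Face_Face_elt_pos:
 assumes l: "l \<in> G" and j: "0 < i" "i <= Suc n" "0 < j" "j <= Suc (Suc n)"
  and xs: "xs \<in> tup (Suc (Suc n))" and m: "m \<in>. MCp M l xs"
 shows "Face l n i (Face l (Suc n) j (elt l (Suc (Suc n)) xs m)) =
  (if keep j xs & keep i (omit j xs) then elt l n (omit i (omit j xs)) m else zero (Ch M l n))"
proof -
 have "Face l (Suc n) j (elt l (Suc (Suc n)) xs m) = (if keep j xs then elt l (Suc n) (omit j xs) m else zero (Ch M l (Suc n)))"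
  using Face_elt[OF l j(4) xs m] MC_face_pos[OF xs j(3,4)] by simp
 moreover have "Face l n i (elt l (Suc n) (omit j xs) m) =
   (if keep i (omit j xs) then elt l n (omit i (omit j xs)) m else zero (Ch M l n))" if "keep j xs"
  using Face_elt[OF l j(2) omit_tuples[OF xs j(4)]] MC_face_pos[OF omit_tuples[OF xs j(4)] j(1,2)]
   MC_part_omit[OF xs j(3,4) that, of l] m by simp
 ultimately show ?thesis using linear_map.zero[OF linear_map_Face[OF l j(2)]] by simp
qed

text \<open>For \<open>i > 0\<close> the identity is \<open>keep_keep_commute\<close> together with
  \<open>omit_omit\<close>. For \<open>i = 0\<close> and \<open>j = 1\<close> it is the composition
  law of a distance module. For \<open>i = 0\<close> and \<open>j > 1\<close> the action along the
  first edge and the omission concern separate parts of the tuple.\<close>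

lemma Face_Face:
 assumes l: "l \<in> G" and ij: "i < j" "j <= Suc (Suc n)" and c: "c \<in>. Ch M l (Suc (Suc n))"
 shows "Face l n i (Face l (Suc n) j c) = Face l n (j - 1) (Face l (Suc n) i c)"
proof (rule MC_linear_eqI[OF l module_MC[OF l] _ _ _ c])
 show "K_linear K (Ch M l (Suc (Suc n))) (Ch M l n) (%c. Face l n i (Face l (Suc n) j c))"
  by (rule K_linear_comp[OF linear_Face linear_Face]) (use l ij in auto)
 show "K_linear K (Ch M l (Suc (Suc n))) (Ch M l n) (%c. Face l n (j - 1) (Face l (Suc n) i c))"
  by (rule K_linear_comp[OF linear_Face linear_Face]) (use l ij in auto)
 fix xs m assume xs: "xs \<in> tup (Suc (Suc n))" and m: "m \<in>. MCp M l xs"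
 show "Face l n i (Face l (Suc n) j (elt l (Suc (Suc n)) xs m)) =
   Face l n (j - 1) (Face l (Suc n) i (elt l (Suc (Suc n)) xs m))"
 proof (cases "i = 0")
  case False
  then show ?thesis
   using Face_Face_elt_pos[OF l _ _ _ _ xs m, of i j] Face_Face_elt_pos[OF l _ _ _ _ xs m, of "j - 1" i] ij
    keep_keep_commute[of xs i j] omit_omit[of i j xs] tuplesD[OF xs] by simp
 next
  case i: True
  obtain x y zs where xs_eq: "xs = x # y # zs" and x: "x \<in> X" "y \<in> X" "fin x y" and yzs: "y # zs \<in> tup (Suc n)"
   using xs by (cases rule: tuples_SucE) blast
  define g where "g = l - pdeg xs"
  have g: "g \<in> G" unfolding g_def using G_diff[OF l path_deg_G[OF xs]] .
  have mg: "m \<in>. Mc x g" using m by (simp add: xs_eq g_def)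
  have tl: "MCp M l (y # zs) = Mc y (g + dr x y)" "pdeg xs = dr x y + pdeg (y # zs)"
   using MC_part_tl[OF xs, of l] path_deg_tl[OF xs] by (simp_all add: xs_eq g_def del: path_length_Cons)
  have mm: "Mm x y g m \<in>. MCp M l (y # zs)"
   unfolding tl using K_linear_closed[OF dm_linear[OF x g] mg] .
  have F0: "Face l (Suc n) 0 (elt l (Suc (Suc n)) xs m) = elt l (Suc n) (y # zs) (Mm x y g m)"
   using Face_elt[OF l _ xs m, of 0] MC_face_0[of l "Suc n" xs m] by (simp add: xs_eq g_def del: path_length_Cons)
  show ?thesis
  proof (cases "j = 1")
   case j: True
   obtain z ws where zs: "zs = z # ws" and z: "z \<in> X" "fin y z" "z # ws \<in> tup n"
    using yzs by (cases rule: tuples_SucE) auto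
   have k1: "keep 1 xs \<longleftrightarrow> between d x y z"
    using keep_inner[of xs 1] tuplesD[OF xs] by (simp add: xs_eq zs)
   have om: "omit 1 xs = x # z # ws" by (simp add: xs_eq zs)
   have omt: "x # z # ws \<in> tup (Suc n)" using omit_tuples[OF xs, of 1] unfolding om by simp
   have "Face l (Suc n) 1 (elt l (Suc (Suc n)) xs m) =
     (if keep 1 xs then elt l (Suc n) (x # z # ws) m else zero (Ch M l (Suc n)))"
    using Face_elt[OF l _ xs m, of 1] MC_face_pos[OF xs, of 1 l m] by (simp add: om[unfolded One_nat_def])
   moreover have "Face l n 0 (elt l (Suc n) (x # z # ws) m) = elt l n (z # ws) (Mm x z g m)" if "keep 1 xs"
   proof -
    have dg: "pdeg (x # z # ws) = pdeg xs" using keep_deg[OF that] unfolding om .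
    then show ?thesis
     using Face_elt[OF l _ omt, of 0 m] MC_face_0[of l n "x # z # ws" m] mg by (simp add: g_def del: path_length_Cons)
   qed
   ultimately have L: "Face l n 0 (Face l (Suc n) 1 (elt l (Suc (Suc n)) xs m)) =
     (if between d x y z then elt l n (z # ws) (Mm x z g m) else zero (Ch M l n))"
    using linear_map.zero[OF linear_map_Face[OF l, of 0]] k1 by simp
   have gy: "l - pdeg (y # zs) = g + dr x y" using tl(2) by (simp add: g_def)
   have "Face l n 0 (Face l (Suc n) 0 (elt l (Suc (Suc n)) xs m)) =
     elt l n (z # ws) (Mm y z (g + dr x y) (Mm x y g m))"
    unfolding F0 using Face_elt[OF l _ yzs mm, of 0] MC_face_0[of l n "y # zs" "Mm x y g m"]
    by (simp add: gy zs[symmetric] del: path_length_Cons) (simp add: zs)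
   also have "... = (if between d x y z then elt l n (z # ws) (Mm x z g m) else zero (Ch M l n))"
   \<comment> \<open>The zero in the composition law belongs to the coefficient module of
     \<open>z # ws\<close>, so including it yields the zero chain, in agreement with the vanishing
     of face 1.\<close>
   proof -
    have "MCp M l (z # ws) = Mc z (g + dr x y + dr y z)"
     using MC_part_tl[OF yzs, of l] gy by (simp add: zs del: path_length_Cons)
    then show ?thesis
     using dm_comp_map[OF x(1,2) z(1) x(3) z(2) g mg] elt_zero[where l = l and n = n and xs = "z # ws"] by simp
   qed
   finally show ?thesis using L i j by simp
  next
   case False
   then have j: "0 < j - 1" "j - 1 <= Suc n" "0 < j" using ij i by simp_all
   have om: "omit j xs = x # omit (j - 1) (y # zs)" using j by (cases j) (simp_all add: xs_eq)
   obtain ws where ws: "omit (j - 1) (y # zs) = y # ws" using j by (cases "j - 1") auto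
   have k: "keep j xs \<longleftrightarrow> keep (j - 1) (y # zs)"
    using keep_Suc_Cons[of x "y # zs" "j - 1"] tuplesD[OF xs] j tuplesD(1)[OF yzs] by (simp add: xs_eq)
   have om: "omit j xs = x # y # ws" unfolding om ws ..
   have omt: "x # y # ws \<in> tup (Suc n)" using omit_tuples[OF xs ij(2)] unfolding om .
   have "Face l (Suc n) j (elt l (Suc (Suc n)) xs m) =
     (if keep j xs then elt l (Suc n) (x # y # ws) m else zero (Ch M l (Suc n)))"
    using Face_elt[OF l ij(2) xs m] MC_face_pos[OF xs j(3) ij(2), of l m] by (simp add: om)
   moreover have "Face l n 0 (elt l (Suc n) (x # y # ws) m) = elt l n (y # ws) (Mm x y g m)" if "keep j xs"
   proof -
    have dg: "pdeg (x # y # ws) = pdeg xs" using keep_deg[OF that] unfolding om .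
    then show ?thesis
     using Face_elt[OF l _ omt, of 0 m] MC_face_0[of l n "x # y # ws" m] mg by (simp add: g_def del: path_length_Cons)
   qed
   ultimately have "Face l n 0 (Face l (Suc n) j (elt l (Suc (Suc n)) xs m)) =
     (if keep j xs then elt l n (y # ws) (Mm x y g m) else zero (Ch M l n))"
    using linear_map.zero[OF linear_map_Face[OF l, of 0]] by simp
   moreover have "Face l n (j - 1) (Face l (Suc n) 0 (elt l (Suc (Suc n)) xs m)) =
     (if keep j xs then elt l n (y # ws) (Mm x y g m) else zero (Ch M l n))"
    unfolding F0 using Face_elt[OF l j(2) yzs mm] MC_face_pos[OF yzs j(1,2), of l "Mm x y g m"] k ws by simp
   ultimately show ?thesis using i by simp
  qed
 qed
qed

lemma MC_bd_MC_bd: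
 assumes l: "l \<in> G" and c: "c \<in>. Ch M l (Suc (Suc n))"
 shows "del M l n (del M l (Suc n) c) = zero (Ch M l n)"
proof -
 interpret A: alt_module K "Ch M l n" by (simp add: alt_module_def module_MC l)
 have cl: "Face l (Suc n) j c \<in>. Ch M l (Suc n)" if "j <= Suc (Suc n)" for j
  using linear_map.closed[OF linear_map_Face[OF l that] c] .
 have cl2: "Face l n i (Face l (Suc n) j c) \<in>. Ch M l n" if "j <= Suc (Suc n)" "i <= Suc n" for i j
  using linear_map.closed[OF linear_map_Face[OF l that(2)] cl[OF that(1)]] .
 have "del M l n (del M l (Suc n) c) =
   alt_sum (Ch M l n) (Suc n) (%i. alt_sum (Ch M l n) (Suc (Suc n)) (%j. Face l n i (Face l (Suc n) j c)))"
  unfolding MC_bd_eq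
  by (rule A.alt_sum_cong)
   (use linear_map.alt_sum[OF linear_map_Face[OF l]] cl cl2 in "auto intro!: A.alt_sum_closed")
 also have "... = zero (Ch M l n)"
  by (rule A.alt_sum_alt_sum) (use cl2 Face_Face[OF l _ _ c] in auto)
 finally show ?thesis .
qed


subsection \<open>Cohomology\<close>

lemma coMC_family: "l \<in> G ==> module_family K (tup n) (coMCp M l)"
proof -
 assume l: "l \<in> G"
 have "last xs \<in> X" if "xs \<in> tup n" for xs
  using tuplesD[OF that] by (cases xs) auto
 then show ?thesis using l
  by (simp add: module_family_def cring_K dm_module G_diff path_deg_G)
qed

lemma module_coMC: "l \<in> G ==> Module.module K (CoCh M l n)"
 unfolding coMC_def by (rule module_family.module_prod[OF coMC_family])

lemma last_omit: "i < n ==> length xs = Suc n ==> last (omit i xs) = last xs"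
 by (simp add: omit_def)

lemma coMC_part_omit:
 assumes "xs \<in> tup (Suc n)" "i <= n" "keep i xs"
 shows "coMCp M l (omit i xs) = coMCp M l xs"
 using assms last_omit[of i "Suc n" xs] tuplesD(1)[OF assms(1)] by (simp add: keep_deg)

text \<open>For cochains the coefficients sit at the last point, so index 0 follows the general rule
  and only the last coface involves the action.\<close>

lemma coMC_coface_le:
 assumes xs: "xs \<in> tup (Suc n)" and i: "i <= n"
 shows "coface M l n i \<alpha> xs = (if keep i xs then \<alpha> (omit i xs) else zero (coMCp M l xs))"
 using keep_inner[of xs i] keep_first[of xs] tuplesD[OF xs] i xs by (cases "i = 0") (simp_all add: coMC_coface_def)

lemma tuples_snocE:
 assumes "xs \<in> tup (Suc n)"
 obtains ys x y where "xs = ys @ [x, y]" "length ys = n" "x \<in> X" "y \<in> X" "fin x y" "ys @ [x] \<in> tup n"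
  "pdeg xs = pdeg (ys @ [x]) + dr x y"
proof -
 obtain zs y where "xs = zs @ [y]" using tuplesD(1)[OF assms] by (cases xs rule: rev_cases) auto
 moreover obtain ys x where "zs = ys @ [x]"
  using tuplesD(1)[OF assms] calculation by (cases zs rule: rev_cases) auto
 ultimately have xs: "xs = ys @ [x, y]" by simp
 have len: "length ys = n" using tuplesD(1)[OF assms] xs by simp
 have pl: "path_length d xs = path_length d (ys @ [x]) + d x y"
  using path_length_append[of d ys x "[y]"] xs by simp
 then have fin: "path_length d (ys @ [x]) < \<infinity>" "fin x y"
  using tuplesD(3)[OF assms] by (simp_all add: ennreal_add_less_top)
 have mem: "x \<in> X" "y \<in> X" "ys @ [x] \<in> tup n"
  using tuplesD(2)[OF assms] xs len fin by (auto simp: tuples_def)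
 obtain a b where "0 <= a" "d x y = ennreal a" "0 <= b" "path_length d (ys @ [x]) = ennreal b"
  using fin by (cases "d x y"; cases "path_length d (ys @ [x])") auto
 then have "pdeg xs = pdeg (ys @ [x]) + dr x y" by (simp add: pl flip: ennreal_plus)
 then show thesis using that[of ys x y] xs len mem fin by blast
qed

lemma omit_snoc2: "omit (Suc (length ys)) (ys @ [x, y]) = ys @ [x]"
 using omit_last[of "ys @ [x]" y] by simp

lemma coMC_coface_last:
 assumes "xs \<in> tup (Suc n)" "xs = ys @ [x, y]"
 shows "coface M l n (Suc n) \<alpha> xs = Mm x y (- l + pdeg (ys @ [x])) (\<alpha> (ys @ [x]))"
proof -
 have "length ys = n" using tuplesD(1)[OF assms(1)] assms(2) by simp
 then show ?thesis using assms omit_snoc2[of ys x y] by (auto simp: coMC_coface_def nth_append)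
qed

lemma linear_coface:
 assumes l: "l \<in> G" and i: "i <= Suc n"
 shows "K_linear K (CoCh M l n) (CoCh M l (Suc n)) (coface M l n i)"
proof -
 have "K_linear K (CoCh M l n) (coMCp M l xs) (\<lambda>\<alpha>. coface M l n i \<alpha> xs)"
  if xs: "xs \<in> tup (Suc n)" for xs
 proof (cases "i <= n")
  case True
  have pr: "K_linear K (CoCh M l n) (coMCp M l (omit i xs)) (\<lambda>\<alpha>. \<alpha> (omit i xs))"
   unfolding coMC_def by (rule module_family.linear_prod_proj[OF coMC_family[OF l] omit_tuples[OF xs i]])
  show ?thesis
  proof (cases "keep i xs")
   case k: True
   show ?thesis using pr k unfolding coMC_coface_le[OF xs True] coMC_part_omit[OF xs True k] by simp
  next
   case False
   then show ?thesis unfolding coMC_coface_le[OF xs True]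
    using K_linear_zero_map[OF module_family.fam[OF coMC_family[OF l] xs]] by simp
  qed
 next
  case False
  then have i: "i = Suc n" using i by simp
  from xs show ?thesis
  proof (cases rule: tuples_snocE)
   case (1 ys x y)
   have pr: "K_linear K (CoCh M l n) (coMCp M l (ys @ [x])) (\<lambda>\<alpha>. \<alpha> (ys @ [x]))"
    unfolding coMC_def by (rule module_family.linear_prod_proj[OF coMC_family[OF l] 1(6)])
   have "K_linear K (coMCp M l (ys @ [x])) (coMCp M l xs) (Mm x y (- l + pdeg (ys @ [x])))"
   proof -
    have g: "- l + pdeg (ys @ [x]) \<in> G" by (intro G_add G_uminus l path_deg_G[OF 1(6)])
    have e: "- l + pdeg xs = - l + pdeg (ys @ [x]) + dr x y"
     and la: "last xs = y" "last (ys @ [x]) = x" using 1(7) by (simp_all add: 1(1))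
    show ?thesis unfolding e la by (rule dm_linear[OF 1(3-5) g])
   qed
   then show ?thesis unfolding i coMC_coface_last[OF xs 1(1)] by (rule K_linear_comp[OF pr])
  qed
 qed
 then have lin: "K_linear K (CoCh M l n) (coMCp M l xs) (\<lambda>\<alpha>. coface M l n i \<alpha> xs)"
  if "xs \<in> tup (Suc n)" for xs using that by blast
 have ext: "coface M l n i \<alpha> \<in> extensional (tup (Suc n))" for \<alpha>
  by (simp add: coMC_coface_def)
 show ?thesis
  unfolding K_linear_def
 proof (intro conjI ballI funcsetI)
  fix \<alpha> assume a: "\<alpha> \<in>. CoCh M l n"
  show "coface M l n i \<alpha> \<in>. CoCh M l (Suc n)"
   using K_linear_closed[OF lin a] ext by (auto simp: coMC_def prod_mod_simps PiE_iff)
  fix \<beta> assume b: "\<beta> \<in>. CoCh M l n"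
  show "coface M l n i (\<alpha> \<oplus>\<^bsub>CoCh M l n\<^esub> \<beta>) =
   coface M l n i \<alpha> \<oplus>\<^bsub>CoCh M l (Suc n)\<^esub> coface M l n i \<beta>"
   by (rule extensional_eqI[OF ext])
    (use lin a b in \<open>auto simp: K_linear_def coMC_def[of X d M l "Suc n"] prod_mod_simps\<close>)
 next
  fix k \<alpha> assume k: "k \<in>. K" and a: "\<alpha> \<in>. CoCh M l n"
  show "coface M l n i (k \<odot>\<^bsub>CoCh M l n\<^esub> \<alpha>) = k \<odot>\<^bsub>CoCh M l (Suc n)\<^esub> coface M l n i \<alpha>"
   by (rule extensional_eqI[OF ext])
    (use lin a k in \<open>auto simp: K_linear_def coMC_def[of X d M l "Suc n"] prod_mod_simps\<close>)
 qed
qed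

lemma linear_map_coface:
 "l \<in> G ==> i <= Suc n ==> linear_map K (CoCh M l n) (CoCh M l (Suc n)) (coface M l n i)"
 by (intro linear_mapI module_coMC linear_coface)

lemma linear_coMC_cobd: "l \<in> G ==> K_linear K (CoCh M l n) (CoCh M l (Suc n)) (codel M l n)"
 unfolding coMC_cobd_def[abs_def] by (intro K_linear_alt_sum_map module_coMC linear_coface)

lemma linear_map_coMC_cobd: "l \<in> G ==> linear_map K (CoCh M l n) (CoCh M l (Suc n)) (codel M l n)"
 by (intro linear_mapI module_coMC linear_coMC_cobd)

text \<open>The mirror image of \<open>Face_Face\<close>: two omissions commute by
  \<open>keep_keep_commute\<close>, and the exceptional index is now the last one.\<close>

lemma coface_coface:
 assumes l: "l \<in> G" and ij: "i < j" "j <= Suc (Suc n)" and a: "\<alpha> \<in>. CoCh M l n"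
 shows "coface M l (Suc n) j (coface M l n i \<alpha>) =
  coface M l (Suc n) i (coface M l n (j - 1) \<alpha>)"
proof (rule extensional_eqI[of _ "tup (Suc (Suc n))"])
 show "coface M l (Suc n) j (coface M l n i \<alpha>) \<in> extensional (tup (Suc (Suc n)))"
  "coface M l (Suc n) i (coface M l n (j - 1) \<alpha>) \<in> extensional (tup (Suc (Suc n)))"
  by (simp_all add: coMC_coface_def)
 fix xs assume xs: "xs \<in> tup (Suc (Suc n))"
 have len: "length xs = Suc (Suc (Suc n))" using tuplesD(1)[OF xs] .
 show "coface M l (Suc n) j (coface M l n i \<alpha>) xs =
  coface M l (Suc n) i (coface M l n (j - 1) \<alpha>) xs"
 proof (cases "j <= Suc n")
  case True
  have i: "i <= n" "j - 1 <= n" "i <= Suc n" using True ij by simp_all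
  have 1: "coface M l (Suc n) q (coface M l n p \<alpha>) xs =
    (if keep q xs & keep p (omit q xs) then \<alpha> (omit p (omit q xs)) else zero (coMCp M l xs))"
   if pq: "p <= n" "q <= Suc n" for p q
  proof -
   have "omit q xs \<in> tup (Suc n)" using omit_tuples[OF xs] pq by simp
   then show ?thesis
    using coMC_part_omit[OF xs pq(2), of l]
    by (auto simp: coMC_coface_le[OF xs pq(2)] coMC_coface_le[OF _ pq(1)])
  qed
  show ?thesis
   unfolding 1[OF i(1) True] 1[OF i(2,3)]
   using keep_keep_commute[of xs i j] omit_omit[of i j xs] tuplesD[OF xs] ij by simp
 next
  case False
  then have j: "j = Suc (Suc n)" using ij by simp
  from xs obtain zs y z where xs_eq: "xs = zs @ [y, z]" and zs: "length zs = Suc n" "zs @ [y] \<in> tup (Suc n)"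
   and yz: "y \<in> X" "z \<in> X" "fin y z" and dxs: "pdeg xs = pdeg (zs @ [y]) + dr y z"
   by (cases rule: tuples_snocE) blast
  obtain ys x where zs_eq: "zs = ys @ [x]" using zs(1) by (cases zs rule: rev_cases) auto
  have ys: "length ys = n" using zs zs_eq by simp
  have yx: "ys @ [x] \<in> tup n" "x \<in> X" "fin x y"
   and dzs: "pdeg (zs @ [y]) = pdeg (ys @ [x]) + dr x y"
   using zs(2) zs_eq by (cases rule: tuples_snocE[OF zs(2)], auto)+
  have L: "coface M l (Suc n) j (coface M l n i \<alpha>) xs =
   Mm y z (- l + pdeg (zs @ [y])) (coface M l n i \<alpha> (zs @ [y]))"
   unfolding j by (rule coMC_coface_last[OF xs xs_eq])
  show ?thesis
  \<comment> \<open>If both cofaces act on coefficients, the composition law of the distance module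
    applies; otherwise the omitted point is too far from the end to be affected by the last edge,
    which is \<open>keep_snoc\<close>.\<close>
  proof (cases "i = Suc n")
   case True
   define g where "g = - l + pdeg (ys @ [x])"
   have g: "g \<in> G" unfolding g_def by (intro G_add G_uminus l path_deg_G[OF yx(1)])
   have ay: "\<alpha> (ys @ [x]) \<in>. Mc x g"
    using a yx(1) by (auto simp: coMC_def prod_mod_simps g_def dest: PiE_mem)
   have "zs @ [y] = ys @ [x, y]" by (simp add: zs_eq)
   then have "coface M l n i \<alpha> (zs @ [y]) = Mm x y g (\<alpha> (ys @ [x]))"
    unfolding True g_def using coMC_coface_last[OF zs(2)] by blast
   moreover have "- l + pdeg (zs @ [y]) = g + dr x y" using dzs by (simp add: g_def)
   ultimately have "coface M l (Suc n) j (coface M l n i \<alpha>) xs =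
     (if between d x y z then Mm x z g (\<alpha> (ys @ [x])) else zero (Mc z (g + dr x y + dr y z)))"
    unfolding L using dm_comp_map[OF yx(2) yz(1,2) yx(3) yz(3) g ay] by presburger
   moreover have "Mc z (g + dr x y + dr y z) = coMCp M l xs"
   proof -
    have "- l + pdeg xs = g + dr x y + dr y z" "last xs = z"
     by (simp_all add: dxs dzs g_def) (simp add: xs_eq)
    then show ?thesis by simp
   qed
   moreover have "keep (Suc n) xs \<longleftrightarrow> between d x y z"
    using keep_inner[of xs "Suc n"] tuplesD[OF xs] ys by (simp add: xs_eq zs_eq nth_append)
   moreover have "coface M l (Suc n) i (coface M l n (j - 1) \<alpha>) xs =
     (if keep (Suc n) xs then coface M l n (Suc n) \<alpha> (omit (Suc n) xs) else zero (coMCp M l xs))"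
    using coMC_coface_le[OF xs, of "Suc n"] True j by simp
   moreover have "coface M l n (Suc n) \<alpha> (omit (Suc n) xs) = Mm x z g (\<alpha> (ys @ [x]))"
   proof -
    have "omit (Suc n) xs = ys @ [x, z]" using ys by (simp add: xs_eq zs_eq omit_def)
    then show ?thesis using coMC_coface_last[OF omit_tuples[OF xs, of "Suc n"]] by (simp add: g_def)
   qed
   ultimately show ?thesis by simp
  next
   case False
   then have i: "i <= n" "i <= Suc n" using ij j by simp_all
   have k: "keep i xs \<longleftrightarrow> keep i (zs @ [y])"
    using keep_snoc[of "zs @ [y]" z i] tuplesD[OF xs] zs i by (simp add: xs_eq)
   obtain ws where ws: "omit i (zs @ [y]) = ws @ [y]" "omit i xs = ws @ [y, z]"
    using i zs by (simp add: xs_eq omit_append)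
   have "coface M l (Suc n) i (coface M l n (j - 1) \<alpha>) xs =
     (if keep i xs then coface M l n (Suc n) \<alpha> (omit i xs) else zero (coMCp M l xs))"
    using coMC_coface_le[OF xs i(2)] j by simp
   moreover have "coface M l n (Suc n) \<alpha> (omit i xs) = Mm y z (- l + pdeg (ws @ [y])) (\<alpha> (ws @ [y]))"
    using coMC_coface_last[OF omit_tuples[OF xs le_SucI[OF i(2)]] ws(2)] .
   moreover have "pdeg (ws @ [y]) = pdeg (zs @ [y])" if "keep i xs"
    using keep_deg[of i "zs @ [y]"] that k ws by simp
   moreover have "Mm y z (- l + pdeg (zs @ [y])) (zero (coMCp M l (zs @ [y]))) = zero (coMCp M l xs)"
   proof -
    have g: "- l + pdeg (zs @ [y]) \<in> G" by (intro G_add G_uminus l path_deg_G[OF zs(2)])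
    have e: "- l + pdeg xs = - l + pdeg (zs @ [y]) + dr y z"
     and la: "last xs = z" "last (zs @ [y]) = y" using dxs by (simp_all add: xs_eq)
    show ?thesis unfolding e la by (rule linear_map.zero[OF dm_linear_map[OF yz g]])
   qed
   ultimately show ?thesis unfolding L coMC_coface_le[OF zs(2) i(1)] using k ws by simp
  qed
 qed
qed

lemma coMC_cobd_cobd:
 assumes l: "l \<in> G" and a: "\<alpha> \<in>. CoCh M l n"
 shows "codel M l (Suc n) (codel M l n \<alpha>) = zero (CoCh M l (Suc (Suc n)))"
proof -
 interpret A: alt_module K "CoCh M l (Suc (Suc n))" by (simp add: alt_module_def module_coMC l)
 have cl: "coface M l n i \<alpha> \<in>. CoCh M l (Suc n)" if "i <= Suc n" for i
  using linear_map.closed[OF linear_map_coface[OF l that] a] .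
 have cl2: "coface M l (Suc n) j (coface M l n i \<alpha>) \<in>. CoCh M l (Suc (Suc n))"
  if "j <= Suc (Suc n)" "i <= Suc n" for i j
  using linear_map.closed[OF linear_map_coface[OF l that(1)] cl[OF that(2)]] .
 have "codel M l (Suc n) (codel M l n \<alpha>) =
   alt_sum (CoCh M l (Suc (Suc n))) (Suc n) (%i. codel M l (Suc n) (coface M l n i \<alpha>))"
  unfolding coMC_cobd_def[of X d M l n]
  by (rule linear_map.alt_sum[OF linear_map_coMC_cobd[OF l]]) (rule cl)
 also have "... = zero (CoCh M l (Suc (Suc n)))"
  unfolding coMC_cobd_def
  by (rule A.alt_sum_alt_sum) (use cl2 coface_coface[OF l _ _ a] in auto)
 finally show ?thesis .
qed

end

subsection \<open>Functoriality\<close>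

text \<open>Morphisms of degree 0, given at each vertex \<open>x\<close> and each degree
  \<open>g\<close> separately.\<close>

locale dist_hom = M: dist_mod K G X d M + N: dist_mod K G X d N
 for K :: "'k ring" and G :: "real set" and X :: "'x set" and d :: "'x => 'x => ennreal"
  and M :: "('x, 'k, 'm) dist_module" and N :: "('x, 'k, 'n) dist_module" +
 fixes f :: "'x => real => 'm => 'n"
 assumes f_linear: "!!x g. x \<in> X ==> g \<in> G ==> K_linear K (dm_comp M x g) (dm_comp N x g) (f x g)"
  and f_map: "!!x y g m. x \<in> X ==> y \<in> X ==> d x y < \<infinity> ==> g \<in> G ==> m \<in>. dm_comp M x g ==>
   f y (g + enn2real (d x y)) (dm_map M x y g m) = dm_map N x y g (f x g m)"
begin

lemma f_linear_map: "x \<in> X ==> g \<in> G ==> linear_map K (dm_comp M x g) (dm_comp N x g) (f x g)"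
 by (intro linear_mapI M.dm_module N.dm_module f_linear)

definition MC_map :: "real => nat => ('x list => 'm) => 'x list => 'n" where
 "MC_map l n c = (\<lambda>xs\<in>tuples X d n. f (xs ! 0) (l - path_deg d xs) (c xs))"

lemma f_MC_part: "l \<in> G ==> xs \<in> tuples X d n ==>
  linear_map K (MC_part d M l xs) (MC_part d N l xs) (f (xs ! 0) (l - path_deg d xs))"
 by (intro f_linear_map M.G_diff M.path_deg_G M.tuples_nth) auto

lemma linear_MC_map: assumes l: "l \<in> G" shows "K_linear K (MC X d M l n) (MC X d N l n) (MC_map l n)"
proof -
 note lin = f_MC_part[OF l, of _ n]
 show ?thesis
  unfolding K_linear_def MC_def sum_mod_finite[OF M.finite_tuples] prod_mod_simps MC_map_def
  using linear_map.closed[OF lin] linear_map.add[OF lin] linear_map.smult[OF lin]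
  by (auto simp: PiE_mem[of _ "tuples X d n" "%xs. carrier (MC_part d M l xs)"] intro!: restrict_ext)
qed

lemma linear_map_MC_map: "l \<in> G ==> linear_map K (MC X d M l n) (MC X d N l n) (MC_map l n)"
 by (intro linear_mapI M.module_MC N.module_MC linear_MC_map)

lemma MC_map_elt:
 assumes l: "l \<in> G" and xs: "xs \<in> tuples X d n"
 shows "MC_map l n (M.elt l n xs m) = N.elt l n xs (f (xs ! 0) (l - path_deg d xs) m)"
 using linear_map.zero[OF f_MC_part[OF l]] by (auto simp: MC_map_def sum_incl_def intro!: restrict_ext)

lemma MC_map_Face:
 assumes l: "l \<in> G" and i: "i <= Suc n" and c: "c \<in>. MC X d M l (Suc n)"
 shows "MC_map l n (M.Face l n i c) = N.Face l n i (MC_map l (Suc n) c)"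
proof (rule M.MC_linear_eqI[OF l N.module_MC[OF l] _ _ _ c])
 show "K_linear K (MC X d M l (Suc n)) (MC X d N l n) (%c. MC_map l n (M.Face l n i c))"
  by (rule K_linear_comp[OF M.linear_Face[OF l i] linear_MC_map[OF l]])
 show "K_linear K (MC X d M l (Suc n)) (MC X d N l n) (%c. N.Face l n i (MC_map l (Suc n) c))"
  by (rule K_linear_comp[OF linear_MC_map[OF l] N.linear_Face[OF l i]])
 fix xs m assume xs: "xs \<in> tuples X d (Suc n)" and m: "m \<in>. MC_part d M l xs"
 let ?fm = "f (xs ! 0) (l - path_deg d xs) m"
 have fm: "?fm \<in>. MC_part d N l xs" using linear_map.closed[OF f_MC_part[OF l xs] m] .
 have "MC_map l n (M.Face l n i (M.elt l (Suc n) xs m)) = MC_map l n (MC_face X d M l n i xs m)"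
  using M.Face_elt[OF l i xs m] by simp
 also have "... = MC_face X d N l n i xs ?fm"
 proof (cases "i = 0")
  case True
  have x: "xs ! 0 \<in> X" "xs ! 1 \<in> X" "d (xs ! 0) (xs ! 1) < \<infinity>" "l - path_deg d xs \<in> G"
   using xs l M.tuples_nth[OF xs] M.tuples_dist_fin[OF xs] M.G_diff M.path_deg_G by auto
  have e: "l - path_deg d (omit 0 xs) = l - path_deg d xs + enn2real (d (xs ! 0) (xs ! 1))"
   using M.path_deg_tl[OF xs] by simp
  have e0: "omit 0 xs ! 0 = xs ! 1" using xs by (cases rule: M.tuples_SucE) simp
  have "f (omit 0 xs ! 0) (l - path_deg d (omit 0 xs)) (dm_map M (xs ! 0) (xs ! 1) (l - path_deg d xs) m)
    = dm_map N (xs ! 0) (xs ! 1) (l - path_deg d xs) ?fm"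
   unfolding e e0 by (rule f_map[OF x m])
  then show ?thesis
   using MC_map_elt[OF l M.omit_tuples[OF xs, of 0]] by (simp add: True M.MC_face_0 N.MC_face_0)
 next
  case False
  then have i0: "0 < i" by simp
  show ?thesis
  proof (cases "M.keep i xs")
   case True
   then show ?thesis
    using MC_map_elt[OF l M.omit_tuples[OF xs i], of m] omit_nth_0[OF i0, of xs] M.tuplesD(1)[OF xs] i M.keep_deg[OF True]
    by (simp add: M.MC_face_pos[OF xs i0 i] N.MC_face_pos[OF xs i0 i])
  next
   case False
   then show ?thesis using linear_map.zero[OF linear_map_MC_map[OF l]]
    by (simp add: M.MC_face_pos[OF xs i0 i] N.MC_face_pos[OF xs i0 i])
  qed
 qed
 also have "... = N.Face l n i (MC_map l (Suc n) (M.elt l (Suc n) xs m))"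
  using MC_map_elt[OF l xs, of m] N.Face_elt[OF l i xs fm] by simp
 finally show "MC_map l n (M.Face l n i (M.elt l (Suc n) xs m)) = N.Face l n i (MC_map l (Suc n) (M.elt l (Suc n) xs m))" .
qed

lemma MC_map_bd:
 assumes l: "l \<in> G" and c: "c \<in>. MC X d M l (Suc n)"
 shows "MC_map l n (MC_bd X d M l n c) = MC_bd X d N l n (MC_map l (Suc n) c)"
proof -
 interpret A: alt_module K "MC X d N l n" by (simp add: alt_module_def N.module_MC l)
 have "MC_map l n (MC_bd X d M l n c) = alt_sum (MC X d N l n) (Suc n) (%i. MC_map l n (M.Face l n i c))"
  unfolding M.MC_bd_eq
  by (rule linear_map.alt_sum[OF linear_map_MC_map[OF l]]) (rule linear_map.closed[OF M.linear_map_Face[OF l] c])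
 also have "... = MC_bd X d N l n (MC_map l (Suc n) c)"
  unfolding N.MC_bd_eq
  by (rule A.alt_sum_cong)
   (use MC_map_Face[OF l _ c] linear_map.closed[OF N.linear_map_Face[OF l] linear_map.closed[OF linear_map_MC_map[OF l] c]] in auto)
 finally show ?thesis .
qed

lemma MC_map_surj:
 assumes l: "l \<in> G" and surj: "!!x g. x \<in> X ==> g \<in> G ==> f x g ` carrier (dm_comp M x g) = carrier (dm_comp N x g)"
 shows "MC_map l n ` carrier (MC X d M l n) = carrier (MC X d N l n)"
proof -
 have "f (xs ! 0) (l - path_deg d xs) ` carrier (MC_part d M l xs) = {b \<in> carrier (MC_part d N l xs). True}" if "xs \<in> tuples X d n" for xs
  using surj[OF M.tuples_nth[OF that, of 0] M.G_diff[OF l M.path_deg_G[OF that]]] by simp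
 from PiE_image_eq[of "tuples X d n", OF this] show ?thesis
  by (simp add: MC_def sum_mod_finite[OF M.finite_tuples] prod_mod_simps MC_map_def[abs_def])
qed

lemma MC_map_eq_zero_iff:
 assumes "c \<in>. MC X d M l n"
 shows "MC_map l n c = zero (MC X d N l n) \<longleftrightarrow>
  (\<forall>xs\<in>tuples X d n. f (xs ! 0) (l - path_deg d xs) (c xs) = zero (MC_part d N l xs))"
 by (auto simp: MC_map_def MC_def sum_mod_simps restrict_def fun_eq_iff)

section \<open>The induced maps on cochains\<close>

definition coMC_map :: "real => nat => ('x list => 'm) => 'x list => 'n" where
 "coMC_map l n c = (\<lambda>xs\<in>tuples X d n. f (last xs) (- l + path_deg d xs) (c xs))"

lemma f_coMC_part: assumes "l \<in> G" "xs \<in> tuples X d n"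
 shows "linear_map K (coMC_part d M l xs) (coMC_part d N l xs) (f (last xs) (- l + path_deg d xs))"
proof -
 have "last xs \<in> X" using M.tuplesD[OF assms(2)] by (cases xs) auto
 then show ?thesis using assms by (intro f_linear_map M.G_add M.G_uminus M.path_deg_G)
qed

lemma linear_coMC_map: assumes l: "l \<in> G" shows "K_linear K (coMC X d M l n) (coMC X d N l n) (coMC_map l n)"
proof -
 note lin = f_coMC_part[OF l, of _ n]
 show ?thesis
  unfolding K_linear_def coMC_def prod_mod_simps coMC_map_def
  using linear_map.closed[OF lin] linear_map.add[OF lin] linear_map.smult[OF lin]
  by (auto simp: PiE_mem[of _ "tuples X d n" "%xs. carrier (dm_comp M (last xs) (path_deg d xs - l))"] intro!: restrict_ext)
qed

lemma linear_map_coMC_map: "l \<in> G ==> linear_map K (coMC X d M l n) (coMC X d N l n) (coMC_map l n)"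
 by (intro linear_mapI M.module_coMC N.module_coMC linear_coMC_map)

lemma coMC_map_coface:
 assumes l: "l \<in> G" and i: "i <= Suc n" and a: "\<alpha> \<in>. coMC X d M l n"
 shows "coMC_map l (Suc n) (coMC_coface X d M l n i \<alpha>) = coMC_coface X d N l n i (coMC_map l n \<alpha>)"
proof (rule extensional_eqI[of _ "tuples X d (Suc n)"])
 fix xs assume xs: "xs \<in> tuples X d (Suc n)"
 show "coMC_map l (Suc n) (coMC_coface X d M l n i \<alpha>) xs = coMC_coface X d N l n i (coMC_map l n \<alpha>) xs"
 proof (cases "i <= n")
  case True
  show ?thesis
  proof (cases "M.keep i xs")
   case k: True
   have "last (omit i xs) = last xs" using True M.tuplesD(1)[OF xs] by (simp add: M.last_omit[of i "Suc n"])
   then show ?thesis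
    using M.omit_tuples[OF xs i] xs k by (simp add: M.coMC_coface_le[OF xs True] N.coMC_coface_le[OF xs True] coMC_map_def M.keep_deg[OF k])
  next
   case False
   then show ?thesis
    using xs linear_map.zero[OF f_coMC_part[OF l xs]]
    by (simp add: M.coMC_coface_le[OF xs True] N.coMC_coface_le[OF xs True] coMC_map_def)
  qed
 next
  case False
  then have i: "i = Suc n" using i by simp
  from xs show ?thesis
  proof (cases rule: M.tuples_snocE)
   case (1 ys x y)
   have g: "- l + path_deg d (ys @ [x]) \<in> G" by (intro M.G_add M.G_uminus l M.path_deg_G[OF 1(6)])
   have e: "- l + path_deg d xs = - l + path_deg d (ys @ [x]) + enn2real (d x y)" "last xs = y"
    using 1(7) by (simp_all add: 1(1))
   have "\<alpha> (ys @ [x]) \<in>. dm_comp M x (- l + path_deg d (ys @ [x]))"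
    using PiE_mem[of \<alpha> "tuples X d n" "%xs. carrier (coMC_part d M l xs)" "ys @ [x]"] a 1(6)
    by (simp add: coMC_def prod_mod_simps)
   from f_map[OF 1(3-5) g this] show ?thesis
    unfolding i N.coMC_coface_last[OF xs 1(1)]
    using xs 1(6) by (simp add: coMC_map_def e M.coMC_coface_last[OF xs 1(1)] del: add_uminus_conv_diff uminus_add_conv_diff)
  qed
 qed
qed (simp_all add: coMC_map_def coMC_coface_def)

lemma coMC_map_cobd:
 assumes l: "l \<in> G" and a: "\<alpha> \<in>. coMC X d M l n"
 shows "coMC_map l (Suc n) (coMC_cobd X d M l n \<alpha>) = coMC_cobd X d N l n (coMC_map l n \<alpha>)"
proof -
 interpret A: alt_module K "coMC X d N l (Suc n)" by (simp add: alt_module_def N.module_coMC l)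
 have "coMC_map l (Suc n) (coMC_cobd X d M l n \<alpha>) =
   alt_sum (coMC X d N l (Suc n)) (Suc n) (%i. coMC_map l (Suc n) (coMC_coface X d M l n i \<alpha>))"
  unfolding coMC_cobd_def
  by (rule linear_map.alt_sum[OF linear_map_coMC_map[OF l]]) (rule linear_map.closed[OF M.linear_map_coface[OF l] a])
 also have "... = coMC_cobd X d N l n (coMC_map l n \<alpha>)"
  unfolding coMC_cobd_def
  by (rule A.alt_sum_cong)
   (use coMC_map_coface[OF l _ a] linear_map.closed[OF N.linear_map_coface[OF l] linear_map.closed[OF linear_map_coMC_map[OF l] a]] in auto)
 finally show ?thesis .
qed

lemma coMC_map_eq_zero_iff:
 assumes "c \<in>. coMC X d M l n"
 shows "coMC_map l n c = zero (coMC X d N l n) \<longleftrightarrow>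
  (\<forall>xs\<in>tuples X d n. f (last xs) (- l + path_deg d xs) (c xs) = zero (coMC_part d N l xs))"
 by (auto simp: coMC_map_def coMC_def prod_mod_simps restrict_def fun_eq_iff)

lemma coMC_map_inj:
 assumes l: "l \<in> G" and inj: "!!x g. x \<in> X ==> g \<in> G ==> inj_on (f x g) (carrier (dm_comp M x g))"
 shows "inj_on (coMC_map l n) (carrier (coMC X d M l n))"
proof (rule inj_onI)
 fix a b assume a: "a \<in>. coMC X d M l n" and b: "b \<in>. coMC X d M l n" and e: "coMC_map l n a = coMC_map l n b"
 show "a = b"
 proof (rule extensional_eqI[of _ "tuples X d n"])
  fix xs assume xs: "xs \<in> tuples X d n"
  have "last xs \<in> X" using M.tuplesD[OF xs] by (cases xs) auto
  moreover have "- l + path_deg d xs \<in> G" by (intro M.G_add M.G_uminus l M.path_deg_G[OF xs])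
  moreover have "f (last xs) (- l + path_deg d xs) (a xs) = f (last xs) (- l + path_deg d xs) (b xs)"
   using fun_cong[OF e, of xs] xs by (simp add: coMC_map_def)
  moreover have "a xs \<in>. coMC_part d M l xs" "b xs \<in>. coMC_part d M l xs"
   using a b xs PiE_mem[of _ "tuples X d n" "%xs. carrier (coMC_part d M l xs)" xs] by (simp_all add: coMC_def prod_mod_simps)
  ultimately show "a xs = b xs" using inj by (meson inj_onD)
 qed (use a b in "auto simp: coMC_def prod_mod_simps PiE_iff")
qed

end

text \<open>Exactness at every vertex and degree carries over tuple by tuple through
  \<open>PiE_image_eq\<close>. This covers chains as well, because there are only finitely many
  tuples and the direct sum is a product.\<close>

lemma (in dist_space) MC_map_exact:
 assumes f: "dist_hom K G X d M N f" and h: "dist_hom K G X d N P h" and l: "l \<in> G"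
  and ex: "!!x g. x \<in> X ==> g \<in> G ==> f x g ` carrier (dm_comp M x g) =
    {n \<in> carrier (dm_comp N x g). h x g n = zero (dm_comp P x g)}"
 shows "dist_hom.MC_map X d f l n ` carrier (Ch M l n) =
   {c \<in> carrier (Ch N l n). dist_hom.MC_map X d h l n c = zero (Ch P l n)}"
  (is ?t1)
  and "dist_hom.coMC_map X d f l n ` carrier (CoCh M l n) =
   {c \<in> carrier (CoCh N l n). dist_hom.coMC_map X d h l n c = zero (CoCh P l n)}"
  (is ?t2)
proof -
 interpret f: dist_hom K G X d M N f by fact
 interpret h: dist_hom K G X d N P h by fact
 have "f (xs ! 0) (l - pdeg xs) ` carrier (MCp M l xs) =
   {b \<in> carrier (MCp N l xs). h (xs ! 0) (l - pdeg xs) b = zero (MCp P l xs)}" if "xs \<in> tup n" for xs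
  using ex[OF tuples_nth[OF that, of 0] G_diff[OF l path_deg_G[OF that]]] by simp
 note im = PiE_image_eq[of "tup n", OF this]
 have "{c \<in> carrier (Ch N l n). h.MC_map l n c = zero (Ch P l n)} =
   {c \<in> carrier (Ch N l n). \<forall>xs\<in>tup n. h (xs ! 0) (l - pdeg xs) (c xs) = zero (MCp P l xs)}"
  using h.MC_map_eq_zero_iff by blast
 then show ?t1
  using im by (simp add: MC_def[of X d N] MC_def[of X d M] sum_mod_finite[OF finite_tuples] prod_mod_simps(1) f.MC_map_def[abs_def])
 have "f (last xs) (- l + pdeg xs) ` carrier (coMCp M l xs) =
   {b \<in> carrier (coMCp N l xs). h (last xs) (- l + pdeg xs) b = zero (coMCp P l xs)}" if xs: "xs \<in> tup n" for xs
 proof (rule ex)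
  show "last xs \<in> X" using tuplesD[OF xs] by (cases xs) auto
  show "- l + pdeg xs \<in> G" by (intro G_add G_uminus l path_deg_G[OF xs])
 qed
 note im = PiE_image_eq[of "tup n", OF this]
 have "{c \<in> carrier (CoCh N l n). h.coMC_map l n c = zero (CoCh P l n)} =
   {c \<in> carrier (CoCh N l n). \<forall>xs\<in>tup n. h (last xs) (- l + pdeg xs) (c xs) = zero (coMCp P l xs)}"
  using h.coMC_map_eq_zero_iff by blast
 then show ?t2
  using im by (simp add: coMC_def[of X d N] coMC_def[of X d M] prod_mod_simps(1) f.coMC_map_def[abs_def])
qed


subsection \<open>Contractions\<close>

text \<open>
 The hypotheses say that \<open>s\<close> is a section, as distance modules, of the action map
 \<open>\<Oplus>\<^sub>y M(y) \<otimes> (y, x) \<rightarrow> M(x)\<close>: here \<open>s y x m\<close> is the component of the section in \<open>M(y)\<close>.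
\<close>

locale relatively_projective = dist_mod K G X d M
 for K :: "'k ring" and G :: "real set" and X :: "'x set" and d :: "'x => 'x => ennreal"
  and M :: "('x, 'k, 'm) dist_module" +
 fixes s :: "'x => 'x => real => 'm => 'm"
 assumes s_linear: "!!x y g. x \<in> X ==> y \<in> X ==> fin y x ==> g \<in> G ==>
   K_linear K (dm_comp M x g) (dm_comp M y (g - dr y x)) (s y x g)"
  and s_section: "!!x g m. x \<in> X ==> g \<in> G ==> m \<in>. dm_comp M x g ==>
   (\<Oplus>\<^bsub>dm_comp M x g\<^esub>y\<in>In x. dm_map M y x (g - dr y x) (s y x g m)) = m"
  and s_map: "!!x y z g m. x \<in> X ==> y \<in> X ==> z \<in> X ==> fin x z ==> fin y z ==> g \<in> G ==>
   m \<in>. dm_comp M x g ==> s y z (g + dr x z) (dm_map M x z g m) =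
    (if fin y x & between d y x z then s y x g m
    else zero (dm_comp M y (g + dr x z - dr y z)))"
begin

text \<open>The section splits the coefficient at the first point into components in
  \<open>M(y)\<close>, and each component is put at the tuple extended by \<open>y\<close> in front.
  This acts as an extra degeneracy.\<close>

definition contr_gen :: "real => nat => 'x list => 'm => 'x list => 'm" where
 "contr_gen l n xs m = (\<Oplus>\<^bsub>Ch M l (Suc n)\<^esub>y\<in>In (xs ! 0).
   elt l (Suc n) (y # xs) (s y (xs ! 0) (l - pdeg xs) m))"

definition contr :: "real => nat => ('x list => 'm) => 'x list => 'm" where
 "contr l n = sum_ext (tup n) (MCp M l) (Ch M l (Suc n)) (contr_gen l n)"

lemma Cons_tuples:
 assumes "xs \<in> tup n" "y \<in> X" "fin y (xs ! 0)"
 shows "y # xs \<in> tup (Suc n)" "pdeg (y # xs) = dr y (xs ! 0) + pdeg xs"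
proof -
 obtain x ys where xs: "xs = x # ys" using tuplesD(1)[OF assms(1)] by (cases xs) auto
 then show "y # xs \<in> tup (Suc n)" using assms tuples_Cons_iff by auto
 show "pdeg (y # xs) = dr y (xs ! 0) + pdeg xs"
  using path_deg_Cons[of y x ys] assms(3) tuplesD(3)[OF assms(1)] xs by simp
qed

lemma linear_contr_term:
 assumes l: "l \<in> G" and xs: "xs \<in> tup n" and y: "y \<in> X" "fin y (xs ! 0)"
 shows "K_linear K (MCp M l xs) (MCp M l (y # xs)) (s y (xs ! 0) (l - pdeg xs))"
proof -
 have e: "l - pdeg (y # xs) = l - pdeg xs - dr y (xs ! 0)" "(y # xs) ! 0 = y"
  using Cons_tuples[OF xs y] by simp_all
 show ?thesis unfolding e
  by (rule s_linear) (use y tuples_nth[OF xs, of 0] G_diff[OF l path_deg_G[OF xs]] in auto)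
qed

lemma linear_contr_gen:
 assumes l: "l \<in> G" and xs: "xs \<in> tup n"
 shows "K_linear K (MCp M l xs) (Ch M l (Suc n)) (contr_gen l n xs)"
 unfolding contr_gen_def
proof (rule K_linear_finsum_map[OF module_family.fam[OF MC_family[OF l] xs] module_MC[OF l]])
 fix y assume "y \<in> In (xs ! 0)"
 then have y: "y \<in> X" "fin y (xs ! 0)" by auto
 show "K_linear K (MCp M l xs) (Ch M l (Suc n)) (%m. elt l (Suc n) (y # xs) (s y (xs ! 0) (l - pdeg xs) m))"
  by (rule K_linear_comp[OF linear_contr_term[OF l xs y] linear_elt[OF l Cons_tuples(1)[OF xs y]]])
qed

lemma linear_contr: "l \<in> G ==> K_linear K (Ch M l n) (Ch M l (Suc n)) (contr l n)"
 unfolding contr_def MC_def[of X d M l n]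
 by (rule module_family.linear_sum_ext[OF MC_family]) (auto intro: module_MC linear_contr_gen)

lemma linear_map_contr: "l \<in> G ==> linear_map K (Ch M l n) (Ch M l (Suc n)) (contr l n)"
 by (intro linear_mapI module_MC linear_contr)

lemma contr_elt:
 "l \<in> G ==> xs \<in> tup n ==> m \<in>. MCp M l xs ==> contr l n (elt l n xs m) = contr_gen l n xs m"
 unfolding contr_def by (rule module_family.sum_ext_incl[OF MC_family]) (auto intro: module_MC linear_contr_gen)

lemma Face_contr_gen:
 assumes l: "l \<in> G" and xs: "xs \<in> tup n" and m: "m \<in>. MCp M l xs" and i: "i <= Suc n"
 shows "Face l n i (contr_gen l n xs m) = (\<Oplus>\<^bsub>Ch M l n\<^esub>y\<in>In (xs ! 0).
   face M l n i (y # xs) (s y (xs ! 0) (l - pdeg xs) m))"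
proof -
 interpret F: linear_map K "Ch M l (Suc n)" "Ch M l n" "Face l n i" by (rule linear_map_Face[OF l i])
 have cl: "s y (xs ! 0) (l - pdeg xs) m \<in>. MCp M l (y # xs)" if "y \<in> X" "fin y (xs ! 0)" for y
  using K_linear_closed[OF linear_contr_term[OF l xs that] m] .
 have ec: "elt l (Suc n) (y # xs) (s y (xs ! 0) (l - pdeg xs) m) \<in>. Ch M l (Suc n)"
  if "y \<in> X" "fin y (xs ! 0)" for y
  using K_linear_closed[OF linear_elt[OF l Cons_tuples(1)[OF xs that]] cl[OF that]] .
 have "Face l n i (contr_gen l n xs m) = (\<Oplus>\<^bsub>Ch M l n\<^esub>y\<in>In (xs ! 0).
   Face l n i (elt l (Suc n) (y # xs) (s y (xs ! 0) (l - pdeg xs) m)))"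
  unfolding contr_gen_def by (rule F.finsum) (use ec in auto)
 also have "... = (\<Oplus>\<^bsub>Ch M l n\<^esub>y\<in>In (xs ! 0).
   face M l n i (y # xs) (s y (xs ! 0) (l - pdeg xs) m))"
 proof (rule F.cod.M.finsum_cong')
  fix y assume "y \<in> In (xs ! 0)"
  then have y: "y \<in> X" "fin y (xs ! 0)" by auto
  show "Face l n i (elt l (Suc n) (y # xs) (s y (xs ! 0) (l - pdeg xs) m)) =
    face M l n i (y # xs) (s y (xs ! 0) (l - pdeg xs) m)"
   by (rule Face_elt[OF l i Cons_tuples(1)[OF xs y] cl[OF y]])
 qed (use K_linear_closed[OF linear_MC_face[OF l Cons_tuples(1)[OF xs] i] cl] in auto)
 finally show ?thesis .
qed

text \<open>Face 0 removes the new point by acting with it, so the components are multiplied back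
  into the first vertex, where \<open>s_section\<close> reassembles \<open>m\<close>.\<close>

lemma Face_0_contr:
 assumes l: "l \<in> G" and c: "c \<in>. Ch M l n"
 shows "Face l n 0 (contr l n c) = c"
proof (rule MC_linear_eqI[OF l module_MC[OF l] _ _ _ c])
 show "K_linear K (Ch M l n) (Ch M l n) (%c. Face l n 0 (contr l n c))"
  by (rule K_linear_comp[OF linear_contr[OF l] linear_Face[OF l]]) simp
 show "K_linear K (Ch M l n) (Ch M l n) (%c. c)" by (auto simp: K_linear_def)
 fix xs m assume xs: "xs \<in> tup n" and m: "m \<in>. MCp M l xs"
 define g where "g = l - pdeg xs"
 define x where "x = xs ! 0"
 have g: "g \<in> G" and x: "x \<in> X" using G_diff[OF l path_deg_G[OF xs]] tuples_nth[OF xs, of 0] by (simp_all add: g_def x_def)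
 have mg: "m \<in>. Mc x g" using m by (simp add: g_def x_def)
 interpret E: linear_map K "MCp M l xs" "Ch M l n" "elt l n xs"
  by (intro linear_mapI module_MC linear_elt l xs module_family.fam[OF MC_family[OF l] xs])
 have t: "Mm y x (g - dr y x) (s y x g m) \<in>. Mc x g" if "y \<in> X" "fin y x" for y
 proof -
  have "g - dr y x \<in> G" using that g x by (intro G_diff dist_G)
  from K_linear_closed[OF dm_linear[OF that(1) x that(2) this] K_linear_closed[OF s_linear[OF x that g] mg]]
  show ?thesis by simp
 qed
 have "Face l n 0 (contr l n (elt l n xs m)) = (\<Oplus>\<^bsub>Ch M l n\<^esub>y\<in>In x.
   face M l n 0 (y # xs) (s y x g m))"
  using Face_contr_gen[OF l xs m, of 0] contr_elt[OF l xs m] by (simp add: x_def g_def)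
 also have "... = (\<Oplus>\<^bsub>Ch M l n\<^esub>y\<in>In x. elt l n xs (Mm y x (g - dr y x) (s y x g m)))"
 proof (rule E.cod.M.finsum_cong')
  fix y assume "y \<in> In x"
  then have y: "y \<in> X" "fin y x" by auto
  have "l - pdeg (y # xs) = g - dr y x"
   using Cons_tuples(2)[OF xs y[unfolded x_def]] by (simp add: g_def x_def)
  then show "face M l n 0 (y # xs) (s y x g m) = elt l n xs (Mm y x (g - dr y x) (s y x g m))"
   by (simp add: MC_face_0 x_def)
 qed (use E.closed t in "auto simp: g_def x_def")
 also have "... = elt l n xs (\<Oplus>\<^bsub>Mc x g\<^esub>y\<in>In x. Mm y x (g - dr y x) (s y x g m))"
  using E.finsum[of "%y. Mm y x (g - dr y x) (s y x g m)" "In x"] t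
  by (simp add: g_def x_def Pi_iff)
 also have "... = elt l n xs m" using s_section[OF x g mg] by simp
 finally show "Face l n 0 (contr l n (elt l n xs m)) = elt l n xs m" .
qed

text \<open>For \<open>i = 0\<close> the point omitted is the former first point, and the identity
  says that the section commutes with the action, which is \<open>s_map\<close>. For
  \<open>i > 0\<close> the omitted point is not adjacent to the new one, so whether the length is
  kept does not depend on the latter.\<close>

lemma Face_Suc_contr:
 assumes l: "l \<in> G" and i: "i <= Suc n" and c: "c \<in>. Ch M l (Suc n)"
 shows "Face l (Suc n) (Suc i) (contr l (Suc n) c) = contr l n (Face l n i c)"
proof (rule MC_linear_eqI[OF l module_MC[OF l] _ _ _ c])
 have i': "Suc i <= Suc (Suc n)" using i by simp
 show "K_linear K (Ch M l (Suc n)) (Ch M l (Suc n)) (%c. Face l (Suc n) (Suc i) (contr l (Suc n) c))"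
  by (rule K_linear_comp[OF linear_contr[OF l] linear_Face[OF l i']])
 show "K_linear K (Ch M l (Suc n)) (Ch M l (Suc n)) (%c. contr l n (Face l n i c))"
  by (rule K_linear_comp[OF linear_Face[OF l i] linear_contr[OF l]])
 interpret A: Module.module K "Ch M l (Suc n)" by (rule module_MC[OF l])
 fix xs m assume xs: "xs \<in> tup (Suc n)" and m: "m \<in>. MCp M l xs"
 define g where "g = l - pdeg xs"
 define x where "x = xs ! 0"
 have g: "g \<in> G" and x: "x \<in> X" using G_diff[OF l path_deg_G[OF xs]] tuples_nth[OF xs, of 0] by (simp_all add: g_def x_def)
 have mg: "m \<in>. Mc x g" using m by (simp add: g_def x_def)
 have L: "Face l (Suc n) (Suc i) (contr l (Suc n) (elt l (Suc n) xs m)) = (\<Oplus>\<^bsub>Ch M l (Suc n)\<^esub>y\<in>In x.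
   face M l (Suc n) (Suc i) (y # xs) (s y x g m))"
  using Face_contr_gen[OF l xs m i'] contr_elt[OF l xs m] by (simp add: g_def x_def)
 have sm: "s y x g m \<in>. MCp M l (y # xs)" if "y \<in> X" "fin y x" for y
  using K_linear_closed[OF linear_contr_term[OF l xs that[unfolded x_def]] m] by (simp add: x_def g_def)
 have fcl: "face M l (Suc n) (Suc i) (y # xs) (s y x g m) \<in>. Ch M l (Suc n)" if "y \<in> X" "fin y x" for y
  using K_linear_closed[OF linear_MC_face[OF l Cons_tuples(1)[OF xs that[unfolded x_def]] i'] sm[OF that]] .
 have fe: "face M l (Suc n) (Suc i) (y # xs) (s y x g m) =
   (if keep (Suc i) (y # xs) then elt l (Suc n) (y # omit i xs) (s y x g m) else zero (Ch M l (Suc n)))"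
  if "y \<in> X" "fin y x" for y
  using MC_face_pos[OF Cons_tuples(1)[OF xs that[unfolded x_def]], of "Suc i" l "s y x g m"] i' by simp
 show "Face l (Suc n) (Suc i) (contr l (Suc n) (elt l (Suc n) xs m)) = contr l n (Face l n i (elt l (Suc n) xs m))"
 proof (cases "i = 0")
  case True
  obtain z zs where xs_eq: "xs = x # z # zs" and z: "z \<in> X" "fin x z" "z # zs \<in> tup n"
   using xs by (cases rule: tuples_SucE) (auto simp: x_def)
  have om: "omit 0 xs = z # zs" "xs ! 1 = z" by (simp_all add: xs_eq)
  have gz: "l - pdeg (z # zs) = g + dr x z" using path_deg_tl[OF xs] unfolding g_def om x_def[symmetric] by simp
  have mz: "Mm x z g m \<in>. MCp M l (z # zs)"
   using K_linear_closed[OF dm_linear[OF x z(1,2) g] mg] gz by simp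
  have "Face l n i (elt l (Suc n) xs m) = elt l n (z # zs) (Mm x z g m)"
   using Face_elt[OF l i xs m] unfolding True MC_face_0 om x_def[symmetric] g_def[symmetric] .
  then have R: "contr l n (Face l n i (elt l (Suc n) xs m)) = (\<Oplus>\<^bsub>Ch M l (Suc n)\<^esub>y\<in>In z.
    elt l (Suc n) (y # z # zs) (s y z (g + dr x z) (Mm x z g m)))"
   using contr_elt[OF l z(3) mz] by (simp add: contr_gen_def gz del: path_length_Cons)
  have k: "keep 1 (y # xs) \<longleftrightarrow> between d y x z" if "y \<in> X" "fin y x" for y
   using keep_inner[of "y # xs" 1] tuplesD[OF Cons_tuples(1)[OF xs that[unfolded x_def]]] by (simp add: xs_eq)
  have ez: "elt l (Suc n) (y # z # zs) (s y z (g + dr x z) (Mm x z g m)) =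
    (if fin y x & between d y x z then elt l (Suc n) (y # z # zs) (s y x g m) else zero (Ch M l (Suc n)))"
   if y: "y \<in> X" "fin y z" for y
  proof -
   have "l - pdeg (y # z # zs) = g + dr x z - dr y z"
    using Cons_tuples(2)[OF z(3) y(1)] y(2) gz by (simp del: path_length_Cons)
   then have "MCp M l (y # z # zs) = Mc y (g + dr x z - dr y z)"
    by (simp del: path_length_Cons)
   then show ?thesis
    using s_map[OF x y(1) z(1,2) y(2) g mg] elt_zero[where l = l and n = "Suc n" and xs = "y # z # zs"]
    by (simp del: path_length_Cons)
  qed
  show ?thesis
   unfolding L R
  \<comment> \<open>The right side sums over more points \<open>y\<close>, namely all that reach
    \<open>z\<close>; by \<open>s_map\<close> the terms of those that do not reach \<open>x\<close>
    vanish.\<close>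
  proof (rule A.M.add.finprod_mono_neutral_cong_left)
   show "finite (In z)" using finite_X by simp
   show sub: "In x \<subseteq> In z"
    using dist_finite_trans[OF _ x z(1) _ z(2)] by blast
   show "elt l (Suc n) (y # z # zs) (s y z (g + dr x z) (Mm x z g m)) = zero (Ch M l (Suc n))"
    if "y \<in> In z - In x" for y
    using ez[of y] that by auto
   show "face M l (Suc n) (Suc i) (y # xs) (s y x g m) =
     elt l (Suc n) (y # z # zs) (s y z (g + dr x z) (Mm x z g m))"
    if "y \<in> In x" for y
   proof -
    have "y \<in> X" "fin y x" "fin y z" using that sub by auto
    then show ?thesis using fe[of y] ez[of y] k[of y] True om(1) by simp
   qed
   have "elt l (Suc n) (y # z # zs) (s y z (g + dr x z) (Mm x z g m)) \<in>. Ch M l (Suc n)"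
    if y: "y \<in> X" "fin y z" for y
   proof -
    have "s y z (g + dr x z) (Mm x z g m) \<in>. MCp M l (y # z # zs)"
     using K_linear_closed[OF linear_contr_term[OF l z(3) y(1)] mz] y(2) gz by (simp del: path_length_Cons)
    then show ?thesis
     using K_linear_closed[OF linear_elt[OF l Cons_tuples(1)[OF z(3) y(1)]]] y(2) by simp
   qed
   then show "(%y. elt l (Suc n) (y # z # zs) (s y z (g + dr x z) (Mm x z g m)))
     \<in> In z \<rightarrow> carrier (Ch M l (Suc n))" by blast
  qed
 next
  case False
  then have i0: "0 < i" by simp
  have k: "keep (Suc i) (y # xs) \<longleftrightarrow> keep i xs" if "y \<in> X" "fin y x" for y
   using keep_Suc_Cons[of y xs i] tuplesD[OF xs] tuplesD(3)[OF Cons_tuples(1)[OF xs that[unfolded x_def]]] i i0 by simp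
  have F: "Face l n i (elt l (Suc n) xs m) = (if keep i xs then elt l n (omit i xs) m else zero (Ch M l n))"
   using Face_elt[OF l i xs m] MC_face_pos[OF xs i0 i] by simp
  show ?thesis
  proof (cases "keep i xs")
   case True
   have om: "omit i xs \<in> tup n" using omit_tuples[OF xs i] .
   have om0: "omit i xs ! 0 = x" using omit_nth_0[OF i0, of xs] tuplesD(1)[OF xs] i by (simp add: x_def)
   have "contr l n (Face l n i (elt l (Suc n) xs m)) = contr_gen l n (omit i xs) m"
    using F True contr_elt[OF l om] MC_part_omit[OF xs i0 i True] m by simp
   also have "... = (\<Oplus>\<^bsub>Ch M l (Suc n)\<^esub>y\<in>In x. elt l (Suc n) (y # omit i xs) (s y x g m))"
    by (simp add: contr_gen_def om0 keep_deg[OF True] g_def)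
   also have "... = (\<Oplus>\<^bsub>Ch M l (Suc n)\<^esub>y\<in>In x. face M l (Suc n) (Suc i) (y # xs) (s y x g m))"
    by (rule A.M.finsum_cong') (use fcl fe k True in auto)
   finally show ?thesis using L by simp
  next
   case False
   have "(\<Oplus>\<^bsub>Ch M l (Suc n)\<^esub>y\<in>In x. face M l (Suc n) (Suc i) (y # xs) (s y x g m)) =
     (\<Oplus>\<^bsub>Ch M l (Suc n)\<^esub>y\<in>In x. (zero (Ch M l (Suc n))))"
    by (rule A.M.finsum_cong') (use fe k False in auto)
   then show ?thesis using L F False linear_map.zero[OF linear_map_contr[OF l]] by simp
  qed
 qed
qed

text \<open>With \<open>Face_0_contr\<close> and \<open>Face_Suc_contr\<close> the boundary of
  \<open>contr c\<close> is \<open>c\<close> minus \<open>contr\<close> of the boundary of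
  \<open>c\<close>, so a cycle bounds. For a 0-chain nothing accounts for face 1 of its contraction,
  which is why homology survives in degree 0.\<close>

lemma MC_acyclic:
 assumes l: "l \<in> G" and c: "c \<in>. Ch M l (Suc n)" and bd: "del M l n c = zero (Ch M l n)"
 shows "\<exists>e\<in>carrier (Ch M l (Suc (Suc n))). del M l (Suc n) e = c"
proof
 interpret A: alt_module K "Ch M l (Suc n)" by (simp add: alt_module_def module_MC l)
 let ?e = "contr l (Suc n) c"
 show e: "?e \<in>. Ch M l (Suc (Suc n))" using linear_map.closed[OF linear_map_contr[OF l] c] .
 have Fc: "Face l n i c \<in>. Ch M l n" if "i <= Suc n" for i
  using linear_map.closed[OF linear_map_Face[OF l that] c] .
 have "del M l (Suc n) ?e = Face l (Suc n) 0 ?e \<ominus>\<^bsub>Ch M l (Suc n)\<^esub>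
   alt_sum (Ch M l (Suc n)) (Suc n) (%i. Face l (Suc n) (Suc i) ?e)"
  unfolding MC_bd_eq by (rule A.alt_sum_Suc2) (rule linear_map.closed[OF linear_map_Face[OF l] e])
 also have "alt_sum (Ch M l (Suc n)) (Suc n) (%i. Face l (Suc n) (Suc i) ?e) =
   alt_sum (Ch M l (Suc n)) (Suc n) (%i. contr l n (Face l n i c))"
  by (rule A.alt_sum_cong)
   (use Face_Suc_contr[OF l _ c] linear_map.closed[OF linear_map_contr[OF l] Fc] in auto)
 also have "... = contr l n (del M l n c)"
  unfolding MC_bd_eq by (rule linear_map.alt_sum[OF linear_map_contr[OF l] Fc, symmetric])
 also have "... = zero (Ch M l (Suc n))" unfolding bd by (rule linear_map.zero[OF linear_map_contr[OF l]])
 finally show "del M l (Suc n) ?e = c" using Face_0_contr[OF l c] c by (simp add: a_minus_def)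
qed

end

text \<open>Dually, \<open>r\<close> is a retraction of the map \<open>M(x) \<rightarrow> \<Prod>\<^sub>y M(y)\<close> that sends \<open>m\<close> to \<open>(m \<cdot> y)\<^sub>y\<close>.\<close>

locale relatively_injective = dist_mod K G X d M
 for K :: "'k ring" and G :: "real set" and X :: "'x set" and d :: "'x => 'x => ennreal"
  and M :: "('x, 'k, 'm) dist_module" +
 fixes r :: "'x => real => ('x => 'm) => 'm"
 assumes r_linear: "!!x g. x \<in> X ==> g \<in> G ==>
   K_linear K (prod_mod (Out x) (%y. dm_comp M y (g + dr x y))) (dm_comp M x g) (r x g)"
  and r_retract: "!!x g m. x \<in> X ==> g \<in> G ==> m \<in>. dm_comp M x g ==>
   r x g (\<lambda>y\<in>Out x. dm_map M x y g m) = m"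
  and r_map: "!!x z g f. x \<in> X ==> z \<in> X ==> fin x z ==> g \<in> G ==>
   f \<in>. prod_mod (Out x) (%y. dm_comp M y (g + dr x y)) ==>
   dm_map M x z g (r x g f) = r z (g + dr x z)
    (\<lambda>y\<in>Out z. if between d x z y then f y
      else zero (dm_comp M y (g + dr x z + dr z y)))"
begin

abbreviation coind :: "'x => real => ('k, 'x => 'm) module" where
 "coind x g \<equiv> prod_mod (Out x) (%y. Mc y (g + dr x y))"

text \<open>The values of a cochain at all extensions of \<open>xs\<close> by one point form an
  element of the coinduced module at the last point, which the retraction sends back to the
  coefficients there.\<close>

definition cocontr :: "real => nat => ('x list => 'm) => 'x list => 'm" where
 "cocontr l n \<alpha> = (\<lambda>xs\<in>tup n. r (last xs) (- l + pdeg xs)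
   (\<lambda>y\<in>Out (last xs). \<alpha> (xs @ [y])))"

lemma module_coind: "x \<in> X ==> g \<in> G ==> Module.module K (coind x g)"
 by (rule module_family.module_prod) (auto simp: module_family_def cring_K intro!: dm_module G_add dist_G)

lemma r_linear_map: "x \<in> X ==> g \<in> G ==> linear_map K (coind x g) (Mc x g) (r x g)"
 by (intro linear_mapI module_coind dm_module r_linear)

lemma snoc_tuples:
 assumes xs: "xs \<in> tup n" and y: "y \<in> X" "fin (last xs) y"
 shows "xs @ [y] \<in> tup (Suc n)" "- l + pdeg (xs @ [y]) = - l + pdeg xs + dr (last xs) y"
proof -
 obtain ys x where xs_eq: "xs = ys @ [x]" using tuplesD(1)[OF xs] by (cases xs rule: rev_cases) auto
 have pl: "path_length d (xs @ [y]) = path_length d xs + d x y"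
  using path_length_append[of d ys x "[y]"] xs_eq by simp
 then show t: "xs @ [y] \<in> tup (Suc n)"
  using xs y xs_eq by (auto simp: tuples_def ennreal_add_less_top)
 from t show "- l + pdeg (xs @ [y]) = - l + pdeg xs + dr (last xs) y"
  by (cases rule: tuples_snocE) (simp add: xs_eq)
qed

lemma last_tuples: "xs \<in> tup n ==> last xs \<in> X" and deg_tuples: "l \<in> G ==> xs \<in> tup n ==> - l + pdeg xs \<in> G"
proof -
 assume xs: "xs \<in> tup n"
 then show "last xs \<in> X" using tuplesD[OF xs] by (cases xs) auto
 show "- l + pdeg xs \<in> G" if "l \<in> G" by (intro G_add G_uminus that path_deg_G[OF xs])
qed

lemma coMC_closed: "\<alpha> \<in>. CoCh M l n ==> xs \<in> tup n ==> \<alpha> xs \<in>. Mc (last xs) (- l + pdeg xs)"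
 unfolding coMC_def prod_mod_simps by (rule PiE_mem)

lemma fibre_closed:
 assumes a: "\<alpha> \<in>. CoCh M l (Suc n)" and xs: "xs \<in> tup n"
 shows "(\<lambda>y\<in>Out (last xs). \<alpha> (xs @ [y])) \<in>. coind (last xs) (- l + pdeg xs)"
proof -
 have "\<alpha> (xs @ [y]) \<in>. Mc y (- l + pdeg xs + dr (last xs) y)"
  if "y \<in> X" "fin (last xs) y" for y
  using coMC_closed[OF a snoc_tuples(1)[OF xs that]] unfolding snoc_tuples(2)[OF xs that] by simp
 then show ?thesis unfolding prod_mod_simps by auto
qed

lemma cocontr_closed:
 assumes l: "l \<in> G" and a: "\<alpha> \<in>. CoCh M l (Suc n)"
 shows "cocontr l n \<alpha> \<in>. CoCh M l n"
proof -
 have "r (last xs) (- l + pdeg xs) (\<lambda>y\<in>Out (last xs). \<alpha> (xs @ [y])) \<in>. coMCp M l xs"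
  if "xs \<in> tup n" for xs
  using linear_map.closed[OF r_linear_map[OF last_tuples deg_tuples] fibre_closed[OF a]] that l by blast
 then show ?thesis unfolding cocontr_def coMC_def prod_mod_simps by simp
qed

lemma linear_cocontr:
 assumes l: "l \<in> G"
 shows "K_linear K (CoCh M l (Suc n)) (CoCh M l n) (cocontr l n)"
 unfolding K_linear_def
proof (intro conjI ballI funcsetI)
 fix a assume a: "a \<in>. CoCh M l (Suc n)"
 show "cocontr l n a \<in>. CoCh M l n" by (rule cocontr_closed[OF l a])
 let ?f = "%a xs. \<lambda>y\<in>Out (last xs). a (xs @ [y])"
 show "cocontr l n (k \<odot>\<^bsub>CoCh M l (Suc n)\<^esub> a) = k \<odot>\<^bsub>CoCh M l n\<^esub> cocontr l n a" if k: "k \<in>. K" for k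
 proof (rule extensional_eqI[of _ "tup n"])
  fix xs assume xs: "xs \<in> tup n"
  interpret r: linear_map K "coind (last xs) (- l + pdeg xs)" "Mc (last xs) (- l + pdeg xs)" "r (last xs) (- l + pdeg xs)"
   by (rule r_linear_map[OF last_tuples[OF xs] deg_tuples[OF l xs]])
  have "?f (k \<odot>\<^bsub>CoCh M l (Suc n)\<^esub> a) xs = k \<odot>\<^bsub>coind (last xs) (- l + pdeg xs)\<^esub> ?f a xs"
   unfolding coMC_def prod_mod_simps
   by (rule restrict_ext) (use snoc_tuples[OF xs] in "simp add: add.assoc del: uminus_add_conv_diff")
  then show "cocontr l n (k \<odot>\<^bsub>CoCh M l (Suc n)\<^esub> a) xs = (k \<odot>\<^bsub>CoCh M l n\<^esub> cocontr l n a) xs"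
   using r.smult[OF k fibre_closed[OF a xs]] xs by (simp add: cocontr_def coMC_def[of X d M l n] prod_mod_simps(4)[where I = "tup n"])
 qed (simp_all add: cocontr_def coMC_def prod_mod_simps)
 fix b assume b: "b \<in>. CoCh M l (Suc n)"
 show "cocontr l n (a \<oplus>\<^bsub>CoCh M l (Suc n)\<^esub> b) = cocontr l n a \<oplus>\<^bsub>CoCh M l n\<^esub> cocontr l n b"
 proof (rule extensional_eqI[of _ "tup n"])
  fix xs assume xs: "xs \<in> tup n"
  interpret r: linear_map K "coind (last xs) (- l + pdeg xs)" "Mc (last xs) (- l + pdeg xs)" "r (last xs) (- l + pdeg xs)"
   by (rule r_linear_map[OF last_tuples[OF xs] deg_tuples[OF l xs]])
  have "?f (a \<oplus>\<^bsub>CoCh M l (Suc n)\<^esub> b) xs = ?f a xs \<oplus>\<^bsub>coind (last xs) (- l + pdeg xs)\<^esub> ?f b xs"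
   unfolding coMC_def prod_mod_simps
   by (rule restrict_ext) (use snoc_tuples[OF xs] in "simp add: add.assoc del: uminus_add_conv_diff")
  then show "cocontr l n (a \<oplus>\<^bsub>CoCh M l (Suc n)\<^esub> b) xs = (cocontr l n a \<oplus>\<^bsub>CoCh M l n\<^esub> cocontr l n b) xs"
   using r.add[OF fibre_closed[OF a xs] fibre_closed[OF b xs]] xs
   by (simp add: cocontr_def coMC_def[of X d M l n] prod_mod_simps(3)[where I = "tup n"])
 qed (simp_all add: cocontr_def coMC_def prod_mod_simps)
qed

lemma linear_map_cocontr: "l \<in> G ==> linear_map K (CoCh M l (Suc n)) (CoCh M l n) (cocontr l n)"
 by (intro linear_mapI module_coMC linear_cocontr)

text \<open>The last coface sends a value to the family of its images under the action; recovering
  the value is what \<open>r_retract\<close> says.\<close>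

lemma cocontr_last:
 assumes l: "l \<in> G" and a: "\<alpha> \<in>. CoCh M l n"
 shows "cocontr l n (coface M l n (Suc n) \<alpha>) = \<alpha>"
proof (rule extensional_eqI[of _ "tup n"])
 show "\<alpha> \<in> extensional (tup n)" using a by (auto simp: coMC_def prod_mod_simps PiE_iff)
 fix xs assume xs: "xs \<in> tup n"
 obtain ys x where xs_eq: "xs = ys @ [x]" using tuplesD(1)[OF xs] by (cases xs rule: rev_cases) auto
 have "coface M l n (Suc n) \<alpha> (xs @ [y]) = Mm (last xs) y (- l + pdeg xs) (\<alpha> xs)"
  if "y \<in> X" "fin (last xs) y" for y
  using coMC_coface_last[OF snoc_tuples(1)[OF xs that], of ys x y] by (simp add: xs_eq)
 then have "(\<lambda>y\<in>Out (last xs). coface M l n (Suc n) \<alpha> (xs @ [y])) =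
   (\<lambda>y\<in>Out (last xs). Mm (last xs) y (- l + pdeg xs) (\<alpha> xs))"
  by (intro restrict_ext) auto
 then show "cocontr l n (coface M l n (Suc n) \<alpha>) xs = \<alpha> xs"
  using r_retract[OF last_tuples[OF xs] deg_tuples[OF l xs] coMC_closed[OF a xs]] xs by (simp add: cocontr_def)
qed (simp add: cocontr_def)

text \<open>For \<open>i \<le> n\<close> the appended point is not adjacent to the omitted one. For
  \<open>i = Suc n\<close> the identity says that the retraction commutes with the action, which is
  \<open>r_map\<close>.\<close>

lemma cocontr_coface:
 assumes l: "l \<in> G" and i: "i <= Suc n" and a: "\<alpha> \<in>. CoCh M l (Suc n)"
 shows "cocontr l (Suc n) (coface M l (Suc n) i \<alpha>) = coface M l n i (cocontr l n \<alpha>)"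
proof (rule extensional_eqI[of _ "tup (Suc n)"])
 fix xs assume xs: "xs \<in> tup (Suc n)"
 let ?Z = "%x. (Out x)"
 have cf: "coface M l (Suc n) i \<alpha> (xs @ [y]) =
   (if keep i (xs @ [y]) then \<alpha> (omit i (xs @ [y])) else zero (coMCp M l (xs @ [y])))"
  if "y \<in> ?Z (last xs)" for y
  using coMC_coface_le[OF snoc_tuples(1)[OF xs] i] that by simp
 have L: "cocontr l (Suc n) (coface M l (Suc n) i \<alpha>) xs = r (last xs) (- l + pdeg xs)
   (\<lambda>y\<in>?Z (last xs). if keep i (xs @ [y]) then \<alpha> (omit i (xs @ [y])) else zero (coMCp M l (xs @ [y])))"
  using xs restrict_ext[of "?Z (last xs)", OF cf] by (simp add: cocontr_def)
 show "cocontr l (Suc n) (coface M l (Suc n) i \<alpha>) xs = coface M l n i (cocontr l n \<alpha>) xs"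
 proof (cases "i <= n")
  case True
  have k: "keep i (xs @ [y]) \<longleftrightarrow> keep i xs" if "y \<in> ?Z (last xs)" for y
   using keep_snoc[of xs y i] tuplesD(3)[OF snoc_tuples(1)[OF xs]] that tuplesD(1)[OF xs] True by simp
  have om: "omit i (xs @ [y]) = omit i xs @ [y]" for y using tuplesD(1)[OF xs] True by (simp add: omit_append)
  have la: "last (omit i xs) = last xs" using True tuplesD(1)[OF xs] by (simp add: last_omit[of i "Suc n"])
  show ?thesis
  proof (cases "keep i xs")
   case kp: True
   have "(\<lambda>y\<in>?Z (last xs). if keep i (xs @ [y]) then \<alpha> (omit i (xs @ [y])) else zero (coMCp M l (xs @ [y])))
     = (\<lambda>y\<in>?Z (last xs). \<alpha> (omit i xs @ [y]))"
    by (rule restrict_ext) (use k kp om in auto)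
   then show ?thesis
    unfolding L coMC_coface_le[OF xs True] using kp omit_tuples[OF xs i] by (simp add: cocontr_def la keep_deg[OF kp])
  next
   case False
   have "(\<lambda>y\<in>?Z (last xs). if keep i (xs @ [y]) then \<alpha> (omit i (xs @ [y])) else zero (coMCp M l (xs @ [y])))
     = zero (coind (last xs) (- l + pdeg xs))"
    unfolding prod_mod_simps
    by (rule restrict_ext) (use k False snoc_tuples(2)[OF xs] in "simp add: add.assoc del: uminus_add_conv_diff")
   then show ?thesis
    unfolding L coMC_coface_le[OF xs True]
    using False linear_map.zero[OF r_linear_map[OF last_tuples[OF xs] deg_tuples[OF l xs]]] by simp
  qed
 next
  case False
  then have i: "i = Suc n" using i by simp
  from xs show ?thesis
  \<comment> \<open>On \<open>xs @ [y]\<close> this coface omits the last point \<open>x\<close> of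
    \<open>xs\<close>, while on \<open>xs\<close> itself it acts along the edge from
    \<open>w\<close> to \<open>x\<close>.\<close>
  proof (cases rule: tuples_snocE)
   case (1 ys w x)
   define g where "g = - l + pdeg (ys @ [w])"
   have g: "g \<in> G" unfolding g_def by (rule deg_tuples[OF l 1(6)])
   have la: "last xs = x" "last (ys @ [w]) = w" and dg: "- l + pdeg xs = g + dr w x"
    using 1(7) by (simp_all add: 1(1) g_def)
   have fib: "(\<lambda>y\<in>?Z w. \<alpha> ((ys @ [w]) @ [y])) \<in>. coind w g"
    using fibre_closed[OF a 1(6)] unfolding la g_def .
   have "coface M l n i (cocontr l n \<alpha>) xs = Mm w x g (cocontr l n \<alpha> (ys @ [w]))"
    unfolding i g_def by (rule coMC_coface_last[OF xs 1(1)])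
   also have "cocontr l n \<alpha> (ys @ [w]) = r w g (\<lambda>y\<in>?Z w. \<alpha> ((ys @ [w]) @ [y]))"
    using 1(6) by (simp add: cocontr_def g_def)
   also have "Mm w x g ... = r x (g + dr w x) (\<lambda>y\<in>?Z x. if between d w x y then (\<lambda>y\<in>?Z w. \<alpha> ((ys @ [w]) @ [y])) y
      else zero (Mc y (g + dr w x + dr x y)))"
    by (rule r_map[OF 1(3-5) g fib])
   also have "(\<lambda>y\<in>?Z x. if between d w x y then (\<lambda>y\<in>?Z w. \<alpha> ((ys @ [w]) @ [y])) y
      else zero (Mc y (g + dr w x + dr x y))) =
     (\<lambda>y\<in>?Z x. if keep i (xs @ [y]) then \<alpha> (omit i (xs @ [y])) else zero (coMCp M l (xs @ [y])))"
   proof (rule restrict_ext)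
    fix y assume y: "y \<in> ?Z x"
    then have yy: "y \<in> X" "fin (last xs) y" "y \<in> ?Z w"
     using dist_finite_trans[OF 1(3,4) _ 1(5)] la by auto
    have "keep i (xs @ [y]) \<longleftrightarrow> between d w x y"
     using keep_inner[of "xs @ [y]" i] tuplesD(3)[OF snoc_tuples(1)[OF xs yy(1,2)]] 1(2) by (simp add: i 1(1) nth_append)
    moreover have "omit i (xs @ [y]) = ys @ [w, y]" using 1(2) by (simp add: i 1(1) omit_def)
    moreover have "coMCp M l (xs @ [y]) = Mc y (g + dr w x + dr x y)"
     unfolding snoc_tuples(2)[OF xs yy(1,2)] dg la by simp
    ultimately show "(if between d w x y then (\<lambda>y\<in>?Z w. \<alpha> ((ys @ [w]) @ [y])) y
      else zero (Mc y (g + dr w x + dr x y))) =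
      (if keep i (xs @ [y]) then \<alpha> (omit i (xs @ [y])) else zero (coMCp M l (xs @ [y])))"
     using yy by simp
   qed
   finally show ?thesis unfolding L la dg by (rule sym)
  qed
 qed
qed (simp_all add: cocontr_def coMC_coface_def)

text \<open>\<open>cocontr\<close> cancels the last coface and commutes with the others. Applied to
  the vanishing coboundary of \<open>\<alpha>\<close> it gives an equation between the coboundary of
  \<open>cocontr \<alpha>\<close> and \<open>\<alpha>\<close> up to sign.\<close>

lemma coMC_acyclic:
 assumes l: "l \<in> G" and a: "\<alpha> \<in>. CoCh M l (Suc n)"
  and bd: "codel M l (Suc n) \<alpha> = zero (CoCh M l (Suc (Suc n)))"
 shows "\<exists>\<beta>\<in>carrier (CoCh M l n). codel M l n \<beta> = \<alpha>"
proof -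
 interpret A: alt_module K "CoCh M l (Suc n)" by (simp add: alt_module_def module_coMC l)
 interpret D: linear_map K "CoCh M l n" "CoCh M l (Suc n)" "codel M l n" by (rule linear_map_coMC_cobd[OF l])
 have cl: "coface M l (Suc n) i \<alpha> \<in>. CoCh M l (Suc (Suc n))" if "i <= Suc (Suc n)" for i
  using linear_map.closed[OF linear_map_coface[OF l that] a] .
 have ccl: "cocontr l (Suc n) (coface M l (Suc n) i \<alpha>) \<in>. CoCh M l (Suc n)" if "i <= Suc (Suc n)" for i
  using cocontr_closed[OF l cl[OF that]] .
 let ?b = "cocontr l n \<alpha>"
 have b: "?b \<in>. CoCh M l n" by (rule cocontr_closed[OF l a])
 have "zero (CoCh M l (Suc n)) = cocontr l (Suc n) (codel M l (Suc n) \<alpha>)"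
  unfolding bd using linear_map.zero[OF linear_map_cocontr[OF l]] by simp
 also have "... = alt_sum (CoCh M l (Suc n)) (Suc (Suc n)) (%i. cocontr l (Suc n) (coface M l (Suc n) i \<alpha>))"
  unfolding coMC_cobd_def by (rule linear_map.alt_sum[OF linear_map_cocontr[OF l] cl])
 also have "... = A.alt_term (Suc (Suc n)) \<alpha> \<oplus>\<^bsub>CoCh M l (Suc n)\<^esub>
   alt_sum (CoCh M l (Suc n)) (Suc n) (%i. cocontr l (Suc n) (coface M l (Suc n) i \<alpha>))"
  using A.alt_sum_Suc[of "Suc n" "%i. cocontr l (Suc n) (coface M l (Suc n) i \<alpha>)"] ccl cocontr_last[OF l a] by simp
 also have "alt_sum (CoCh M l (Suc n)) (Suc n) (%i. cocontr l (Suc n) (coface M l (Suc n) i \<alpha>)) =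
   codel M l n ?b"
  unfolding coMC_cobd_def
  by (rule A.alt_sum_cong) (use cocontr_coface[OF l _ a] linear_map.closed[OF linear_map_coface[OF l] b] in auto)
 finally have "A.alt_term (Suc (Suc n)) \<alpha> \<oplus>\<^bsub>CoCh M l (Suc n)\<^esub> codel M l n ?b = zero (CoCh M l (Suc n))" by simp
 then have e: "A.alt_term (Suc (Suc n)) \<alpha> = \<ominus>\<^bsub>CoCh M l (Suc n)\<^esub> codel M l n ?b"
  using A.M.minus_equality[of "A.alt_term (Suc (Suc n)) \<alpha>" "codel M l n ?b"] a D.closed[OF b] by simp
 show ?thesis
 \<comment> \<open>The identity comes from the coface of index \<open>Suc (Suc n)\<close>, whose
   sign depends on the parity of \<open>n\<close>; the primitive is adjusted accordingly.\<close>
 proof (cases "even n")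
  case True
  then have "codel M l n (\<ominus>\<^bsub>CoCh M l n\<^esub> ?b) = \<alpha>" using e b by (simp add: A.alt_term_def D.minus)
  then show ?thesis using b by (intro bexI[of _ "\<ominus>\<^bsub>CoCh M l n\<^esub> ?b"]) auto
 next
  case False
  then have "\<alpha> = codel M l n ?b"
   using e a D.closed[OF b] A.M.minus_minus by (metis A.alt_term_def even_Suc)
  then show ?thesis using b by (intro bexI[of _ ?b]) simp
 qed
qed

end

section \<open>Graded modules over the distance algebra\<close>

lemma (in Module.module) finsum_submodule:
 assumes "submodule H R M" "f \<in> S \<rightarrow> H"
 shows "finsum M f S \<in> H"
proof -
 note sub = submoduleE[OF assms(1)]
 have z: "zero M \<in> H" using assms(1) by (simp add: submodule_def subgroup_def)
 show ?thesis
  using assms(2)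
 proof (induction S rule: infinite_finite_induct)
  case (insert i S)
  then have "finsum M f (insert i S) = f i \<oplus>\<^bsub>M\<^esub> finsum M f S"
   using sub(1) by (intro M.finsum_insert) auto
  then show ?case using insert sub(5) by auto
 qed (use z in simp_all)
qed

lemma (in free_module) free_span:
 assumes "submodule H K (free_mod K I)" "!!i. i \<in> I ==> basis_elt K I i \<in> H"
 shows "carrier (free_mod K I) \<subseteq> H"
proof
 interpret F: Module.module K "free_mod K I" by (rule module_free)
 fix f assume f: "f \<in>. free_mod K I"
 have "sum_incl I (%_. ring_mod K) i (f i) \<in> H" if "i \<in> I" for i
 proof -
  have "f i \<in>. K" using f that by (auto simp: free_mod_def sum_mod_simps ring_mod_simps)
  then show ?thesis using incl_eq_basis[OF that] F.submoduleE(4)[OF assms(1)] assms(2)[OF that] by simp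
 qed
 then have "(\<Oplus>\<^bsub>free_mod K I\<^esub>i\<in>{i \<in> I. f i \<noteq> (zero (ring_mod K))}. sum_incl I (%_. ring_mod K) i (f i)) \<in> H"
  by (intro F.finsum_submodule[OF assms(1)]) auto
 then show "f \<in> H" using fm.sum_decomp[of f] f by (simp add: free_mod_def)
qed

lemma (in module_family) sum_decomp_finite:
 assumes I: "finite I" and f: "f \<in>. sum_mod I A"
 shows "(\<Oplus>\<^bsub>sum_mod I A\<^esub>i\<in>I. sum_incl I A i (f i)) = f"
proof -
 interpret S: Module.module K "sum_mod I A" by (rule module_sum)
 have "(\<Oplus>\<^bsub>sum_mod I A\<^esub>i\<in>{i \<in> I. f i \<noteq> (zero (A i))}. sum_incl I A i (f i)) = (\<Oplus>\<^bsub>sum_mod I A\<^esub>i\<in>I. sum_incl I A i (f i))"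
 proof (rule S.M.add.finprod_mono_neutral_cong_left[OF I])
  show "sum_incl I A i (f i) = zero (sum_mod I A)" if "i \<in> I - {i \<in> I. f i \<noteq> (zero (A i))}" for i
   using that by (auto simp: sum_incl_def sum_mod_simps)
  show "(%i. sum_incl I A i (f i)) \<in> I \<rightarrow> carrier (sum_mod I A)"
   using f incl_closed by (auto simp: sum_mod_simps)
 qed auto
 then show ?thesis using sum_decomp[OF f] by simp
qed

section \<open>The distance algebra and the ideal \<open>JX\<close>\<close>

context dist_space
begin

abbreviation \<Lambda> where "\<Lambda> \<equiv> dist_algebra K X d"

abbreviation "Lam \<equiv> ga_comp \<Lambda>"
abbreviation "hom0 \<equiv> graded_hom K G \<Lambda> 0"

text \<open>The type of a basis element does not record its degree; here the index set is pinned to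
  the degree of the pair itself.\<close>

abbreviation ee :: "'x => 'x => 'x \<times> 'x => 'k" where
 "ee x y \<equiv> basis_elt K (prs (dr x y)) (x, y)"

lemma free_module_K: "free_module K"
 using cring_K by (simp add: free_module_def)

lemma ga_comp: "Lam g = free_mod K (prs g)"
 by (simp add: dist_algebra_def)

lemma module_ga: "Module.module K (Lam g)"
 unfolding ga_comp by (rule free_module.module_free[OF free_module_K])

lemma pairsI: "x \<in> X ==> y \<in> X ==> fin x y ==> (x, y) \<in> prs (dr x y)"
 by (simp add: pairs_def)

lemma basis_ga: "p \<in> prs g ==> basis_elt K (prs g) p \<in>. Lam g"
 unfolding ga_comp by (rule free_module.basis_closed[OF free_module_K])

text \<open>Separation of points: at finite distance, degree 0 means distance 0, hence
  equality.\<close>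

lemma pairs_0: "prs 0 = (%x. (x, x)) ` X"
 by (auto simp: pairs_def enn2real_eq_0_iff dist_self dist_eq_0)

lemma pairs_neg: "g < 0 ==> prs g = {}"
 using enn2real_nonneg by (auto simp: pairs_def not_less)

lemma pair_mult_closed:
 assumes "p \<in> prs g" "q \<in> prs h"
 shows "pair_mult K X d (g + h) p q \<in>. Lam (g + h)"
proof (cases "snd p = fst q & between d (fst p) (snd p) (snd q)")
 case True
 then have e: "d (fst p) (snd q) = d (fst p) (snd p) + d (fst q) (snd q)" unfolding between_def by metis
 obtain a b where "0 <= a" "d (fst p) (snd p) = ennreal a" "0 <= b" "d (fst q) (snd q) = ennreal b"
  using assms by (cases "d (fst p) (snd p)"; cases "d (fst q) (snd q)") (auto simp: pairs_def)
 then have "(fst p, snd q) \<in> prs (g + h)"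
  using assms e by (auto simp: pairs_def simp flip: ennreal_plus)
 then show ?thesis unfolding pair_mult_def if_P[OF True] by (rule basis_ga)
next
 case False
 interpret M: Module.module K "Lam (g + h)" by (rule module_ga)
 show ?thesis using False M.zero_closed by (auto simp: pair_mult_def ga_comp)
qed

lemma ga_mult: "ga_mult \<Lambda> g h a b = lin_ext K (prs g) (Lam (g + h))
  (%p. lin_ext K (prs h) (Lam (g + h)) (%q. pair_mult K X d (g + h) p q) b) a"
 by (simp add: dist_algebra_def)

lemma ga_mult_linear_r:
 assumes "a \<in>. Lam g"
 shows "K_linear K (Lam h) (Lam (g + h)) (%b. ga_mult \<Lambda> g h a b)"
 unfolding ga_mult
proof (rule free_module.linear_lin_ext_param[OF free_module_K module_ga module_ga])
 show "a \<in>. free_mod K (prs g)" using assms by (simp add: ga_comp)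
 fix p assume "p \<in> prs g"
 then show "K_linear K (Lam h) (Lam (g + h)) (lin_ext K (prs h) (Lam (g + h)) (pair_mult K X d (g + h) p))"
  unfolding ga_comp[of h]
  by (intro free_module.linear_lin_ext[OF free_module_K module_ga] pair_mult_closed)
qed

lemma ga_mult_linear_l:
 assumes "b \<in>. Lam h"
 shows "K_linear K (Lam g) (Lam (g + h)) (%a. ga_mult \<Lambda> g h a b)"
 unfolding ga_mult ga_comp[of g]
proof (rule free_module.linear_lin_ext[OF free_module_K module_ga])
 fix p assume "p \<in> prs g"
 then have "K_linear K (Lam h) (Lam (g + h)) (lin_ext K (prs h) (Lam (g + h)) (pair_mult K X d (g + h) p))"
  unfolding ga_comp[of h]
  by (intro free_module.linear_lin_ext[OF free_module_K module_ga] pair_mult_closed)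
 then show "lin_ext K (prs h) (Lam (g + h)) (pair_mult K X d (g + h) p) b \<in>. Lam (g + h)"
  using K_linear_closed assms by metis
qed

lemma ga_mult_closed:
 "a \<in>. Lam g ==> b \<in>. Lam h ==> ga_mult \<Lambda> g h a b \<in>. Lam (g + h)"
 using K_linear_closed[OF ga_mult_linear_r] .

lemma ga_mult_basis:
 assumes "p \<in> prs g" "q \<in> prs h"
 shows "ga_mult \<Lambda> g h (basis_elt K (prs g) p) (basis_elt K (prs h) q) = pair_mult K X d (g + h) p q"
proof -
 have *: "lin_ext K (prs h) (Lam (g + h)) (pair_mult K X d (g + h) p') (basis_elt K (prs h) q) = pair_mult K X d (g + h) p' q"
  if "p' \<in> prs g" for p'
  by (rule free_module.lin_ext_basis[OF free_module_K module_ga]) (use that assms pair_mult_closed in auto)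
 show ?thesis
  unfolding ga_mult
  by (subst free_module.lin_ext_basis[OF free_module_K module_ga])
   (use assms * pair_mult_closed in auto)
qed

lemma ga_one: "ga_one \<Lambda> = (\<Oplus>\<^bsub>Lam 0\<^esub> x\<in>X. ee x x)"
proof -
 interpret M: Module.module K "Lam 0" by (rule module_ga)
 show ?thesis
  unfolding dist_algebra_def graded_algebra.simps
  by (rule M.M.finsum_cong'[unfolded ga_comp]) (use basis_ga[of _ 0] in "auto simp: dist_self pairs_0 ga_comp")
qed

lemma ee_self: "x \<in> X ==> ee x x = basis_elt K (prs 0) (x, x)"
 by (simp add: dist_self)

lemma ga_one_closed: "ga_one \<Lambda> \<in>. Lam 0"
proof -
 interpret M: Module.module K "Lam 0" by (rule module_ga)
 show ?thesis unfolding ga_one by (rule M.M.finsum_closed) (use basis_ga[of _ 0] in "auto simp: dist_self pairs_0")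
qed

lemma between_refl: "x \<in> X ==> y \<in> X ==> between d x y y" "x \<in> X ==> y \<in> X ==> between d x x y"
 by (simp_all add: between_def dist_self)

lemma ga_one_right:
 assumes "a \<in>. Lam g"
 shows "ga_mult \<Lambda> g 0 a (ga_one \<Lambda>) = a"
proof (rule free_module.free_linear_eqI[OF free_module_K module_ga _ _ _ assms[unfolded ga_comp]])
 show "K_linear K (free_mod K (prs g)) (Lam g) (%a. ga_mult \<Lambda> g 0 a (ga_one \<Lambda>))"
  using ga_mult_linear_l[OF ga_one_closed, of g] by (simp add: ga_comp)
 show "K_linear K (free_mod K (prs g)) (Lam g) (%a. a)" by (simp add: ga_comp K_linear_def)
 fix p assume p: "p \<in> prs g"
 interpret L: linear_map K "Lam 0" "Lam g" "%b. ga_mult \<Lambda> g 0 (basis_elt K (prs g) p) b"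
  using ga_mult_linear_r[OF basis_ga[OF p], of 0] by (intro linear_mapI module_ga) simp
 have e: "ee x x \<in>. Lam 0" if "x \<in> X" for x using basis_ga[of "(x, x)" 0] that by (simp add: dist_self pairs_0)
 have sp: "snd p \<in> X" "fst p \<in> X" using p by (auto simp: pairs_def)
 have "ga_mult \<Lambda> g 0 (basis_elt K (prs g) p) (ga_one \<Lambda>) =
   (\<Oplus>\<^bsub>Lam g\<^esub>x\<in>X. ga_mult \<Lambda> g 0 (basis_elt K (prs g) p) (ee x x))"
  unfolding ga_one by (rule L.finsum) (use e in auto)
 also have "... = (\<Oplus>\<^bsub>Lam g\<^esub>x\<in>X. if snd p = x then basis_elt K (prs g) p else zero (Lam g))"
 proof (rule L.cod.M.finsum_cong')
  fix x assume x: "x \<in> X"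
  show "ga_mult \<Lambda> g 0 (basis_elt K (prs g) p) (ee x x) = (if snd p = x then basis_elt K (prs g) p else zero (Lam g))"
   using ga_mult_basis[OF p, of "(x, x)" 0] x sp between_refl
   by (auto simp: pairs_0 ee_self pair_mult_def ga_comp)
 qed (use basis_ga[OF p] in auto)
 also have "... = basis_elt K (prs g) p"
  by (rule L.cod.M.finsum_singleton) (use sp finite_X basis_ga[OF p] in auto)
 finally show "ga_mult \<Lambda> g 0 (basis_elt K (prs g) p) (ga_one \<Lambda>) = basis_elt K (prs g) p" .
qed

lemma ga_one_left:
 assumes "a \<in>. Lam g"
 shows "ga_mult \<Lambda> 0 g (ga_one \<Lambda>) a = a"
proof (rule free_module.free_linear_eqI[OF free_module_K module_ga _ _ _ assms[unfolded ga_comp]])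
 show "K_linear K (free_mod K (prs g)) (Lam g) (%a. ga_mult \<Lambda> 0 g (ga_one \<Lambda>) a)"
  using ga_mult_linear_r[OF ga_one_closed, of g] by (simp add: ga_comp)
 show "K_linear K (free_mod K (prs g)) (Lam g) (%a. a)" by (simp add: ga_comp K_linear_def)
 fix p assume p: "p \<in> prs g"
 interpret L: linear_map K "Lam 0" "Lam g" "%b. ga_mult \<Lambda> 0 g b (basis_elt K (prs g) p)"
  using ga_mult_linear_l[OF basis_ga[OF p], of 0] by (intro linear_mapI module_ga) simp
 have e: "ee x x \<in>. Lam 0" if "x \<in> X" for x using basis_ga[of "(x, x)" 0] that by (simp add: dist_self pairs_0)
 have sp: "snd p \<in> X" "fst p \<in> X" using p by (auto simp: pairs_def)
 have "ga_mult \<Lambda> 0 g (ga_one \<Lambda>) (basis_elt K (prs g) p) =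
   (\<Oplus>\<^bsub>Lam g\<^esub>x\<in>X. ga_mult \<Lambda> 0 g (ee x x) (basis_elt K (prs g) p))"
  unfolding ga_one by (rule L.finsum) (use e in auto)
 also have "... = (\<Oplus>\<^bsub>Lam g\<^esub>x\<in>X. if fst p = x then basis_elt K (prs g) p else zero (Lam g))"
 proof (rule L.cod.M.finsum_cong')
  fix x assume x: "x \<in> X"
  show "ga_mult \<Lambda> 0 g (ee x x) (basis_elt K (prs g) p) = (if fst p = x then basis_elt K (prs g) p else zero (Lam g))"
   using ga_mult_basis[OF _ p, of "(x, x)" 0] x sp between_refl
   by (auto simp: pairs_0 ee_self pair_mult_def ga_comp)
 qed (use basis_ga[OF p] in auto)
 also have "... = basis_elt K (prs g) p"
  by (rule L.cod.M.finsum_singleton) (use sp finite_X basis_ga[OF p] in auto)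
 finally show "ga_mult \<Lambda> 0 g (ga_one \<Lambda>) (basis_elt K (prs g) p) = basis_elt K (prs g) p" .
qed

lemma ga_neg: "g < 0 ==> carrier (Lam g) = {(zero (Lam g))}"
 by (auto simp: ga_comp pairs_neg free_mod_def sum_mod_simps)

text \<open>There are no pairs of negative degree, so two nonzero homogeneous elements have a
  product of degree 0 only if both have degree 0. Hence zero in degree 0 and everything elsewhere is
  an ideal. It contains the generators, and in positive degrees it is spanned by them.\<close>

lemma dist_ideal_eq:
 assumes g: "g \<in> G"
 shows "JX g = (if g = 0 then {(zero (Lam 0))} else carrier (Lam g))"
  and "graded_ideal K G \<Lambda> JX"
proof -
 define J where "J g = (if g = 0 then {(zero (Lam 0))} else carrier (Lam g))" for g :: real
 define T where "T g = (if g > 0 then basis_elt K (prs g) ` prs g else {})" for g :: real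
 have z: "ga_mult \<Lambda> g h a b = zero (Lam (g + h))"
  if "a \<in>. Lam g" "b \<in>. Lam h" "a = zero (Lam g) \<or> b = zero (Lam h)" for g h a b
  using that linear_map.zero[OF linear_mapI[OF module_ga module_ga ga_mult_linear_l[OF that(2), of g]]]
   linear_map.zero[OF linear_mapI[OF module_ga module_ga ga_mult_linear_r[OF that(1), of h]]] by auto
 have absorb: "ga_mult \<Lambda> g h a b \<in> J (g + h)"
  if "a \<in>. Lam g" "b \<in>. Lam h" "a \<in> J g \<or> b \<in> J h" for g h a b
 proof (cases "g + h = 0")
  case True
  \<comment> \<open>If the degrees are not both zero, one is negative, and the algebra vanishes
    there.\<close>
  have "g < 0 \<or> h < 0 \<or> g = 0 & h = 0" using True by linarith
  then have "a = zero (Lam g) \<or> b = zero (Lam h)"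
   using that ga_neg[of g] ga_neg[of h] by (auto simp: J_def)
  then show ?thesis using z[OF that(1,2)] True by (simp add: J_def)
 next
  case False
  then show ?thesis using ga_mult_closed[OF that(1,2)] by (simp add: J_def)
 qed
 have Jc: "J g \<subseteq> carrier (Lam g)" for g
  using abelian_monoid.zero_closed[OF abelian_group.axioms(1)[OF module.axioms(2)[OF module_ga[of 0]]]] by (simp add: J_def)
 have ideal: "graded_ideal K G \<Lambda> J"
  unfolding graded_ideal_def
 proof (intro conjI ballI)
  show "submodule (J g) K (Lam g)" for g
   using submodule_zero[OF module_ga[of 0]] module.carrier_is_submodule[OF module_ga] by (simp add: J_def)
 qed (use absorb Jc in blast)+
 have TJ: "T h \<subseteq> J h" for h using basis_ga by (auto simp: T_def J_def)
 have eq: "JX g = J g" if g: "g \<in> G" for g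
 proof
  show "JX g \<subseteq> J g"
   unfolding dist_ideal_def gen_graded_ideal_def T_def[abs_def, symmetric] using ideal TJ by blast
  have "J g \<subseteq> I g" if I: "graded_ideal K G \<Lambda> I" "\<forall>h\<in>G. T h \<subseteq> I h" for I
  proof -
   have sub: "submodule (I g) K (Lam g)" using I(1) g by (simp add: graded_ideal_def)
   then have 0: "zero (Lam g) \<in> I g" by (simp add: submodule_def subgroup_def)
   show ?thesis
   proof (cases "g > 0")
    case True
    have TI: "T g \<subseteq> I g" using I(2) g by blast
    \<comment> \<open>In positive degree every basis element is one of the generators of the
      ideal.\<close>
    have "carrier (free_mod K (prs g)) \<subseteq> I g"
     by (rule free_module.free_span[OF free_module_K]) (use sub TI True in "auto simp: T_def ga_comp")
    then show ?thesis using True by (simp add: J_def ga_comp)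
   next
    case False
    then show ?thesis using 0 ga_neg[of g] by (auto simp: J_def)
   qed
  qed
  then show "J g \<subseteq> JX g"
   unfolding dist_ideal_def gen_graded_ideal_def T_def[abs_def, symmetric] by blast
 qed
 show "JX g = (if g = 0 then {(zero (Lam 0))} else carrier (Lam g))"
  using eq[OF g] by (simp add: J_def)
 show "graded_ideal K G \<Lambda> JX"
  using ideal G_add unfolding graded_ideal_def by (simp add: eq)
qed

lemma free_module_pairs_eqI:
 assumes "Module.module K B" "K_linear K (Lam g) B F" "K_linear K (Lam g) B H"
  and "!!x y. x \<in> X ==> y \<in> X ==> fin x y ==> g = dr x y ==> F (ee x y) = H (ee x y)"
  and "a \<in>. Lam g"
 shows "F a = H a"
proof (rule free_module.free_linear_eqI[OF free_module_K assms(1), of "prs g"])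
 fix p assume "p \<in> prs g"
 then show "F (basis_elt K (prs g) p) = H (basis_elt K (prs g) p)"
  using assms(4)[of "fst p" "snd p"] by (auto simp: pairs_def)
qed (use assms in "simp_all add: ga_comp")

lemma ee_mult:
 assumes "x \<in> X" "y \<in> X" "fin x y" "y' \<in> X" "z \<in> X" "fin y' z"
 shows "ga_mult \<Lambda> (dr x y) (dr y' z) (ee x y) (ee y' z) =
   (if y = y' & between d x y z then basis_elt K (prs (dr x y + dr y' z)) (x, z)
   else zero (Lam (dr x y + dr y' z)))"
 unfolding ga_mult_basis[OF pairsI[OF assms(1-3)] pairsI[OF assms(4-6)]] pair_mult_def ga_comp by (simp only: fst_conv snd_conv)

lemma between_deg:
 assumes "fin x y" "fin y z" "between d x y z"
 shows "dr x y + dr y z = dr x z"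
proof -
 obtain a b where "0 <= a" "d x y = ennreal a" "0 <= b" "d y z = ennreal b"
  using assms by (cases "d x y"; cases "d y z") auto
 then show ?thesis using assms(3) unfolding between_def by (metis enn2real_ennreal ennreal_plus add_nonneg_nonneg)
qed

end

subsection \<open>The distance module of a right module\<close>

locale right_mod = dist_space K G X d
 for K :: "'k ring" and G :: "real set" and X :: "'x set" and d :: "'x => 'x => ennreal" +
 fixes P :: "('k, 'x \<times> 'x => 'k, 'p) graded_module"
 assumes right_graded: "right_graded_module K G (dist_algebra K X d) P"
begin

abbreviation "Pc \<equiv> gm_comp P"
abbreviation "act \<equiv> gm_act P"

lemma gm_module: "g \<in> G ==> Module.module K (Pc g)"
 and act_linear_l: "g \<in> G ==> h \<in> G ==> a \<in>. Lam h ==>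
  K_linear K (Pc g) (Pc (g + h)) (%m. act g h m a)"
 and act_linear_r: "g \<in> G ==> h \<in> G ==> p \<in>. Pc g ==>
  K_linear K (Lam h) (Pc (g + h)) (%a. act g h p a)"
 and act_one: "g \<in> G ==> p \<in>. Pc g ==> act g 0 p (ga_one \<Lambda>) = p"
 and act_assoc: "g \<in> G ==> h \<in> G ==> k \<in> G ==> p \<in>. Pc g ==>
  a \<in>. Lam h ==> b \<in>. Lam k ==>
  act (g + h) k (act g h p a) b = act g (h + k) p (ga_mult \<Lambda> h k a b)"
 using right_graded unfolding right_graded_module_def by simp_all

abbreviation A :: "'x => 'x => real => 'p => 'p" where
 "A x y g p \<equiv> act g (dr x y) p (ee x y)"

lemma A_linear: "x \<in> X ==> y \<in> X ==> fin x y ==> g \<in> G ==>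
  K_linear K (Pc g) (Pc (g + dr x y)) (A x y g)"
 by (intro act_linear_l basis_ga pairsI dist_G)

lemma A_linear_map: "x \<in> X ==> y \<in> X ==> fin x y ==> g \<in> G ==>
  linear_map K (Pc g) (Pc (g + dr x y)) (A x y g)"
 by (intro linear_mapI gm_module A_linear G_add dist_G)

lemma A_closed: "x \<in> X ==> y \<in> X ==> fin x y ==> g \<in> G ==> p \<in>. Pc g ==>
  A x y g p \<in>. Pc (g + dr x y)"
 using linear_map.closed[OF A_linear_map] .

lemma A_self_closed: "x \<in> X ==> g \<in> G ==> p \<in>. Pc g ==> A x x g p \<in>. Pc g"
 using A_closed[of x x g p] by (simp add: dist_self)

lemma A_comp:
 assumes "x \<in> X" "y \<in> X" "fin x y" "y' \<in> X" "z \<in> X" "fin y' z" and g: "g \<in> G" and p: "p \<in>. Pc g"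
 shows "A y' z (g + dr x y) (A x y g p) =
  (if y = y' & between d x y z then A x z g p else zero (Pc (g + dr x y + dr y' z)))"
proof -
 have G: "dr x y \<in> G" "dr y' z \<in> G" using assms dist_G by blast+
 have "A y' z (g + dr x y) (A x y g p) = act g (dr x y + dr y' z) p
   (ga_mult \<Lambda> (dr x y) (dr y' z) (ee x y) (ee y' z))"
  by (rule act_assoc) (use assms G in "auto intro!: basis_ga pairsI")
 also have "... = (if y = y' & between d x y z then A x z g p else zero (Pc (g + dr x y + dr y' z)))"
 proof (cases "y = y' & between d x y z")
  case True
  then have "dr x y + dr y' z = dr x z" using between_deg[OF assms(3), of z] assms(6) by blast
  then show ?thesis unfolding ee_mult[OF assms(1-6)] if_P[OF True] by (simp only:)
 next
  case False
  have "linear_map K (Lam (dr x y + dr y' z)) (Pc (g + (dr x y + dr y' z)))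
   (%a. act g (dr x y + dr y' z) p a)"
   by (intro linear_mapI module_ga gm_module act_linear_r G_add g G p)
  from linear_map.zero[OF this] show ?thesis using False ee_mult[OF assms(1-6)] by (auto simp: add.assoc)
 qed
 finally show ?thesis .
qed

text \<open>This is the action of the unit, which is the sum of the idempotents \<open>e_x\<close>
  because \<open>X\<close> is finite.\<close>

lemma unit_decomp:
 assumes g: "g \<in> G" and p: "p \<in>. Pc g"
 shows "(\<Oplus>\<^bsub>Pc g\<^esub>x\<in>X. A x x g p) = p"
proof -
 have "linear_map K (Lam 0) (Pc (g + 0)) (%a. act g 0 p a)"
  by (intro linear_mapI module_ga gm_module act_linear_r G_add G_0 g p)
 then interpret L: linear_map K "Lam 0" "Pc g" "%a. act g 0 p a" by simp
 have e: "ee x x \<in>. Lam 0" if "x \<in> X" for x using basis_ga[of "(x, x)" 0] that by (simp add: dist_self pairs_0)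
 have "p = act g 0 p (ga_one \<Lambda>)" using act_one[OF g p] by simp
 also have "... = (\<Oplus>\<^bsub>Pc g\<^esub>x\<in>X. act g 0 p (ee x x))"
  unfolding ga_one by (rule L.finsum) (use e in auto)
 also have "... = (\<Oplus>\<^bsub>Pc g\<^esub>x\<in>X. A x x g p)"
  by (rule L.cod.M.finsum_cong') (use A_self_closed[OF _ g p] in "auto simp: dist_self")
 finally show ?thesis by simp
qed

text \<open>\<open>P e_x\<close> is encoded as the set of fixed points of the idempotent
  \<open>e_x\<close>. Its elements and operations are those of \<open>P\<close>, so passing to a
  vertex changes the carrier only.\<close>

definition vtx :: "('x, 'k, 'p) dist_module" where
 "vtx = \<lparr>dm_comp = (%x g. Pc g\<lparr>carrier := {p \<in> carrier (Pc g). A x x g p = p}\<rparr>),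
   dm_map = (%x y g p. A x y g p)\<rparr>"

lemma vertex_simps:
 "carrier (dm_comp vtx x g) = {p \<in> carrier (Pc g). A x x g p = p}"
 "zero (dm_comp vtx x g) = zero (Pc g)"
 "p \<oplus>\<^bsub>dm_comp vtx x g\<^esub> q = p \<oplus>\<^bsub>Pc g\<^esub> q"
 "k \<odot>\<^bsub>dm_comp vtx x g\<^esub> p = k \<odot>\<^bsub>Pc g\<^esub> p"
 "dm_map vtx x y g p = A x y g p"
 by (simp_all add: vtx_def)

lemma vertex_submodule:
 assumes x: "x \<in> X" and g: "g \<in> G"
 shows "submodule {p \<in> carrier (Pc g). A x x g p = p} K (Pc g)"
proof -
 interpret L: linear_map K "Pc g" "Pc g" "A x x g"
  using A_linear_map[OF x x _ g] x by (simp add: dist_self)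
 show ?thesis by (rule L.dom.submoduleI') (auto simp: L.zero L.add L.smult)
qed

lemma A_vertex:
 assumes "x \<in> X" "y \<in> X" "fin x y" "g \<in> G" "p \<in>. Pc g"
 shows "A x y g p \<in>. dm_comp vtx y (g + dr x y)"
 using A_comp[OF assms(1-3) assms(2,2) _ assms(4,5)] A_closed[OF assms] between_refl[OF assms(1,2)] assms(2)
 by (simp add: vertex_simps dist_self)

lemma A_self_vertex:
 assumes "x \<in> X" "g \<in> G" "p \<in>. Pc g"
 shows "A x x g p \<in>. dm_comp vtx x g"
 using A_vertex[OF assms(1,1) _ assms(2,3)] assms(1) by (simp add: dist_self)

lemma A_other:
 assumes "x \<in> X" "y \<in> X" "z \<in> X" "fin y z" "x \<noteq> y" "g \<in> G" "p \<in>. dm_comp vtx x g"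
 shows "A y z g p = zero (Pc (g + dr y z))"
 using A_comp[OF assms(1,1) _ assms(2-4) assms(6), of p] assms by (simp add: vertex_simps dist_self)

lemma distance_module_vertex: "distance_module K G X d vtx"
 unfolding distance_module_def
proof (intro conjI ballI allI impI)
 fix x g assume x: "x \<in> X" and g: "g \<in> G"
 show "Module.module K (dm_comp vtx x g)"
  unfolding vtx_def dist_module.simps by (rule submodule_module[OF gm_module[OF g] vertex_submodule[OF x g]])
 fix m assume m: "m \<in>. dm_comp vtx x g"
 show "dm_map vtx x x g m = m" using m by (simp add: vertex_simps)
next
 fix x y g assume xy: "x \<in> X" "y \<in> X" "fin x y" and g: "g \<in> G"
 show "K_linear K (dm_comp vtx x g) (dm_comp vtx y (g + dr x y)) (dm_map vtx x y g)"
  using A_vertex[OF xy g] linear_map.add[OF A_linear_map[OF xy g]] linear_map.smult[OF A_linear_map[OF xy g]]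
  unfolding K_linear_def by (auto simp: vertex_simps)
next
 fix x y z g m assume x: "x \<in> X" "y \<in> X" "z \<in> X" and f: "fin x y & fin y z" and g: "g \<in> G"
  and m: "m \<in>. dm_comp vtx x g"
 show "dm_map vtx y z (g + dr x y) (dm_map vtx x y g m) =
   (if between d x y z then dm_map vtx x z g m
    else zero (dm_comp vtx z (g + dr x y + dr y z)))"
  using A_comp[OF x(1,2) _ x(2,3) _ g, of m] f m by (simp add: vertex_simps)
qed

sublocale V: dist_mod K G X d vtx
 by unfold_locales (rule distance_module_vertex)

lemma vertex_incl: "x \<in> X ==> g \<in> G ==> linear_map K (dm_comp vtx x g) (Pc g) (%p. p)"
 by (intro linear_mapI V.dm_module gm_module) (auto simp: K_linear_def vertex_simps)

text \<open>Elements of degree \<open>l\<close> correspond to \<open>0\<close>-chains of the distance module.\<close>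

definition total :: "real => ('x list => 'p) => 'p" where
 "total l c = (\<Oplus>\<^bsub>Pc l\<^esub>x\<in>X. c [x])"

definition spread :: "real => 'p => 'x list => 'p" where
 "spread l p = (\<lambda>xs\<in>tup 0. A (xs ! 0) (xs ! 0) l p)"

lemma MC_0_iff: "c \<in>. Ch vtx l 0 \<longleftrightarrow>
  c \<in> extensional (tup 0) & (\<forall>x\<in>X. c [x] \<in>. dm_comp vtx x l)"
 unfolding MC_def sum_mod_finite[OF finite_tuples] prod_mod_simps PiE_iff by (auto simp: tuples_0)

lemma total_linear:
 assumes l: "l \<in> G"
 shows "linear_map K (Ch vtx l 0) (Pc l) (total l)"
proof (rule linear_mapI[OF V.module_MC[OF l] gm_module[OF l]])
 have "K_linear K (Ch vtx l 0) (Pc l) (%c. c [x])" if x: "x \<in> X" for x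
 proof -
  have t: "[x] \<in> tup 0" using x by (simp add: tuples_0)
  have "K_linear K (Ch vtx l 0) (MCp vtx l [x]) (%c. c [x])"
   unfolding MC_def by (rule module_family.linear_sum_proj[OF V.MC_family[OF l] t])
  then show ?thesis using K_linear_comp[OF _ linear_map.linear[OF vertex_incl[OF x l]]] by simp
 qed
 then show "K_linear K (Ch vtx l 0) (Pc l) (total l)"
  unfolding total_def[abs_def] by (intro K_linear_finsum_map[OF V.module_MC[OF l] gm_module[OF l]])
qed

text \<open>Orthogonality of the idempotents: multiplication by a pair starting at \<open>x\<close>
  kills the components at the other vertices.\<close>

lemma A_total:
 assumes l: "l \<in> G" and c: "c \<in>. Ch vtx l 0" and x: "x \<in> X" "y \<in> X" "fin x y"
 shows "A x y l (total l c) = A x y l (c [x])"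
proof -
 interpret L: linear_map K "Pc l" "Pc (l + dr x y)" "A x y l" by (rule A_linear_map[OF x l])
 have cx: "c [z] \<in>. dm_comp vtx z l" "c [z] \<in>. Pc l" if "z \<in> X" for z
  using c that by (auto simp: MC_0_iff vertex_simps)
 have "A x y l (total l c) = (\<Oplus>\<^bsub>Pc (l + dr x y)\<^esub>z\<in>X. A x y l (c [z]))"
  unfolding total_def by (rule L.finsum) (use cx in auto)
 also have "... = (\<Oplus>\<^bsub>Pc (l + dr x y)\<^esub>z\<in>X. if x = z then A x y l (c [z]) else zero (Pc (l + dr x y)))"
  by (rule L.cod.M.finsum_cong') (use A_other[OF _ x _ l] cx L.closed in auto)
 also have "... = A x y l (c [x])"
  by (rule L.cod.M.finsum_singleton) (use x finite_X cx L.closed in auto)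
 finally show ?thesis .
qed

lemma spread_linear:
 assumes l: "l \<in> G" shows "linear_map K (Pc l) (Ch vtx l 0) (spread l)"
proof (rule linear_mapI[OF gm_module[OF l] V.module_MC[OF l]])
 have L: "linear_map K (Pc l) (Pc l) (A x x l)" if "x \<in> X" for x
  using A_linear_map[OF that that _ l] that by (simp add: dist_self)
 show "K_linear K (Pc l) (Ch vtx l 0) (spread l)"
  unfolding K_linear_def MC_def sum_mod_finite[OF finite_tuples] prod_mod_simps
  using A_self_vertex[OF _ l] linear_map.add[OF L] linear_map.smult[OF L]
  by (auto simp: spread_def tuples_0 vertex_simps intro!: restrict_ext)
qed

lemma total_spread: "l \<in> G ==> p \<in>. Pc l ==> total l (spread l p) = p"
proof -
 assume l: "l \<in> G" and p: "p \<in>. Pc l"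
 interpret M: Module.module K "Pc l" by (rule gm_module[OF l])
 have "total l (spread l p) = (\<Oplus>\<^bsub>Pc l\<^esub>x\<in>X. A x x l p)"
  unfolding total_def by (rule M.M.finsum_cong') (use A_self_closed[OF _ l p] in "auto simp: spread_def tuples_0")
 then show ?thesis using unit_decomp[OF l p] by simp
qed

lemma spread_total: "l \<in> G ==> c \<in>. Ch vtx l 0 ==> spread l (total l c) = c"
proof (rule extensional_eqI[of _ "tup 0"])
 assume l: "l \<in> G" and c: "c \<in>. Ch vtx l 0"
 show "c \<in> extensional (tup 0)" using c by (simp add: MC_0_iff)
 fix xs assume xs: "xs \<in> tup 0"
 then obtain x where x: "xs = [x]" "x \<in> X" by (auto simp: tuples_0)
 have "A x x l (total l c) = c [x]"
  using A_total[OF l c x(2,2)] c x by (simp add: dist_self MC_0_iff vertex_simps)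
 then show "spread l (total l c) xs = c xs" using xs x by (simp add: spread_def)
qed (simp add: spread_def)

end

subsection \<open>The right module of a distance module\<close>

lemma graded_hom_0:
 "graded_hom K G L 0 M N \<phi> \<longleftrightarrow>
   (\<forall>g\<in>G. K_linear K (gm_comp M g) (gm_comp N g) (\<phi> g)) &
   (\<forall>g\<in>G. \<forall>h\<in>G. \<forall>m\<in>carrier (gm_comp M g). \<forall>a\<in>carrier (ga_comp L h).
    \<phi> (g + h) (gm_act M g h m a) = gm_act N g h (\<phi> g m) a)"
 by (simp add: graded_hom_def)

lemma graded_hom_comp:
 assumes "graded_hom K G L 0 M N \<phi>" "graded_hom K G L 0 N N' \<psi>"
 shows "graded_hom K G L 0 M N' (%g m. \<psi> g (\<phi> g m))"
 using assms K_linear_closed[of K "gm_comp M g" "gm_comp N g" "\<phi> g" for g]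
 unfolding graded_hom_0 by (auto intro: K_linear_comp)

text \<open>Both sides of the compatibility are linear in the algebra element, and the pairs span
  the algebra; so the action of pairs is all that has to be compared.\<close>

lemma (in dist_space) graded_homI:
 assumes M: "right_mod K G X d M" and N: "right_mod K G X d N"
  and lin: "!!g. g \<in> G ==> K_linear K (gm_comp M g) (gm_comp N g) (\<phi> g)"
  and act: "!!g x y m. g \<in> G ==> x \<in> X ==> y \<in> X ==> fin x y ==> m \<in>. gm_comp M g ==>
   \<phi> (g + dr x y) (gm_act M g (dr x y) m (ee x y)) = gm_act N g (dr x y) (\<phi> g m) (ee x y)"
 shows "hom0 M N \<phi>"
 unfolding graded_hom_0
proof (intro conjI ballI)
 interpret M: right_mod K G X d M by fact
 interpret N: right_mod K G X d N by fact
 fix g h m a assume g: "g \<in> G" and h: "h \<in> G" and m: "m \<in>. gm_comp M g" and a: "a \<in>. Lam h"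
 have gh: "g + h \<in> G" by (intro G_add g h)
 show "\<phi> (g + h) (gm_act M g h m a) = gm_act N g h (\<phi> g m) a"
 proof (rule free_module_pairs_eqI[OF N.gm_module[OF gh] _ _ _ a])
  show "K_linear K (Lam h) (gm_comp N (g + h)) (%a. \<phi> (g + h) (gm_act M g h m a))"
   by (rule K_linear_comp[OF M.act_linear_r[OF g h m] lin[OF gh]])
  show "K_linear K (Lam h) (gm_comp N (g + h)) (%a. gm_act N g h (\<phi> g m) a)"
   by (rule N.act_linear_r[OF g h K_linear_closed[OF lin[OF g] m]])
 qed (use act g m in simp)
qed (rule lin)

section \<open>The action of the distance algebra on the sum of all components\<close>

context dist_mod
begin

abbreviation bar :: "('k, 'x \<times> 'x => 'k, 'x => 'm) graded_module" where
 "bar \<equiv> bar_module K X d M"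

lemma bar_family: "g \<in> G ==> module_family K X (%x. Mc x g)"
 by (simp add: module_family_def cring_K dm_module)

lemma bar_comp: "gm_comp bar g = sum_mod X (%x. Mc x g)"
 by (simp add: bar_module_def)

lemma bar_carrier: "carrier (gm_comp bar g) = (\<Pi>\<^sub>E x\<in>X. carrier (Mc x g))"
 by (simp add: bar_comp sum_mod_finite finite_X prod_mod_simps)

lemma bar_module: "g \<in> G ==> Module.module K (gm_comp bar g)"
 unfolding bar_comp by (rule module_family.module_sum[OF bar_family])

abbreviation inj :: "real => 'x => 'm => 'x => 'm" where
 "inj g \<equiv> sum_incl X (%x. Mc x g)"

lemma inj_linear: "g \<in> G ==> x \<in> X ==> linear_map K (Mc x g) (gm_comp bar g) (inj g x)"
 unfolding bar_comp by (rule module_family.linear_map_incl[OF bar_family])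

lemma bar_proj: "g \<in> G ==> x \<in> X ==> linear_map K (gm_comp bar g) (Mc x g) (%c. c x)"
 unfolding bar_comp by (rule module_family.linear_map_sum_proj[OF bar_family])

lemma inj_nth: "x \<in> X ==> y \<in> X ==> inj g x m y = (if y = x then m else zero (Mc y g))"
 by (simp add: sum_incl_def)

lemma bar_term_linear:
 assumes g: "g \<in> G" and p: "(x, y) \<in> prs h"
 shows "K_linear K (gm_comp bar g) (gm_comp bar (g + h)) (%m. inj (g + h) y (Mm x y g (m x)))"
proof -
 have xy: "x \<in> X" "y \<in> X" "fin x y" and h: "h = dr x y" using p by (auto simp: pairs_def)
 have "g + h \<in> G" unfolding h by (intro G_add g dist_G xy)
 then show ?thesis
  using K_linear_comp[OF linear_map.linear[OF bar_proj[OF g xy(1)]]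
    K_linear_comp[OF dm_linear[OF xy g] linear_map.linear[OF inj_linear[OF _ xy(2)]]]] h by simp
qed

lemma bar_act: "gm_act bar g h m a = lin_ext K (prs h) (gm_comp bar (g + h))
  (%p. inj (g + h) (snd p) (Mm (fst p) (snd p) g (m (fst p)))) a"
 by (simp add: bar_module_def case_prod_unfold)

lemma bar_act_linear_r:
 assumes g: "g \<in> G" and h: "h \<in> G" and m: "m \<in>. gm_comp bar g"
 shows "K_linear K (Lam h) (gm_comp bar (g + h)) (%a. gm_act bar g h m a)"
 unfolding bar_act ga_comp
 by (rule free_module.linear_lin_ext[OF free_module_K bar_module])
  (use K_linear_closed[OF bar_term_linear[OF g] m] G_add g h in auto)

lemma bar_act_linear_l:
 assumes g: "g \<in> G" and h: "h \<in> G" and a: "a \<in>. Lam h"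
 shows "K_linear K (gm_comp bar g) (gm_comp bar (g + h)) (%m. gm_act bar g h m a)"
 unfolding bar_act
 by (rule free_module.linear_lin_ext_param[OF free_module_K bar_module bar_module])
  (use bar_term_linear[OF g] G_add g h a in "auto simp: ga_comp")

lemma bar_act_basis:
 assumes g: "g \<in> G" and m: "m \<in>. gm_comp bar g" and p: "(x, y) \<in> prs h" and h: "h \<in> G"
 shows "gm_act bar g h m (basis_elt K (prs h) (x, y)) = inj (g + h) y (Mm x y g (m x))"
proof -
 have "gm_act bar g h m (basis_elt K (prs h) (x, y)) =
   inj (g + h) (snd (x, y)) (Mm (fst (x, y)) (snd (x, y)) g (m (fst (x, y))))"
  unfolding bar_act
  by (rule free_module.lin_ext_basis[OF free_module_K bar_module[OF G_add[OF g h]] _ p])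
   (use K_linear_closed[OF bar_term_linear[OF g] m] in auto)
 then show ?thesis by simp
qed

lemma bar_act_ee:
 "g \<in> G ==> m \<in>. gm_comp bar g ==> x \<in> X ==> y \<in> X ==> fin x y ==>
  gm_act bar g (dr x y) m (ee x y) = inj (g + dr x y) y (Mm x y g (m x))"
 by (rule bar_act_basis) (auto intro: pairsI dist_G)

lemma bar_act_closed:
 "g \<in> G ==> h \<in> G ==> m \<in>. gm_comp bar g ==> a \<in>. Lam h ==>
  gm_act bar g h m a \<in>. gm_comp bar (g + h)"
 using K_linear_closed[OF bar_act_linear_r] .

lemma bar_act_one:
 assumes g: "g \<in> G" and m: "m \<in>. gm_comp bar g"
 shows "gm_act bar g 0 m (ga_one \<Lambda>) = m"
proof -
 interpret L: linear_map K "Lam 0" "gm_comp bar g" "%a. gm_act bar g 0 m a"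
  using bar_act_linear_r[OF g G_0 m] by (intro linear_mapI module_ga bar_module g) simp
 have e: "ee x x \<in>. Lam 0" if "x \<in> X" for x using basis_ga[of "(x, x)" 0] that by (simp add: dist_self pairs_0)
 have mx: "m x \<in>. Mc x g" if "x \<in> X" for x using m that unfolding bar_carrier by auto
 have "gm_act bar g 0 m (ga_one \<Lambda>) = (\<Oplus>\<^bsub>gm_comp bar g\<^esub>x\<in>X. gm_act bar g 0 m (ee x x))"
  unfolding ga_one by (rule L.finsum) (use e in auto)
 also have "... = (\<Oplus>\<^bsub>gm_comp bar g\<^esub>x\<in>X. inj g x (m x))"
 proof (rule L.cod.M.finsum_cong')
  fix x assume x: "x \<in> X"
  show "gm_act bar g 0 m (ee x x) = inj g x (m x)"
   using bar_act_ee[OF g m x x] dm_id[OF x g mx[OF x]] x by (simp add: dist_self)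
 qed (use linear_map.closed[OF inj_linear[OF g]] mx in auto)
 also have "... = m"
  unfolding bar_comp by (rule module_family.sum_decomp_finite[OF bar_family[OF g] finite_X]) (use m in "simp add: bar_comp")
 finally show ?thesis .
qed

text \<open>If the inner points differ, the left side is zero since the first factor moves
  everything into the summand at \<open>y\<close>, and the right side since the product of the pairs
  is zero. If they agree, this is the composition law of the distance module.\<close>

lemma bar_act_assoc_basis:
 assumes g: "g \<in> G" and h: "h \<in> G" and k: "k \<in> G" and m: "m \<in>. gm_comp bar g"
  and p: "p \<in> prs h" and q: "q \<in> prs k"
 shows "gm_act bar (g + h) k (gm_act bar g h m (basis_elt K (prs h) p)) (basis_elt K (prs k) q) =
  gm_act bar g (h + k) m (ga_mult \<Lambda> h k (basis_elt K (prs h) p) (basis_elt K (prs k) q))"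
proof -
 obtain x y where pe: "p = (x, y)" by force
 obtain y' z where qe: "q = (y', z)" by force
 have xy: "x \<in> X" "y \<in> X" "fin x y" "h = dr x y" using p pe by (auto simp: pairs_def)
 have yz: "y' \<in> X" "z \<in> X" "fin y' z" "k = dr y' z" using q qe by (auto simp: pairs_def)
 have gh: "g + h \<in> G" "h + k \<in> G" "g + h + k \<in> G" using g h k by (simp_all add: G_add)
 have mx: "m x \<in>. Mc x g" using m xy unfolding bar_carrier by auto
 have mp: "gm_act bar g h m (basis_elt K (prs h) p) = inj (g + h) y (Mm x y g (m x))"
  unfolding pe by (rule bar_act_basis[OF g m p[unfolded pe] h])
 have mc: "inj (g + h) y (Mm x y g (m x)) \<in>. gm_comp bar (g + h)"
  using bar_act_closed[OF g h m basis_ga[OF p]] unfolding mp .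
 have L: "gm_act bar (g + h) k (gm_act bar g h m (basis_elt K (prs h) p)) (basis_elt K (prs k) q) =
   inj (g + h + k) z (Mm y' z (g + h) (inj (g + h) y (Mm x y g (m x)) y'))"
  unfolding mp qe by (rule bar_act_basis[OF gh(1) mc q[unfolded qe] k])
 have z: "inj (g + h + k) z (zero (Mc z (g + h + k))) = zero (gm_comp bar (g + h + k))"
  using linear_map.zero[OF inj_linear[OF gh(3) yz(2)]] .
 have z': "gm_act bar g (h + k) m (zero (Lam (h + k))) = zero (gm_comp bar (g + h + k))"
  using linear_map.zero[OF linear_mapI[OF module_ga bar_module[OF G_add[OF g gh(2)]] bar_act_linear_r[OF g gh(2) m]]]
  by (simp add: add.assoc)
 have R: "ga_mult \<Lambda> h k (basis_elt K (prs h) p) (basis_elt K (prs k) q) =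
   (if y = y' & between d x y z then basis_elt K (prs (h + k)) (x, z) else zero (Lam (h + k)))"
  using ga_mult_basis[OF p q] unfolding pe qe pair_mult_def ga_comp fst_conv snd_conv .
 show ?thesis
 proof (cases "y = y'")
  case False
  then have "inj (g + h) y (Mm x y g (m x)) y' = zero (Mc y' (g + h))"
   using xy yz by (simp add: inj_nth)
  then have "Mm y' z (g + h) (inj (g + h) y (Mm x y g (m x)) y') = zero (Mc z (g + h + k))"
   using linear_map.zero[OF dm_linear_map[OF yz(1-3) gh(1)]] yz(4) by simp
  then show ?thesis using L R z z' False by simp
 next
  case True
  then have 1: "inj (g + h) y (Mm x y g (m x)) y' = Mm x y g (m x)"
   using xy yz by (simp add: inj_nth)
  have 2: "Mm y z (g + h) (Mm x y g (m x)) =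
    (if between d x y z then Mm x z g (m x) else zero (Mc z (g + h + k)))"
   using dm_comp_map[OF xy(1,2) yz(2) xy(3) _ g mx] yz True by (simp add: xy(4))
  show ?thesis
  proof (cases "between d x y z")
   case b: True
   have "(x, z) \<in> prs (h + k)"
    using between_deg[OF xy(3) _ b] yz True xy dist_finite_trans[OF xy(1,2) yz(2) xy(3)] by (simp add: pairs_def)
   then have "gm_act bar g (h + k) m (basis_elt K (prs (h + k)) (x, z)) = inj (g + (h + k)) z (Mm x z g (m x))"
    by (rule bar_act_basis[OF g m _ gh(2)])
   then show ?thesis using L R 1 2 True b by (simp add: add.assoc)
  next
   case False
   then show ?thesis using L R 1 2 z z' True by simp
  qed
 qed
qed

lemma right_graded_bar: "right_graded_module K G \<Lambda> bar"
 unfolding right_graded_module_def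
proof (intro conjI ballI)
 fix g h k m a b assume g: "g \<in> G" and h: "h \<in> G" and k: "k \<in> G" and m: "m \<in>. gm_comp bar g"
  and a: "a \<in>. Lam h" and b: "b \<in>. Lam k"
 have gh: "g + h \<in> G" "h + k \<in> G" "g + h + k \<in> G" using g h k by (simp_all add: G_add)
 have M: "Module.module K (gm_comp bar (g + h + k))" by (rule bar_module[OF gh(3)])
 have r: "K_linear K (Lam (h + k)) (gm_comp bar (g + h + k)) (%a. gm_act bar g (h + k) m a)"
  using bar_act_linear_r[OF g gh(2) m] by (simp add: add.assoc)
 show "gm_act bar (g + h) k (gm_act bar g h m a) b = gm_act bar g (h + k) m (ga_mult \<Lambda> h k a b)"
 proof (rule free_module.free_linear_eqI[OF free_module_K M _ _ _ a[unfolded ga_comp]])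
  show "K_linear K (free_mod K (prs h)) (gm_comp bar (g + h + k)) (%a. gm_act bar (g + h) k (gm_act bar g h m a) b)"
   using K_linear_comp[OF bar_act_linear_r[OF g h m] bar_act_linear_l[OF gh(1) k b]] unfolding ga_comp .
  show "K_linear K (free_mod K (prs h)) (gm_comp bar (g + h + k)) (%a. gm_act bar g (h + k) m (ga_mult \<Lambda> h k a b))"
   using K_linear_comp[OF ga_mult_linear_l[OF b] r] unfolding ga_comp .
  fix p assume p: "p \<in> prs h"
  let ?p = "basis_elt K (prs h) p"
  show "gm_act bar (g + h) k (gm_act bar g h m ?p) b = gm_act bar g (h + k) m (ga_mult \<Lambda> h k ?p b)"
  proof (rule free_module.free_linear_eqI[OF free_module_K M _ _ _ b[unfolded ga_comp]])
   show "K_linear K (free_mod K (prs k)) (gm_comp bar (g + h + k)) (%b. gm_act bar (g + h) k (gm_act bar g h m ?p) b)"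
    using bar_act_linear_r[OF gh(1) k bar_act_closed[OF g h m basis_ga[OF p]]] unfolding ga_comp .
   show "K_linear K (free_mod K (prs k)) (gm_comp bar (g + h + k)) (%b. gm_act bar g (h + k) m (ga_mult \<Lambda> h k ?p b))"
    using K_linear_comp[OF ga_mult_linear_r[OF basis_ga[OF p]] r] unfolding ga_comp .
  qed (rule bar_act_assoc_basis[OF g h k m p])
 qed
qed (use bar_module bar_act_linear_l bar_act_linear_r bar_act_one in blast)+

lemma right_mod_bar: "right_mod K G X d bar"
 by (intro right_mod.intro right_mod_axioms.intro right_graded_bar) (rule dist_space_axioms)

end

lemma (in dist_hom) bar_hom:
 "graded_hom K G M.\<Lambda> 0 M.bar N.bar (%g c. \<lambda>x\<in>X. f x g (c x))"
proof (rule M.graded_homI[OF M.right_mod_bar N.right_mod_bar])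
 fix g assume g: "g \<in> G"
 note lin = f_linear_map[OF _ g]
 show "K_linear K (gm_comp M.bar g) (gm_comp N.bar g) (%c. \<lambda>x\<in>X. f x g (c x))"
  unfolding K_linear_def M.bar_comp N.bar_comp sum_mod_finite[OF M.finite_X] prod_mod_simps
  using linear_map.closed[OF lin] linear_map.add[OF lin] linear_map.smult[OF lin]
  by (auto simp: PiE_mem[of _ X "%x. carrier (dm_comp M x g)"] intro!: restrict_ext)
 fix x y m assume xy: "x \<in> X" "y \<in> X" "d x y < \<infinity>" and m: "m \<in>. gm_comp M.bar g"
 have gd: "g + enn2real (d x y) \<in> G" by (intro M.G_add g M.dist_G xy)
 have mx: "m x \<in>. dm_comp M x g" using m xy unfolding M.bar_carrier by auto
 have fm: "(\<lambda>x\<in>X. f x g (m x)) \<in>. gm_comp N.bar g"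
  using m linear_map.closed[OF lin] unfolding M.bar_carrier N.bar_carrier by auto
 show "(\<lambda>z\<in>X. f z (g + enn2real (d x y)) (gm_act M.bar g (enn2real (d x y)) m (M.ee x y) z)) =
   gm_act N.bar g (enn2real (d x y)) (\<lambda>x\<in>X. f x g (m x)) (M.ee x y)"
  unfolding M.bar_act_ee[OF g m xy] N.bar_act_ee[OF g fm xy]
  using f_map[OF xy g mx] linear_map.zero[OF f_linear_map[OF _ gd]] xy
  by (auto simp: sum_incl_def intro!: restrict_ext)
qed

context right_mod
begin

lemma bar_total:
 assumes g: "g \<in> G" and c: "c \<in>. gm_comp V.bar g" and xy: "x \<in> X" "y \<in> X" "fin x y"
 shows "A x y g (\<Oplus>\<^bsub>Pc g\<^esub>z\<in>X. c z) = A x y g (c x)"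
proof -
 let ?c = "\<lambda>xs\<in>tup 0. c (xs ! 0)"
 interpret M: Module.module K "Pc g" by (rule gm_module[OF g])
 have cz: "c z \<in>. dm_comp vtx z g" if "z \<in> X" for z using c that unfolding V.bar_carrier by auto
 then have c': "?c \<in>. Ch vtx g 0" by (auto simp: MC_0_iff tuples_0)
 have "total g ?c = (\<Oplus>\<^bsub>Pc g\<^esub>z\<in>X. c z)"
  unfolding total_def by (rule M.M.finsum_cong') (use cz in "auto simp: tuples_0 vertex_simps")
 then show ?thesis using A_total[OF g c' xy] xy by (simp add: tuples_0)
qed

text \<open>With \<open>mod_to_bar\<close> these are the two comparison maps between
  \<open>P\<close> and the sum of its vertex components; lifting problems for \<open>P\<close> are
  translated along them.\<close>

lemma bar_to_mod: "hom0 V.bar P (%g c. \<Oplus>\<^bsub>Pc g\<^esub>x\<in>X. c x)"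
proof (rule graded_homI[OF V.right_mod_bar right_mod_axioms])
 fix g assume g: "g \<in> G"
 show "K_linear K (gm_comp V.bar g) (Pc g) (%c. \<Oplus>\<^bsub>Pc g\<^esub>x\<in>X. c x)"
  by (rule K_linear_finsum_map[OF V.bar_module[OF g] gm_module[OF g]])
   (rule K_linear_comp[OF linear_map.linear[OF V.bar_proj[OF g]] linear_map.linear[OF vertex_incl[OF _ g]]])
 fix x y c assume xy: "x \<in> X" "y \<in> X" "fin x y" and c: "c \<in>. gm_comp V.bar g"
 have gd: "g + dr x y \<in> G" by (intro G_add g dist_G xy)
 interpret M: Module.module K "Pc (g + dr x y)" by (rule gm_module[OF gd])
 have cx: "c x \<in>. Pc g" using c xy unfolding V.bar_carrier by (auto simp: vertex_simps)
 have "(\<Oplus>\<^bsub>Pc (g + dr x y)\<^esub>z\<in>X. V.inj (g + dr x y) y (A x y g (c x)) z) =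
   (\<Oplus>\<^bsub>Pc (g + dr x y)\<^esub>z\<in>X. if y = z then A x y g (c x) else zero (Pc (g + dr x y)))"
  by (rule M.M.finsum_cong') (use A_closed[OF xy g cx] xy in "auto simp: V.inj_nth vertex_simps")
 also have "... = A x y g (c x)"
  by (rule M.M.finsum_singleton) (use A_closed[OF xy g cx] xy finite_X in auto)
 finally show "(\<Oplus>\<^bsub>Pc (g + dr x y)\<^esub>z\<in>X. gm_act V.bar g (dr x y) c (ee x y) z) =
   A x y g (\<Oplus>\<^bsub>Pc g\<^esub>x\<in>X. c x)"
  unfolding V.bar_act_ee[OF g c xy] bar_total[OF g c xy] by (simp add: vertex_simps)
qed

lemma mod_to_bar: "hom0 P V.bar (%g p. \<lambda>x\<in>X. A x x g p)"
proof (rule graded_homI[OF right_mod_axioms V.right_mod_bar])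
 have cl: "(\<lambda>x\<in>X. A x x g p) \<in>. gm_comp V.bar g" if "g \<in> G" "p \<in>. Pc g" for g p
  unfolding V.bar_carrier using A_self_vertex that by auto
 fix g assume g: "g \<in> G"
 have L: "linear_map K (Pc g) (Pc g) (A x x g)" if "x \<in> X" for x
  using A_linear_map[OF that that _ g] that by (simp add: dist_self)
 show "K_linear K (Pc g) (gm_comp V.bar g) (%p. \<lambda>x\<in>X. A x x g p)"
  unfolding K_linear_def
  using cl[OF g] linear_map.add[OF L] linear_map.smult[OF L]
  by (auto simp: V.bar_comp sum_mod_simps vertex_simps intro!: restrict_ext)
 fix x y p assume xy: "x \<in> X" "y \<in> X" "fin x y" and p: "p \<in>. Pc g"
 have "A z z (g + dr x y) (A x y g p) = V.inj (g + dr x y) y (A x y g (A x x g p)) z" if z: "z \<in> X" for z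
  using A_comp[OF xy z z _ g p] A_comp[OF xy(1,1) _ xy(1,2,3) g p] xy z between_refl by (auto simp: V.inj_nth vertex_simps dist_self)
 then show "(\<lambda>z\<in>X. A z z (g + dr x y) (A x y g p)) = gm_act V.bar g (dr x y) (\<lambda>x\<in>X. A x x g p) (ee x y)"
  unfolding V.bar_act_ee[OF g cl[OF g p] xy] using xy
  by (intro extensional_eqI[of _ X]) (auto simp: vertex_simps sum_incl_def)
qed

text \<open>An element of \<open>P e_x\<close> is killed by the other idempotents, so it occupies
  the summand at \<open>x\<close> only.\<close>

lemma mod_to_bar_vertex:
 assumes x: "x \<in> X" and g: "g \<in> G" and p: "p \<in>. dm_comp vtx x g"
 shows "(\<lambda>z\<in>X. A z z g p) = V.inj g x p"
proof -
 have "A z z g p = zero (Pc g)" if "z \<in> X" "z \<noteq> x" for z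
  using A_other[OF x that(1,1) _ _ g p] that by (simp add: dist_self)
 then show ?thesis using p by (auto simp: sum_incl_def vertex_simps intro!: restrict_ext)
qed

lemma vertex_hom:
 assumes Q: "right_mod K G X d Q" and \<phi>: "hom0 P Q \<phi>"
 shows "dist_hom K G X d vtx (right_mod.vtx K X d Q) (%x g. \<phi> g)"
proof -
 interpret Q: right_mod K G X d Q by fact
 have lin: "K_linear K (Pc g) (gm_comp Q g) (\<phi> g)" if "g \<in> G" for g
  using \<phi> that by (simp add: graded_hom_0)
 have act: "\<phi> (g + dr x y) (A x y g p) = Q.A x y g (\<phi> g p)"
  if "x \<in> X" "y \<in> X" "fin x y" "g \<in> G" "p \<in>. Pc g" for x y g p
  using \<phi> that dist_G[OF that(1-3)] basis_ga[OF pairsI[OF that(1-3)]] unfolding graded_hom_0 by blast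
 show ?thesis
 proof (intro dist_hom.intro dist_hom_axioms.intro)
  fix x g assume x: "x \<in> X" and g: "g \<in> G"
  have "Q.A x x g (\<phi> g p) = \<phi> g p" if "p \<in>. Pc g" "A x x g p = p" for p
   using act[OF x x _ g that(1)] that(2) x by (simp add: dist_self)
  then show "K_linear K (dm_comp vtx x g) (dm_comp Q.vtx x g) (\<phi> g)"
   using lin[OF g] unfolding K_linear_def by (auto simp: vertex_simps Q.vertex_simps)
 qed (simp_all add: V.dist_mod_axioms Q.V.dist_mod_axioms vertex_simps Q.vertex_simps act)
qed

end

subsection \<open>Induced and coinduced distance modules\<close>

text \<open>Either side says that the path through all four points is no longer than the distance of
  its ends: \<open>keep_keep_commute\<close> for a tuple of four points.\<close>

lemma (in dist_space) between_quad:
 assumes "x \<in> X" "y \<in> X" "z \<in> X" "w \<in> X" "fin x y" "fin y z" "fin z w"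
 shows "between d y z w & between d x y w \<longleftrightarrow> between d x y z & between d x z w"
proof -
 have fin: "fin x z" "fin y w"
  using dist_finite_trans[OF assms(1-3,5,6)] dist_finite_trans[OF assms(2-4,6,7)] by auto
 have "keep 2 [x, y, z, w] \<longleftrightarrow> between d y z w" "keep 1 [x, y, z, w] \<longleftrightarrow> between d x y z"
  using keep_inner[of "[x, y, z, w]" 2] keep_inner[of "[x, y, z, w]" 1] assms
  by (simp_all add: ennreal_add_less_top numeral_2_eq_2)
 moreover have "keep 1 (omit 2 [x, y, z, w]) \<longleftrightarrow> between d x y w" "keep 1 (omit 1 [x, y, z, w]) \<longleftrightarrow> between d x z w"
  using keep_inner[of "[x, y, w]" 1] keep_inner[of "[x, z, w]" 1] assms fin
  by (simp_all add: ennreal_add_less_top numeral_2_eq_2)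
 ultimately show ?thesis using keep_keep_commute[of "[x, y, z, w]" 1 2] assms by auto
qed

context dist_mod
begin

text \<open>At \<open>x\<close> this is the sum over \<open>y\<close> of
  \<open>M(y) \<otimes> (y, x)\<close>: the module induced from the components of \<open>M\<close>,
  forgetting the action on them. As \<open>X\<close> is finite, the product serves as direct
  sum.\<close>

definition ind_mod :: "('x, 'k, 'x => 'm) dist_module" where
 "ind_mod = \<lparr>dm_comp = (%x g. prod_mod (In x) (%y. Mc y (g - dr y x))),
   dm_map = (%x z g f. \<lambda>y\<in>In z. if fin y x & between d y x z then f y
    else zero (Mc y (g + dr x z - dr y z)))\<rparr>"

text \<open>A family at \<open>x\<close> assigns to each pair \<open>(x, y)\<close> a value in
  \<open>M(y)\<close>: the coinduced module. Acting with \<open>(x, z)\<close> and then evaluating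
  at \<open>(z, y)\<close> means evaluating at the product of the two pairs.\<close>

definition coind_mod :: "('x, 'k, 'x => 'm) dist_module" where
 "coind_mod = \<lparr>dm_comp = (%x g. prod_mod (Out x) (%y. Mc y (g + dr x y))),
   dm_map = (%x z g f. \<lambda>y\<in>Out z. if between d x z y then f y
    else zero (Mc y (g + dr x z + dr z y)))\<rparr>"

lemma ind_family: "x \<in> X ==> g \<in> G ==> module_family K (In x) (%y. Mc y (g - dr y x))"
 by (auto simp: module_family_def cring_K intro!: dm_module G_diff dist_G)

lemma coind_family: "x \<in> X ==> g \<in> G ==> module_family K (Out x) (%y. Mc y (g + dr x y))"
 by (auto simp: module_family_def cring_K intro!: dm_module G_add dist_G)

lemma K_linear_prod_modI:
 assumes "!!i. i \<in> I ==> K_linear K B (A i) (%b. f b i)" "!!b. f b \<in> extensional I"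
 shows "K_linear K B (prod_mod I A) f"
 unfolding K_linear_def
proof (intro conjI ballI funcsetI)
 fix b assume b: "b \<in>. B"
 show "f b \<in>. prod_mod I A"
  using assms(2) K_linear_closed[OF assms(1) b] by (simp add: prod_mod_simps PiE_iff)
 fix c assume c: "c \<in>. B"
 show "f (b \<oplus>\<^bsub>B\<^esub> c) = f b \<oplus>\<^bsub>prod_mod I A\<^esub> f c"
  by (rule extensional_eqI[OF assms(2)]) (use assms(1) b c in "auto simp: K_linear_def prod_mod_simps")
next
 fix k b assume "k \<in>. K" "b \<in>. B"
 then show "f (k \<odot>\<^bsub>B\<^esub> b) = k \<odot>\<^bsub>prod_mod I A\<^esub> f b"
  by (intro extensional_eqI[OF assms(2)]) (use assms(1) in "auto simp: K_linear_def prod_mod_simps")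
qed

text \<open>The composition law is associativity of the product of pairs, in the form of
  \<open>between_quad\<close>. The degrees of the zero elements on the two sides agree only by
  additivity of distances along a geodesic.\<close>

lemma distance_module_ind: "distance_module K G X d ind_mod"
 unfolding distance_module_def
proof (intro conjI ballI allI impI)
 fix x g assume x: "x \<in> X" and g: "g \<in> G"
 show "Module.module K (dm_comp ind_mod x g)"
  unfolding ind_mod_def dist_module.simps by (rule module_family.module_prod[OF ind_family[OF x g]])
 fix m assume m: "m \<in>. dm_comp ind_mod x g"
 have ext: "m \<in> extensional (In x)" using m by (auto simp: ind_mod_def prod_mod_simps PiE_iff)
 show "dm_map ind_mod x x g m = m"
  by (rule extensional_eqI[OF _ ext]) (auto simp: ind_mod_def x between_refl)
next
 fix x z g assume x: "x \<in> X" "z \<in> X" "fin x z" and g: "g \<in> G"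
 have gz: "g + dr x z \<in> G" by (intro G_add g dist_G x)
 show "K_linear K (dm_comp ind_mod x g) (dm_comp ind_mod z (g + dr x z)) (dm_map ind_mod x z g)"
  unfolding ind_mod_def dist_module.simps
 proof (rule K_linear_prod_modI)
  fix y assume y: "y \<in> In z"
  let ?I = "In x" and ?A = "%y. Mc y (g - dr y x)"
  show "K_linear K (prod_mod ?I ?A) (Mc y (g + dr x z - dr y z))
    (%f. (\<lambda>y\<in>In z. if fin y x & between d y x z then f y
     else zero (Mc y (g + dr x z - dr y z))) y)"
  proof (cases "fin y x & between d y x z")
   case True
   then have yI: "y \<in> ?I" using y by auto
   have e: "g - dr y x = g + dr x z - dr y z"
    using between_deg[of y x z] True x by simp
   have "K_linear K (prod_mod ?I ?A) (Mc y (g - dr y x)) (%f. f y)"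
    by (rule module_family.linear_prod_proj[OF ind_family[OF x(1) g] yI])
   then show ?thesis unfolding e using y True by simp
  next
   case False
   then show ?thesis
    using K_linear_zero_map[OF module_family.fam[OF ind_family[OF x(2) gz] y], of "prod_mod ?I ?A"] y by auto
  qed
 qed simp
next
 fix x z w g f assume xz: "x \<in> X" "z \<in> X" "w \<in> X" and fin: "fin x z & fin z w" and g: "g \<in> G"
 let ?g = "g + dr x z"
 show "dm_map ind_mod z w ?g (dm_map ind_mod x z g f) =
   (if between d x z w then dm_map ind_mod x w g f else zero (dm_comp ind_mod w (?g + dr z w)))"
 proof (rule extensional_eqI[of _ "In w"])
  fix y assume y: "y \<in> In w"
  have 1: "dm_map ind_mod z w ?g (dm_map ind_mod x z g f) y =
   (if fin y z & between d y z w & fin y x & between d y x z then f y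
    else zero (Mc y (?g + dr z w - dr y w)))"
  proof -
   have "Mc y (?g - dr y z) = Mc y (?g + dr z w - dr y w)"
    if "fin y z" "between d y z w"
    by (rule arg_cong[where f = "Mc y"]) (use between_deg[OF that(1) _ that(2)] fin in simp)
   then show ?thesis using y by (auto simp: ind_mod_def)
  qed
  have 2: "(if between d x z w then dm_map ind_mod x w g f else zero (dm_comp ind_mod w (?g + dr z w))) y =
   (if between d x z w & fin y x & between d y x w then f y
    else zero (Mc y (?g + dr z w - dr y w)))"
   using y between_deg[of x z w] fin by (auto simp: ind_mod_def prod_mod_simps add.assoc)
  show "dm_map ind_mod z w ?g (dm_map ind_mod x z g f) y =
   (if between d x z w then dm_map ind_mod x w g f else zero (dm_comp ind_mod w (?g + dr z w))) y"
   unfolding 1 2 using between_quad[of y x z w] dist_finite_trans[of y x z] y xz fin by auto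
 qed (auto simp: ind_mod_def prod_mod_simps)
qed

lemma distance_module_coind: "distance_module K G X d coind_mod"
 unfolding distance_module_def
proof (intro conjI ballI allI impI)
 fix x g assume x: "x \<in> X" and g: "g \<in> G"
 show "Module.module K (dm_comp coind_mod x g)"
  unfolding coind_mod_def dist_module.simps by (rule module_family.module_prod[OF coind_family[OF x g]])
 fix m assume m: "m \<in>. dm_comp coind_mod x g"
 have ext: "m \<in> extensional (Out x)" using m by (auto simp: coind_mod_def prod_mod_simps PiE_iff)
 show "dm_map coind_mod x x g m = m"
  by (rule extensional_eqI[OF _ ext]) (auto simp: coind_mod_def x between_refl)
next
 fix x z g assume x: "x \<in> X" "z \<in> X" "fin x z" and g: "g \<in> G"
 have gz: "g + dr x z \<in> G" by (intro G_add g dist_G x)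
 show "K_linear K (dm_comp coind_mod x g) (dm_comp coind_mod z (g + dr x z)) (dm_map coind_mod x z g)"
  unfolding coind_mod_def dist_module.simps
 proof (rule K_linear_prod_modI)
  fix y assume y: "y \<in> Out z"
  let ?I = "Out x" and ?A = "%y. Mc y (g + dr x y)"
  have yI: "y \<in> ?I" using dist_finite_trans[OF x(1,2) _ x(3)] y by auto
  show "K_linear K (prod_mod ?I ?A) (Mc y (g + dr x z + dr z y))
    (%f. (\<lambda>y\<in>Out z. if between d x z y then f y
     else zero (Mc y (g + dr x z + dr z y))) y)"
  proof (cases "between d x z y")
   case True
   have e: "g + dr x y = g + dr x z + dr z y"
    using between_deg[of x z y] True x y by simp
   have "K_linear K (prod_mod ?I ?A) (Mc y (g + dr x y)) (%f. f y)"
    by (rule module_family.linear_prod_proj[OF coind_family[OF x(1) g] yI])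
   then show ?thesis unfolding e using y True by simp
  next
   case False
   then show ?thesis
    using K_linear_zero_map[OF module_family.fam[OF coind_family[OF x(2) gz] y], of "prod_mod ?I ?A"] y by auto
  qed
 qed simp
next
 fix x z w g f assume xz: "x \<in> X" "z \<in> X" "w \<in> X" and fin: "fin x z & fin z w" and g: "g \<in> G"
 let ?g = "g + dr x z"
 show "dm_map coind_mod z w ?g (dm_map coind_mod x z g f) =
   (if between d x z w then dm_map coind_mod x w g f else zero (dm_comp coind_mod w (?g + dr z w)))"
 proof (rule extensional_eqI[of _ "Out w"])
  fix y assume y: "y \<in> Out w"
  have zy: "fin z y" using dist_finite_trans[of z w y] y xz fin by auto
  have 1: "dm_map coind_mod z w ?g (dm_map coind_mod x z g f) y =
   (if between d z w y & between d x z y then f y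
    else zero (Mc y (?g + dr z w + dr w y)))"
   using y between_deg[of z w y] fin zy by (auto simp: coind_mod_def add.assoc)
  have 2: "(if between d x z w then dm_map coind_mod x w g f else zero (dm_comp coind_mod w (?g + dr z w))) y =
   (if between d x z w & between d x w y then f y
    else zero (Mc y (?g + dr z w + dr w y)))"
  proof -
   have "g + dr x w = ?g + dr z w" if "between d x z w"
    using between_deg[OF _ _ that] fin by simp
   then show ?thesis using y by (auto simp: coind_mod_def prod_mod_simps add.assoc)
  qed
  show "dm_map coind_mod z w ?g (dm_map coind_mod x z g f) y =
   (if between d x z w then dm_map coind_mod x w g f else zero (dm_comp coind_mod w (?g + dr z w))) y"
   unfolding 1 2 using between_quad[of x z w y] y xz fin by auto
 qed (auto simp: coind_mod_def prod_mod_simps)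
qed

lemma dist_mod_ind: "dist_mod K G X d ind_mod" and dist_mod_coind: "dist_mod K G X d coind_mod"
 by (simp_all add: dist_mod_def dist_mod_axioms_def distance_module_ind distance_module_coind dist_space_axioms)

section \<open>The action map out of the induced module and its dual into the coinduced one\<close>

definition ind_counit :: "'x => real => ('x => 'm) => 'm" where
 "ind_counit x g f = (\<Oplus>\<^bsub>Mc x g\<^esub>y\<in>In x. Mm y x (g - dr y x) (f y))"

definition coind_unit :: "'x => real => 'm => 'x => 'm" where
 "coind_unit x g m = (\<lambda>y\<in>Out x. Mm x y g m)"

lemma dm_map_back:
 "x \<in> X ==> y \<in> X ==> fin y x ==> g \<in> G ==>
  K_linear K (Mc y (g - dr y x)) (Mc x g) (Mm y x (g - dr y x))"
 using dm_linear[of y x "g - dr y x"] G_diff[of g "dr y x"] dist_G by simp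

lemma ind_counit_hom: "dist_hom K G X d ind_mod M ind_counit"
proof (intro dist_hom.intro dist_hom_axioms.intro dist_mod_ind dist_mod_axioms)
 fix x g assume x: "x \<in> X" and g: "g \<in> G"
 show "K_linear K (dm_comp ind_mod x g) (Mc x g) (ind_counit x g)"
  unfolding ind_counit_def[abs_def] ind_mod_def dist_module.simps
 proof (rule K_linear_finsum_map[OF module_family.module_prod[OF ind_family[OF x g]] dm_module[OF x g]])
  fix y assume y: "y \<in> In x"
  show "K_linear K (prod_mod (In x) (%y. Mc y (g - dr y x))) (Mc x g)
   (%f. Mm y x (g - dr y x) (f y))"
   by (rule K_linear_comp[OF module_family.linear_prod_proj[OF ind_family[OF x g] y] dm_map_back]) (use x y g in auto)
 qed
next
 fix x z g f assume x: "x \<in> X" "z \<in> X" "fin x z" and g: "g \<in> G" and f: "f \<in>. dm_comp ind_mod x g"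
 have gz: "g + dr x z \<in> G" by (intro G_add g dist_G x)
 interpret L: linear_map K "Mc x g" "Mc z (g + dr x z)" "Mm x z g"
  by (rule dm_linear_map[OF x g])
 have fy: "f y \<in>. Mc y (g - dr y x)" if "y \<in> X" "fin y x" for y
  using f that by (auto simp: ind_mod_def prod_mod_simps)
 let ?t = "%y. Mm y z (g + dr x z - dr y z) (if fin y x & between d y x z then f y
     else zero (Mc y (g + dr x z - dr y z)))"
 have tz: "Mm y z (g + dr x z - dr y z) (zero (Mc y (g + dr x z - dr y z)))
   = zero (Mc z (g + dr x z))" if "y \<in> X" "fin y z" for y
  by (rule linear_map.zero[OF linear_mapI[OF dm_module dm_module dm_map_back]])
   (use that x gz in "auto intro!: G_diff dist_G")
 have ft: "f y \<in>. Mc y (g + dr x z - dr y z)" if "y \<in> X" "fin y x" "between d y x z" for y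
 proof -
  have e: "g - dr y x = g + dr x z - dr y z"
   using between_deg[OF that(2) x(3) that(3)] by simp
  show ?thesis using fy[OF that(1,2)] unfolding e .
 qed
 have tcl: "?t y \<in>. Mc z (g + dr x z)" if "y \<in> X" "fin y z" for y
  using tz[OF that] K_linear_closed[OF dm_map_back[OF x(2) that gz]] ft[OF that(1)] L.cod.M.zero_closed by auto
 have "ind_counit z (g + dr x z) (dm_map ind_mod x z g f) = (\<Oplus>\<^bsub>Mc z (g + dr x z)\<^esub>y\<in>In z. ?t y)"
  unfolding ind_counit_def
  by (rule L.cod.M.finsum_cong') (use tcl in "auto simp: ind_mod_def")
 \<comment> \<open>The sum at \<open>z\<close> ranges over all points that reach \<open>z\<close>;
   the points that do not reach \<open>x\<close> contribute zero.\<close>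
 also have "... = (\<Oplus>\<^bsub>Mc z (g + dr x z)\<^esub>y\<in>In x. Mm x z g (Mm y x (g - dr y x) (f y)))"
 proof (rule L.cod.M.add.finprod_mono_neutral_cong_left[symmetric])
  show "finite (In z)" using finite_X by simp
  show sub: "In x \<subseteq> In z"
   using dist_finite_trans[OF _ x(1,2) _ x(3)] by blast
  show "?t y = zero (Mc z (g + dr x z))" if "y \<in> In z - In x" for y
   using that tz[of y] by auto
  show "?t \<in> In z \<rightarrow> carrier (Mc z (g + dr x z))" using tcl by blast
  fix y assume "y \<in> In x"
  then have y: "y \<in> X" "fin y x" "fin y z" using sub by auto
  have gy: "g - dr y x \<in> G" by (intro G_diff g dist_G y x)
  have "Mm x z (g - dr y x + dr y x) (Mm y x (g - dr y x) (f y)) =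
    (if between d y x z then Mm y z (g - dr y x) (f y)
    else zero (Mc z (g - dr y x + dr y x + dr x z)))"
   by (rule dm_comp_map[OF y(1) x(1,2) y(2) x(3) gy fy[OF y(1,2)]])
  moreover have "Mm y z (g - dr y x) = Mm y z (g + dr x z - dr y z)" if "between d y x z"
   by (rule arg_cong[where f = "Mm y z"]) (use between_deg[OF y(2) x(3) that] in simp)
  ultimately show "Mm x z g (Mm y x (g - dr y x) (f y)) = ?t y"
   using tz[OF y(1,3)] y(2) by simp
 qed
 also have "... = Mm x z g (ind_counit x g f)"
  unfolding ind_counit_def
  by (rule L.finsum[symmetric]) (use K_linear_closed[OF dm_map_back[OF x(1) _ _ g] fy] in auto)
 finally show "ind_counit z (g + dr x z) (dm_map ind_mod x z g f) = Mm x z g (ind_counit x g f)" .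
qed

lemma coind_unit_hom: "dist_hom K G X d M coind_mod coind_unit"
proof (intro dist_hom.intro dist_hom_axioms.intro dist_mod_coind dist_mod_axioms)
 fix x g assume x: "x \<in> X" and g: "g \<in> G"
 show "K_linear K (Mc x g) (dm_comp coind_mod x g) (coind_unit x g)"
  unfolding coind_mod_def dist_module.simps coind_unit_def
  by (rule K_linear_prod_modI) (use dm_linear[OF x _ _ g] in auto)
next
 fix x z g m assume x: "x \<in> X" "z \<in> X" "fin x z" and g: "g \<in> G" and m: "m \<in>. Mc x g"
 show "coind_unit z (g + dr x z) (Mm x z g m) = dm_map coind_mod x z g (coind_unit x g m)"
  unfolding coind_unit_def coind_mod_def dist_module.simps
 proof (rule restrict_ext)
  fix y assume "y \<in> Out z"
  then have y: "y \<in> X" "fin z y" "y \<in> Out x" using dist_finite_trans[OF x(1,2) _ x(3)] by auto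
  show "Mm z y (g + dr x z) (Mm x z g m) =
   (if between d x z y then (\<lambda>y\<in>Out x. Mm x y g m) y
    else zero (Mc y (g + dr x z + dr z y)))"
   using dm_comp_map[OF x(1,2) y(1) x(3) y(2) g m] y(3) by simp
 qed
qed

end

subsection \<open>Transport along injections of types\<close>

abbreviation "decode e \<equiv> inv_into UNIV e"

text \<open>Operations decode, compute in \<open>A\<close> and encode again. Since \<open>e\<close>
  need not be onto, decoding is meaningful on its image only, which is where the carrier
  lies.\<close>

definition map_mod :: "('a => 'b) => ('k, 'a) module => ('k, 'b) module" where
 "map_mod e A = \<lparr>carrier = e ` carrier A, monoid.mult = undefined, one = undefined, zero = e (zero A),
   add = (%a b. e (decode e a \<oplus>\<^bsub>A\<^esub> decode e b)), smult = (%k a. e (k \<odot>\<^bsub>A\<^esub> decode e a))\<rparr>"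

definition map_graded :: "('a => 'b) => ('k, 'l, 'a) graded_module => ('k, 'l, 'b) graded_module" where
 "map_graded e A = \<lparr>gm_comp = (%g. map_mod e (gm_comp A g)), gm_act = (%g h m a. e (gm_act A g h (decode e m) a))\<rparr>"

lemma map_mod_simps:
 "carrier (map_mod e A) = e ` carrier A" "zero (map_mod e A) = e (zero A)"
 "a \<oplus>\<^bsub>map_mod e A\<^esub> b = e (decode e a \<oplus>\<^bsub>A\<^esub> decode e b)" "k \<odot>\<^bsub>map_mod e A\<^esub> a = e (k \<odot>\<^bsub>A\<^esub> decode e a)"
 by (simp_all add: map_mod_def)

lemma module_map_mod:
 assumes e: "inj e" and A: "Module.module K A"
 shows "Module.module K (map_mod e A)"
proof -
 interpret A: Module.module K A by fact
 show ?thesis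
 proof (rule moduleI)
  show "cring K" by (rule A.R.is_cring)
  show "abelian_group (map_mod e A)"
  proof (rule abelian_groupI)
   fix x assume "x \<in>. map_mod e A"
   then obtain a where a: "a \<in>. A" "x = e a" by (auto simp: map_mod_simps)
   then show "\<exists>y\<in>carrier (map_mod e A). y \<oplus>\<^bsub>map_mod e A\<^esub> x = zero (map_mod e A)"
    by (intro bexI[of _ "e (\<ominus>\<^bsub>A\<^esub> a)"]) (auto simp: map_mod_simps inv_f_f[OF e] A.M.l_neg)
  qed (auto simp: map_mod_simps inv_f_f[OF e] A.M.a_ac)
 qed (auto simp: map_mod_simps inv_f_f[OF e] A.smult_l_distr A.smult_r_distr A.smult_assoc1)
qed

lemma map_mod_linear:
 assumes e: "inj e"
 shows "K_linear K A (map_mod e A) e" "Module.module K A ==> K_linear K (map_mod e A) A (decode e)"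
proof -
 show "K_linear K A (map_mod e A) e" by (auto simp: K_linear_def map_mod_simps inv_f_f[OF e])
 assume "Module.module K A"
 then interpret Module.module K A .
 show "K_linear K (map_mod e A) A (decode e)" by (auto simp: K_linear_def map_mod_simps inv_f_f[OF e])
qed

lemma map_graded_hom:
 assumes e: "inj e" and A: "!!g. g \<in> G ==> Module.module K (gm_comp A g)"
 shows "graded_hom K G L 0 A (map_graded e A) (%g. e)" "graded_hom K G L 0 (map_graded e A) A (%g. decode e)"
proof -
 show "graded_hom K G L 0 A (map_graded e A) (%g. e)"
  unfolding graded_hom_0 using map_mod_linear(1)[OF e] by (auto simp: map_graded_def inv_f_f[OF e])
 show "graded_hom K G L 0 (map_graded e A) A (%g. decode e)"
  unfolding graded_hom_0 using map_mod_linear(2)[OF e A] by (auto simp: map_graded_def inv_f_f[OF e])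
qed

lemma right_graded_map:
 assumes e: "inj e" and A: "right_graded_module K G L A"
 shows "right_graded_module K G L (map_graded e A)"
proof -
 have M: "Module.module K (gm_comp A g)" if "g \<in> G" for g using A that by (simp add: right_graded_module_def)
 have comp: "gm_comp (map_graded e A) g = map_mod e (gm_comp A g)" for g by (simp add: map_graded_def)
 have act: "gm_act (map_graded e A) g h m a = e (gm_act A g h (decode e m) a)" for g h m a by (simp add: map_graded_def)
 show ?thesis
  unfolding right_graded_module_def comp act
 proof (intro conjI ballI)
  fix g h a assume g: "g \<in> G" and h: "h \<in> G" and a: "a \<in>. ga_comp L h"
  show "K_linear K (map_mod e (gm_comp A g)) (map_mod e (gm_comp A (g + h))) (%m. e (gm_act A g h (decode e m) a))"
   using A g h a unfolding right_graded_module_def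
   by (intro K_linear_comp[OF _ map_mod_linear(1)[OF e]] K_linear_comp[OF map_mod_linear(2)[OF e M[OF g]]]) blast
 next
  fix g h m assume g: "g \<in> G" and h: "h \<in> G" and m: "m \<in>. map_mod e (gm_comp A g)"
  then have "decode e m \<in>. gm_comp A g" by (auto simp: map_mod_simps inv_f_f[OF e])
  then show "K_linear K (ga_comp L h) (map_mod e (gm_comp A (g + h))) (%a. e (gm_act A g h (decode e m) a))"
   using A g h unfolding right_graded_module_def by (intro K_linear_comp[OF _ map_mod_linear(1)[OF e]]) blast
 next
  fix g assume g: "g \<in> G"
  show "Module.module K (map_mod e (gm_comp A g))" by (rule module_map_mod[OF e M[OF g]])
  fix m assume "m \<in>. map_mod e (gm_comp A g)"
  then show "e (gm_act A g 0 (decode e m) (ga_one L)) = m"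
   using A g by (auto simp: map_mod_simps inv_f_f[OF e] right_graded_module_def)
 next
  fix g h k m a b assume "g \<in> G" "h \<in> G" "k \<in> G" "m \<in>. map_mod e (gm_comp A g)"
   "a \<in>. ga_comp L h" "b \<in>. ga_comp L k"
  then show "e (gm_act A (g + h) k (decode e (e (gm_act A g h (decode e m) a))) b) = e (gm_act A g (h + k) (decode e m) (ga_mult L h k a b))"
   using A by (auto simp: map_mod_simps inv_f_f[OF e] right_graded_module_def)
 qed
qed

text \<open>Projectivity is stated for test modules on the type
  \<open>real \<times> 'p => 'l\<close> only. Transporting \<open>A\<close> there along
  \<open>enc\<close> and lifting the identity of \<open>P\<close> gives the section.\<close>

lemma graded_projective_section:
 fixes A :: "('k, 'l, 'a) graded_module" and P :: "('k, 'l, 'p) graded_module" and enc :: "'a => real \<times> 'p => 'l"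
 assumes P: "graded_projective K G L P" and A: "right_graded_module K G L A" and enc: "inj enc"
  and e: "graded_hom K G L 0 A P e" and surj: "!!g. g \<in> G ==> e g ` carrier (gm_comp A g) = carrier (gm_comp P g)"
 shows "\<exists>s. graded_hom K G L 0 P A s & (\<forall>g\<in>G. \<forall>p\<in>carrier (gm_comp P g). e g (s g p) = p)"
proof -
 have M: "Module.module K (gm_comp A g)" if "g \<in> G" for g using A that by (simp add: right_graded_module_def)
 let ?A = "map_graded enc A" and ?e = "%g a. e g (decode enc a)"
 have id: "graded_hom K G L 0 P P (%g p. p)"
  by (auto simp: graded_hom_0 K_linear_def)
 have surj': "\<forall>g\<in>G. ?e g ` carrier (gm_comp ?A g) = carrier (gm_comp P g)"
  using surj by (simp add: map_graded_def map_mod_simps image_image inv_f_f[OF enc])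
 have hom: "graded_hom K G L 0 ?A P ?e" by (rule graded_hom_comp[OF map_graded_hom(2)[OF enc M] e])
 have rP: "right_graded_module K G L P" using P by (simp add: graded_projective_def)
 have "\<forall>(A :: ('k, 'l, real \<times> 'p => 'l) graded_module) (B :: ('k, 'l, 'p) graded_module) e f.
    right_graded_module K G L A & right_graded_module K G L B & graded_hom K G L 0 A B e &
    (\<forall>g\<in>G. e g ` carrier (gm_comp A g) = carrier (gm_comp B g)) & graded_hom K G L 0 P B f \<longrightarrow>
    (\<exists>s. graded_hom K G L 0 P A s & (\<forall>g\<in>G. \<forall>p\<in>carrier (gm_comp P g). e g (s g p) = f g p))"
  using P unfolding graded_projective_def by blast
 from this[rule_format, of ?A P ?e "%g p. p"] obtain s where s: "graded_hom K G L 0 P ?A s" "\<forall>g\<in>G. \<forall>p\<in>carrier (gm_comp P g). ?e g (s g p) = p"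
  using right_graded_map[OF enc A] rP hom surj' id by blast
 then show ?thesis using graded_hom_comp[OF s(1) map_graded_hom(2)[OF enc M]] by blast
qed

text \<open>Here both ends of the test injection must lie on the type fixed in the definition of
  injectivity, so \<open>J\<close> itself is transported too; the map to be extended is its
  decoding.\<close>

lemma graded_injective_retraction:
 fixes A :: "('k, 'l, 'a) graded_module" and J :: "('k, 'l, 'i) graded_module"
  and enc :: "'a => real \<times> 'i => 'l" and encJ :: "'i => real \<times> 'i => 'l"
 assumes J: "graded_injective K G L J" and A: "right_graded_module K G L A" and enc: "inj enc" and encJ: "inj encJ"
  and e: "graded_hom K G L 0 J A e" and inj: "!!g. g \<in> G ==> inj_on (e g) (carrier (gm_comp J g))"
 shows "\<exists>s. graded_hom K G L 0 A J s & (\<forall>g\<in>G. \<forall>a\<in>carrier (gm_comp J g). s g (e g a) = a)"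
proof -
 have M: "Module.module K (gm_comp A g)" if "g \<in> G" for g using A that by (simp add: right_graded_module_def)
 have rJ: "right_graded_module K G L J" using J by (simp add: graded_injective_def)
 then have MJ: "Module.module K (gm_comp J g)" if "g \<in> G" for g using that by (simp add: right_graded_module_def)
 let ?A = "map_graded enc A" and ?J = "map_graded encJ J" and ?e = "%g a. enc (e g (decode encJ a))"
 have hom: "graded_hom K G L 0 ?J ?A ?e"
  by (rule graded_hom_comp[OF graded_hom_comp[OF map_graded_hom(2)[OF encJ MJ] e] map_graded_hom(1)[OF enc M]])
 have inj': "\<forall>g\<in>G. inj_on (?e g) (carrier (gm_comp ?J g))"
  by (auto simp: map_graded_def map_mod_simps inv_f_f[OF encJ] intro!: inj_onI dest!: injD[OF enc] dest: inj_onD[OF inj])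
 have f: "graded_hom K G L 0 ?J J (%g. decode encJ)" by (rule map_graded_hom(2)[OF encJ MJ])
 have "\<forall>(A :: ('k, 'l, real \<times> 'i => 'l) graded_module) (B :: ('k, 'l, real \<times> 'i => 'l) graded_module) e f.
    right_graded_module K G L A & right_graded_module K G L B & graded_hom K G L 0 A B e &
    (\<forall>g\<in>G. inj_on (e g) (carrier (gm_comp A g))) & graded_hom K G L 0 A J f \<longrightarrow>
    (\<exists>s. graded_hom K G L 0 B J s & (\<forall>g\<in>G. \<forall>a\<in>carrier (gm_comp A g). s g (e g a) = f g a))"
  using J unfolding graded_injective_def by blast
 from this[rule_format, of ?J ?A ?e "%g. decode encJ"] obtain s where s: "graded_hom K G L 0 ?A J s"
  "\<forall>g\<in>G. \<forall>a\<in>carrier (gm_comp ?J g). s g (?e g a) = decode encJ a"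
  using right_graded_map[OF enc A] right_graded_map[OF encJ rJ] hom inj' f by blast
 have "s g (enc (e g a)) = a" if "g \<in> G" "a \<in>. gm_comp J g" for g a
  using s(2) that by (auto simp: map_graded_def map_mod_simps inv_f_f[OF encJ])
 then show ?thesis using graded_hom_comp[OF map_graded_hom(1)[OF enc M] s(1)] by blast
qed

text \<open>
 The test modules of the definitions of projectivity and injectivity have elements in
 \<open>real \<times> 'p => 'x \<times> 'x => 'k\<close>; functions \<open>'x => 'x => 'p\<close> embed as their graphs if \<open>'k\<close> has two elements.
\<close>

lemma graph_encoding:
 assumes "(a :: 'k) \<noteq> b"
 shows "inj (\<lambda>(f :: 'x => 'x => 'p) (r :: real, p) (x, y). if f x y = p then a else b)"
  and "inj (\<lambda>(i :: 'p) (r :: real, p) (q :: 'x \<times> 'x). if i = p then a else b)"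
proof -
 show "inj (\<lambda>(f :: 'x => 'x => 'p) (r :: real, p) (x, y). if f x y = p then a else b)"
 proof (rule injI, intro ext)
  fix f f' :: "'x => 'x => 'p" and x y
  assume "(\<lambda>(r :: real, p) (x, y). if f x y = p then a else b) = (%(r, p) (x, y). if f' x y = p then a else b)"
  from fun_cong[OF fun_cong[OF this, of "(0, f' x y)"], of "(x, y)"] show "f x y = f' x y"
   using assms by (simp split: if_splits)
 qed
 show "inj (\<lambda>(i :: 'p) (r :: real, p) (q :: 'x \<times> 'x). if i = p then a else b)"
 proof (rule injI)
  fix i i' :: 'p
  assume "(\<lambda>(r :: real, p) (q :: 'x \<times> 'x). if i = p then a else b) = (%(r, p) q. if i' = p then a else b)"
  from fun_cong[OF fun_cong[OF this, of "(0, i')"], of undefined] show "i = i'"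
   using assms by (simp split: if_splits)
 qed
qed

text \<open>If the type of scalars has one element, then \<open>\<one>\<close> and
  \<open>\<zero>\<close> of \<open>K\<close> coincide and every module vanishes.\<close>

lemma trivial_module:
 assumes "!!a b :: 'k. a = b" "Module.module (K :: 'k ring) A" "x \<in>. A"
 shows "x = zero A"
proof -
 interpret Module.module K A by fact
 have "x = \<one>\<^bsub>K\<^esub> \<odot>\<^bsub>A\<^esub> x" using assms(3) by simp
 also have "\<one>\<^bsub>K\<^esub> = zero K" by (rule assms(1))
 finally show ?thesis using assms(3) by simp
qed


section \<open>Projectives split off induced modules, injectives split off coinduced ones\<close>

context right_mod
begin

text \<open>The section supplied by projectivity is one of graded modules. As it commutes with the
  idempotents, it restricts to each \<open>P e_x\<close>, and its components there satisfy the
  conditions of \<open>relatively_projective\<close>.\<close>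

theorem projective_imp_relatively_projective:
 assumes "graded_projective K G \<Lambda> P"
 shows "\<exists>s. relatively_projective K G X d vtx s"
proof (cases "\<exists>a b :: 'k. a \<noteq> b")
 case True
 then obtain a b :: 'k where ab: "a \<noteq> b" by blast
 interpret I: dist_mod K G X d V.ind_mod by (rule V.dist_mod_ind)
 interpret C: dist_hom K G X d V.ind_mod vtx V.ind_counit by (rule V.ind_counit_hom)
 \<comment> \<open>The surjection to be split: the action map at each vertex, followed by summation
   over the vertices.\<close>
 let ?e = "%g c. \<Oplus>\<^bsub>Pc g\<^esub>x\<in>X. (\<lambda>x\<in>X. V.ind_counit x g (c x)) x"
 have e: "hom0 I.bar P ?e" by (rule graded_hom_comp[OF C.bar_hom bar_to_mod])
 have e_inj: "?e g (I.inj g x f) = V.ind_counit x g f" if x: "x \<in> X" and g: "g \<in> G" and f: "f \<in>. dm_comp V.ind_mod x g" for g x f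
 proof -
  interpret M: Module.module K "Pc g" by (rule gm_module[OF g])
  have cl: "V.ind_counit x g f \<in>. Pc g"
   using K_linear_closed[OF C.f_linear[OF x g] f] by (simp add: vertex_simps)
  have "?e g (I.inj g x f) = (\<Oplus>\<^bsub>Pc g\<^esub>z\<in>X. if x = z then V.ind_counit x g f else zero (Pc g))"
   using linear_map.zero[OF C.f_linear_map[OF _ g]] cl x
   by (intro M.M.finsum_cong') (auto simp: I.inj_nth vertex_simps)
  also have "... = V.ind_counit x g f"
   by (rule M.M.finsum_singleton) (use x finite_X cl in auto)
  finally show ?thesis .
 qed
 have surj: "?e g ` carrier (gm_comp I.bar g) = carrier (Pc g)" if g: "g \<in> G" for g
 proof (intro equalityI subsetI)
  fix p assume "p \<in> ?e g ` carrier (gm_comp I.bar g)"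
  then obtain c where c: "p = ?e g c" "c \<in>. gm_comp I.bar g" by blast
  have "K_linear K (gm_comp I.bar g) (Pc g) (?e g)" using e g unfolding graded_hom_0 by blast
  from K_linear_closed[OF this c(2)] show "p \<in>. Pc g" unfolding c(1) .
 next
  fix p assume p: "p \<in>. Pc g"
  interpret M: Module.module K "Pc g" by (rule gm_module[OF g])
  \<comment> \<open>A preimage of \<open>p\<close>: the component \<open>p e_x\<close> is placed at
    \<open>y = x\<close>, where the pair acts as the identity.\<close>
  let ?u = "%x. \<lambda>y\<in>In x. if y = x then A x x g p else zero (dm_comp vtx y (g - dr y x))"
  have u: "?u x \<in>. dm_comp V.ind_mod x g" if "x \<in> X" for x
   using A_self_vertex[OF that g p] module_family.zero_closed_fam[OF V.ind_family[OF that g]] that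
   by (auto simp: V.ind_mod_def prod_mod_simps dist_self)
  have eu: "V.ind_counit x g (?u x) = A x x g p" if x: "x \<in> X" for x
  proof -
   interpret Vx: Module.module K "dm_comp vtx x g" by (rule V.dm_module[OF x g])
   have "V.ind_counit x g (?u x) = (\<Oplus>\<^bsub>dm_comp vtx x g\<^esub>y\<in>In x. if x = y then A x x g p else zero (dm_comp vtx x g))"
    unfolding V.ind_counit_def
   proof (rule Vx.M.finsum_cong')
    fix y assume "y \<in> In x"
    then have y: "y \<in> X" "fin y x" by auto
    have "dm_map vtx y x (g - dr y x) (zero (dm_comp vtx y (g - dr y x))) = zero (dm_comp vtx x g)"
     by (rule linear_map.zero[OF linear_mapI[OF V.dm_module V.dm_module V.dm_map_back]]) (use y x g in "auto intro!: G_diff dist_G")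
    then show "dm_map vtx y x (g - dr y x) (?u x y) = (if x = y then A x x g p else zero (dm_comp vtx x g))"
     using V.dm_id[OF x g A_self_vertex[OF x g p]] y by (auto simp: dist_self)
   qed (use A_self_vertex[OF x g p] in auto)
   also have "... = A x x g p"
    by (rule Vx.M.finsum_singleton) (use x finite_X A_self_vertex[OF x g p] in "auto simp: dist_self")
   finally show ?thesis .
  qed
  have "?e g (\<lambda>x\<in>X. ?u x) = (\<Oplus>\<^bsub>Pc g\<^esub>x\<in>X. A x x g p)"
   by (rule M.M.finsum_cong') (use eu A_self_closed[OF _ g p] in auto)
  also have "... = p" by (rule unit_decomp[OF g p])
  finally have "?e g (\<lambda>x\<in>X. ?u x) = p" .
  moreover have "(\<lambda>x\<in>X. ?u x) \<in>. gm_comp I.bar g" unfolding I.bar_carrier using u by auto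
  ultimately show "p \<in> ?e g ` carrier (gm_comp I.bar g)" by (intro image_eqI[of p "?e g" "\<lambda>x\<in>X. ?u x"]) simp_all
 qed
 obtain \<sigma> where \<sigma>: "hom0 P I.bar \<sigma>" and sec: "!!g p. g \<in> G ==> p \<in>. Pc g ==> ?e g (\<sigma> g p) = p"
  using graded_projective_section[OF assms I.right_graded_bar graph_encoding(1)[OF ab] e surj] by blast
 have lin: "linear_map K (Pc g) (gm_comp I.bar g) (\<sigma> g)" if "g \<in> G" for g
  using \<sigma> that by (intro linear_mapI gm_module I.bar_module) (auto simp: graded_hom_0)
 have act: "\<sigma> (g + dr x z) (A x z g p) = I.inj (g + dr x z) z (dm_map V.ind_mod x z g (\<sigma> g p x))"
  if "x \<in> X" "z \<in> X" "fin x z" "g \<in> G" "p \<in>. Pc g" for x z g p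
  using \<sigma> that dist_G[OF that(1-3)] basis_ga[OF pairsI[OF that(1-3)]] I.bar_act_ee[OF that(4) linear_map.closed[OF lin] that(1-3)]
  unfolding graded_hom_0 by metis
 have \<sigma>x: "\<sigma> g p x \<in>. dm_comp V.ind_mod x g" if "x \<in> X" "g \<in> G" "p \<in>. Pc g" for x g p
  using linear_map.closed[OF lin[OF that(2)] that(3)] that(1) unfolding I.bar_carrier by auto
 \<comment> \<open>Commuting with \<open>e_x\<close> confines the image of \<open>P e_x\<close> to
   the summand at \<open>x\<close>, so the components of the section can be read off there.\<close>
 have vertex: "\<sigma> g p = I.inj g x (\<sigma> g p x)" if x: "x \<in> X" and g: "g \<in> G" and p: "p \<in>. dm_comp vtx x g" for x g p
  using act[OF x x _ g, of p] I.dm_id[OF x g \<sigma>x[OF x g]] p x by (simp add: vertex_simps dist_self)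
 have "relatively_projective K G X d vtx (%y x g p. \<sigma> g p x y)"
 proof (intro relatively_projective.intro relatively_projective_axioms.intro V.dist_mod_axioms)
  fix x y g assume x: "x \<in> X" "y \<in> X" "fin y x" and g: "g \<in> G"
  have "K_linear K (dm_comp vtx x g) (gm_comp I.bar g) (%p. \<sigma> g p)"
   by (rule K_linear_comp[OF linear_map.linear[OF vertex_incl[OF x(1) g]] linear_map.linear[OF lin[OF g]]])
  moreover have "K_linear K (dm_comp V.ind_mod x g) (dm_comp vtx y (g - dr y x)) (%f. f y)"
   unfolding V.ind_mod_def dist_module.simps by (rule module_family.linear_prod_proj[OF V.ind_family[OF x(1) g]]) (use x in simp)
  ultimately show "K_linear K (dm_comp vtx x g) (dm_comp vtx y (g - dr y x)) (%p. \<sigma> g p x y)"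
   using K_linear_comp[OF _ K_linear_comp[OF linear_map.linear[OF I.bar_proj[OF g x(1)]]]] by blast
 next
  fix x g p assume x: "x \<in> X" and g: "g \<in> G" and p: "p \<in>. dm_comp vtx x g"
  have pP: "p \<in>. Pc g" using p by (simp add: vertex_simps)
  have "V.ind_counit x g (\<sigma> g p x) = p"
   using sec[OF g pP] e_inj[OF x g \<sigma>x[OF x g pP]] vertex[OF x g p] by simp
  then show "(\<Oplus>\<^bsub>dm_comp vtx x g\<^esub>y\<in>In x. dm_map vtx y x (g - dr y x) (\<sigma> g p x y)) = p"
   by (simp add: V.ind_counit_def)
 next
  fix x y z g p assume x: "x \<in> X" "y \<in> X" "z \<in> X" "fin x z" "fin y z" and g: "g \<in> G" and p: "p \<in>. dm_comp vtx x g"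
  have pP: "p \<in>. Pc g" using p by (simp add: vertex_simps)
  have "\<sigma> (g + dr x z) (A x z g p) z = dm_map V.ind_mod x z g (\<sigma> g p x)"
   unfolding act[OF x(1,3,4) g pP] using x by (simp add: I.inj_nth)
  then show "\<sigma> (g + dr x z) (dm_map vtx x z g p) z y = (if fin y x & between d y x z then \<sigma> g p x y
    else zero (dm_comp vtx y (g + dr x z - dr y z)))"
   using x by (simp add: V.ind_mod_def vertex_simps(5))
 qed
 then show ?thesis by blast
next
 case False
 then have triv: "x = zero A" if "Module.module K A" "x \<in>. A" for A :: "('k, 'p) module" and x
  using trivial_module[OF _ that] by blast
 have zero: "z \<in>. dm_comp vtx x g \<longleftrightarrow> z = zero (dm_comp vtx x g)" if "x \<in> X" "g \<in> G" for x g z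
  using triv[OF V.dm_module[OF that]] abelian_monoid.zero_closed[OF abelian_group.axioms(1)[OF module.axioms(2)[OF V.dm_module[OF that]]]] by blast
 \<comment> \<open>With one-element scalars all components are zero, and zero maps satisfy every
   condition.\<close>
 have "relatively_projective K G X d vtx (%y x g p. (zero (dm_comp vtx y (g - dr y x))))"
 proof (intro relatively_projective.intro relatively_projective_axioms.intro V.dist_mod_axioms)
  fix x y g assume "x \<in> X" "y \<in> X" "fin y x" and g: "g \<in> G"
  then show "K_linear K (dm_comp vtx x g) (dm_comp vtx y (g - dr y x)) (%p. (zero (dm_comp vtx y (g - dr y x))))"
   by (intro K_linear_zero_map V.dm_module G_diff dist_G)
 next
  fix x g p assume x: "x \<in> X" and g: "g \<in> G" and p: "p \<in>. dm_comp vtx x g"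
  interpret Vx: Module.module K "dm_comp vtx x g" by (rule V.dm_module[OF x g])
  have "(\<Oplus>\<^bsub>dm_comp vtx x g\<^esub>y\<in>In x. dm_map vtx y x (g - dr y x) (zero (dm_comp vtx y (g - dr y x)))) \<in>. dm_comp vtx x g"
  proof (rule Vx.M.finsum_closed, rule funcsetI)
   fix y assume "y \<in> In x"
   then have y: "y \<in> X" "fin y x" by auto
   have "g - dr y x \<in> G" by (intro G_diff g dist_G y x)
   then show "dm_map vtx y x (g - dr y x) (zero (dm_comp vtx y (g - dr y x))) \<in>. dm_comp vtx x g"
    by (intro K_linear_closed[OF V.dm_map_back[OF x y g]]) (use zero[OF y(1)] in blast)
  qed
  then show "(\<Oplus>\<^bsub>dm_comp vtx x g\<^esub>y\<in>In x. dm_map vtx y x (g - dr y x) (zero (dm_comp vtx y (g - dr y x)))) = p"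
   unfolding iffD1[OF zero[OF x g] p] by (rule iffD1[OF zero[OF x g]])
 next
  fix x y z g p assume x: "x \<in> X" "y \<in> X" "z \<in> X" "fin x z" "fin y z"
  show "zero (dm_comp vtx y (g + dr x z - dr y z)) =
   (if fin y x & between d y x z then zero (dm_comp vtx y (g - dr y x))
    else zero (dm_comp vtx y (g + dr x z - dr y z)))"
  proof (cases "fin y x & between d y x z")
   case True
   then have e: "g - dr y x = g + dr x z - dr y z"
    using between_deg[of y x z] x(4) by simp
   show ?thesis unfolding e by simp
  qed auto
 qed
 then show ?thesis by blast
qed

text \<open>Dually, the identity of \<open>P\<close> is extended along the embedding into the
  coinduced module, and the retraction restricts to the vertices.\<close>

theorem injective_imp_relatively_injective:
 assumes "graded_injective K G \<Lambda> P"
 shows "\<exists>r. relatively_injective K G X d vtx r"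
proof (cases "\<exists>a b :: 'k. a \<noteq> b")
 case True
 then obtain a b :: 'k where ab: "a \<noteq> b" by blast
 interpret I: dist_mod K G X d V.coind_mod by (rule V.dist_mod_coind)
 interpret C: dist_hom K G X d vtx V.coind_mod V.coind_unit by (rule V.coind_unit_hom)
 let ?e = "%g p. \<lambda>x\<in>X. V.coind_unit x g ((\<lambda>x\<in>X. A x x g p) x)"
 have e: "hom0 P I.bar ?e" by (rule graded_hom_comp[OF mod_to_bar C.bar_hom])
 have inj: "inj_on (?e g) (carrier (Pc g))" if g: "g \<in> G" for g
 proof (rule inj_onI)
  fix p q assume p: "p \<in>. Pc g" and q: "q \<in>. Pc g" and eq: "?e g p = ?e g q"
  interpret M: Module.module K "Pc g" by (rule gm_module[OF g])
  \<comment> \<open>The value at the trivial pair \<open>(x, x)\<close> returns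
    \<open>p e_x\<close>; all these components together determine \<open>p\<close>, so the map is
    injective.\<close>
  have ex: "?e g p x x = A x x g p" if "x \<in> X" "p \<in>. Pc g" for x p
   using that V.dm_id[OF that(1) g A_self_vertex[OF that(1) g that(2)]] by (simp add: V.coind_unit_def dist_self)
  have "A x x g p = A x x g q" if "x \<in> X" for x
   using ex[OF that p] ex[OF that q] fun_cong[OF fun_cong[OF eq, of x], of x] by metis
  then have "(\<Oplus>\<^bsub>Pc g\<^esub>x\<in>X. A x x g p) = (\<Oplus>\<^bsub>Pc g\<^esub>x\<in>X. A x x g q)"
   by (intro M.M.finsum_cong') (use A_self_closed[OF _ g q] in auto)
  then show "p = q" using unit_decomp[OF g p] unit_decomp[OF g q] by simp
 qed
 obtain \<rho> where \<rho>: "hom0 I.bar P \<rho>" and ret: "!!g p. g \<in> G ==> p \<in>. Pc g ==> \<rho> g (?e g p) = p"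
  using graded_injective_retraction[OF assms I.right_graded_bar graph_encoding[OF ab] e inj] by blast
 have lin: "linear_map K (gm_comp I.bar g) (Pc g) (\<rho> g)" if "g \<in> G" for g
  using \<rho> that by (intro linear_mapI gm_module I.bar_module) (auto simp: graded_hom_0)
 have ic: "I.inj g x f \<in>. gm_comp I.bar g" if "x \<in> X" "g \<in> G" "f \<in>. dm_comp V.coind_mod x g" for x g f
  using linear_map.closed[OF I.inj_linear[OF that(2,1)] that(3)] .
 have act: "A x z g (\<rho> g (I.inj g x f)) = \<rho> (g + dr x z) (I.inj (g + dr x z) z (dm_map V.coind_mod x z g f))"
  if "x \<in> X" "z \<in> X" "fin x z" "g \<in> G" "f \<in>. dm_comp V.coind_mod x g" for x z g f
 proof -
  have "\<rho> (g + dr x z) (gm_act I.bar g (dr x z) (I.inj g x f) (ee x z)) = A x z g (\<rho> g (I.inj g x f))"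
   using \<rho> ic[OF that(1,4,5)] that(4) dist_G[OF that(1-3)] basis_ga[OF pairsI[OF that(1-3)]] unfolding graded_hom_0 by blast
  then show ?thesis using I.bar_act_ee[OF that(4) ic[OF that(1,4,5)] that(1-3)] that(1) by (simp add: I.inj_nth)
 qed
 \<comment> \<open>The retraction commutes with \<open>e_x\<close>, so it maps the summand at
   \<open>x\<close> into \<open>P e_x\<close>.\<close>
 have rv: "\<rho> g (I.inj g x f) \<in>. dm_comp vtx x g" if "x \<in> X" "g \<in> G" "f \<in>. dm_comp V.coind_mod x g" for x g f
  using act[OF that(1,1) _ that(2,3)] I.dm_id[OF that] linear_map.closed[OF lin[OF that(2)] ic[OF that]] that(1)
  by (simp add: vertex_simps dist_self)
 have cm: "dm_comp V.coind_mod x g = prod_mod (Out x) (%y. dm_comp vtx y (g + dr x y))" for x g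
  by (simp add: V.coind_mod_def)
 have "relatively_injective K G X d vtx (%x g f. \<rho> g (I.inj g x f))"
 proof (intro relatively_injective.intro relatively_injective_axioms.intro V.dist_mod_axioms, unfold cm[symmetric])
  fix x g assume x: "x \<in> X" and g: "g \<in> G"
  have "K_linear K (dm_comp V.coind_mod x g) (Pc g) (%f. \<rho> g (I.inj g x f))"
   by (rule K_linear_comp[OF linear_map.linear[OF I.inj_linear[OF g x]] linear_map.linear[OF lin[OF g]]])
  then show "K_linear K (dm_comp V.coind_mod x g) (dm_comp vtx x g) (%f. \<rho> g (I.inj g x f))"
   using rv[OF x g] unfolding K_linear_def by (auto simp: vertex_simps(3,4))
  fix p assume p: "p \<in>. dm_comp vtx x g"
  have "?e g p = I.inj g x (V.coind_unit x g p)"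
   unfolding mod_to_bar_vertex[OF x g p]
   using linear_map.zero[OF C.f_linear_map[OF _ g]] x by (auto simp: sum_incl_def intro!: restrict_ext)
  then show "\<rho> g (I.inj g x (\<lambda>y\<in>Out x. dm_map vtx x y g p)) = p"
   using ret[OF g, of p] p by (simp add: V.coind_unit_def vertex_simps)
 next
  fix x z g f assume x: "x \<in> X" "z \<in> X" "fin x z" and g: "g \<in> G" and f: "f \<in>. dm_comp V.coind_mod x g"
  show "dm_map vtx x z g (\<rho> g (I.inj g x f)) = \<rho> (g + dr x z) (I.inj (g + dr x z) z
    (\<lambda>y\<in>Out z. if between d x z y then f y
      else zero (dm_comp vtx y (g + dr x z + dr z y))))"
   using act[OF x g f] by (simp add: V.coind_mod_def vertex_simps(5))
 qed
 then show ?thesis by blast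
next
 case False
 then have triv: "x = zero A" if "Module.module K A" "x \<in>. A" for A :: "('k, 'p) module" and x
  using trivial_module[OF _ that] by blast
 have zero: "z \<in>. dm_comp vtx x g \<longleftrightarrow> z = zero (dm_comp vtx x g)" if "x \<in> X" "g \<in> G" for x g z
  using triv[OF V.dm_module[OF that]] abelian_monoid.zero_closed[OF abelian_group.axioms(1)[OF module.axioms(2)[OF V.dm_module[OF that]]]] by blast
 have "relatively_injective K G X d vtx (%x g f. (zero (dm_comp vtx x g)))"
 proof (intro relatively_injective.intro relatively_injective_axioms.intro V.dist_mod_axioms)
  fix x g assume x: "x \<in> X" and g: "g \<in> G"
  then show "K_linear K (prod_mod (Out x) (%y. dm_comp vtx y (g + dr x y))) (dm_comp vtx x g) (%f. (zero (dm_comp vtx x g)))"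
   by (intro K_linear_zero_map V.dm_module)
  fix p assume "p \<in>. dm_comp vtx x g"
  then show "zero (dm_comp vtx x g) = p" using zero[OF x g] by simp
 next
  fix x z g assume x: "x \<in> X" "z \<in> X" "fin x z" and g: "g \<in> G"
  show "dm_map vtx x z g (zero (dm_comp vtx x g)) = zero (dm_comp vtx z (g + dr x z))"
   by (rule linear_map.zero[OF V.dm_linear_map[OF x g]])
 qed
 then show ?thesis by blast
qed

end

section \<open>Tensor products with a quotient of the algebra\<close>

lemma (in Module.module) diff_zero_iff: "x \<in>. M ==> y \<in>. M ==> x \<ominus>\<^bsub>M\<^esub> y = zero M \<longleftrightarrow> x = y"
 by (metis M.a_inv_closed M.minus_equality M.minus_minus M.r_neg a_minus_def)

text \<open>The universal property of quotients, with the induced map written in the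
  \<open>the_elem\<close> form of the definitions, so that it applies to them literally.\<close>

lemma quot_lift:
 assumes q: "quotient_module K A H" and f: "linear_map K A C f" and H: "!!x. x \<in> H ==> f x = zero C"
 shows "x \<in>. A ==> the_elem (f ` (H +>\<^bsub>A\<^esub> x)) = f x"
  and "linear_map K (quot_mod A H) C (%X. the_elem (f ` X))"
proof -
 interpret q: quotient_module K A H by fact
 interpret f: linear_map K A C f by fact
 have *: "the_elem (f ` (H +>\<^bsub>A\<^esub> x)) = f x" if x: "x \<in>. A" for x
 proof (rule q.the_elem_coset[OF x])
  fix y assume y: "y \<in>. A" "y \<ominus>\<^bsub>A\<^esub> x \<in> H"
  then have "f y \<ominus>\<^bsub>C\<^esub> f x = zero C" using H[OF y(2)] x by (simp add: f.diff)
  then show "f y = f x" using f.closed x y f.cod.diff_zero_iff by blast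
 qed
 then show "x \<in>. A ==> the_elem (f ` (H +>\<^bsub>A\<^esub> x)) = f x" .
 have "K_linear K (quot_mod A H) C (%X. the_elem (f ` X))"
  unfolding K_linear_def using f.closed f.add f.smult
  by (auto simp: q.quot_carrier q.quot_add q.quot_smult *)
 then show "linear_map K (quot_mod A H) C (%X. the_elem (f ` X))"
  by (intro linear_mapI q.module_quot f.cod.module_axioms)
qed

lemma (in module_family) sum_span:
 assumes "submodule H K (sum_mod I A)" "!!i a. i \<in> I ==> a \<in>. A i ==> sum_incl I A i a \<in> H"
 shows "carrier (sum_mod I A) \<subseteq> H"
proof
 interpret S: Module.module K "sum_mod I A" by (rule module_sum)
 fix f assume f: "f \<in>. sum_mod I A"
 have "(\<Oplus>\<^bsub>sum_mod I A\<^esub>i\<in>{i \<in> I. f i \<noteq> (zero (A i))}. sum_incl I A i (f i)) \<in> H"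
  by (rule S.finsum_submodule[OF assms(1)]) (use f assms(2) in "auto simp: sum_mod_simps")
 then show "f \<in> H" using sum_decomp[OF f] by simp
qed

section \<open>Tensor products over \<open>K\<close>\<close>

locale tensor_pair = A: Module.module K A + B: Module.module K B
 for K :: "'k ring" and A :: "('k, 'a) module" and B :: "('k, 'b) module"
begin

abbreviation "AB \<equiv> carrier A \<times> carrier B"

lemma fK: "free_module K" by (simp add: free_module_def A.R.is_cring)

lemma F_module: "Module.module K (free_mod K AB)" by (rule free_module.module_free[OF fK])

abbreviation "e a b \<equiv> basis_elt K AB (a, b)"

definition gens :: "('a \<times> 'b => 'k) set" where
 "gens = {e (a \<oplus>\<^bsub>A\<^esub> a') b \<ominus>\<^bsub>free_mod K AB\<^esub> (e a b \<oplus>\<^bsub>free_mod K AB\<^esub> e a' b) | a a' b.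
     a \<in>. A & a' \<in>. A & b \<in>. B} \<union>
    {e a (b \<oplus>\<^bsub>B\<^esub> b') \<ominus>\<^bsub>free_mod K AB\<^esub> (e a b \<oplus>\<^bsub>free_mod K AB\<^esub> e a b') | a b b'.
     a \<in>. A & b \<in>. B & b' \<in>. B} \<union>
    {e (k \<odot>\<^bsub>A\<^esub> a) b \<ominus>\<^bsub>free_mod K AB\<^esub> (k \<odot>\<^bsub>free_mod K AB\<^esub> e a b) | k a b.
     k \<in>. K & a \<in>. A & b \<in>. B} \<union>
    {e a (k \<odot>\<^bsub>B\<^esub> b) \<ominus>\<^bsub>free_mod K AB\<^esub> (k \<odot>\<^bsub>free_mod K AB\<^esub> e a b) | k a b.
     k \<in>. K & a \<in>. A & b \<in>. B}"

lemma tensor_rel_eq: "tensor_rel K A B = mod_span K (free_mod K AB) gens"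
 by (simp add: tensor_rel_def gens_def Let_def)

lemma e_closed: "a \<in>. A ==> b \<in>. B ==> e a b \<in>. free_mod K AB"
 by (rule free_module.basis_closed[OF fK]) simp

lemma gens_closed: "gens \<subseteq> carrier (free_mod K AB)"
proof -
 interpret F: Module.module K "free_mod K AB" by (rule F_module)
 show ?thesis unfolding gens_def using e_closed by auto
qed

lemma rel_sub: "submodule (tensor_rel K A B) K (free_mod K AB)" "gens \<subseteq> tensor_rel K A B"
 unfolding tensor_rel_eq by (rule submodule_mod_span[OF F_module gens_closed])+

sublocale q: quotient_module K "free_mod K AB" "tensor_rel K A B"
 by (rule quotient_moduleI[OF F_module rel_sub(1)])

abbreviation "pure \<equiv> pure_tensor K A B"

lemma module_tensor: "Module.module K (tensor K A B)"
 unfolding tensor_def by (rule q.module_quot)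

lemma pure_closed: "a \<in>. A ==> b \<in>. B ==> pure a b \<in>. tensor K A B"
 unfolding tensor_def pure_tensor_def q.quot_carrier using e_closed by blast

lemma gens_relI:
 "a \<in>. A ==> a' \<in>. A ==> b \<in>. B ==>
  e (a \<oplus>\<^bsub>A\<^esub> a') b \<ominus>\<^bsub>free_mod K AB\<^esub> (e a b \<oplus>\<^bsub>free_mod K AB\<^esub> e a' b) \<in> gens"
 "a \<in>. A ==> b \<in>. B ==> b' \<in>. B ==>
  e a (b \<oplus>\<^bsub>B\<^esub> b') \<ominus>\<^bsub>free_mod K AB\<^esub> (e a b \<oplus>\<^bsub>free_mod K AB\<^esub> e a b') \<in> gens"
 "k \<in>. K ==> a \<in>. A ==> b \<in>. B ==>
  e (k \<odot>\<^bsub>A\<^esub> a) b \<ominus>\<^bsub>free_mod K AB\<^esub> (k \<odot>\<^bsub>free_mod K AB\<^esub> e a b) \<in> gens"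
 "k \<in>. K ==> a \<in>. A ==> b \<in>. B ==>
  e a (k \<odot>\<^bsub>B\<^esub> b) \<ominus>\<^bsub>free_mod K AB\<^esub> (k \<odot>\<^bsub>free_mod K AB\<^esub> e a b) \<in> gens"
   apply (unfold gens_def)
   apply (rule UnI1, rule UnI1, rule UnI1, blast)
  apply (rule UnI1, rule UnI1, rule UnI2, blast)
  apply (rule UnI1, rule UnI2, blast)
 apply (rule UnI2, blast)
 done

lemma pure_linear_l: 
 assumes b: "b \<in>. B"
 shows "K_linear K A (tensor K A B) (%a. pure a b)"
proof -
 have 1: "pure (a \<oplus>\<^bsub>A\<^esub> a') b = pure a b \<oplus>\<^bsub>tensor K A B\<^esub> pure a' b" if "a \<in>. A" "a' \<in>. A" for a a'
  unfolding tensor_def pure_tensor_def q.quot_add[OF e_closed[OF that(1) b] e_closed[OF that(2) b]]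
  by (rule q.coset_eq_iff[THEN iffD2])
   (use rel_sub(2) gens_relI(1)[OF that b] e_closed that b in "auto intro: A.M.a_closed")
 have 2: "pure (k \<odot>\<^bsub>A\<^esub> a) b = k \<odot>\<^bsub>tensor K A B\<^esub> pure a b" if "k \<in>. K" "a \<in>. A" for k a
  unfolding tensor_def pure_tensor_def q.quot_smult[OF that(1) e_closed[OF that(2) b]]
  by (rule q.coset_eq_iff[THEN iffD2])
   (use rel_sub(2) gens_relI(3)[OF that b] e_closed that b in "auto")
 show ?thesis unfolding K_linear_def using pure_closed[OF _ b] 1 2 by blast
qed

lemma pure_linear_r:
 assumes a: "a \<in>. A"
 shows "K_linear K B (tensor K A B) (%b. pure a b)"
proof -
 have 1: "pure a (b \<oplus>\<^bsub>B\<^esub> b') = pure a b \<oplus>\<^bsub>tensor K A B\<^esub> pure a b'" if "b \<in>. B" "b' \<in>. B" for b b'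
  unfolding tensor_def pure_tensor_def q.quot_add[OF e_closed[OF a that(1)] e_closed[OF a that(2)]]
  by (rule q.coset_eq_iff[THEN iffD2])
   (use rel_sub(2) gens_relI(2)[OF a that] e_closed that a in "auto intro: A.M.a_closed")
 have 2: "pure a (k \<odot>\<^bsub>B\<^esub> b) = k \<odot>\<^bsub>tensor K A B\<^esub> pure a b" if "k \<in>. K" "b \<in>. B" for k b
  unfolding tensor_def pure_tensor_def q.quot_smult[OF that(1) e_closed[OF a that(2)]]
  by (rule q.coset_eq_iff[THEN iffD2])
   (use rel_sub(2) gens_relI(4)[OF that(1) a that(2)] e_closed that a in "auto")
 show ?thesis unfolding K_linear_def using pure_closed[OF a] 1 2 by blast
qed

lemma tensor_span:
 assumes H: "submodule H K (tensor K A B)" and pure: "!!a b. a \<in>. A ==> b \<in>. B ==> pure a b \<in> H"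
 shows "carrier (tensor K A B) \<subseteq> H"
proof -
 let ?c = "%x. tensor_rel K A B +>\<^bsub>free_mod K AB\<^esub> x"
 have c: "linear_map K (free_mod K AB) (tensor K A B) ?c"
  unfolding tensor_def by (intro linear_mapI F_module q.module_quot q.linear_coset)
 have "carrier (free_mod K AB) \<subseteq> {x \<in> carrier (free_mod K AB). ?c x \<in> H}"
  by (rule free_module.free_span[OF fK linear_map.vimage_submodule[OF c H]])
   (use pure e_closed in "auto simp: pure_tensor_def")
 then show ?thesis by (auto simp: tensor_def q.quot_carrier)
qed

text \<open>The universal property. The map \<open>F\<close> is spelled out because
  \<open>tensor_map\<close> is the instance of this very term for a bilinear map given by pure
  tensors.\<close>

lemma tensor_lift:
 assumes C: "Module.module K C" and l: "!!b. b \<in>. B ==> K_linear K A C (%a. \<phi> a b)"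
  and r: "!!a. a \<in>. A ==> K_linear K B C (%b. \<phi> a b)"
 defines "F \<equiv> %X. the_elem (lin_ext K AB C (%(a, b). \<phi> a b) ` X)"
 shows "linear_map K (tensor K A B) C F" "!!a b. a \<in>. A ==> b \<in>. B ==> F (pure a b) = \<phi> a b"
proof -
 interpret C: Module.module K C by fact
 let ?f = "lin_ext K AB C (%(a, b). \<phi> a b)"
 have cl: "\<phi> a b \<in>. C" if "a \<in>. A" "b \<in>. B" for a b
  using K_linear_closed[OF l[OF that(2)] that(1)] .
 have f: "linear_map K (free_mod K AB) C ?f"
  by (intro linear_mapI F_module C free_module.linear_lin_ext[OF fK]) (auto intro: cl)
 then interpret f: linear_map K "free_mod K AB" C ?f .
 have fe: "?f (e a b) = \<phi> a b" if "a \<in>. A" "b \<in>. B" for a b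
  using free_module.lin_ext_basis[OF fK C, of AB "%(a, b). \<phi> a b" "(a, b)"] that cl by auto
 have "gens \<subseteq> {x \<in> carrier (free_mod K AB). ?f x = zero C}"
 proof
  fix x assume x: "x \<in> gens"
  have [simp]: "\<phi> (a \<oplus>\<^bsub>A\<^esub> a') b = \<phi> a b \<oplus>\<^bsub>C\<^esub> \<phi> a' b" "k \<in>. K ==> \<phi> (k \<odot>\<^bsub>A\<^esub> a) b = k \<odot>\<^bsub>C\<^esub> \<phi> a b"
   if "a \<in>. A" "a' \<in>. A" "b \<in>. B" for a a' b k
   using l[OF that(3)] that by (auto simp: K_linear_def)
  have [simp]: "\<phi> a (b \<oplus>\<^bsub>B\<^esub> b') = \<phi> a b \<oplus>\<^bsub>C\<^esub> \<phi> a b'" "k \<in>. K ==> \<phi> a (k \<odot>\<^bsub>B\<^esub> b) = k \<odot>\<^bsub>C\<^esub> \<phi> a b"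
   if "a \<in>. A" "b \<in>. B" "b' \<in>. B" for a b b' k
   using r[OF that(1)] that by (auto simp: K_linear_def)
  have "?f x = zero C"
   using x unfolding gens_def by (auto simp: f.diff f.add f.smult e_closed fe cl C.diff_zero_iff)
  then show "x \<in> {x \<in> carrier (free_mod K AB). ?f x = zero C}" using x gens_closed by blast
 qed
 then have rel: "?f x = zero C" if "x \<in> tensor_rel K A B" for x
  using mod_span_subset[OF f.kernel_submodule] that unfolding tensor_rel_eq by blast
 show "linear_map K (tensor K A B) C F"
  unfolding tensor_def F_def by (rule quot_lift(2)[OF q.quotient_module_axioms f rel])
 show "F (pure a b) = \<phi> a b" if "a \<in>. A" "b \<in>. B" for a b
  unfolding F_def pure_tensor_def using quot_lift(1)[OF q.quotient_module_axioms f rel e_closed[OF that]] fe[OF that] by simp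
qed

end

lemma tensor_map_linear:
 assumes A: "Module.module K A" and B: "Module.module K B" and A': "Module.module K A'" and f: "K_linear K A A' f"
 shows "linear_map K (tensor K A B) (tensor K A' B) (tensor_map K A A' B f)"
  "a \<in>. A ==> b \<in>. B ==> tensor_map K A A' B f (pure_tensor K A B a b) = pure_tensor K A' B (f a) b"
proof -
 interpret t: tensor_pair K A B using A B by (simp add: tensor_pair_def)
 interpret t': tensor_pair K A' B using A' B by (simp add: tensor_pair_def)
 have l: "K_linear K A (tensor K A' B) (%a. pure_tensor K A' B (f a) b)" if "b \<in>. B" for b
  by (rule K_linear_comp[OF f t'.pure_linear_l[OF that]])
 have r: "K_linear K B (tensor K A' B) (%b. pure_tensor K A' B (f a) b)" if "a \<in>. A" for a
  by (rule t'.pure_linear_r[OF K_linear_closed[OF f that]])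
 note lift = t.tensor_lift[where \<phi> = "%a b. pure_tensor K A' B (f a) b", OF t'.module_tensor l r]
 show "linear_map K (tensor K A B) (tensor K A' B) (tensor_map K A A' B f)"
  using lift(1) by (simp add: tensor_map_def[abs_def])
 show "a \<in>. A ==> b \<in>. B ==> tensor_map K A A' B f (pure_tensor K A B a b) = pure_tensor K A' B (f a) b"
  using lift(2) by (simp add: tensor_map_def)
qed

section \<open>A graded algebra with a graded ideal and its quotient on either side\<close>

locale algebra_ideal =
 fixes K :: "'k ring" and G :: "real set" and L :: "('k, 'l) graded_algebra" and J :: "real => 'l set"
 assumes cring_K: "cring K" and G0: "0 \<in> G" and G_add: "!!g h. g \<in> G ==> h \<in> G ==> g + h \<in> G"
  and L_module: "!!g. g \<in> G ==> Module.module K (ga_comp L g)"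
  and mult_linear_r: "!!g h a. a \<in>. ga_comp L g ==> K_linear K (ga_comp L h) (ga_comp L (g + h)) (%b. ga_mult L g h a b)"
  and mult_linear_l: "!!g h b. b \<in>. ga_comp L h ==> K_linear K (ga_comp L g) (ga_comp L (g + h)) (%a. ga_mult L g h a b)"
  and one_closed: "ga_one L \<in>. ga_comp L 0"
  and one_right: "!!g a. a \<in>. ga_comp L g ==> ga_mult L g 0 a (ga_one L) = a"
  and one_left: "!!g a. a \<in>. ga_comp L g ==> ga_mult L 0 g (ga_one L) a = a"
  and ideal: "graded_ideal K G L J"
begin

abbreviation "Lc \<equiv> ga_comp L"

lemma J_sub: "g \<in> G ==> submodule (J g) K (Lc g)"
 and J_left: "g \<in> G ==> h \<in> G ==> a \<in>. Lc g ==> b \<in> J h ==> ga_mult L g h a b \<in> J (g + h)"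
 and J_right: "g \<in> G ==> h \<in> G ==> a \<in>. Lc g ==> b \<in> J h ==> ga_mult L h g b a \<in> J (h + g)"
 using ideal unfolding graded_ideal_def by blast+

lemma Lq: "g \<in> G ==> quotient_module K (Lc g) (J g)"
 by (intro quotient_moduleI L_module J_sub)

abbreviation "co h a \<equiv> J h +>\<^bsub>Lc h\<^esub> a"

lemma co_carrier: "g \<in> G ==> carrier (quot_mod (Lc g) (J g)) = co g ` carrier (Lc g)"
 by (rule quotient_module.quot_carrier[OF Lq])

lemma mult_closed: "a \<in>. Lc g ==> b \<in>. Lc h ==> ga_mult L g h a b \<in>. Lc (g + h)"
 using K_linear_closed[OF mult_linear_r] .

lemma left_act:
 assumes g: "k \<in> G" "h \<in> G" and a: "a \<in>. Lc h" and s: "s \<in>. Lc k"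
 shows "gm_act (left_quot L J) k h (co k s) a = co (h + k) (ga_mult L h k a s)"
proof -
 interpret q: quotient_module K "Lc k" "J k" by (rule Lq[OF g(1)])
 interpret q': quotient_module K "Lc (h + k)" "J (h + k)" by (rule Lq[OF G_add[OF g(2,1)]])
 interpret l: linear_map K "Lc k" "Lc (h + k)" "%b. ga_mult L h k a b"
  by (rule linear_mapI[OF q.module_axioms q'.module_axioms mult_linear_r[OF a]])
 have "the_elem ((%s. co (h + k) (ga_mult L h k a s)) ` (co k s)) = co (h + k) (ga_mult L h k a s)"
 proof (rule q.the_elem_coset[OF s])
  fix y assume y: "y \<in>. Lc k" "y \<ominus>\<^bsub>Lc k\<^esub> s \<in> J k"
  then show "co (h + k) (ga_mult L h k a y) = co (h + k) (ga_mult L h k a s)"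
   using q'.coset_eq_iff[OF l.closed l.closed, of y s] J_left[OF g(2,1) a y(2)] s by (simp add: l.diff)
 qed
 then show ?thesis by (simp add: left_quot_def)
qed

lemma right_act:
 assumes g: "k \<in> G" "h \<in> G" and a: "a \<in>. Lc h" and s: "s \<in>. Lc k"
 shows "gm_act (right_quot L J) k h (co k s) a = co (k + h) (ga_mult L k h s a)"
proof -
 interpret q: quotient_module K "Lc k" "J k" by (rule Lq[OF g(1)])
 interpret q': quotient_module K "Lc (k + h)" "J (k + h)" by (rule Lq[OF G_add[OF g]])
 interpret l: linear_map K "Lc k" "Lc (k + h)" "%b. ga_mult L k h b a"
  by (rule linear_mapI[OF q.module_axioms q'.module_axioms mult_linear_l[OF a]])
 have "the_elem ((%s. co (k + h) (ga_mult L k h s a)) ` (co k s)) = co (k + h) (ga_mult L k h s a)"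
 proof (rule q.the_elem_coset[OF s])
  fix y assume y: "y \<in>. Lc k" "y \<ominus>\<^bsub>Lc k\<^esub> s \<in> J k"
  then show "co (k + h) (ga_mult L k h y a) = co (k + h) (ga_mult L k h s a)"
   using q'.coset_eq_iff[OF l.closed l.closed, of y s] J_right[OF g(2,1) a y(2)] s by (simp add: l.diff)
 qed
 then show ?thesis by (simp add: right_quot_def)
qed

end

text \<open>The setting for identifying \<open>P \<otimes> L/J\<close> with \<open>P/PJ\<close> in
  each degree, and \<open>Hom(L/J, P)\<close> with the elements of \<open>P\<close> annihilated by
  \<open>J\<close>.\<close>

locale tensor_quotient = algebra_ideal K G L J
 for K :: "'k ring" and G :: "real set" and L :: "('k, 'l) graded_algebra" and J :: "real => 'l set" +
 fixes P :: "('k, 'l, 'p) graded_module"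
 assumes right_graded: "right_graded_module K G L P"
begin

abbreviation "Pc \<equiv> gm_comp P"
abbreviation "act \<equiv> gm_act P"

abbreviation "N \<equiv> left_quot L J"

lemma N_comp: "gm_comp N g = quot_mod (Lc g) (J g)"
 by (simp add: left_quot_def)

lemma P_module: "g \<in> G ==> Module.module K (Pc g)"
 and act_linear_l: "g \<in> G ==> h \<in> G ==> a \<in>. Lc h ==>
  K_linear K (Pc g) (Pc (g + h)) (%m. act g h m a)"
 and act_linear_r: "g \<in> G ==> h \<in> G ==> p \<in>. Pc g ==>
  K_linear K (Lc h) (Pc (g + h)) (%a. act g h p a)"
 and act_one: "g \<in> G ==> p \<in>. Pc g ==> act g 0 p (ga_one L) = p"
 and act_assoc: "g \<in> G ==> h \<in> G ==> k \<in> G ==> p \<in>. Pc g ==>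
  a \<in>. Lc h ==> b \<in>. Lc k ==>
  act (g + h) k (act g h p a) b = act g (h + k) p (ga_mult L h k a b)"
 using right_graded unfolding right_graded_module_def by simp_all

lemma act_closed: "g \<in> G ==> h \<in> G ==> p \<in>. Pc g ==> a \<in>. Lc h ==>
  act g h p a \<in>. Pc (g + h)"
 using K_linear_closed[OF act_linear_r] .

lemma N_module: "g \<in> G ==> Module.module K (gm_comp N g)"
 unfolding N_comp by (rule quotient_module.module_quot[OF Lq])

lemma tp: "g \<in> G ==> h \<in> G ==> tensor_pair K (Pc g) (gm_comp N h)"
 by (simp add: tensor_pair_def P_module N_module)

definition PJ :: "real => 'p set" where
 "PJ l = mod_span K (Pc l) {act g h p j | g h p j. g \<in> G & h \<in> G & g + h = l & p \<in>. Pc g & j \<in> J h}"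

lemma J_closed: "h \<in> G ==> j \<in> J h ==> j \<in>. Lc h"
 using module.submoduleE(1)[OF L_module J_sub] by blast

lemma PJ_sub:
 assumes l: "l \<in> G"
 shows "submodule (PJ l) K (Pc l)"
  "!!g h p j. g \<in> G ==> h \<in> G ==> g + h = l ==> p \<in>. Pc g ==> j \<in> J h ==> act g h p j \<in> PJ l"
proof -
 let ?S = "{act g h p j | g h p j. g \<in> G & h \<in> G & g + h = l & p \<in>. Pc g & j \<in> J h}"
 have S: "?S \<subseteq> carrier (Pc l)" using act_closed J_closed by blast
 show "submodule (PJ l) K (Pc l)" unfolding PJ_def by (rule submodule_mod_span(1)[OF P_module[OF l] S])
 show "act g h p j \<in> PJ l" if "g \<in> G" "h \<in> G" "g + h = l" "p \<in>. Pc g" "j \<in> J h" for g h p j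
  using submodule_mod_span(2)[OF P_module[OF l] S] that unfolding PJ_def by blast
qed

lemma Pq: "l \<in> G ==> quotient_module K (Pc l) (PJ l)"
 by (intro quotient_moduleI P_module PJ_sub)

abbreviation "TS l \<equiv> graded_tensor_sum K G P N l"
abbreviation "TR l \<equiv> graded_tensor_rel K G L P N l"
abbreviation "inc l \<equiv> sum_incl (deg_pairs G l) (tensor_parts K P N)"
abbreviation "pu g h \<equiv> pure_tensor K (Pc g) (gm_comp N h)"

lemma TS_family: "module_family K (deg_pairs G l) (tensor_parts K P N)"
 using tensor_pair.module_tensor[OF tp] cring_K by (auto simp: module_family_def deg_pairs_def)

lemma TS_module: "Module.module K (TS l)"
 unfolding graded_tensor_sum_def by (rule module_family.module_sum[OF TS_family])

lemma inc_linear: "g \<in> G ==> h \<in> G ==> g + h = l ==>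
  linear_map K (tensor K (Pc g) (gm_comp N h)) (TS l) (inc l (g, h))"
 using module_family.linear_map_incl[OF TS_family, of "(g, h)" l] by (simp add: graded_tensor_sum_def deg_pairs_def)

definition rel_elt where
 "rel_elt l g h k m a n = inc l (g + h, k) (pu (g + h) k (act g h m a) n)
    \<ominus>\<^bsub>TS l\<^esub> inc l (g, h + k) (pu g (h + k) m (gm_act N k h n a))"

definition rel_set where
 "rel_set l = {rel_elt l g h k m a n | g h k m a n. g \<in> G & h \<in> G & k \<in> G & g + h + k = l &
    m \<in>. Pc g & a \<in>. Lc h & n \<in>. gm_comp N k}"

lemma TR_eq: "TR l = mod_span K (TS l) (rel_set l)"
 by (simp add: graded_tensor_rel_def rel_set_def rel_elt_def)

lemma N_act_closed: "k \<in> G ==> h \<in> G ==> a \<in>. Lc h ==> n \<in>. gm_comp N k ==>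
  gm_act N k h n a \<in>. gm_comp N (h + k)"
 using left_act mult_closed by (auto simp: N_comp co_carrier G_add)

lemma inc_closed: "g \<in> G ==> h \<in> G ==> g + h = l ==> m \<in>. Pc g ==> n \<in>. gm_comp N h ==>
  inc l (g, h) (pu g h m n) \<in>. TS l"
 using linear_map.closed[OF inc_linear] tensor_pair.pure_closed[OF tp] by blast

lemma rel_terms_closed:
 assumes "g \<in> G" "h \<in> G" "k \<in> G" "g + h + k = l" "m \<in>. Pc g" "a \<in>. Lc h" "n \<in>. gm_comp N k"
 shows "inc l (g + h, k) (pu (g + h) k (act g h m a) n) \<in>. TS l"
  "inc l (g, h + k) (pu g (h + k) m (gm_act N k h n a)) \<in>. TS l"
 by (rule inc_closed; use assms act_closed N_act_closed G_add in force)+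

lemma rel_set_closed: "rel_set l \<subseteq> carrier (TS l)"
proof -
 interpret S: Module.module K "TS l" by (rule TS_module)
 have "rel_elt l g h k m a n \<in>. TS l"
  if "g \<in> G" "h \<in> G" "k \<in> G" "g + h + k = l" "m \<in>. Pc g" "a \<in>. Lc h"
   "n \<in>. gm_comp N k" for g h k m a n
  unfolding rel_elt_def a_minus_def by (intro S.M.a_closed S.M.a_inv_closed rel_terms_closed[OF that])
 then show ?thesis unfolding rel_set_def by blast
qed

lemma TR_sub: "submodule (TR l) K (TS l)" "rel_set l \<subseteq> TR l"
 unfolding TR_eq by (rule submodule_mod_span[OF TS_module rel_set_closed])+

lemma Tq: "quotient_module K (TS l) (TR l)"
 by (intro quotient_moduleI TS_module TR_sub)

abbreviation "T l \<equiv> graded_tensor K G L P N l"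
abbreviation "cl l u \<equiv> TR l +>\<^bsub>TS l\<^esub> u"

lemma T_module: "Module.module K (T l)"
 unfolding graded_tensor_def by (rule quotient_module.module_quot[OF Tq])

lemma cl_linear: "linear_map K (TS l) (T l) (cl l)"
 unfolding graded_tensor_def by (intro linear_mapI TS_module quotient_module.module_quot[OF Tq] quotient_module.linear_coset[OF Tq])

lemma cl_rel:
 assumes "g \<in> G" "h \<in> G" "k \<in> G" "g + h + k = l" "m \<in>. Pc g" "a \<in>. Lc h" "n \<in>. gm_comp N k"
 shows "cl l (inc l (g + h, k) (pu (g + h) k (act g h m a) n)) = cl l (inc l (g, h + k) (pu g (h + k) m (gm_act N k h n a)))"
proof -
 have "rel_elt l g h k m a n \<in> TR l" using TR_sub(2) assms unfolding rel_set_def by blast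
 then show ?thesis
  using quotient_module.coset_eq_iff[OF Tq rel_terms_closed[OF assms]] by (simp add: rel_elt_def)
qed

text \<open>The map \<open>p \<mapsto> p \<otimes> 1\<close>, whose kernel will be
  \<open>PJ\<close>.\<close>

definition \<tau> :: "real => 'p => (real \<times> real => ('p \<times> 'l set => 'k) set) set" where
 "\<tau> l p = cl l (inc l (l, 0) (pu l 0 p (co 0 (ga_one L))))"

lemma one_N: "co 0 (ga_one L) \<in>. gm_comp N 0"
 using one_closed by (simp add: N_comp co_carrier G0)

lemma \<tau>_linear: "l \<in> G ==> linear_map K (Pc l) (T l) (\<tau> l)"
proof (rule linear_mapI[OF P_module T_module])
 assume l: "l \<in> G"
 have "K_linear K (Pc l) (TS l) (%p. inc l (l, 0) (pu l 0 p (co 0 (ga_one L))))"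
  using K_linear_comp[OF tensor_pair.pure_linear_l[OF tp[OF l G0] one_N] linear_map.linear[OF inc_linear[OF l G0]]] by simp
 then show "K_linear K (Pc l) (T l) (\<tau> l)"
  unfolding \<tau>_def[abs_def] by (rule K_linear_comp[OF _ linear_map.linear[OF cl_linear]])
qed

text \<open>The class of \<open>a\<close> is \<open>a\<close> times the class of the unit, and
  \<open>a\<close> may be moved across the tensor sign.\<close>

lemma pure_to_\<tau>:
 assumes "g \<in> G" "h \<in> G" "g + h = l" "m \<in>. Pc g" "a \<in>. Lc h"
 shows "cl l (inc l (g, h) (pu g h m (co h a))) = \<tau> l (act g h m a)"
proof -
 have "gm_act N 0 h (co 0 (ga_one L)) a = co h a"
  using left_act[OF G0 assms(2,5) one_closed] one_right[OF assms(5)] by simp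
 then show ?thesis
  using cl_rel[OF assms(1,2) G0 _ assms(4,5) one_N, of l] assms(3) by (simp add: \<tau>_def)
qed

text \<open>Every element is a sum of pure tensors, and those are values of \<open>\<tau>\<close> by
  \<open>pure_to_\<tau>\<close>. The span argument runs twice: inside each summand, then over the
  direct sum.\<close>

lemma \<tau>_surj: assumes l: "l \<in> G" shows "\<tau> l ` carrier (Pc l) = carrier (T l)"
proof
 interpret t: linear_map K "Pc l" "T l" "\<tau> l" by (rule \<tau>_linear[OF l])
 let ?I = "\<tau> l ` carrier (Pc l)"
 show "?I \<subseteq> carrier (T l)" using t.closed by blast
 have I: "submodule ?I K (T l)" by (rule t.image_submodule[OF t.dom.carrier_is_submodule])
 let ?H = "{u \<in> carrier (TS l). cl l u \<in> ?I}"
 have H: "submodule ?H K (TS l)" by (rule linear_map.vimage_submodule[OF cl_linear I])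
 have "carrier (sum_mod (deg_pairs G l) (tensor_parts K P N)) \<subseteq> ?H"
 proof (rule module_family.sum_span[OF TS_family, of ?H l])
  show "submodule ?H K (sum_mod (deg_pairs G l) (tensor_parts K P N))" using H by (simp only: graded_tensor_sum_def)
 next
  fix i t assume i: "i \<in> deg_pairs G l" and t: "t \<in>. tensor_parts K P N i"
  obtain g h where gh: "i = (g, h)" "g \<in> G" "h \<in> G" "g + h = l" using i by (auto simp: deg_pairs_def)
  have "carrier (tensor K (Pc g) (gm_comp N h)) \<subseteq>
    {t \<in> carrier (tensor K (Pc g) (gm_comp N h)). inc l (g, h) t \<in> ?H}"
  proof (rule tensor_pair.tensor_span[OF tp[OF gh(2,3)] linear_map.vimage_submodule[OF inc_linear[OF gh(2-4)] H]])
   fix m n assume m: "m \<in>. Pc g" and n: "n \<in>. gm_comp N h"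
   obtain a where a: "a \<in>. Lc h" "n = co h a" using n gh by (auto simp: N_comp co_carrier)
   have "cl l (inc l (g, h) (pu g h m n)) \<in> ?I"
    using pure_to_\<tau>[OF gh(2-4) m a(1)] act_closed[OF gh(2,3) m a(1)] gh(4) a(2) by blast
   then show "pu g h m n \<in> {t \<in> carrier (tensor K (Pc g) (gm_comp N h)). inc l (g, h) t \<in> ?H}"
    using tensor_pair.pure_closed[OF tp[OF gh(2,3)] m n] inc_closed[OF gh(2-4) m n] by blast
  qed
  then show "inc l i t \<in> ?H" using t gh(1) by auto
 qed
 then show "carrier (T l) \<subseteq> ?I"
  unfolding graded_tensor_def quotient_module.quot_carrier[OF Tq] by (auto simp: graded_tensor_sum_def)
qed

abbreviation "Q l \<equiv> quot_mod (Pc l) (PJ l)"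
abbreviation "pq l p \<equiv> PJ l +>\<^bsub>Pc l\<^esub> p"

lemma pq_linear: "l \<in> G ==> linear_map K (Pc l) (Q l) (pq l)"
 by (intro linear_mapI P_module quotient_module.module_quot[OF Pq] quotient_module.linear_coset[OF Pq])

text \<open>The pairing that sends \<open>p\<close> and the class of \<open>a\<close> to the class
  of \<open>p a\<close> modulo \<open>PJ\<close>; changing \<open>a\<close> by an element of
  \<open>J\<close> changes \<open>p a\<close> by one of \<open>PJ\<close>.\<close>

definition \<psi> where "\<psi> l g h p n = the_elem ((%a. pq l (act g h p a)) ` n)"

lemma \<psi>_lift:
 assumes gh: "g \<in> G" "h \<in> G" "g + h = l" and p: "p \<in>. Pc g"
 shows "a \<in>. Lc h ==> \<psi> l g h p (co h a) = pq l (act g h p a)"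
  and "K_linear K (gm_comp N h) (Q l) (\<psi> l g h p)"
proof -
 have l: "l \<in> G" using gh G_add by blast
 have lin: "linear_map K (Lc h) (Q l) (%a. pq l (act g h p a))"
  using K_linear_comp[OF act_linear_r[OF gh(1,2) p], of "Q l" "pq l"] linear_map.linear[OF pq_linear[OF l]] gh(3)
  by (intro linear_mapI L_module gh quotient_module.module_quot[OF Pq] l) simp
 have z: "pq l (act g h p j) = zero (Q l)" if "j \<in> J h" for j
  using quotient_module.coset_zero_iff[OF Pq[OF l]] PJ_sub(2)[OF l gh p that] act_closed[OF gh(1,2) p J_closed[OF gh(2) that]] gh(3) by simp
 show "a \<in>. Lc h ==> \<psi> l g h p (co h a) = pq l (act g h p a)"
  unfolding \<psi>_def by (rule quot_lift(1)[OF Lq[OF gh(2)] lin z])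
 show "K_linear K (gm_comp N h) (Q l) (\<psi> l g h p)"
  unfolding \<psi>_def[abs_def] N_comp by (rule linear_map.linear[OF quot_lift(2)[OF Lq[OF gh(2)] lin z]])
qed

lemma \<psi>_linear_l:
 assumes gh: "g \<in> G" "h \<in> G" "g + h = l" and n: "n \<in>. gm_comp N h"
 shows "K_linear K (Pc g) (Q l) (%p. \<psi> l g h p n)"
proof -
 have l: "l \<in> G" using gh G_add by blast
 obtain a where a: "a \<in>. Lc h" "n = co h a" using n gh by (auto simp: N_comp co_carrier)
 have "K_linear K (Pc g) (Q l) (%p. pq l (act g h p a))"
  using K_linear_comp[OF act_linear_l[OF gh(1,2) a(1)], of "Q l" "pq l"] linear_map.linear[OF pq_linear[OF l]] gh(3) by simp
 then show ?thesis
  by (rule K_linear_cong[rotated 2]) (use \<psi>_lift(1)[OF gh _ a(1)] a(2) P_module gh in auto)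
qed

text \<open>One inclusion holds since elements of \<open>J\<close> are zero in the quotient. For the
  other, \<open>\<psi>\<close> extends to a map \<open>\<Theta>\<close> on the direct sum of tensor
  products that respects the relations and sends the representative of \<open>\<tau> p\<close> to
  the class of \<open>p\<close>.\<close>

lemma \<tau>_kernel:
 assumes l: "l \<in> G" and p: "p \<in>. Pc l"
 shows "\<tau> l p = zero (T l) \<longleftrightarrow> p \<in> PJ l"
proof
 interpret t: linear_map K "Pc l" "T l" "\<tau> l" by (rule \<tau>_linear[OF l])
 assume "p \<in> PJ l"
 moreover have "PJ l \<subseteq> {p \<in> carrier (Pc l). \<tau> l p = zero (T l)}"
  unfolding PJ_def
 proof (rule mod_span_subset[OF t.kernel_submodule], rule subsetI)
  fix q assume "q \<in> {act g h p j |g h p j. g \<in> G & h \<in> G & g + h = l & p \<in>. Pc g & j \<in> J h}"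
  then obtain g h p j where q: "q = act g h p j" and gh: "g \<in> G" "h \<in> G" "g + h = l"
   and p: "p \<in>. Pc g" and j: "j \<in> J h" by blast
  note jc = J_closed[OF gh(2) j]
  have "co h j = zero (gm_comp N h)" unfolding N_comp using quotient_module.coset_zero_iff[OF Lq[OF gh(2)] jc] j by simp
  then have "pu g h p (co h j) = zero (tensor K (Pc g) (gm_comp N h))"
   using linear_map.zero[OF linear_mapI[OF N_module tensor_pair.module_tensor[OF tp] tensor_pair.pure_linear_r[OF tp]]] gh p by simp
  then have "cl l (inc l (g, h) (pu g h p (co h j))) = zero (T l)"
   using linear_map.zero[OF inc_linear[OF gh]] linear_map.zero[OF cl_linear] by simp
  then have "\<tau> l q = zero (T l)"
   using pure_to_\<tau>[OF gh p jc] q by simp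
  then show "q \<in> {p \<in> carrier (Pc l). \<tau> l p = zero (T l)}"
   using act_closed[OF gh(1,2) p jc] gh(3) q by simp
 qed
 ultimately show "\<tau> l p = zero (T l)" by blast
next
 assume t0: "\<tau> l p = zero (T l)"
 have Qm: "Module.module K (Q l)" by (rule quotient_module.module_quot[OF Pq[OF l]])
 define \<theta> where "\<theta> = (%(g, h) X. the_elem (lin_ext K (carrier (Pc g) \<times> carrier (gm_comp N h)) (Q l) (%(a, b). \<psi> l g h a b) ` X))"
 have \<theta>: "linear_map K (tensor_parts K P N (g, h)) (Q l) (\<theta> (g, h))"
   "!!m n. m \<in>. Pc g ==> n \<in>. gm_comp N h ==> \<theta> (g, h) (pu g h m n) = \<psi> l g h m n"
  if gh: "g \<in> G" "h \<in> G" "g + h = l" for g h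
  using tensor_pair.tensor_lift[OF tp[OF gh(1,2)] Qm \<psi>_linear_l[OF gh] \<psi>_lift(2)[OF gh]] by (simp_all add: \<theta>_def)
 define \<Theta> where "\<Theta> = sum_ext (deg_pairs G l) (tensor_parts K P N) (Q l) \<theta>"
 have \<theta>': "K_linear K (tensor_parts K P N i) (Q l) (\<theta> i)" if "i \<in> deg_pairs G l" for i
  using that linear_map.linear[OF \<theta>(1)] unfolding deg_pairs_def by (cases i) blast
 have \<Theta>: "linear_map K (TS l) (Q l) \<Theta>"
  unfolding \<Theta>_def graded_tensor_sum_def by (rule module_family.linear_map_sum_ext[OF TS_family Qm \<theta>'])
 interpret \<Theta>: linear_map K "TS l" "Q l" \<Theta> by (rule \<Theta>)
 have \<Theta>i: "\<Theta> (inc l (g, h) (pu g h m n)) = \<psi> l g h m n"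
  if gh: "g \<in> G" "h \<in> G" "g + h = l" and m: "m \<in>. Pc g" and n: "n \<in>. gm_comp N h" for g h m n
 proof -
  have "\<Theta> (inc l (g, h) (pu g h m n)) = \<theta> (g, h) (pu g h m n)"
   unfolding \<Theta>_def
   by (rule module_family.sum_ext_incl[OF TS_family Qm \<theta>'])
    (use gh tensor_pair.pure_closed[OF tp[OF gh(1,2)] m n] in "auto simp: deg_pairs_def")
  then show ?thesis using \<theta>(2)[OF gh m n] by simp
 qed
 \<comment> \<open>The balancing relations are respected because
   \<open>(m a) b = m (a b)\<close>.\<close>
 have "rel_set l \<subseteq> {u \<in> carrier (TS l). \<Theta> u = zero (Q l)}"
 proof
  fix u assume u: "u \<in> rel_set l"
  then obtain g h k m a n where gh: "g \<in> G" "h \<in> G" "k \<in> G" "g + h + k = l" and m: "m \<in>. Pc g"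
   and a: "a \<in>. Lc h" and n: "n \<in>. gm_comp N k" and ue: "u = rel_elt l g h k m a n"
   unfolding rel_set_def by blast
  obtain b where b: "b \<in>. Lc k" "n = co k b" using n gh by (auto simp: N_comp co_carrier)
  have e: "g + h \<in> G" "h + k \<in> G" "g + (h + k) = l" using gh G_add by (auto simp: add.assoc)
  have 1: "\<Theta> (inc l (g + h, k) (pu (g + h) k (act g h m a) n)) = pq l (act (g + h) k (act g h m a) b)"
   using \<Theta>i[OF e(1) gh(3,4) act_closed[OF gh(1,2) m a] n] \<psi>_lift(1)[OF e(1) gh(3,4) act_closed[OF gh(1,2) m a] b(1)] b(2) by simp
  have 2: "\<Theta> (inc l (g, h + k) (pu g (h + k) m (gm_act N k h n a))) = pq l (act g (h + k) m (ga_mult L h k a b))"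
   using \<Theta>i[OF gh(1) e(2,3) m N_act_closed[OF gh(3,2) a n]] left_act[OF gh(3,2) a b(1)]
    \<psi>_lift(1)[OF gh(1) e(2,3) m mult_closed[OF a b(1)]] b(2) by simp
  have "\<Theta> u = zero (Q l)"
   unfolding ue rel_elt_def \<Theta>.diff[OF rel_terms_closed[OF gh m a n]] 1 2
   using act_assoc[OF gh(1-3) m a b(1)] linear_map.closed[OF pq_linear[OF l]] act_closed[OF gh(1) e(2) m mult_closed[OF a b(1)]] e(3)
   by (simp add: \<Theta>.cod.diff_zero_iff)
  then show "u \<in> {u \<in> carrier (TS l). \<Theta> u = zero (Q l)}" using u rel_set_closed by blast
 qed
 then have rel: "\<Theta> u = zero (Q l)" if "u \<in> TR l" for u
  using mod_span_subset[OF \<Theta>.kernel_submodule] that unfolding TR_eq by blast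
 have ic: "inc l (l, 0) (pu l 0 p (co 0 (ga_one L))) \<in>. TS l"
  by (rule inc_closed) (use l G0 p one_N in auto)
 then have "inc l (l, 0) (pu l 0 p (co 0 (ga_one L))) \<in> TR l"
  using t0 quotient_module.coset_zero_iff[OF Tq ic] by (simp add: \<tau>_def graded_tensor_def)
 \<comment> \<open>The representative of \<open>\<tau> l p\<close> is a relation, so its image under
   \<open>\<Theta>\<close>, the class of \<open>p\<close>, is zero.\<close>
 then have "\<psi> l l 0 p (co 0 (ga_one L)) = zero (Q l)"
  using rel \<Theta>i[OF l G0 _ p one_N] by simp
 then have "pq l p = zero (Q l)" using \<psi>_lift(1)[OF l G0 _ p one_closed] act_one[OF l p] by simp
 then show "p \<in> PJ l" using quotient_module.coset_zero_iff[OF Pq[OF l] p] by simp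
qed

end

text \<open>The second part is naturality of \<open>\<tau>\<close>: under the identification with
  \<open>P/PJ\<close> the map on tensor products is the one induced by
  \<open>\<phi>\<close>.\<close>

lemma graded_tensor_map_linear:
 assumes P: "tensor_quotient K G L J P" and P': "tensor_quotient K G L J P'" and \<phi>: "graded_hom K G L 0 P P' \<phi>"
  and l: "l \<in> G"
 shows "linear_map K (graded_tensor K G L P (left_quot L J) l) (graded_tensor K G L P' (left_quot L J) l)
   (graded_tensor_map K G L P P' (left_quot L J) l \<phi>)"
  and "p \<in>. gm_comp P l ==> graded_tensor_map K G L P P' (left_quot L J) l \<phi> (tensor_quotient.\<tau> K G L J P l p) =
   tensor_quotient.\<tau> K G L J P' l (\<phi> l p)"
proof -
 interpret P: tensor_quotient K G L J P by fact
 interpret P': tensor_quotient K G L J P' by fact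
 have lin: "K_linear K (gm_comp P g) (gm_comp P' g) (\<phi> g)" if "g \<in> G" for g using \<phi> that by (simp add: graded_hom_0)
 define tm where "tm = (%(g, h). tensor_map K (gm_comp P g) (gm_comp P' g) (gm_comp P.N h) (\<phi> g))"
 define S where "S u = (\<lambda>i\<in>deg_pairs G l. tm i (u i))" for u
 have tml: "linear_map K (tensor_parts K P P.N i) (tensor_parts K P' P.N i) (tm i)" if "i \<in> deg_pairs G l" for i
  using tensor_map_linear(1)[OF P.P_module P.N_module P'.P_module lin] that unfolding deg_pairs_def tm_def by (cases i) auto
 have tmp: "tm (g, h) (P.pu g h m n) = P'.pu g h (\<phi> g m) n"
  if "g \<in> G" "h \<in> G" "m \<in>. gm_comp P g" "n \<in>. gm_comp P.N h" for g h m n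
  using tensor_map_linear(2)[OF P.P_module P.N_module P'.P_module lin] that unfolding tm_def by simp
 have S: "linear_map K (P.TS l) (P'.TS l) S"
 proof (rule linear_mapI[OF P.TS_module P'.TS_module])
  have fin: "finite {i \<in> deg_pairs G l. tm i (u i) \<noteq> (zero (tensor_parts K P' P.N i))}"
   if "finite {i \<in> deg_pairs G l. u i \<noteq> (zero (tensor_parts K P P.N i))}" for u
   by (rule finite_subset[OF _ that]) (use linear_map.zero[OF tml] in auto)
  have "S u \<in>. P'.TS l" if u: "u \<in>. P.TS l" for u
  proof -
   have "u i \<in>. tensor_parts K P P.N i" if "i \<in> deg_pairs G l" for i
    using u that PiE_mem unfolding graded_tensor_sum_def sum_mod_simps by blast
   then have "tm i (u i) \<in>. tensor_parts K P' P.N i" if "i \<in> deg_pairs G l" for i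
    using linear_map.closed[OF tml[OF that]] that by blast
   moreover have "{i \<in> deg_pairs G l. S u i \<noteq> (zero (tensor_parts K P' P.N i))} = {i \<in> deg_pairs G l. tm i (u i) \<noteq> (zero (tensor_parts K P' P.N i))}"
    by (auto simp: S_def)
   ultimately show ?thesis
    using fin[of u] u unfolding graded_tensor_sum_def sum_mod_simps by (simp add: S_def)
  qed
  moreover have "S (u \<oplus>\<^bsub>P.TS l\<^esub> v) = S u \<oplus>\<^bsub>P'.TS l\<^esub> S v" "k \<in>. K ==> S (k \<odot>\<^bsub>P.TS l\<^esub> u) = k \<odot>\<^bsub>P'.TS l\<^esub> S u"
   if u: "u \<in>. P.TS l" "v \<in>. P.TS l" for u v k
  proof -
   have c: "u i \<in>. tensor_parts K P P.N i" "v i \<in>. tensor_parts K P P.N i" if "i \<in> deg_pairs G l" for i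
    using u that PiE_mem unfolding graded_tensor_sum_def sum_mod_simps by blast+
   show "S (u \<oplus>\<^bsub>P.TS l\<^esub> v) = S u \<oplus>\<^bsub>P'.TS l\<^esub> S v"
    unfolding graded_tensor_sum_def sum_mod_simps S_def
    by (rule restrict_ext) (use linear_map.add[OF tml c] in simp)
   show "S (k \<odot>\<^bsub>P.TS l\<^esub> u) = k \<odot>\<^bsub>P'.TS l\<^esub> S u" if "k \<in>. K"
    unfolding graded_tensor_sum_def sum_mod_simps S_def
    by (rule restrict_ext) (use linear_map.smult[OF tml that c(1)] in simp)
  qed
  ultimately show "K_linear K (P.TS l) (P'.TS l) S" unfolding K_linear_def by blast
 qed
 interpret S: linear_map K "P.TS l" "P'.TS l" S by (rule S)
 have Si: "S (P.inc l (g, h) (P.pu g h m n)) = P'.inc l (g, h) (P'.pu g h (\<phi> g m) n)"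
  if gh: "g \<in> G" "h \<in> G" "g + h = l" and m: "m \<in>. gm_comp P g" and n: "n \<in>. gm_comp P.N h" for g h m n
  unfolding S_def sum_incl_def
  by (rule restrict_ext) (use linear_map.zero[OF tml] tmp[OF gh(1,2) m n] in auto)
 have \<phi>c: "\<phi> g m \<in>. gm_comp P' g" if "g \<in> G" "m \<in>. gm_comp P g" for g m
  using K_linear_closed[OF lin[OF that(1)] that(2)] .
 let ?f = "%u. P'.cl l (S u)"
 have f: "linear_map K (P.TS l) (P'.T l) ?f"
  by (intro linear_mapI P.TS_module P'.T_module K_linear_comp[OF S.linear linear_map.linear[OF P'.cl_linear]])
 have "P.rel_set l \<subseteq> {u \<in> carrier (P.TS l). ?f u = zero (P'.T l)}"
 proof
  fix u assume u: "u \<in> P.rel_set l"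
  then obtain g h k m a n where gh: "g \<in> G" "h \<in> G" "k \<in> G" "g + h + k = l" and m: "m \<in>. gm_comp P g"
   and a: "a \<in>. ga_comp L h" and n: "n \<in>. gm_comp P.N k" and ue: "u = P.rel_elt l g h k m a n"
   unfolding P.rel_set_def by blast
  have e: "g + h \<in> G" "h + k \<in> G" "g + (h + k) = l" using gh P.G_add by (auto simp: add.assoc)
  have pa: "\<phi> (g + h) (gm_act P g h m a) = gm_act P' g h (\<phi> g m) a" using \<phi> gh m a unfolding graded_hom_0 by blast
  \<comment> \<open>Linearity of \<open>\<phi>\<close> over the algebra turns a balancing relation
    for \<open>m\<close> into the one for \<open>\<phi> m\<close>.\<close>
  have "S u = P'.rel_elt l g h k (\<phi> g m) a n"
   unfolding ue P.rel_elt_def S.diff[OF P.rel_terms_closed[OF gh m a n]] P'.rel_elt_def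
    Si[OF e(1) gh(3,4) P.act_closed[OF gh(1,2) m a] n] Si[OF gh(1) e(2,3) m P.N_act_closed[OF gh(3,2) a n]] pa ..
  then have "S u \<in> P'.TR l" using P'.TR_sub(2) gh \<phi>c[OF gh(1) m] a n unfolding P'.rel_set_def by blast
  moreover have uc: "u \<in>. P.TS l" using u P.rel_set_closed by blast
  ultimately show "u \<in> {u \<in> carrier (P.TS l). ?f u = zero (P'.T l)}"
   using quotient_module.coset_zero_iff[OF P'.Tq S.closed[OF uc]] unfolding graded_tensor_def by blast
 qed
 then have rel: "?f u = zero (P'.T l)" if "u \<in> P.TR l" for u
  using mod_span_subset[OF linear_map.kernel_submodule[OF f]] that unfolding P.TR_eq by blast
 have map_eq: "graded_tensor_map K G L P P' P.N l \<phi> = (%X. the_elem (?f ` X))"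
  unfolding graded_tensor_map_def S_def tm_def by (simp add: case_prod_unfold cong: restrict_cong)
 show "linear_map K (P.T l) (P'.T l) (graded_tensor_map K G L P P' P.N l \<phi>)"
  unfolding map_eq graded_tensor_def[of K G L P] by (rule quot_lift(2)[OF P.Tq f rel])
 show "graded_tensor_map K G L P P' P.N l \<phi> (P.\<tau> l p) = P'.\<tau> l (\<phi> l p)" if p: "p \<in>. gm_comp P l"
 proof -
  have "P.inc l (l, 0) (P.pu l 0 p (P.co 0 (ga_one L))) \<in>. P.TS l"
   by (rule P.inc_closed) (use l P.G0 p P.one_N in auto)
  from quot_lift(1)[OF P.Tq f rel this] show ?thesis
   unfolding map_eq P.\<tau>_def P'.\<tau>_def using Si[OF l P.G0 _ p P.one_N] by simp
 qed
qed

subsection \<open>Homomorphisms out of a quotient of the algebra\<close>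

lemma hom_mod_simps:
 "f \<in>. hom_mod K A B \<longleftrightarrow> f \<in> carrier A \<rightarrow>\<^sub>E carrier B & K_linear K A B f"
 "zero (hom_mod K A B) = (\<lambda>x\<in>carrier A. (zero B))"
 "f \<oplus>\<^bsub>hom_mod K A B\<^esub> g = (\<lambda>x\<in>carrier A. f x \<oplus>\<^bsub>B\<^esub> g x)"
 "k \<odot>\<^bsub>hom_mod K A B\<^esub> f = (\<lambda>x\<in>carrier A. k \<odot>\<^bsub>B\<^esub> f x)"
 by (simp_all add: hom_mod_def prod_mod_def)

lemma module_hom_mod:
 assumes A: "Module.module K A" and B: "Module.module K B"
 shows "Module.module K (hom_mod K A B)"
proof -
 interpret B: Module.module K B by fact
 have fam: "module_family K (carrier A) (%_. B)" by (simp add: module_family_def B B.R.is_cring)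
 interpret P: Module.module K "prod_mod (carrier A) (%_. B)" by (rule module_family.module_prod[OF fam])
 have r: "K_linear K A B (restrict f (carrier A))" if "K_linear K A B f" for f
  by (rule K_linear_cong[OF _ A that]) simp
 have "submodule {f \<in> carrier A \<rightarrow>\<^sub>E carrier B. K_linear K A B f} K (prod_mod (carrier A) (%_. B))"
 proof (rule P.submoduleI')
  fix f g assume f: "f \<in> {f \<in> carrier A \<rightarrow>\<^sub>E carrier B. K_linear K A B f}" and g: "g \<in> {f \<in> carrier A \<rightarrow>\<^sub>E carrier B. K_linear K A B f}"
  have "f \<oplus>\<^bsub>prod_mod (carrier A) (%_. B)\<^esub> g \<in>. prod_mod (carrier A) (%_. B)"
   by (rule P.M.a_closed) (use f g in "auto simp: prod_mod_simps")
  then show "f \<oplus>\<^bsub>prod_mod (carrier A) (%_. B)\<^esub> g \<in> {f \<in> carrier A \<rightarrow>\<^sub>E carrier B. K_linear K A B f}"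
   using f g by (simp add: prod_mod_simps r K_linear_add_map[OF B])
 next
  fix k f assume k: "k \<in>. K" and f: "f \<in> {f \<in> carrier A \<rightarrow>\<^sub>E carrier B. K_linear K A B f}"
  have "k \<odot>\<^bsub>prod_mod (carrier A) (%_. B)\<^esub> f \<in>. prod_mod (carrier A) (%_. B)"
   by (rule P.smult_closed) (use f k in "auto simp: prod_mod_simps")
  then show "k \<odot>\<^bsub>prod_mod (carrier A) (%_. B)\<^esub> f \<in> {f \<in> carrier A \<rightarrow>\<^sub>E carrier B. K_linear K A B f}"
   using f k by (simp add: prod_mod_simps r K_linear_smult_map[OF B])
 qed (auto simp: prod_mod_simps intro!: r[of "%x. (zero B)"] K_linear_zero_map B)
 from submodule_module[OF P.module_axioms this] show ?thesis by (simp add: hom_mod_def)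
qed

context tensor_quotient
begin

abbreviation "S \<equiv> right_quot L J"
abbreviation "H l \<equiv> graded_Hom K G L S P l"

text \<open>Evaluation at the class of the unit, which generates \<open>L/J\<close>.\<close>

definition "ev \<phi> = \<phi> 0 (co 0 (ga_one L))"

lemma S_comp: "gm_comp S g = quot_mod (Lc g) (J g)"
 by (simp add: right_quot_def)

lemma S_module: "g \<in> G ==> Module.module K (gm_comp S g)"
 unfolding S_comp by (rule quotient_module.module_quot[OF Lq])

lemma S_cases:
 assumes "g \<in> G" "s \<in>. gm_comp S g" obtains a where "a \<in>. Lc g" "s = co g a"
 using assms by (auto simp: S_comp co_carrier)

lemma co_closed: "g \<in> G ==> a \<in>. Lc g ==> co g a \<in>. gm_comp S g"
 by (simp add: S_comp co_carrier)

lemma S_act_closed: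
 assumes "g \<in> G" "h \<in> G" "s \<in>. gm_comp S g" "a \<in>. Lc h"
 shows "gm_act S g h s a \<in>. gm_comp S (g + h)"
 using assms(3) right_act[OF assms(1,2,4)] co_closed[OF G_add[OF assms(1,2)] mult_closed[OF _ assms(4)]]
 by (auto elim!: S_cases[OF assms(1)])

lemma H_simps:
 "\<phi> \<in>. H l \<longleftrightarrow> \<phi> \<in> (\<Pi>\<^sub>E g\<in>G. carrier (gm_comp S g) \<rightarrow>\<^sub>E carrier (Pc (g + l))) & graded_hom K G L l S P \<phi>"
 "zero (H l) = (\<lambda>g\<in>G. \<lambda>s\<in>carrier (gm_comp S g). (zero (Pc (g + l))))"
 "\<phi> \<oplus>\<^bsub>H l\<^esub> \<chi> = (\<lambda>g\<in>G. \<lambda>s\<in>carrier (gm_comp S g). \<phi> g s \<oplus>\<^bsub>Pc (g + l)\<^esub> \<chi> g s)"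
 "k \<odot>\<^bsub>H l\<^esub> \<phi> = (\<lambda>g\<in>G. \<lambda>s\<in>carrier (gm_comp S g). k \<odot>\<^bsub>Pc (g + l)\<^esub> \<phi> g s)"
 by (auto simp: graded_Hom_def prod_mod_def hom_mod_def graded_hom_def PiE_iff)

text \<open>Elements of graded Hom are extensional both in the degree and in the argument; this
  brings a homomorphism given by a formula into that form.\<close>

lemma H_restrict:
 assumes l: "l \<in> G" and lin: "!!g. g \<in> G ==> K_linear K (gm_comp S g) (Pc (g + l)) (\<phi> g)"
  and act: "!!g h s a. g \<in> G ==> h \<in> G ==> s \<in>. gm_comp S g ==> a \<in>. Lc h ==>
   \<phi> (g + h) (gm_act S g h s a) = act (g + l) h (\<phi> g s) a"
 shows "(\<lambda>g\<in>G. \<lambda>s\<in>carrier (gm_comp S g). \<phi> g s) \<in>. H l"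
 unfolding H_simps graded_hom_def
proof (intro conjI ballI)
 fix g assume g: "g \<in> G"
 show "K_linear K (gm_comp S g) (Pc (g + l)) ((\<lambda>g\<in>G. \<lambda>s\<in>carrier (gm_comp S g). \<phi> g s) g)"
  by (rule K_linear_cong[OF _ S_module[OF g] lin[OF g]]) (simp add: g)
qed (use K_linear_closed[OF lin] act S_act_closed G_add in auto)

lemma HD:
 assumes "\<phi> \<in>. H l"
 shows "g \<in> G ==> K_linear K (gm_comp S g) (Pc (g + l)) (\<phi> g)"
  and "g \<in> G ==> h \<in> G ==> s \<in>. gm_comp S g ==> a \<in>. Lc h ==>
   \<phi> (g + h) (gm_act S g h s a) = act (g + l) h (\<phi> g s) a"
  and "\<phi> = (\<lambda>g\<in>G. \<lambda>s\<in>carrier (gm_comp S g). \<phi> g s)"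
proof -
 show "\<phi> = (\<lambda>g\<in>G. \<lambda>s\<in>carrier (gm_comp S g). \<phi> g s)"
 proof (rule extensional_eqI[of _ G])
  show "\<phi> \<in> extensional G" using assms by (auto simp: H_simps PiE_iff)
  fix g assume g: "g \<in> G"
  have "\<phi> g \<in> extensional (carrier (gm_comp S g))" using assms g by (auto simp: H_simps PiE_iff)
  then show "\<phi> g = (\<lambda>g\<in>G. \<lambda>s\<in>carrier (gm_comp S g). \<phi> g s) g" using g by (simp add: extensional_restrict)
 qed simp
qed (use assms in "auto simp: H_simps graded_hom_def")

lemma module_H:
 assumes l: "l \<in> G"
 shows "Module.module K (H l)"
proof -
 let ?A = "prod_mod G (%g. hom_mod K (gm_comp S g) (Pc (g + l)))"
 have P': "Module.module K (Pc (g + l))" if "g \<in> G" for g by (rule P_module[OF G_add[OF that l]])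
 interpret A: Module.module K ?A
  by (rule module_family.module_prod) (simp add: module_family_def cring_K module_hom_mod S_module P')
 have "submodule (carrier (H l)) K ?A"
 proof (rule A.submoduleI')
  show "carrier (H l) \<subseteq> carrier ?A" by (auto simp: graded_Hom_def prod_mod_simps)
  have op: "zero ?A = zero (H l)" "add ?A = add (H l)" "smult ?A = smult (H l)" by (simp_all add: graded_Hom_def)
  show "zero ?A \<in>. H l" unfolding op H_simps(2)
   by (rule H_restrict[OF l K_linear_zero_map[OF P']])
    (use linear_map.zero[OF linear_mapI[OF P' P_module act_linear_l]] l G_add in "simp_all add: add.assoc add.commute[of l] add.left_commute[of l]")
  fix \<phi> \<chi> k assume \<phi>: "\<phi> \<in>. H l"
  show "\<phi> \<oplus>\<^bsub>?A\<^esub> \<chi> \<in>. H l" if \<chi>: "\<chi> \<in>. H l" unfolding op H_simps(3)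
  proof (rule H_restrict[OF l K_linear_add_map[OF P' HD(1)[OF \<phi>] HD(1)[OF \<chi>]]])
   fix g h s a assume g: "g \<in> G" and h: "h \<in> G" and s: "s \<in>. gm_comp S g" and a: "a \<in>. Lc h"
   have e: "g + h + l = g + l + h" by simp
   show "\<phi> (g + h) (gm_act S g h s a) \<oplus>\<^bsub>Pc (g + h + l)\<^esub> \<chi> (g + h) (gm_act S g h s a) =
     act (g + l) h (\<phi> g s \<oplus>\<^bsub>Pc (g + l)\<^esub> \<chi> g s) a"
    unfolding e HD(2)[OF \<phi> g h s a] HD(2)[OF \<chi> g h s a]
    by (rule linear_map.add[OF linear_mapI[OF P'[OF g] P_module[OF G_add[OF G_add[OF g l] h]] act_linear_l[OF G_add[OF g l] h a]],
      OF K_linear_closed[OF HD(1)[OF \<phi> g] s] K_linear_closed[OF HD(1)[OF \<chi> g] s], symmetric])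
  qed
  show "k \<odot>\<^bsub>?A\<^esub> \<phi> \<in>. H l" if k: "k \<in>. K" unfolding op H_simps(4)
  proof (rule H_restrict[OF l K_linear_smult_map[OF P' k HD(1)[OF \<phi>]]])
   fix g h s a assume g: "g \<in> G" and h: "h \<in> G" and s: "s \<in>. gm_comp S g" and a: "a \<in>. Lc h"
   have e: "g + h + l = g + l + h" by simp
   show "k \<odot>\<^bsub>Pc (g + h + l)\<^esub> \<phi> (g + h) (gm_act S g h s a) =
     act (g + l) h (k \<odot>\<^bsub>Pc (g + l)\<^esub> \<phi> g s) a"
    unfolding e HD(2)[OF \<phi> g h s a]
    by (rule linear_map.smult[OF linear_mapI[OF P'[OF g] P_module[OF G_add[OF G_add[OF g l] h]] act_linear_l[OF G_add[OF g l] h a]],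
      OF k K_linear_closed[OF HD(1)[OF \<phi> g] s], symmetric])
  qed
 qed
 from submodule_module[OF A.module_axioms this] show ?thesis by (simp add: graded_Hom_def)
qed

lemma one_S: "co 0 (ga_one L) \<in>. gm_comp S 0"
 by (rule co_closed[OF G0 one_closed])

lemma ev_linear: assumes "l \<in> G" shows "linear_map K (H l) (Pc l) ev"
proof (rule linear_mapI[OF module_H[OF assms] P_module[OF assms]])
 have "ev \<phi> \<in>. Pc l" if "\<phi> \<in>. H l" for \<phi>
  using K_linear_closed[OF HD(1)[OF that G0] one_S] by (simp add: ev_def)
 then show "K_linear K (H l) (Pc l) ev"
  unfolding K_linear_def by (simp add: H_simps(3,4) ev_def G0 one_S)
qed

lemma ev_determines:
 assumes \<phi>: "\<phi> \<in>. H l" and g: "g \<in> G" and a: "a \<in>. Lc g"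
 shows "\<phi> g (co g a) = act l g (ev \<phi>) a"
 using HD(2)[OF \<phi> G0 g one_S a] right_act[OF G0 g a one_closed] one_left[OF a] by (simp add: ev_def)

lemma ev_inj: "inj_on ev (carrier (H l))"
proof (rule inj_onI)
 fix \<phi> \<chi> assume \<phi>: "\<phi> \<in>. H l" and \<chi>: "\<chi> \<in>. H l" and e: "ev \<phi> = ev \<chi>"
 have "\<phi> g s = \<chi> g s" if g: "g \<in> G" and s: "s \<in>. gm_comp S g" for g s
 proof -
  obtain a where a: "a \<in>. Lc g" "s = co g a" using S_cases[OF g s] .
  show ?thesis unfolding a(2) ev_determines[OF \<phi> g a(1)] ev_determines[OF \<chi> g a(1)] e ..
 qed
 then have "(\<lambda>g\<in>G. \<lambda>s\<in>carrier (gm_comp S g). \<phi> g s) = (\<lambda>g\<in>G. \<lambda>s\<in>carrier (gm_comp S g). \<chi> g s)"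
  by (intro restrict_ext)
 then show "\<phi> = \<chi>" using HD(3)[OF \<phi>] HD(3)[OF \<chi>] by simp
qed

text \<open>A homomorphism is determined by its value \<open>i\<close> at the unit, and
  \<open>i\<close> must be killed by \<open>J\<close> since \<open>J\<close> is zero in the source.
  Conversely such an \<open>i\<close> defines the homomorphism sending the class of \<open>a\<close>
  to \<open>i a\<close>.\<close>

lemma ev_image:
 assumes l: "l \<in> G"
 shows "ev ` carrier (H l) = {i \<in> carrier (Pc l). \<forall>h\<in>G. \<forall>j\<in>J h. act l h i j = zero (Pc (l + h))}"
proof (intro subset_antisym subsetI)
 fix i assume "i \<in> ev ` carrier (H l)"
 then obtain \<phi> where \<phi>: "\<phi> \<in>. H l" and i: "i = ev \<phi>" by blast
 have "act l h i j = zero (Pc (l + h))" if h: "h \<in> G" and j: "j \<in> J h" for h j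
 proof -
  have jc: "j \<in>. Lc h" by (rule J_closed[OF h j])
  have "co h j = zero (gm_comp S h)" unfolding S_comp using quotient_module.coset_zero_iff[OF Lq[OF h] jc] j by simp
  then have "\<phi> h (co h j) = zero (Pc (h + l))"
   using linear_map.zero[OF linear_mapI[OF S_module[OF h] P_module[OF G_add[OF h l]] HD(1)[OF \<phi> h]]] by simp
  then show ?thesis using ev_determines[OF \<phi> h jc] i by (simp add: add.commute)
 qed
 then show "i \<in> {i \<in> carrier (Pc l). \<forall>h\<in>G. \<forall>j\<in>J h. act l h i j = zero (Pc (l + h))}"
  using linear_map.closed[OF ev_linear[OF l] \<phi>] i by simp
next
 fix i assume "i \<in> {i \<in> carrier (Pc l). \<forall>h\<in>G. \<forall>j\<in>J h. act l h i j = zero (Pc (l + h))}"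
 then have i: "i \<in>. Pc l" and z: "!!h j. h \<in> G ==> j \<in> J h ==> act l h i j = zero (Pc (l + h))" by auto
 have lin: "linear_map K (Lc g) (Pc (g + l)) (act l g i)" if g: "g \<in> G" for g
  using act_linear_r[OF l g i] by (intro linear_mapI L_module g P_module G_add l) (simp add: add.commute)
 \<comment> \<open>Multiplication of \<open>i\<close> from the right, on representatives; that
   \<open>i\<close> kills \<open>J\<close> makes it independent of them.\<close>
 define \<phi> where "\<phi> = (%g X. the_elem (act l g i ` X))"
 have \<phi>c: "\<phi> g (co g a) = act l g i a" if "g \<in> G" "a \<in>. Lc g" for g a
  unfolding \<phi>_def by (rule quot_lift(1)[OF Lq[OF that(1)] lin[OF that(1)] _ that(2)]) (use z[OF that(1)] in "simp add: add.commute")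
 let ?\<phi> = "\<lambda>g\<in>G. \<lambda>s\<in>carrier (gm_comp S g). \<phi> g s"
 have m: "?\<phi> \<in>. H l"
 proof (rule H_restrict[OF l])
  show "K_linear K (gm_comp S g) (Pc (g + l)) (\<phi> g)" if g: "g \<in> G" for g
   unfolding S_comp \<phi>_def by (rule linear_map.linear[OF quot_lift(2)[OF Lq[OF g] lin[OF g]]]) (use z[OF g] in "simp add: add.commute")
  fix g h s b assume g: "g \<in> G" and h: "h \<in> G" and s: "s \<in>. gm_comp S g" and b: "b \<in>. Lc h"
  obtain a where a: "a \<in>. Lc g" "s = co g a" using S_cases[OF g s] .
  show "\<phi> (g + h) (gm_act S g h s b) = act (g + l) h (\<phi> g s) b"
   unfolding a(2) right_act[OF g h b a(1)] \<phi>c[OF G_add[OF g h] mult_closed[OF a(1) b]] \<phi>c[OF g a(1)]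
   unfolding add.commute[of g l] by (rule act_assoc[OF l g h i a(1) b, symmetric])
 qed
 have "ev ?\<phi> = i" using \<phi>c[OF G0 one_closed] act_one[OF l i] one_S G0 by (simp add: ev_def)
 then show "i \<in> ev ` carrier (H l)" by (rule rev_image_eqI[OF m sym])
qed

end

lemma graded_Hom_map_linear:
 assumes P: "tensor_quotient K G L J P" and P': "tensor_quotient K G L J P'" and \<psi>: "graded_hom K G L 0 P P' \<psi>"
  and l: "l \<in> G"
 shows "linear_map K (graded_Hom K G L (right_quot L J) P l) (graded_Hom K G L (right_quot L J) P' l)
   (graded_Hom_map G (right_quot L J) l \<psi>)"
  and "\<phi> \<in>. graded_Hom K G L (right_quot L J) P l ==>
   tensor_quotient.ev L J (graded_Hom_map G (right_quot L J) l \<psi> \<phi>) = \<psi> l (tensor_quotient.ev L J \<phi>)"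
proof -
 interpret P: tensor_quotient K G L J P by fact
 interpret P': tensor_quotient K G L J P' by fact
 have lin: "linear_map K (gm_comp P (g + l)) (gm_comp P' (g + l)) (\<psi> (g + l))" if "g \<in> G" for g
  using \<psi> P.G_add[OF that l] by (intro linear_mapI P.P_module P'.P_module) (simp_all add: graded_hom_0)
 have cl: "graded_Hom_map G P.S l \<psi> \<phi> \<in>. P'.H l" if \<phi>: "\<phi> \<in>. P.H l" for \<phi>
  unfolding graded_Hom_map_def
 proof (rule P'.H_restrict[OF l K_linear_comp[OF P.HD(1)[OF \<phi>] linear_map.linear[OF lin]]])
  fix g h s a assume g: "g \<in> G" and h: "h \<in> G" and s: "s \<in>. gm_comp P.S g" and a: "a \<in>. ga_comp L h"
  have "\<psi> (g + l + h) (gm_act P (g + l) h (\<phi> g s) a) = gm_act P' (g + l) h (\<psi> (g + l) (\<phi> g s)) a"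
   using \<psi> P.G_add[OF g l] h K_linear_closed[OF P.HD(1)[OF \<phi> g] s] a unfolding graded_hom_0 by blast
  moreover have e: "g + h + l = g + l + h" by simp
  ultimately show "\<psi> (g + h + l) (\<phi> (g + h) (gm_act P.S g h s a)) = gm_act P' (g + l) h (\<psi> (g + l) (\<phi> g s)) a"
   unfolding P.HD(2)[OF \<phi> g h s a] e by blast
 qed
 show "linear_map K (P.H l) (P'.H l) (graded_Hom_map G P.S l \<psi>)"
 proof (rule linear_mapI[OF P.module_H[OF l] P'.module_H[OF l]], unfold K_linear_def, intro conjI ballI)
  show "graded_Hom_map G P.S l \<psi> \<in> carrier (P.H l) \<rightarrow> carrier (P'.H l)" using cl by blast
  fix \<phi> assume \<phi>: "\<phi> \<in>. P.H l"
  note c = K_linear_closed[OF P.HD(1)]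
  show "graded_Hom_map G P.S l \<psi> (\<phi> \<oplus>\<^bsub>P.H l\<^esub> \<phi>') = graded_Hom_map G P.S l \<psi> \<phi> \<oplus>\<^bsub>P'.H l\<^esub> graded_Hom_map G P.S l \<psi> \<phi>'"
   if \<phi>': "\<phi>' \<in>. P.H l" for \<phi>'
   unfolding P.H_simps(3) P'.H_simps(3) graded_Hom_map_def
   by (intro restrict_ext) (simp add: linear_map.add[OF lin c[OF \<phi>] c[OF \<phi>']])
  show "graded_Hom_map G P.S l \<psi> (k \<odot>\<^bsub>P.H l\<^esub> \<phi>) = k \<odot>\<^bsub>P'.H l\<^esub> graded_Hom_map G P.S l \<psi> \<phi>" if "k \<in>. K" for k
   unfolding P.H_simps(4) P'.H_simps(4) graded_Hom_map_def
   by (intro restrict_ext) (simp add: linear_map.smult[OF lin that c[OF \<phi>]])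
 qed
 show "P.ev (graded_Hom_map G P.S l \<psi> \<phi>) = \<psi> l (P.ev \<phi>)" if "\<phi> \<in>. P.H l"
  using P.G0 P.one_S by (simp add: P.ev_def graded_Hom_map_def)
qed

section \<open>Magnitude homology as Tor and Ext\<close>

lemma (in dist_space) algebra_ideal: "algebra_ideal K G \<Lambda> JX"
 by (intro algebra_ideal.intro cring_K G_0 G_add module_ga ga_mult_linear_r ga_mult_linear_l ga_one_closed
   ga_one_right ga_one_left dist_ideal_eq(2)[OF G_0])

lemma (in dist_space) path_deg_pair: "pdeg [x, y] = dr x y"
 by (simp add: path_length_def)

lemma (in dist_space) tuples_1: "tup (Suc 0) = {[x, y] | x y. x \<in> X & y \<in> X & fin x y}"
 by (auto simp: tuples_def length_Suc_conv path_length_def)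

lemma (in dist_space) dist_ideal_0: "h \<in> G ==> j \<in> JX h ==> h = 0 ==> j = zero (Lam h)"
 using dist_ideal_eq(1)[of h] by simp

lemma (in dist_space) ee_dist_ideal:
 assumes "x \<in> X" "y \<in> X" "fin x y" "x \<noteq> y"
 shows "dr x y \<noteq> 0" "ee x y \<in> JX (dr x y)"
proof -
 show "dr x y \<noteq> 0"
  using pairsI[OF assms(1-3)] pairs_0 assms(4) by auto
 then show "ee x y \<in> JX (dr x y)"
  using dist_ideal_eq(1)[OF dist_G[OF assms(1-3)]] basis_ga[OF pairsI[OF assms(1-3)]] by simp
qed

section \<open>The differentials next to degree 0\<close>

context dist_mod
begin

lemma MC_bd_pair:
 assumes l: "l \<in> G" and xy: "x \<in> X" "y \<in> X" "fin x y" and m: "m \<in>. Mc x (l - dr x y)"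
 shows "del M l 0 (elt l 1 [x, y] m) =
  elt l 0 [y] (Mm x y (l - dr x y) m) \<ominus>\<^bsub>Ch M l 0\<^esub> (if x = y then elt l 0 [x] m else zero (Ch M l 0))"
proof -
 interpret A: alt_module K "Ch M l 0" by (simp add: alt_module_def module_MC l)
 have t: "[x, y] \<in> tup (Suc 0)" using xy by (auto simp: tuples_1)
 have m': "m \<in>. MCp M l [x, y]" using m by (simp add: path_deg_pair)
 have F: "Face l 0 i (elt l (Suc 0) [x, y] m) = face M l 0 i [x, y] m" if "i <= 1" for i
  using Face_elt[OF l _ t m'] that by simp
 have c: "face M l 0 i [x, y] m \<in>. Ch M l 0" if "i <= 1" for i
  using K_linear_closed[OF linear_MC_face[OF l t] m'] that by simp
 have "del M l 0 (elt l 1 [x, y] m) = face M l 0 0 [x, y] m \<ominus>\<^bsub>Ch M l 0\<^esub> face M l 0 1 [x, y] m"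
  unfolding MC_bd_eq by (simp add: A.alt_sum_Suc2 A.alt_sum_0 F c)
 then show ?thesis by (simp add: MC_face_def omit_def path_deg_pair)
qed

lemma coMC_cobd_pair:
 assumes l: "l \<in> G" and a: "\<alpha> \<in>. CoCh M l 0" and xy: "x \<in> X" "y \<in> X" "fin x y"
 shows "codel M l 0 \<alpha> [x, y] =
  (if x = y then \<alpha> [y] else zero (Mc y (- l + dr x y))) \<ominus>\<^bsub>Mc y (- l + dr x y)\<^esub> Mm x y (- l) (\<alpha> [x])"
proof -
 interpret A: alt_module K "CoCh M l (Suc 0)" by (simp add: alt_module_def module_coMC l)
 have t: "[x, y] \<in> tup (Suc 0)" using xy by (auto simp: tuples_1)
 have c: "coface M l 0 i \<alpha> \<in>. CoCh M l (Suc 0)" if "i <= 1" for i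
  using linear_map.closed[OF linear_map_coface[OF l] a] that by simp
 have P: "linear_map K (CoCh M l (Suc 0)) (coMCp M l [x, y]) (\<lambda>\<alpha>. \<alpha> [x, y])"
  unfolding coMC_def by (rule module_family.linear_map_proj[OF coMC_family[OF l] t])
 have "codel M l 0 \<alpha> = coface M l 0 0 \<alpha> \<ominus>\<^bsub>CoCh M l (Suc 0)\<^esub> coface M l 0 1 \<alpha>"
  unfolding coMC_cobd_def by (simp add: A.alt_sum_Suc2 A.alt_sum_0 c)
 then have "codel M l 0 \<alpha> [x, y] = coface M l 0 0 \<alpha> [x, y]
   \<ominus>\<^bsub>coMCp M l [x, y]\<^esub> coface M l 0 1 \<alpha> [x, y]"
  using linear_map.diff[OF P c c, of 0 1] by simp
 then show ?thesis using t by (simp add: coMC_coface_def omit_def path_deg_pair path_length_def[of d "[x]"])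
qed

end

section \<open>Degree 0: \<open>P \<otimes> S\<close> as a cokernel and \<open>Hom(S, P)\<close> as
  a kernel\<close>

context right_mod
begin

sublocale T: tensor_quotient K G \<Lambda> JX P
 by (intro tensor_quotient.intro tensor_quotient_axioms.intro algebra_ideal right_graded)

lemma elt_MC_0: "l \<in> G ==> z \<in> X ==> p \<in>. dm_comp vtx z l ==> V.elt l 0 [z] p \<in>. Ch vtx l 0"
 using K_linear_closed[OF V.linear_elt, of l "[z]" 0 p] by (simp add: tuples_0 path_length_def)

lemma total_elt:
 assumes l: "l \<in> G" and z: "z \<in> X" and p: "p \<in>. dm_comp vtx z l"
 shows "total l (V.elt l 0 [z] p) = p"
proof -
 interpret M: Module.module K "Pc l" by (rule gm_module[OF l])
 have pc: "p \<in>. Pc l" using p by (simp add: vertex_simps)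
 have "total l (V.elt l 0 [z] p) = (\<Oplus>\<^bsub>Pc l\<^esub>x\<in>X. if z = x then p else zero (Pc l))"
  unfolding total_def by (rule M.M.finsum_cong') (use pc in "auto simp: sum_incl_def tuples_0 vertex_simps")
 also have "... = p" by (rule M.M.finsum_singleton) (use z finite_X pc in auto)
 finally show ?thesis .
qed

lemma spread_vertex: "l \<in> G ==> z \<in> X ==> p \<in>. dm_comp vtx z l ==> spread l p = V.elt l 0 [z] p"
 using spread_total[OF _ elt_MC_0, of l z p] by (simp add: total_elt)

text \<open>Both sides are spanned by the products \<open>p (x, y)\<close> with
  \<open>x \<noteq> y\<close>: on the left because outside degree 0 the algebra is spanned by such
  pairs, on the right because they are the boundaries of 1-chains. Chains at \<open>(x, x)\<close>
  contribute nothing.\<close>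

lemma PJ_eq: assumes l: "l \<in> G" shows "T.PJ l = total l ` del vtx l 0 ` carrier (Ch vtx l 1)"
proof
 interpret t: linear_map K "Ch vtx l 0" "Pc l" "total l" by (rule total_linear[OF l])
 interpret s: linear_map K "Pc l" "Ch vtx l 0" "spread l" by (rule spread_linear[OF l])
 interpret b: linear_map K "Ch vtx l 1" "Ch vtx l 0" "del vtx l 0"
  using V.linear_map_MC_bd[OF l, of 0] by simp
 let ?B = "del vtx l 0 ` carrier (Ch vtx l 1)"
 have B: "submodule ?B K (Ch vtx l 0)" by (rule b.image_submodule[OF b.dom.carrier_is_submodule])
 let ?H = "{p \<in> carrier (Pc l). spread l p \<in> ?B}"
 have H: "submodule ?H K (Pc l)" by (rule s.vimage_submodule[OF B])
 have zB: "zero (Pc l) \<in> ?H" using H by (simp add: submodule_def subgroup_def)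
 \<comment> \<open>The 1-chain with this boundary has the coefficient \<open>p e_x\<close> at
   \<open>[x, y]\<close>; its last face vanishes as the points differ.\<close>
 have edge: "A x y g p \<in> ?H" if x: "x \<in> X" "y \<in> X" "fin x y" "x \<noteq> y" and g: "g \<in> G" "g + dr x y = l"
  and p: "p \<in>. Pc g" for x y g p
 proof -
  have ge: "l - dr x y = g" using g(2) by simp
  have q: "A x y g p \<in>. dm_comp vtx y l" using A_vertex[OF x(1-3) g(1) p] g(2) by simp
  have m: "A x x g p \<in>. dm_comp vtx x g" by (rule A_self_vertex[OF x(1) g(1) p])
  have "A x y g (A x x g p) = A x y g p"
   using A_comp[OF x(1,1) _ x(1-3) g(1) p] x between_refl by (simp add: dist_self)
  then have "del vtx l 0 (V.elt l 1 [x, y] (A x x g p)) = V.elt l 0 [y] (A x y g p) \<ominus>\<^bsub>Ch vtx l 0\<^esub> (zero (Ch vtx l 0))"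
   using V.MC_bd_pair[OF l x(1-3), unfolded ge, OF m] x(4) by (simp add: vertex_simps)
  also have "... = spread l (A x y g p)"
   unfolding spread_vertex[OF l x(2) q] using elt_MC_0[OF l x(2) q] by (simp add: a_minus_def)
  finally have "spread l (A x y g p) = del vtx l 0 (V.elt l 1 [x, y] (A x x g p))" by simp
  moreover have "V.elt l 1 [x, y] (A x x g p) \<in>. Ch vtx l 1"
   by (rule K_linear_closed[OF V.linear_elt[OF l]]) (use x m ge in "auto simp: tuples_1 path_deg_pair")
  ultimately show ?thesis using q by (simp add: vertex_simps)
 qed
 have "act g h p j \<in> ?H" if gh: "g \<in> G" "h \<in> G" "g + h = l" and p: "p \<in>. Pc g" and j: "j \<in> JX h" for g h p j
 proof -
  interpret a: linear_map K "Lam h" "Pc l" "act g h p"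
   using act_linear_r[OF gh(1,2) p] gh(3) by (intro linear_mapI module_ga gm_module l) simp
  show ?thesis
  proof (cases "h = 0")
   case True
   then show ?thesis using dist_ideal_0[OF gh(2) j True] a.zero zB by simp
  next
   case False
   \<comment> \<open>For \<open>h \<noteq> 0\<close> every pair of degree \<open>h\<close> has
     distinct points, so \<open>edge\<close> covers all basis elements.\<close>
   have "carrier (free_mod K (prs h)) \<subseteq> {a \<in> carrier (Lam h). act g h p a \<in> ?H}"
   proof (rule free_module.free_span[OF free_module_K])
    show "submodule {a \<in> carrier (Lam h). act g h p a \<in> ?H} K (free_mod K (prs h))"
     using a.vimage_submodule[OF H] by (simp add: ga_comp)
    fix q assume q: "q \<in> prs h"
    then obtain x y where xy: "q = (x, y)" "x \<in> X" "y \<in> X" "fin x y" "h = dr x y" by (auto simp: pairs_def)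
    then have "x \<noteq> y" using False by (auto simp: dist_self)
    then show "basis_elt K (prs h) q \<in> {a \<in> carrier (Lam h). act g h p a \<in> ?H}"
     using edge[OF xy(2-4) _ gh(1) _ p] basis_ga[OF q] gh(3) xy(1,5) by simp
   qed
   then show ?thesis using T.J_closed[OF gh(2) j] by (auto simp: ga_comp)
  qed
 qed
 then have "T.PJ l \<subseteq> ?H" unfolding T.PJ_def by (intro mod_span_subset[OF H] subsetI) blast
 then show "T.PJ l \<subseteq> total l ` ?B" using total_spread[OF l] by (force simp: image_iff)
 have PJ0: "zero (Pc l) \<in> T.PJ l" using T.PJ_sub(1)[OF l] by (simp add: submodule_def subgroup_def)
 have K: "submodule {c \<in> carrier (Ch vtx l 1). total l (del vtx l 0 c) \<in> T.PJ l} K (Ch vtx l 1)"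
  by (rule linear_map.vimage_submodule[OF linear_mapI[OF b.dom.module_axioms gm_module[OF l] K_linear_comp[OF b.linear t.linear]] T.PJ_sub(1)[OF l]])
 have "carrier (sum_mod (tup 1) (MCp vtx l)) \<subseteq> {c \<in> carrier (Ch vtx l 1). total l (del vtx l 0 c) \<in> T.PJ l}"
 proof (rule module_family.sum_span[OF V.MC_family[OF l]])
  fix xs m assume xs: "xs \<in> tup 1" and m: "m \<in>. MCp vtx l xs"
  obtain x y where xy: "xs = [x, y]" "x \<in> X" "y \<in> X" "fin x y" using xs by (auto simp: tuples_1)
  let ?g = "l - dr x y"
  have g: "?g \<in> G" by (intro G_diff l dist_G xy)
  have m': "m \<in>. dm_comp vtx x ?g" using m by (simp add: xy path_deg_pair)
  have q: "A x y ?g m \<in>. dm_comp vtx y l" using A_vertex[OF xy(2-4) g, of m] m' by (simp add: vertex_simps)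
  have eq: "total l (del vtx l 0 (V.elt l 1 [x, y] m)) =
   total l (V.elt l 0 [y] (A x y ?g m) \<ominus>\<^bsub>Ch vtx l 0\<^esub> (if x = y then V.elt l 0 [x] m else zero (Ch vtx l 0)))"
   using V.MC_bd_pair[OF l xy(2-4) m'] by (simp add: vertex_simps)
  have "total l (del vtx l 0 (V.elt l 1 [x, y] m)) \<in> T.PJ l"
  proof (cases "x = y")
   \<comment> \<open>Both faces of \<open>[x, x]\<close> give the same chain and cancel.\<close>
   case True
   then have "A x y ?g m = m" using m' xy by (simp add: dist_self vertex_simps)
   then show ?thesis unfolding eq using True elt_MC_0[OF l xy(3) q] PJ0 by (simp add: a_minus_def t.dom.M.r_neg t.zero)
  next
   case False
   have "total l (del vtx l 0 (V.elt l 1 [x, y] m)) = A x y ?g m"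
    unfolding eq using False elt_MC_0[OF l xy(3) q] total_elt[OF l xy(3) q] by (simp add: a_minus_def)
   then show ?thesis
    using T.PJ_sub(2)[OF l g dist_G[OF xy(2-4)] _ _ ee_dist_ideal(2)[OF xy(2-4) False], of m] m' by (simp add: vertex_simps)
  qed
  then show "V.elt l 1 xs m \<in> {c \<in> carrier (Ch vtx l 1). total l (del vtx l 0 c) \<in> T.PJ l}"
   using K_linear_closed[OF V.linear_elt[OF l xs] m] xy(1) by simp
 qed (use K in "simp add: MC_def")
 then show "total l ` ?B \<subseteq> T.PJ l" by (auto simp: MC_def)
qed

definition "kap l c = T.\<tau> l (total l c)"

lemma kap_linear: "l \<in> G ==> linear_map K (Ch vtx l 0) (T.T l) (kap l)"
 unfolding kap_def[abs_def]
 by (intro linear_mapI V.module_MC T.T_module K_linear_comp[OF linear_map.linear[OF total_linear] linear_map.linear[OF T.\<tau>_linear]])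

lemma kap_surj: assumes l: "l \<in> G" shows "kap l ` carrier (Ch vtx l 0) = carrier (T.T l)"
proof -
 have "total l ` carrier (Ch vtx l 0) = carrier (Pc l)"
  using linear_map.closed[OF total_linear[OF l]] linear_map.closed[OF spread_linear[OF l]] total_spread[OF l] by (force simp: image_iff)
 then show ?thesis using T.\<tau>_surj[OF l] by (simp add: kap_def[abs_def] image_image[symmetric])
qed

text \<open>As \<open>total\<close> is a bijection, a chain with total in \<open>PJ\<close> is
  itself a boundary by \<open>PJ_eq\<close>.\<close>

lemma kap_ker:
 assumes l: "l \<in> G" and c: "c \<in>. Ch vtx l 0"
 shows "kap l c = zero (T.T l) \<longleftrightarrow> (\<exists>y\<in>carrier (Ch vtx l 1). del vtx l 0 y = c)"
proof -
 have bc: "del vtx l 0 y \<in>. Ch vtx l 0" if "y \<in>. Ch vtx l 1" for y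
  using linear_map.closed[OF V.linear_map_MC_bd[OF l, of 0]] that by simp
 have "kap l c = zero (T.T l) \<longleftrightarrow> total l c \<in> T.PJ l"
  unfolding kap_def by (rule T.\<tau>_kernel[OF l linear_map.closed[OF total_linear[OF l] c]])
 also have "... \<longleftrightarrow> (\<exists>y\<in>carrier (Ch vtx l 1). total l c = total l (del vtx l 0 y))"
  unfolding PJ_eq[OF l] by blast
 also have "... \<longleftrightarrow> (\<exists>y\<in>carrier (Ch vtx l 1). del vtx l 0 y = c)"
  using spread_total[OF l c] spread_total[OF l bc] by auto
 finally show ?thesis .
qed

text \<open>One-point tuples have length 0 and equal first and last points, and their number is
  finite. So \<open>total\<close> and \<open>spread\<close> serve for cochains too, with the sign of
  \<open>l\<close> reversed.\<close>

lemma coMC_0: "CoCh vtx l 0 = Ch vtx (- l) 0"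
proof -
 have "restrict f (tup 0) = restrict g (tup 0)" if "!!xs. xs \<in> tup 0 ==> f xs = g xs" for f g :: "_ => 'p"
  using that by (rule restrict_ext)
 moreover have "coMCp vtx l xs = MCp vtx (- l) xs" if "xs \<in> tup 0" for xs
  using that by (auto simp: tuples_0 path_length_def)
 ultimately show ?thesis
  unfolding coMC_def MC_def sum_mod_finite[OF finite_tuples] prod_mod_def by (simp cong: PiE_cong restrict_cong)
qed

text \<open>Homomorphisms from \<open>S\<close> enter degree 0 cochains by their value at the unit,
  split into its vertex components.\<close>

definition "cokap l \<phi> = spread (- l) (T.ev \<phi>)"

lemma cokap_linear: "l \<in> G ==> linear_map K (T.H (- l)) (CoCh vtx l 0) (cokap l)"
 unfolding cokap_def[abs_def] coMC_0
 by (intro linear_mapI V.module_MC T.module_H G_uminus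
   K_linear_comp[OF linear_map.linear[OF T.ev_linear] linear_map.linear[OF spread_linear]])

lemma cokap_inj: assumes l: "l \<in> G" shows "inj_on (cokap l) (carrier (T.H (- l)))"
proof (rule inj_onI)
 fix \<phi> \<chi> assume \<phi>: "\<phi> \<in>. T.H (- l)" "\<chi> \<in>. T.H (- l)" and e: "cokap l \<phi> = cokap l \<chi>"
 have l': "- l \<in> G" by (intro G_uminus l)
 have "T.ev \<phi> = T.ev \<chi>"
  using arg_cong[OF e, of "total (- l)"] linear_map.closed[OF T.ev_linear[OF l']] \<phi>
  by (simp add: cokap_def total_spread[OF l'])
 then show "\<phi> = \<chi>" using \<phi> T.ev_inj by (metis inj_onD)
qed

text \<open>The coboundary at \<open>[x, y]\<close> with \<open>x \<noteq> y\<close> is minus the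
  product of \<open>i\<close> with \<open>(x, y)\<close>, and these pairs span the ideal in nonzero
  degrees.\<close>

lemma spread_cocycle:
 assumes l: "l \<in> G" and i: "i \<in>. Pc (- l)"
 shows "codel vtx l 0 (spread (- l) i) = zero (CoCh vtx l 1) \<longleftrightarrow>
  (\<forall>h\<in>G. \<forall>j\<in>JX h. act (- l) h i j = zero (Pc (- l + h)))"
proof -
 have l': "- l \<in> G" by (intro G_uminus l)
 let ?s = "spread (- l) i"
 have s: "?s \<in>. CoCh vtx l 0" unfolding coMC_0 by (rule linear_map.closed[OF spread_linear[OF l'] i])
 have sx: "?s [x] = A x x (- l) i" if "x \<in> X" for x using that by (simp add: spread_def tuples_0)
 have ed: "codel vtx l 0 ?s [x, y] = zero (Pc (- l + dr x y)) \<longleftrightarrow>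
   x = y \<or> A x y (- l) i = zero (Pc (- l + dr x y))" if xy: "x \<in> X" "y \<in> X" "fin x y" for x y
 proof -
  let ?V = "dm_comp vtx y (- l + dr x y)"
  have g: "- l + dr x y \<in> G" by (intro G_add l' dist_G xy)
  interpret W: Module.module K ?V by (rule V.dm_module[OF xy(2) g])
  have q: "A x y (- l) i \<in>. ?V" by (rule A_vertex[OF xy l' i])
  have "A x y (- l) (A x x (- l) i) = A x y (- l) i"
   using A_comp[OF xy(1,1) _ xy l' i] xy between_refl by (simp add: dist_self)
  then have e: "codel vtx l 0 ?s [x, y] = (if x = y then A x y (- l) i else zero ?V) \<ominus>\<^bsub>?V\<^esub> A x y (- l) i"
   using V.coMC_cobd_pair[OF l s xy] sx xy by (simp add: vertex_simps)
  \<comment> \<open>At \<open>x = y\<close> the two cofaces cancel, so only distinct points impose a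
    condition.\<close>
  have "(if x = y then A x y (- l) i else zero ?V) \<ominus>\<^bsub>?V\<^esub> A x y (- l) i = zero ?V \<longleftrightarrow> x = y \<or> A x y (- l) i = zero ?V"
   using q W.diff_zero_iff[OF W.M.zero_closed q] W.diff_zero_iff[OF q q] by auto
  then show ?thesis unfolding e vertex_simps(2) .
 qed
 have cc: "codel vtx l 0 ?s \<in>. CoCh vtx l 1"
  using linear_map.closed[OF V.linear_map_coMC_cobd[OF l] s] by simp
 have "codel vtx l 0 ?s = zero (CoCh vtx l 1) \<longleftrightarrow>
   (\<forall>xs\<in>tup 1. codel vtx l 0 ?s xs = zero (coMCp vtx l xs))"
  using cc unfolding coMC_def prod_mod_simps by (auto simp: PiE_iff intro!: extensional_eqI[of _ "tup 1"])
 also have "... \<longleftrightarrow> (\<forall>x\<in>X. \<forall>y\<in>X. fin x y & x \<noteq> y \<longrightarrow> A x y (- l) i = zero (Pc (- l + dr x y)))"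
 proof -
  have "(\<forall>xs\<in>tup 1. codel vtx l 0 ?s xs = zero (coMCp vtx l xs)) \<longleftrightarrow>
    (\<forall>x\<in>X. \<forall>y\<in>X. fin x y \<longrightarrow> codel vtx l 0 ?s [x, y] = zero (Pc (- l + dr x y)))"
   by (auto simp: tuples_1 vertex_simps path_deg_pair)
  then show ?thesis using ed by blast
 qed
 also have "... \<longleftrightarrow> (\<forall>h\<in>G. \<forall>j\<in>JX h. act (- l) h i j = zero (Pc (- l + h)))" (is "?e \<longleftrightarrow> ?j")
 proof
  assume ?j
  then show ?e using ee_dist_ideal(2) dist_G by blast
 next
  assume e: ?e
  show ?j
  proof (intro ballI)
   fix h j assume h: "h \<in> G" and j: "j \<in> JX h"
   have g: "- l + h \<in> G" by (intro G_add l' h)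
   show "act (- l) h i j = zero (Pc (- l + h))"
   proof (cases "h = 0")
    case True
    show ?thesis unfolding dist_ideal_0[OF h j True]
     by (rule linear_map.zero[OF linear_mapI[OF module_ga gm_module[OF g] act_linear_r[OF l' h i]]])
   next
    case False
    show ?thesis
    proof (rule free_module_pairs_eqI[OF gm_module[OF g] act_linear_r[OF l' h i] K_linear_zero_map[OF gm_module[OF g]] _ T.J_closed[OF h j]])
     fix x y assume xy: "x \<in> X" "y \<in> X" "fin x y" "h = dr x y"
     then have "x \<noteq> y" using False by (auto simp: dist_self)
     then show "act (- l) h i (ee x y) = zero (Pc (- l + h))"
      using e xy by simp
    qed
   qed
  qed
 qed
 finally show ?thesis .
qed

lemma cokap_im:
 assumes l: "l \<in> G"
 shows "cokap l ` carrier (T.H (- l)) = {\<alpha> \<in> carrier (CoCh vtx l 0). codel vtx l 0 \<alpha> = zero (CoCh vtx l 1)}"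
proof -
 have l': "- l \<in> G" by (intro G_uminus l)
 have "cokap l ` carrier (T.H (- l)) = spread (- l) ` T.ev ` carrier (T.H (- l))"
  by (simp add: cokap_def[abs_def] image_image)
 also have "... = spread (- l) ` {i \<in> carrier (Pc (- l)). codel vtx l 0 (spread (- l) i) = zero (CoCh vtx l 1)}"
  unfolding T.ev_image[OF l'] using spread_cocycle[OF l] by (intro arg_cong[of _ _ "%S. spread (- l) ` S"]) blast
 also have "... = {\<alpha> \<in> carrier (CoCh vtx l 0). codel vtx l 0 \<alpha> = zero (CoCh vtx l 1)}"
  unfolding coMC_0
  using linear_map.closed[OF spread_linear[OF l']] linear_map.closed[OF total_linear[OF l']] spread_total[OF l'] by (force simp: image_iff)
 finally show ?thesis .
qed

end

section \<open>Passage to vertices and naturality in the coefficients\<close>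

context right_mod
begin

lemmas tensor_quotient = T.tensor_quotient_axioms

lemma hom_A:
 assumes "right_mod K G X d Q" and \<phi>: "hom0 P Q \<phi>"
  and "x \<in> X" "y \<in> X" "fin x y" "g \<in> G" "p \<in>. Pc g"
 shows "\<phi> (g + dr x y) (A x y g p) = gm_act Q g (dr x y) (\<phi> g p) (ee x y)"
 using \<phi> assms(6,7) dist_G[OF assms(3-5)] basis_ga[OF pairsI[OF assms(3-5)]] unfolding graded_hom_0 by blast

text \<open>Exactness survives multiplication by the idempotent \<open>e_x\<close>. The predicate
  \<open>z\<close> will be the condition of lying in the kernel of the next map.\<close>

lemma vertex_image:
 assumes Q: "right_mod K G X d Q" and \<phi>: "hom0 P Q \<phi>" and x: "x \<in> X" and g: "g \<in> G"
  and im: "\<phi> g ` carrier (Pc g) = {q \<in> carrier (gm_comp Q g). z q}"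
 shows "\<phi> g ` carrier (dm_comp vtx x g) = {q \<in> carrier (dm_comp (right_mod.vtx K X d Q) x g). z q}"
proof -
 interpret Q: right_mod K G X d Q by fact
 have xx: "fin x x" using x by (simp add: dist_self)
 have A: "\<phi> g (A x x g p) = Q.A x x g (\<phi> g p)" if "p \<in>. Pc g" for p
  using hom_A[OF Q \<phi> x x xx g that] x by (simp add: dist_self)
 show ?thesis
 proof (intro subset_antisym subsetI)
  fix q assume "q \<in> \<phi> g ` carrier (dm_comp vtx x g)"
  then obtain p where p: "p \<in>. Pc g" "A x x g p = p" "q = \<phi> g p" by (auto simp: vertex_simps)
  then have "q \<in> {q \<in> carrier (gm_comp Q g). z q}" using im by blast
  then show "q \<in> {q \<in> carrier (dm_comp Q.vtx x g). z q}" using A[OF p(1)] p(2,3) by (simp add: Q.vertex_simps)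
 next
  fix q assume q: "q \<in> {q \<in> carrier (dm_comp Q.vtx x g). z q}"
  then have "q \<in> \<phi> g ` carrier (Pc g)" unfolding im by (simp add: Q.vertex_simps)
  then obtain p where p: "p \<in>. Pc g" "q = \<phi> g p" by blast
  \<comment> \<open>The preimage \<open>p\<close> may have components at other vertices;
    \<open>p e_x\<close> is a preimage as well, since \<open>q e_x = q\<close>.\<close>
  have "q = \<phi> g (A x x g p)" unfolding A[OF p(1)] using q p(2) by (simp add: Q.vertex_simps)
  then show "q \<in> \<phi> g ` carrier (dm_comp vtx x g)" using A_self_vertex[OF x g p(1)] by blast
 qed
qed

lemma kap_natural:
 assumes Q: "right_mod K G X d Q" and \<phi>: "hom0 P Q \<phi>" and l: "l \<in> G" and c: "c \<in>. Ch vtx l 0"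
 shows "right_mod.kap K G X d Q l (dist_hom.MC_map X d (%x. \<phi>) l 0 c) =
  graded_tensor_map K G \<Lambda> P Q (left_quot \<Lambda> JX) l \<phi> (kap l c)"
proof -
 interpret Q: right_mod K G X d Q by fact
 interpret h: dist_hom K G X d vtx Q.vtx "%x. \<phi>" by (rule vertex_hom[OF Q \<phi>])
 interpret \<phi>: linear_map K "Pc l" "gm_comp Q l" "\<phi> l"
  using \<phi> l by (intro linear_mapI gm_module Q.gm_module) (simp_all add: graded_hom_0)
 have cx: "c [x] \<in>. Pc l" if "x \<in> X" for x using c that by (simp add: MC_0_iff vertex_simps)
 have "Q.total l (h.MC_map l 0 c) = (\<Oplus>\<^bsub>gm_comp Q l\<^esub>x\<in>X. \<phi> l (c [x]))"
  unfolding Q.total_def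
  by (rule \<phi>.cod.M.finsum_cong') (use cx \<phi>.closed in "auto simp: h.MC_map_def tuples_0 path_length_def")
 also have "... = \<phi> l (total l c)" unfolding total_def by (rule \<phi>.finsum[symmetric]) (use cx in auto)
 finally show ?thesis
  unfolding Q.kap_def kap_def
  using graded_tensor_map_linear(2)[OF T.tensor_quotient_axioms Q.T.tensor_quotient_axioms \<phi> l linear_map.closed[OF total_linear[OF l] c]] by simp
qed

lemma cokap_natural:
 assumes Q: "right_mod K G X d Q" and \<phi>: "hom0 P Q \<phi>" and l: "l \<in> G" and c: "\<chi> \<in>. T.H (- l)"
 shows "right_mod.cokap K G X d Q l (graded_Hom_map G (right_quot \<Lambda> JX) (- l) \<phi> \<chi>) =
  dist_hom.coMC_map X d (%x. \<phi>) l 0 (cokap l \<chi>)"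
proof -
 interpret Q: right_mod K G X d Q by fact
 interpret h: dist_hom K G X d vtx Q.vtx "%x. \<phi>" by (rule vertex_hom[OF Q \<phi>])
 have l': "- l \<in> G" by (intro G_uminus l)
 let ?i = "T.ev \<chi>"
 have i: "?i \<in>. Pc (- l)" by (rule linear_map.closed[OF T.ev_linear[OF l'] c])
 have "Q.A x x (- l) (\<phi> (- l) ?i) = \<phi> (- l) (A x x (- l) ?i)" if "x \<in> X" for x
  using hom_A[OF Q \<phi> that that _ l' i] that by (simp add: dist_self)
 then have "Q.spread (- l) (\<phi> (- l) ?i) = h.coMC_map l 0 (spread (- l) ?i)"
  by (auto simp: Q.spread_def spread_def h.coMC_map_def tuples_0 path_length_def intro!: restrict_ext)
 then show ?thesis
  unfolding Q.cokap_def cokap_def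
  using graded_Hom_map_linear(2)[OF T.tensor_quotient_axioms Q.T.tensor_quotient_axioms \<phi> l' c] by simp
qed

end

section \<open>Augmentations and the comparison with Tor and Ext\<close>

context dist_mod
begin

lemma bar_nth: "m \<in>. gm_comp bar g ==> x \<in> X ==> m x \<in>. Mc x g"
 unfolding bar_carrier by (rule PiE_mem)

text \<open>The given augmentation has values in families over all vertices. On \<open>P e_x\<close>
  they are concentrated at \<open>x\<close>, so evaluation at \<open>x\<close> turns it into a
  morphism of distance modules with the same kernel and a full image.\<close>

lemma augmentation:
 assumes P: "right_mod K G X d P" and aug: "hom0 P bar aug"
  and surj: "!!g. g \<in> G ==> aug g ` carrier (gm_comp P g) = carrier (gm_comp bar g)"
 defines "V \<equiv> right_mod.vtx K X d P"
 shows "dist_hom K G X d V M (%x g p. aug g p x)"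
  and "!!x g. x \<in> X ==> g \<in> G ==> (%p. aug g p x) ` carrier (dm_comp V x g) = carrier (Mc x g)"
  and "!!x g p. x \<in> X ==> g \<in> G ==> p \<in>. dm_comp V x g ==> aug g p = zero (gm_comp bar g) \<longleftrightarrow> aug g p x = zero (Mc x g)"
proof -
 interpret P: right_mod K G X d P by fact
 have lin: "linear_map K (gm_comp P g) (gm_comp bar g) (aug g)" if "g \<in> G" for g
  using aug that by (intro linear_mapI P.gm_module bar_module) (simp_all add: graded_hom_0)
 have A: "aug (g + dr x y) (P.A x y g p) = inj (g + dr x y) y (Mm x y g (aug g p x))"
  if "x \<in> X" "y \<in> X" "fin x y" "g \<in> G" "p \<in>. gm_comp P g" for x y g p
  using P.hom_A[OF right_mod_bar aug that] bar_act_ee[OF that(4) linear_map.closed[OF lin[OF that(4)] that(5)] that(1-3)] by simp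
 have A': "aug g (P.A x x g p) = inj g x (aug g p x)" if x: "x \<in> X" and g: "g \<in> G" and p: "p \<in>. gm_comp P g" for x g p
  using A[OF x x _ g p] dm_id[OF x g bar_nth[OF linear_map.closed[OF lin[OF g] p] x]] x by (simp add: dist_self)
 have hl: "K_linear K (dm_comp V x g) (Mc x g) (%p. aug g p x)" if "x \<in> X" "g \<in> G" for x g
  using K_linear_comp[OF linear_map.linear[OF P.vertex_incl[OF that]] K_linear_comp[OF linear_map.linear[OF lin] linear_map.linear[OF bar_proj]]] that
  by (simp add: V_def)
 show "dist_hom K G X d V M (%x g p. aug g p x)"
 proof (intro dist_hom.intro dist_hom_axioms.intro hl dist_mod_axioms)
  show "dist_mod K G X d V" unfolding V_def by (rule P.V.dist_mod_axioms)
  fix x y g m assume xy: "x \<in> X" "y \<in> X" "fin x y" and g: "g \<in> G" and m: "m \<in>. dm_comp V x g"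
  show "aug (g + dr x y) (dm_map V x y g m) y = Mm x y g (aug g m x)"
   using A[OF xy g, of m] m xy by (simp add: V_def P.vertex_simps inj_nth)
 qed
 fix x g assume x: "x \<in> X" and g: "g \<in> G"
 show "(%p. aug g p x) ` carrier (dm_comp V x g) = carrier (Mc x g)"
 proof (intro subset_antisym subsetI)
  fix m assume m: "m \<in>. Mc x g"
  have "inj g x m \<in> aug g ` carrier (gm_comp P g)" unfolding surj[OF g] by (rule linear_map.closed[OF inj_linear[OF g x] m])
  then obtain p where p: "p \<in>. gm_comp P g" "inj g x m = aug g p" by blast
  have "aug g (P.A x x g p) x = m" unfolding A'[OF x g p(1)] using x by (simp add: inj_nth flip: p(2))
  moreover have "P.A x x g p \<in>. dm_comp V x g" unfolding V_def by (rule P.A_self_vertex[OF x g p(1)])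
  ultimately show "m \<in> (%p. aug g p x) ` carrier (dm_comp V x g)" by blast
 qed (use K_linear_closed[OF hl[OF x g]] in blast)
 fix p assume p: "p \<in>. dm_comp V x g"
 have e: "aug g p = inj g x (aug g p x)"
  using A'[OF x g, of p] p by (simp add: V_def P.vertex_simps)
 show "aug g p = zero (gm_comp bar g) \<longleftrightarrow> aug g p x = zero (Mc x g)"
 proof
  assume "aug g p x = zero (Mc x g)"
  then show "aug g p = zero (gm_comp bar g)" using e linear_map.zero[OF inj_linear[OF g x]] by simp
 qed (use linear_map.zero[OF bar_proj[OF g x]] in simp)
qed

text \<open>Dually, the coaugmentation is restricted to the summand at \<open>x\<close>. It commutes
  with \<open>e_x\<close>, so it takes that summand into \<open>I e_x\<close>, and exactness is
  inherited.\<close>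

lemma coaugmentation:
 assumes I: "right_mod K G X d I" and coaug: "hom0 bar I coaug"
  and inj: "!!g. g \<in> G ==> inj_on (coaug g) (carrier (gm_comp bar g))"
 defines "V \<equiv> right_mod.vtx K X d I"
 shows "dist_hom K G X d M V (%x g m. coaug g (inj g x m))"
  and "!!x g. x \<in> X ==> g \<in> G ==> inj_on (%m. coaug g (inj g x m)) (carrier (Mc x g))"
  and "!!x g z. x \<in> X ==> g \<in> G ==> coaug g ` carrier (gm_comp bar g) = {i \<in> carrier (gm_comp I g). z i} ==>
   (%m. coaug g (inj g x m)) ` carrier (Mc x g) = {i \<in> carrier (dm_comp V x g). z i}"
proof -
 interpret I: right_mod K G X d I by fact
 have lin: "linear_map K (gm_comp bar g) (gm_comp I g) (coaug g)" if "g \<in> G" for g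
  using coaug that by (intro linear_mapI I.gm_module bar_module) (simp_all add: graded_hom_0)
 have ij: "inj g x m \<in>. gm_comp bar g" if "x \<in> X" "g \<in> G" "m \<in>. Mc x g" for x g m
  by (rule linear_map.closed[OF inj_linear[OF that(2,1)] that(3)])
 have A: "I.A x y g (coaug g c) = coaug (g + dr x y) (inj (g + dr x y) y (Mm x y g (c x)))"
  if "x \<in> X" "y \<in> X" "fin x y" "g \<in> G" "c \<in>. gm_comp bar g" for x y g c
  using right_mod.hom_A[OF right_mod_bar I coaug that] bar_act_ee[OF that(4,5,1-3)] by simp
 have A': "I.A x x g (coaug g c) = coaug g (inj g x (c x))" if x: "x \<in> X" and g: "g \<in> G" and c: "c \<in>. gm_comp bar g" for x g c
  using A[OF x x _ g c] dm_id[OF x g bar_nth[OF c x]] x by (simp add: dist_self)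
 have V: "coaug g (inj g x m) \<in>. dm_comp V x g" if x: "x \<in> X" and g: "g \<in> G" and m: "m \<in>. Mc x g" for x g m
  using A'[OF x g ij[OF x g m]] linear_map.closed[OF lin[OF g] ij[OF x g m]] x by (simp add: V_def I.vertex_simps inj_nth)
 show "dist_hom K G X d M V (%x g m. coaug g (inj g x m))"
 proof (intro dist_hom.intro dist_hom_axioms.intro dist_mod_axioms)
  show "dist_mod K G X d V" unfolding V_def by (rule I.V.dist_mod_axioms)
  fix x g assume x: "x \<in> X" and g: "g \<in> G"
  show "K_linear K (Mc x g) (dm_comp V x g) (%m. coaug g (inj g x m))"
   using K_linear_comp[OF linear_map.linear[OF inj_linear[OF g x]] linear_map.linear[OF lin[OF g]]] V[OF x g]
   unfolding K_linear_def by (auto simp: V_def I.vertex_simps)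
  fix y m assume y: "y \<in> X" "fin x y" and m: "m \<in>. Mc x g"
  show "coaug (g + dr x y) (inj (g + dr x y) y (Mm x y g m)) = dm_map V x y g (coaug g (inj g x m))"
   using A[OF x y g ij[OF x g m]] x by (simp add: V_def I.vertex_simps inj_nth)
 qed
 fix x g assume x: "x \<in> X" and g: "g \<in> G"
 show "inj_on (%m. coaug g (inj g x m)) (carrier (Mc x g))"
 proof (rule inj_onI)
  fix m n assume mn: "m \<in>. Mc x g" "n \<in>. Mc x g" "coaug g (inj g x m) = coaug g (inj g x n)"
  have "inj g x m = inj g x n" by (rule inj_onD[OF inj[OF g] mn(3) ij[OF x g mn(1)] ij[OF x g mn(2)]])
  from fun_cong[OF this, of x] show "m = n" using x by (simp add: inj_nth)
 qed
 fix z assume im: "coaug g ` carrier (gm_comp bar g) = {i \<in> carrier (gm_comp I g). z i}"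
 show "(%m. coaug g (inj g x m)) ` carrier (Mc x g) = {i \<in> carrier (dm_comp V x g). z i}"
 proof (intro subset_antisym subsetI)
  fix i assume "i \<in> (%m. coaug g (inj g x m)) ` carrier (Mc x g)"
  then obtain m where m: "m \<in>. Mc x g" "i = coaug g (inj g x m)" by blast
  then have "i \<in> {i \<in> carrier (gm_comp I g). z i}" using im ij[OF x g m(1)] by blast
  then show "i \<in> {i \<in> carrier (dm_comp V x g). z i}" using V[OF x g m(1)] m(2) by simp
 next
  fix i assume i: "i \<in> {i \<in> carrier (dm_comp V x g). z i}"
  then have "i \<in> coaug g ` carrier (gm_comp bar g)" unfolding im by (simp add: V_def I.vertex_simps)
  then obtain c where c: "c \<in>. gm_comp bar g" "i = coaug g c" by blast
  have "i = coaug g (inj g x (c x))" unfolding A'[OF x g c(1), symmetric] using i c(2) by (simp add: V_def I.vertex_simps)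
  then show "i \<in> (%m. coaug g (inj g x m)) ` carrier (Mc x g)" using bar_nth[OF c(1) x] by blast
 qed
qed

text \<open>The complex \<open>C\<close> stands for the magnitude complex up to the isomorphism
  \<open>\<rho>\<close>. With coefficients \<open>\<rho>\<close> is the identity; for the complex
  without coefficients it relates that complex to chains in the trivial distance module.\<close>

theorem homology_Tor:
 assumes res: "projective_resolution K G \<Lambda> bar P bd aug" and l: "l \<in> G"
  and \<rho>: "!!m. linear_map K (Ch M l m) (C m) (\<rho> m)" "!!m. bij_betw (\<rho> m) (carrier (Ch M l m)) (carrier (C m))"
  and bC: "!!m. linear_map K (C (Suc m)) (C m) (bC m)"
  and comm: "!!m c. c \<in>. Ch M l (Suc m) ==> \<rho> m (del M l m c) = bC m (\<rho> (Suc m) c)"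
 shows "mod_iso K (homology C bC n) (Tor_via K G \<Lambda> P bd (S_left K G X d) n l)"
proof -
 have proj: "!!k. graded_projective K G \<Lambda> (P k)" and bd: "!!k. hom0 (P (Suc k)) (P k) (bd k)"
  and aug: "hom0 (P 0) bar aug"
  and surj: "!!g. g \<in> G ==> aug g ` carrier (gm_comp (P 0) g) = carrier (gm_comp bar g)"
  and ex0: "!!g. g \<in> G ==> bd 0 g ` carrier (gm_comp (P 1) g) = {p \<in> carrier (gm_comp (P 0) g). aug g p = zero (gm_comp bar g)}"
  and ex: "!!k g. g \<in> G ==> bd (Suc k) g ` carrier (gm_comp (P (Suc (Suc k))) g) = {p \<in> carrier (gm_comp (P (Suc k)) g). bd k g p = zero (gm_comp (P k) g)}"
  using res unfolding projective_resolution_def by simp_all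
 have rm: "right_mod K G X d (P k)" for k
  using proj[of k] by (intro right_mod.intro right_mod_axioms.intro dist_space_axioms) (simp add: graded_projective_def)
 define V where "V k = right_mod.vtx K X d (P k)" for k
 have Vm: "dist_mod K G X d (V k)" for k
  unfolding V_def using right_mod.distance_module_vertex[OF rm] by (intro dist_mod.intro dist_mod_axioms.intro dist_space_axioms)
 have F: "dist_hom K G X d (V (Suc k)) (V k) (%x. bd k)" for k
  unfolding V_def by (rule right_mod.vertex_hom[OF rm rm bd])
 note E = augmentation[OF rm aug surj, folded V_def]
 interpret E: dist_hom K G X d "V 0" M "%x g p. aug g p x" by (rule E(1))
 have Ec: "E.MC_map l m c \<in>. Ch M l m" if "c \<in>. Ch (V 0) l m" for m c
  by (rule linear_map.closed[OF E.linear_map_MC_map[OF l] that])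
 have imV: "bd k g ` carrier (dm_comp (V (Suc k)) x g) = {q \<in> carrier (dm_comp (V k) x g). z q}"
  if "x \<in> X" "g \<in> G" "bd k g ` carrier (gm_comp (P (Suc k)) g) = {q \<in> carrier (gm_comp (P k) g). z q}" for k g x z
  unfolding V_def by (rule right_mod.vertex_image[OF rm rm bd that])
 interpret D: double_complex K C bC "%k m. Ch (V k) l m" "%k m. del (V k) l m" "%m c. \<rho> m (E.MC_map l m c)"
  "%k m. dist_hom.MC_map X d (%x. bd k) l m" "%k. graded_tensor K G \<Lambda> (P k) (S_left K G X d) l"
  "%k. graded_tensor_map K G \<Lambda> (P (Suc k)) (P k) (S_left K G X d) l (bd k)" "%k. right_mod.kap K G X d (P k) l"
 proof (rule double_complex.intro)
  fix k m
  show "linear_map K (Ch (V 0) l m) (C m) (%c. \<rho> m (E.MC_map l m c))"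
   using \<rho>(1)[of m] linear_map.linear[OF \<rho>(1)[of m]]
   by (intro linear_mapI E.M.module_MC l K_linear_comp[OF E.linear_MC_map[OF l]]) (simp_all add: linear_map_def)
  \<comment> \<open>Carried over from the magnitude complex along \<open>\<rho>\<close>, which is
    onto.\<close>
  show "bC m (bC (Suc m) x) = zero (C m)" if x: "x \<in>. C (Suc (Suc m))" for x
  proof -
   obtain c where c: "c \<in>. Ch M l (Suc (Suc m))" "x = \<rho> (Suc (Suc m)) c"
    using bij_betw_imp_surj_on[OF \<rho>(2)[of "Suc (Suc m)"]] x by blast
   show ?thesis
    unfolding c(2) comm[OF c(1), symmetric] comm[OF linear_map.closed[OF linear_map_MC_bd[OF l] c(1)], symmetric] MC_bd_MC_bd[OF l c(1)]
    by (rule linear_map.zero[OF \<rho>(1)])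
  qed
  \<comment> \<open>Projectivity of \<open>P k\<close> enters here and only here, through the
    contraction.\<close>
  show "\<exists>y\<in>carrier (Ch (V k) l (Suc (Suc m))). del (V k) l (Suc m) y = x"
   if x: "x \<in>. Ch (V k) l (Suc m)" "del (V k) l m x = zero (Ch (V k) l m)" for x
  proof -
   obtain s where "relatively_projective K G X d (V k) s"
    using right_mod.projective_imp_relatively_projective[OF rm proj] unfolding V_def by blast
   then show ?thesis by (rule relatively_projective.MC_acyclic[OF _ l x])
  qed
  show "\<rho> m (E.MC_map l m (del (V 0) l m x)) = bC m (\<rho> (Suc m) (E.MC_map l (Suc m) x))" if "x \<in>. Ch (V 0) l (Suc m)" for x
   using E.MC_map_bd[OF l that] comm[OF Ec[OF that]] by simp
  have Es: "E.MC_map l m ` carrier (Ch (V 0) l m) = carrier (Ch M l m)"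
   by (rule E.MC_map_surj[OF l E(2)])
  show "(%c. \<rho> m (E.MC_map l m c)) ` carrier (Ch (V 0) l m) = carrier (C m)"
   using bij_betw_imp_surj_on[OF \<rho>(2)[of m]] Es by (simp flip: image_image)
  have "dist_hom.MC_map X d (%x. bd 0) l m ` carrier (Ch (V 1) l m) = {c \<in> carrier (Ch (V 0) l m). E.MC_map l m c = zero (Ch M l m)}"
  proof (rule MC_map_exact(1)[OF _ E(1) l])
   show "dist_hom K G X d (V 1) (V 0) (%x. bd 0)" using F[of 0] by simp
   show "bd 0 g ` carrier (dm_comp (V 1) x g) = {p \<in> carrier (dm_comp (V 0) x g). aug g p x = zero (Mc x g)}" if "x \<in> X" "g \<in> G" for x g
    using imV[of x g 0, OF that] ex0[OF that(2)] E(3)[OF _ that] by auto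
  qed
  moreover have "\<rho> m (E.MC_map l m c) = zero (C m) \<longleftrightarrow> E.MC_map l m c = zero (Ch M l m)" if c: "c \<in>. Ch (V 0) l m" for c
  proof -
   interpret B: Module.module K "Ch M l m" by (rule module_MC[OF l])
   show ?thesis using inj_on_eq_iff[OF bij_betw_imp_inj_on[OF \<rho>(2)] Ec[OF c] B.M.zero_closed] linear_map.zero[OF \<rho>(1)] by simp
  qed
  ultimately show "dist_hom.MC_map X d (%x. bd 0) l m ` carrier (Ch (V 1) l m) = {x \<in> carrier (Ch (V 0) l m). \<rho> m (E.MC_map l m x) = zero (C m)}"
   by auto
  show "dist_hom.MC_map X d (%x. bd (Suc k)) l m ` carrier (Ch (V (Suc (Suc k))) l m) =
    {x \<in> carrier (Ch (V (Suc k)) l m). dist_hom.MC_map X d (%x. bd k) l m x = zero (Ch (V k) l m)}"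
  proof (rule MC_map_exact(1)[OF F F l])
   show "bd (Suc k) g ` carrier (dm_comp (V (Suc (Suc k))) x g) = {p \<in> carrier (dm_comp (V (Suc k)) x g). bd k g p = zero (dm_comp (V k) x g)}"
    if "x \<in> X" "g \<in> G" for x g
    using imV[OF that ex[OF that(2)]] right_mod.vertex_simps(2)[OF rm] by (simp add: V_def)
  qed
 \<comment> \<open>What remains are linearity, vanishing of squares and naturality of the
   constituents, together with the description of degree 0 by \<open>kap\<close>.\<close>
 qed (rule bC dist_mod.linear_map_MC_bd[OF Vm l] graded_tensor_map_linear(1)[OF right_mod.tensor_quotient[OF rm] right_mod.tensor_quotient[OF rm] bd l]
   dist_hom.linear_map_MC_map[OF F l] right_mod.kap_linear[OF rm l, folded V_def] dist_mod.MC_bd_MC_bd[OF Vm l] dist_hom.MC_map_bd[OF F l]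
   right_mod.kap_natural[OF rm rm bd l, folded V_def] right_mod.kap_surj[OF rm l, folded V_def] right_mod.kap_ker[OF rm l, folded V_def];
   assumption?)+
 show ?thesis unfolding Tor_via_def by (rule D.homology_iso)
qed

text \<open>As for Tor, with \<open>\<rho>\<close> now pointing from \<open>C\<close> to the
  cochains, so that it composes with the embedding given by the coaugmentation.\<close>

theorem cohomology_Ext:
 assumes res: "injective_resolution K G \<Lambda> bar I cobd coaug" and l: "l \<in> G"
  and \<rho>: "!!m. linear_map K (C m) (CoCh M l m) (\<rho> m)" "!!m. bij_betw (\<rho> m) (carrier (C m)) (carrier (CoCh M l m))"
  and bC: "!!m. linear_map K (C m) (C (Suc m)) (bC m)"
  and comm: "!!m c. c \<in>. C m ==> \<rho> (Suc m) (bC m c) = codel M l m (\<rho> m c)"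
 shows "mod_iso K (cohomology C bC n) (Ext_via K G \<Lambda> (S_right K G X d) I cobd n l)"
proof -
 have inj: "!!k. graded_injective K G \<Lambda> (I k)" and cobd: "!!k. hom0 (I k) (I (Suc k)) (cobd k)"
  and coaug: "hom0 bar (I 0) coaug"
  and cinj: "!!g. g \<in> G ==> inj_on (coaug g) (carrier (gm_comp bar g))"
  and ex0: "!!g. g \<in> G ==> coaug g ` carrier (gm_comp bar g) = {p \<in> carrier (gm_comp (I 0) g). cobd 0 g p = zero (gm_comp (I 1) g)}"
  and ex: "!!k g. g \<in> G ==> cobd k g ` carrier (gm_comp (I k) g) = {p \<in> carrier (gm_comp (I (Suc k)) g). cobd (Suc k) g p = zero (gm_comp (I (Suc (Suc k))) g)}"
  using res unfolding injective_resolution_def by simp_all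
 have rm: "right_mod K G X d (I k)" for k
  using inj[of k] by (intro right_mod.intro right_mod_axioms.intro dist_space_axioms) (simp add: graded_injective_def)
 define V where "V k = right_mod.vtx K X d (I k)" for k
 have Vm: "dist_mod K G X d (V k)" for k
  unfolding V_def using right_mod.distance_module_vertex[OF rm] by (intro dist_mod.intro dist_mod_axioms.intro dist_space_axioms)
 have F: "dist_hom K G X d (V k) (V (Suc k)) (%x. cobd k)" for k
  unfolding V_def by (rule right_mod.vertex_hom[OF rm rm cobd])
 have l': "- l \<in> G" by (intro G_uminus l)
 note E = coaugmentation[OF rm coaug cinj, folded V_def]
 interpret E: dist_hom K G X d M "V 0" "%x g m. coaug g (inj g x m)" by (rule E(1))
 have \<rho>c: "\<rho> m c \<in>. CoCh M l m" if "c \<in>. C m" for m c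
  by (rule linear_map.closed[OF \<rho>(1) that])
 interpret D: double_cocomplex K C bC "%k m. CoCh (V k) l m" "%k m. codel (V k) l m" "%m c. E.coMC_map l m (\<rho> m c)"
  "%k m. dist_hom.coMC_map X d (%x. cobd k) l m" "%k. graded_Hom K G \<Lambda> (S_right K G X d) (I k) (- l)"
  "%k. graded_Hom_map G (S_right K G X d) (- l) (cobd k)" "%k. right_mod.cokap K G X d (I k) l"
 proof (rule double_cocomplex.intro)
  fix k m
  show "linear_map K (C m) (CoCh (V 0) l m) (%c. E.coMC_map l m (\<rho> m c))"
   using \<rho>(1)[of m] by (intro linear_mapI E.N.module_coMC l K_linear_comp[OF linear_map.linear[OF \<rho>(1)] E.linear_coMC_map[OF l]]) (simp add: linear_map_def)
  show "bC (Suc m) (bC m x) = zero (C (Suc (Suc m)))" if x: "x \<in>. C m" for x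
  proof -
   have "\<rho> (Suc (Suc m)) (bC (Suc m) (bC m x)) = \<rho> (Suc (Suc m)) (zero (C (Suc (Suc m))))"
    unfolding comm[OF linear_map.closed[OF bC x]] comm[OF x] coMC_cobd_cobd[OF l \<rho>c[OF x]] by (rule linear_map.zero[OF \<rho>(1), symmetric])
   moreover have "zero (C (Suc (Suc m))) \<in>. C (Suc (Suc m))"
   proof -
    interpret B: Module.module K "C (Suc (Suc m))" using bC[of "Suc m"] by (simp add: linear_map_def)
    show ?thesis by (rule B.M.zero_closed)
   qed
   ultimately show ?thesis
    using inj_onD[OF bij_betw_imp_inj_on[OF \<rho>(2)] _ linear_map.closed[OF bC linear_map.closed[OF bC x]]] by blast
  qed
  \<comment> \<open>Injectivity of \<open>I k\<close> is used through the retraction that contracts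
    the cochains.\<close>
  show "\<exists>y\<in>carrier (CoCh (V k) l m). codel (V k) l m y = x"
   if x: "x \<in>. CoCh (V k) l (Suc m)" "codel (V k) l (Suc m) x = zero (CoCh (V k) l (Suc (Suc m)))" for x
  proof -
   obtain r where "relatively_injective K G X d (V k) r"
    using right_mod.injective_imp_relatively_injective[OF rm inj] unfolding V_def by blast
   then show ?thesis by (rule relatively_injective.coMC_acyclic[OF _ l x])
  qed
  show "codel (V 0) l m (E.coMC_map l m (\<rho> m x)) = E.coMC_map l (Suc m) (\<rho> (Suc m) (bC m x))" if "x \<in>. C m" for x
   using E.coMC_map_cobd[OF l \<rho>c[OF that]] comm[OF that] by simp
  show "inj_on (%c. E.coMC_map l m (\<rho> m c)) (carrier (C m))"
   using comp_inj_on[OF bij_betw_imp_inj_on[OF \<rho>(2)[of m]], of "E.coMC_map l m"] E.coMC_map_inj[OF l E(2), of m] bij_betw_imp_surj_on[OF \<rho>(2)[of m]]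
   by (simp add: comp_def)
  have "E.coMC_map l m ` carrier (CoCh M l m) = {x \<in> carrier (CoCh (V 0) l m). dist_hom.coMC_map X d (%x. cobd 0) l m x = zero (CoCh (V 1) l m)}"
  proof (rule MC_map_exact(2)[OF E(1) _ l])
   show "dist_hom K G X d (V 0) (V 1) (%x. cobd 0)" using F[of 0] by simp
   show "(%m. coaug g (inj g x m)) ` carrier (Mc x g) = {p \<in> carrier (dm_comp (V 0) x g). cobd 0 g p = zero (dm_comp (V 1) x g)}"
    if "x \<in> X" "g \<in> G" for x g
    using E(3)[OF _ that ex0[OF that(2)]] right_mod.vertex_simps(2)[OF rm] by (simp add: V_def)
  qed
  then show "(%c. E.coMC_map l m (\<rho> m c)) ` carrier (C m) = {x \<in> carrier (CoCh (V 0) l m). dist_hom.coMC_map X d (%x. cobd 0) l m x = zero (CoCh (V 1) l m)}"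
   using bij_betw_imp_surj_on[OF \<rho>(2)[of m]] by (simp flip: image_image)
  show "dist_hom.coMC_map X d (%x. cobd k) l m ` carrier (CoCh (V k) l m) =
    {x \<in> carrier (CoCh (V (Suc k)) l m). dist_hom.coMC_map X d (%x. cobd (Suc k)) l m x = zero (CoCh (V (Suc (Suc k))) l m)}"
  proof (rule MC_map_exact(2)[OF F F l])
   show "cobd k g ` carrier (dm_comp (V k) x g) = {p \<in> carrier (dm_comp (V (Suc k)) x g). cobd (Suc k) g p = zero (dm_comp (V (Suc (Suc k))) x g)}"
    if "x \<in> X" "g \<in> G" for x g
    using right_mod.vertex_image[OF rm rm cobd that ex[OF that(2), of k]] right_mod.vertex_simps(2)[OF rm] by (simp add: V_def)
  qed
 qed (rule bC dist_mod.linear_map_coMC_cobd[OF Vm l] graded_Hom_map_linear(1)[OF right_mod.tensor_quotient[OF rm] right_mod.tensor_quotient[OF rm] cobd l']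
   dist_hom.linear_map_coMC_map[OF F l] right_mod.cokap_linear[OF rm l, folded V_def] dist_mod.coMC_cobd_cobd[OF Vm l] dist_hom.coMC_map_cobd[OF F l]
   right_mod.cokap_natural[OF rm rm cobd l] right_mod.cokap_inj[OF rm l] right_mod.cokap_im[OF rm l, folded V_def]; assumption?)+
 show ?thesis unfolding Ext_via_def by (rule D.cohomology_iso)
qed

end

subsection \<open>Trivial coefficients\<close>

lemma (in linear_map) inj_onI_kernel:
 assumes "!!x. x \<in>. A ==> f x = zero B ==> x = zero A"
 shows "inj_on f (carrier A)"
proof (rule inj_onI)
 fix x y assume x: "x \<in>. A" and y: "y \<in>. A" and e: "f x = f y"
 have "f (x \<ominus>\<^bsub>A\<^esub> y) = zero B" using diff[OF x y] cod.diff_zero_iff[OF closed[OF x] closed[OF y]] e by simp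
 then have "x \<ominus>\<^bsub>A\<^esub> y = zero A" by (rule assms[rotated]) (simp add: x y)
 then show "x = y" using dom.diff_zero_iff[OF x y] by simp
qed

lemma K_linear_inv_into:
 assumes f: "linear_map K A B f" and bij: "bij_betw f (carrier A) (carrier B)"
 shows "K_linear K B A (inv_into (carrier A) f)"
proof -
 interpret linear_map K A B f by fact
 note i = bij_betw_inv_into_right[OF bij] bij_betwE[OF bij_betw_inv_into[OF bij], rule_format]
 have eq: "inv_into (carrier A) f (f x) = x" if "x \<in>. A" for x by (rule bij_betw_inv_into_left[OF bij that])
 have "inv_into (carrier A) f (x \<oplus>\<^bsub>B\<^esub> y) = inv_into (carrier A) f x \<oplus>\<^bsub>A\<^esub> inv_into (carrier A) f y"
  if "x \<in>. B" "y \<in>. B" for x y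
  using eq[of "inv_into (carrier A) f x \<oplus>\<^bsub>A\<^esub> inv_into (carrier A) f y"] i that by (simp add: add)
 moreover have "inv_into (carrier A) f (k \<odot>\<^bsub>B\<^esub> x) = k \<odot>\<^bsub>A\<^esub> inv_into (carrier A) f x"
  if "k \<in>. K" "x \<in>. B" for k x
  using eq[of "k \<odot>\<^bsub>A\<^esub> inv_into (carrier A) f x"] i that by (simp add: smult)
 ultimately show ?thesis unfolding K_linear_def using i(2) by simp
qed

lemma graded_hom_inv_into:
 assumes \<phi>: "graded_hom K G L 0 M N \<phi>" and bij: "!!g. g \<in> G ==> bij_betw (\<phi> g) (carrier (gm_comp M g)) (carrier (gm_comp N g))"
  and M: "!!g. g \<in> G ==> Module.module K (gm_comp M g)" and N: "!!g. g \<in> G ==> Module.module K (gm_comp N g)"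
  and act: "!!g h m a. g \<in> G ==> h \<in> G ==> m \<in>. gm_comp M g ==> a \<in>. ga_comp L h ==>
   gm_act M g h m a \<in>. gm_comp M (g + h)"
  and G_add: "!!g h. g \<in> G ==> h \<in> G ==> g + h \<in> G"
 shows "graded_hom K G L 0 N M (%g. inv_into (carrier (gm_comp M g)) (\<phi> g))"
 unfolding graded_hom_0
proof (intro conjI ballI)
 fix g assume g: "g \<in> G"
 show "K_linear K (gm_comp N g) (gm_comp M g) (inv_into (carrier (gm_comp M g)) (\<phi> g))"
  using \<phi> g by (intro K_linear_inv_into linear_mapI M N bij) (simp_all add: graded_hom_0)
 fix h n a assume h: "h \<in> G" and n: "n \<in>. gm_comp N g" and a: "a \<in>. ga_comp L h"
 let ?m = "inv_into (carrier (gm_comp M g)) (\<phi> g) n"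
 have m: "?m \<in>. gm_comp M g" using bij_betwE[OF bij_betw_inv_into[OF bij[OF g]]] n by blast
 have "\<phi> (g + h) (gm_act M g h ?m a) = gm_act N g h (\<phi> g ?m) a" using \<phi> g h m a unfolding graded_hom_0 by blast
 also have "\<phi> g ?m = n" by (rule bij_betw_inv_into_right[OF bij[OF g] n])
 finally show "inv_into (carrier (gm_comp M (g + h))) (\<phi> (g + h)) (gm_act N g h n a) = gm_act M g h ?m a"
  using bij_betw_inv_into_left[OF bij[OF G_add[OF g h]] act[OF g h m a]] by simp
qed

context dist_space
begin

text \<open>In nonzero degree the carrier of the ring is cut down to \<open>{0}\<close>, so that all
  components have the same zero and the same operations.\<close>

definition triv :: "('x, 'k, 'k) dist_module" where
 "triv = \<lparr>dm_comp = (%x g. if g = 0 then ring_mod K else (ring_mod K)\<lparr>carrier := {(zero K)}\<rparr>),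
   dm_map = (%x y g m. if x = y then m else zero K)\<rparr>"

lemma triv_simps:
 "carrier (dm_comp triv x g) = (if g = 0 then carrier K else {(zero K)})"
 "zero (dm_comp triv x g) = zero K"
 "m \<oplus>\<^bsub>dm_comp triv x g\<^esub> n = m \<oplus>\<^bsub>K\<^esub> n"
 "k \<odot>\<^bsub>dm_comp triv x g\<^esub> m = k \<otimes>\<^bsub>K\<^esub> m"
 "dm_map triv x y g m = (if x = y then m else zero K)"
 by (simp_all add: triv_def ring_mod_def)

lemma distance_module_triv: "distance_module K G X d triv"
proof -
 interpret cring K by (rule cring_K)
 interpret R: Module.module K "ring_mod K" by (rule module_ring_mod[OF cring_K])
 have eq: "x = y" if "between d x y x" "x \<in> X" "y \<in> X" for x y
  using that dist_eq_0[of x y] by (simp add: between_def dist_self)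
 show ?thesis
  unfolding distance_module_def
 proof (intro conjI ballI allI impI)
  fix x g show "Module.module K (dm_comp triv x g)"
   using module_ring_mod[OF cring_K] submodule_module[OF module_ring_mod[OF cring_K] submodule_zero[OF module_ring_mod[OF cring_K]]]
   by (simp add: triv_def ring_mod_simps)
 next
  fix x y g assume "x \<in> X" "y \<in> X" "fin x y"
  then show "K_linear K (dm_comp triv x g) (dm_comp triv y (g + dr x y)) (dm_map triv x y g)"
   by (cases "x = y") (auto simp: K_linear_def triv_simps dist_self)
 next
  fix x y z g m assume "x \<in> X" "y \<in> X" "z \<in> X"
  then show "dm_map triv y z (g + dr x y) (dm_map triv x y g m) =
    (if between d x y z then dm_map triv x z g m else zero (dm_comp triv z (g + dr x y + dr y z)))"
   using eq[of x y] between_refl by (auto simp: triv_simps)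
 qed (simp add: triv_simps)
qed

sublocale T: dist_mod K G X d triv
 by unfold_locales (rule distance_module_triv)

lemma finite_tol: "finite (tol l n)" and tol_tuples: "xs \<in> tol l n ==> xs \<in> tup n"
 using finite_tuples[of n] by (auto simp: tuples_of_length_def)

lemma module_MC0: "Module.module K (Ch0 l n)"
 unfolding MC0_def by (rule free_module.module_free[OF free_module_K])

lemma omit_tol: "xs \<in> tol l (Suc n) ==> i <= Suc n ==> keep i xs ==> omit i xs \<in> tol l n"
 using omit_tuples[of xs n i] by (simp add: tuples_of_length_def keep_deg)

lemma MC0_face_eq:
 assumes "xs \<in> tup (Suc n)"
 shows "face0 l n i xs = (if keep i xs then basis_elt K (tol l n) (omit i xs) else zero (Ch0 l n))"
 using path_length_omit_le[OF tuplesD(2)[OF assms], of i] by (auto simp: MC0_face_def keep_def)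

lemma MC0_face_closed:
 assumes "xs \<in> tol l (Suc n)" "i <= Suc n"
 shows "face0 l n i xs \<in>. Ch0 l n"
proof -
 interpret F: Module.module K "Ch0 l n" by (rule module_MC0)
 show ?thesis
  using free_module.basis_closed[OF free_module_K omit_tol[OF assms]] by (simp add: MC0_face_eq[OF tol_tuples[OF assms(1)]] MC0_def[symmetric])
qed

definition "Face0 l n i = lin_ext K (tol l (Suc n)) (Ch0 l n) (face0 l n i)"

lemma MC0_bd_eq: "del0 l n c = alt_sum (Ch0 l n) (Suc n) (%i. Face0 l n i c)"
 by (simp add: MC0_bd_def Face0_def)

lemma linear_Face0: "i <= Suc n ==> K_linear K (Ch0 l (Suc n)) (Ch0 l n) (Face0 l n i)"
 unfolding Face0_def MC0_def[of K X d l "Suc n"]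
 by (rule free_module.linear_lin_ext[OF free_module_K module_MC0]) (rule MC0_face_closed)

lemma Face0_basis: "i <= Suc n ==> xs \<in> tol l (Suc n) ==>
  Face0 l n i (basis_elt K (tol l (Suc n)) xs) = face0 l n i xs"
 unfolding Face0_def by (rule free_module.lin_ext_basis[OF free_module_K module_MC0]) (rule MC0_face_closed)

lemma linear_MC0_bd: "linear_map K (Ch0 l (Suc n)) (Ch0 l n) (del0 l n)"
 unfolding MC0_bd_eq[abs_def] by (intro linear_mapI K_linear_alt_sum_map module_MC0 linear_Face0)

text \<open>With trivial coefficients the component at a tuple is zero unless its length is
  \<open>l\<close>, so nothing is lost by restricting to the tuples of length
  \<open>l\<close>.\<close>

definition "\<rho> l n (c :: 'x list => 'k) = restrict c (tol l n)"

lemma \<rho>_linear: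
 assumes l: "l \<in> G" shows "linear_map K (Ch triv l n) (Ch0 l n) (\<rho> l n)"
proof (rule linear_mapI[OF T.module_MC[OF l] module_MC0])
 show "K_linear K (Ch triv l n) (Ch0 l n) (\<rho> l n)"
  unfolding K_linear_def MC_def MC0_def free_mod_def sum_mod_finite[OF finite_tuples] sum_mod_finite[OF finite_tol] prod_mod_simps \<rho>_def
  by (auto simp: tuples_of_length_def triv_simps ring_mod_simps PiE_iff intro!: restrict_ext split: if_splits)
qed

lemma \<rho>_bij: assumes l: "l \<in> G" shows "bij_betw (\<rho> l n) (carrier (Ch triv l n)) (carrier (Ch0 l n))"
proof (rule bij_betw_byWitness[where f' = "%c. \<lambda>xs\<in>tup n. if pdeg xs = l then c xs else zero K"])
 show "\<forall>c\<in>carrier (Ch triv l n). (\<lambda>xs\<in>tup n. if pdeg xs = l then \<rho> l n c xs else zero K) = c"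
 proof
  fix c assume c: "c \<in>. Ch triv l n"
  have "c xs = zero K" if "xs \<in> tup n" "pdeg xs \<noteq> l" for xs
   using c that by (auto simp: MC_def sum_mod_simps triv_simps dest!: PiE_mem)
  then show "(\<lambda>xs\<in>tup n. if pdeg xs = l then \<rho> l n c xs else zero K) = c"
   using c by (intro extensional_eqI[of _ "tup n"]) (auto simp: \<rho>_def tuples_of_length_def MC_def sum_mod_simps PiE_iff)
 qed
 show "\<forall>c\<in>carrier (Ch0 l n). \<rho> l n (\<lambda>xs\<in>tup n. if pdeg xs = l then c xs else zero K) = c"
  unfolding MC0_def free_mod_def sum_mod_finite[OF finite_tol] prod_mod_simps
  by (auto simp: \<rho>_def tuples_of_length_def PiE_iff intro!: extensional_eqI[of _ "tol l n"])
 show "\<rho> l n ` carrier (Ch triv l n) \<subseteq> carrier (Ch0 l n)" using linear_map.closed[OF \<rho>_linear[OF l]] by blast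
 have "zero K \<in>. K" using cring_K by (simp add: cring.cring_simprules)
 then show "(%c. \<lambda>xs\<in>tup n. if pdeg xs = l then c xs else zero K) ` carrier (Ch0 l n) \<subseteq> carrier (Ch triv l n)"
  unfolding MC_def MC0_def free_mod_def sum_mod_finite[OF finite_tuples] sum_mod_finite[OF finite_tol] prod_mod_simps
  by (auto simp: tuples_of_length_def triv_simps ring_mod_simps PiE_iff)
qed

lemma \<rho>_elt:
 assumes "xs \<in> tol l n" "m \<in>. K"
 shows "\<rho> l n (T.elt l n xs m) = m \<odot>\<^bsub>Ch0 l n\<^esub> basis_elt K (tol l n) xs"
 unfolding MC0_def free_module.incl_eq_basis[OF free_module_K assms, symmetric] \<rho>_def
 by (auto simp: sum_incl_def tuples_of_length_def triv_simps ring_mod_simps intro!: restrict_ext)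

text \<open>In the trivial module face 0 keeps the coefficient if the first two points agree and
  kills it otherwise; by \<open>keep_first\<close> this too is the condition that the length is
  kept. So all faces follow the rule of the complex without coefficients.\<close>

lemma \<rho>_Face:
 assumes l: "l \<in> G" and i: "i <= Suc n" and c: "c \<in>. Ch triv l (Suc n)"
 shows "\<rho> l n (T.Face l n i c) = Face0 l n i (\<rho> l (Suc n) c)"
proof (rule T.MC_linear_eqI[OF l module_MC0 _ _ _ c])
 show L: "K_linear K (Ch triv l (Suc n)) (Ch0 l n) (%c. \<rho> l n (T.Face l n i c))"
  by (rule K_linear_comp[OF T.linear_Face[OF l i] linear_map.linear[OF \<rho>_linear[OF l]]])
 show R: "K_linear K (Ch triv l (Suc n)) (Ch0 l n) (%c. Face0 l n i (\<rho> l (Suc n) c))"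
  by (rule K_linear_comp[OF linear_map.linear[OF \<rho>_linear[OF l]] linear_Face0[OF i]])
 interpret L: linear_map K "Ch triv l (Suc n)" "Ch0 l n" "%c. \<rho> l n (T.Face l n i c)" by (rule linear_mapI[OF T.module_MC[OF l] module_MC0 L])
 interpret R: linear_map K "Ch triv l (Suc n)" "Ch0 l n" "%c. Face0 l n i (\<rho> l (Suc n) c)" by (rule linear_mapI[OF T.module_MC[OF l] module_MC0 R])
 fix xs m assume xs: "xs \<in> tup (Suc n)" and m: "m \<in>. MCp triv l xs"
 show "\<rho> l n (T.Face l n i (T.elt l (Suc n) xs m)) = Face0 l n i (\<rho> l (Suc n) (T.elt l (Suc n) xs m))"
 proof (cases "pdeg xs = l")
  case False
  then have "m = zero (MCp triv l xs)" using m by (simp add: triv_simps)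
  then show ?thesis using T.elt_zero[of "Suc n" l xs] L.zero R.zero by simp
 next
  case True
  have tol: "xs \<in> tol l (Suc n)" using xs True by (simp add: tuples_of_length_def)
  have mK: "m \<in>. K" using m True by (simp add: triv_simps)
  have F: "face triv l n i xs m = (if keep i xs then T.elt l n (omit i xs) m else zero (Ch triv l n))"
  proof (cases "i = 0")
   case True
   then show ?thesis using keep_first[of xs] tuplesD[OF xs] T.elt_zero[of n l "omit 0 xs"] by (simp add: T.MC_face_0 triv_simps)
  qed (use T.MC_face_pos[OF xs _ i] in simp)
  interpret M: Module.module K "Ch0 l n" by (rule module_MC0)
  have FL: "K_linear K (Ch0 l (Suc n)) (Ch0 l n) (Face0 l n i)" by (rule linear_Face0[OF i])
  have "Face0 l n i (\<rho> l (Suc n) (T.elt l (Suc n) xs m)) = m \<odot>\<^bsub>Ch0 l n\<^esub> face0 l n i xs"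
   unfolding \<rho>_elt[OF tol mK] using FL mK free_module.basis_closed[OF free_module_K tol] Face0_basis[OF i tol]
   by (simp add: K_linear_def MC0_def)
  also have "... = \<rho> l n (face triv l n i xs m)"
   unfolding F MC0_face_eq[OF xs] using \<rho>_elt[OF omit_tol[OF tol i] mK] linear_map.zero[OF \<rho>_linear[OF l]] mK by simp
  finally show ?thesis using T.Face_elt[OF l i xs m] by simp
 qed
qed

lemma \<rho>_bd:
 assumes l: "l \<in> G" and c: "c \<in>. Ch triv l (Suc n)"
 shows "\<rho> l n (del triv l n c) = del0 l n (\<rho> l (Suc n) c)"
proof -
 interpret A: alt_module K "Ch0 l n" by (simp add: alt_module_def module_MC0)
 note r = linear_map.closed[OF \<rho>_linear[OF l]]
 have "\<rho> l n (del triv l n c) = alt_sum (Ch0 l n) (Suc n) (%i. \<rho> l n (T.Face l n i c))"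
  unfolding T.MC_bd_eq by (rule linear_map.alt_sum[OF \<rho>_linear[OF l]]) (rule linear_map.closed[OF T.linear_map_Face[OF l] c])
 also have "... = del0 l n (\<rho> l (Suc n) c)"
  unfolding MC0_bd_eq by (rule A.alt_sum_cong) (use \<rho>_Face[OF l _ c] K_linear_closed[OF linear_Face0 r[OF c]] in auto)
 finally show ?thesis .
qed

section \<open>Cochains without coefficients\<close>

abbreviation "C0 l k \<equiv> hom_mod K (Ch0 l k) (ring_mod K)"

abbreviation "bd0 l k \<equiv> %f. \<lambda>c\<in>carrier (Ch0 l (Suc k)). f (del0 l k c)"

abbreviation "b0 l n \<equiv> basis_elt K (tol l n)"

text \<open>A functional on a free module is the family of its values on the basis; at tuples of
  other lengths the coefficient module is zero.\<close>

definition "\<sigma> l n f = (\<lambda>xs\<in>tup n. if pdeg xs = l then f (b0 l n xs) else zero K)"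

lemma b0_closed: "xs \<in> tup n ==> pdeg xs = l ==> b0 l n xs \<in>. Ch0 l n"
 unfolding MC0_def by (rule free_module.basis_closed[OF free_module_K]) (simp add: tuples_of_length_def)

lemma module_C0: "Module.module K (C0 l k)"
 by (rule module_hom_mod[OF module_MC0 module_ring_mod[OF cring_K]])

lemma linear_bd0: "linear_map K (C0 l k) (C0 l (Suc k)) (bd0 l k)"
proof (rule linear_mapI[OF module_C0 module_C0])
 have "bd0 l k f \<in>. C0 l (Suc k)" if f: "f \<in>. C0 l k" for f
 proof -
  have F: "K_linear K (Ch0 l (Suc k)) (ring_mod K) (%c. f (del0 l k c))"
   using K_linear_comp[OF linear_map.linear[OF linear_MC0_bd[of l k]], of "ring_mod K" f] f by (simp add: hom_mod_simps)
  have "K_linear K (Ch0 l (Suc k)) (ring_mod K) (bd0 l k f)" by (rule K_linear_cong[OF _ module_MC0 F]) simp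
  then show ?thesis using K_linear_closed[OF F] by (auto simp: hom_mod_simps)
 qed
 then show "K_linear K (C0 l k) (C0 l (Suc k)) (bd0 l k)"
  using linear_map.closed[OF linear_MC0_bd] by (auto simp: K_linear_def hom_mod_simps(3,4) intro!: restrict_ext)
qed

lemma \<sigma>_linear:
 assumes l: "l \<in> G" shows "linear_map K (C0 l n) (CoCh triv l n) (\<sigma> l n)"
proof (rule linear_mapI[OF module_C0 T.module_coMC[OF l]])
 interpret cring K by (rule cring_K)
 have "f (b0 l n xs) \<in>. K" if "f \<in>. C0 l n" "xs \<in> tup n" "pdeg xs = l" for f xs
  using K_linear_closed[OF _ b0_closed[OF that(2,3)], of K "ring_mod K" f] that(1) by (simp add: hom_mod_simps ring_mod_simps)
 then show "K_linear K (C0 l n) (CoCh triv l n) (\<sigma> l n)"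
  by (auto simp: K_linear_def coMC_def prod_mod_simps \<sigma>_def triv_simps hom_mod_simps(3,4) ring_mod_simps b0_closed intro!: restrict_ext)
qed

lemma \<sigma>_bij:
 assumes l: "l \<in> G" shows "bij_betw (\<sigma> l n) (carrier (C0 l n)) (carrier (CoCh triv l n))"
 unfolding bij_betw_def
proof
 note R = module_ring_mod[OF cring_K]
 show "inj_on (\<sigma> l n) (carrier (C0 l n))"
 proof (rule inj_onI)
  fix f g assume fg: "f \<in>. C0 l n" "g \<in>. C0 l n" and e: "\<sigma> l n f = \<sigma> l n g"
  show "f = g"
  proof (rule extensional_eqI[of _ "carrier (Ch0 l n)"])
   show "f \<in> extensional (carrier (Ch0 l n))" "g \<in> extensional (carrier (Ch0 l n))"
    using fg by (auto simp: hom_mod_simps PiE_iff)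
   fix c assume "c \<in>. Ch0 l n"
   then have c: "c \<in>. free_mod K (tol l n)" by (simp add: MC0_def)
   have "f (b0 l n xs) = g (b0 l n xs)" if "xs \<in> tol l n" for xs
    using fun_cong[OF e, of xs] that by (simp add: \<sigma>_def tuples_of_length_def)
   then show "f c = g c"
    by (rule free_module.free_linear_eqI[OF free_module_K R _ _ _ c, rotated 2]) (use fg in "simp_all add: hom_mod_simps MC0_def")
  qed
 qed
 show "\<sigma> l n ` carrier (C0 l n) = carrier (CoCh triv l n)"
 proof (intro subset_antisym subsetI)
  fix \<alpha> assume a: "\<alpha> \<in>. CoCh triv l n"
  let ?F = "lin_ext K (tol l n) (ring_mod K) \<alpha>"
  have ac: "\<alpha> xs \<in>. ring_mod K" if "xs \<in> tol l n" for xs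
   using a that by (auto simp: coMC_def prod_mod_simps tuples_of_length_def triv_simps ring_mod_simps dest!: PiE_mem)
  have F: "K_linear K (Ch0 l n) (ring_mod K) ?F"
   unfolding MC0_def by (rule free_module.linear_lin_ext[OF free_module_K R ac])
  have Fb: "?F (b0 l n xs) = \<alpha> xs" if "xs \<in> tol l n" for xs
   by (rule free_module.lin_ext_basis[OF free_module_K R ac that])
  let ?f = "restrict ?F (carrier (Ch0 l n))"
  have f: "?f \<in>. C0 l n"
   using K_linear_closed[OF F] K_linear_cong[OF _ module_MC0 F, of ?f] by (auto simp: hom_mod_simps)
  have "\<alpha> xs = zero K" if "xs \<in> tup n" "pdeg xs \<noteq> l" for xs
   using a that by (auto simp: coMC_def prod_mod_simps triv_simps dest!: PiE_mem)
  moreover have "?f (b0 l n xs) = \<alpha> xs" if "xs \<in> tup n" "pdeg xs = l" for xs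
   using Fb[of xs] b0_closed[OF that] that by (simp add: tuples_of_length_def)
  ultimately have "\<sigma> l n ?f xs = \<alpha> xs" if "xs \<in> tup n" for xs
   unfolding \<sigma>_def using that by (cases "pdeg xs = l") simp_all
  then have "\<sigma> l n ?f = \<alpha>"
   using a by (intro extensional_eqI[of _ "tup n"]) (auto simp: \<sigma>_def coMC_def prod_mod_simps PiE_iff)
  then show "\<alpha> \<in> \<sigma> l n ` carrier (C0 l n)" by (rule rev_image_eqI[OF f sym])
 qed (use linear_map.closed[OF \<sigma>_linear[OF l]] in blast)
qed

text \<open>The last coface acts by the trivial module and so keeps its argument only if the last
  two points agree, which is \<open>keep_last\<close>.\<close>

lemma triv_coface:
 assumes xs: "xs \<in> tup (Suc n)" and i: "i <= Suc n"
 shows "coface triv l n i \<alpha> xs = (if keep i xs then \<alpha> (omit i xs) else zero K)"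
proof (cases "i <= n")
 case True
 then show ?thesis using T.coMC_coface_le[OF xs True] by (simp add: triv_simps)
next
 case False
 then have "i = Suc n" using i by simp
 then show ?thesis using keep_last[of xs n] tuplesD[OF xs] xs by (simp add: coMC_coface_def triv_simps)
qed

lemma \<sigma>_bd:
 assumes l: "l \<in> G" and f: "f \<in>. C0 l n"
 shows "\<sigma> l (Suc n) (bd0 l n f) = codel triv l n (\<sigma> l n f)"
proof (rule extensional_eqI[of _ "tup (Suc n)"])
 have s: "\<sigma> l n f \<in>. CoCh triv l n" by (rule linear_map.closed[OF \<sigma>_linear[OF l] f])
 have cc: "codel triv l n (\<sigma> l n f) \<in>. CoCh triv l (Suc n)"
  by (rule linear_map.closed[OF T.linear_map_coMC_cobd[OF l] s])
 then show "codel triv l n (\<sigma> l n f) \<in> extensional (tup (Suc n))" by (auto simp: coMC_def prod_mod_simps PiE_iff)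
 fix xs assume xs: "xs \<in> tup (Suc n)"
 show "\<sigma> l (Suc n) (bd0 l n f) xs = codel triv l n (\<sigma> l n f) xs"
 proof (cases "pdeg xs = l")
  case False
  then have "codel triv l n (\<sigma> l n f) xs = zero K"
   using cc xs by (auto simp: coMC_def prod_mod_simps triv_simps dest!: PiE_mem)
  then show ?thesis using xs False by (simp add: \<sigma>_def)
 next
  case True
  have tol: "xs \<in> tol l (Suc n)" using xs True by (simp add: tuples_of_length_def)
  have part: "coMCp triv l xs = ring_mod K" using True by (simp add: triv_def)
  have P: "linear_map K (CoCh triv l (Suc n)) (ring_mod K) (\<lambda>\<alpha>. \<alpha> xs)"
   unfolding coMC_def using module_family.linear_map_proj[OF T.coMC_family[OF l] xs] unfolding part .
  interpret f: linear_map K "Ch0 l n" "ring_mod K" f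
   using f by (intro linear_mapI module_MC0 module_ring_mod cring_K) (simp add: hom_mod_simps)
  interpret A: alt_module K "ring_mod K" by (simp add: alt_module_def f.cod.module_axioms)
  interpret B: alt_module K "Ch0 l n" by (simp add: alt_module_def f.dom.module_axioms)
  have b: "b0 l (Suc n) xs \<in>. Ch0 l (Suc n)" by (rule b0_closed[OF xs True])
  have "del0 l n (b0 l (Suc n) xs) = alt_sum (Ch0 l n) (Suc n) (%i. face0 l n i xs)"
   unfolding MC0_bd_eq by (rule B.alt_sum_cong) (use Face0_basis[OF _ tol] MC0_face_closed[OF tol] in auto)
  then have "\<sigma> l (Suc n) (bd0 l n f) xs = alt_sum (ring_mod K) (Suc n) (%i. f (face0 l n i xs))"
   using xs True b f.alt_sum[OF MC0_face_closed[OF tol], of "Suc n"] by (simp add: \<sigma>_def)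
  also have "... = alt_sum (ring_mod K) (Suc n) (%i. coface triv l n i (\<sigma> l n f) xs)"
  proof (rule A.alt_sum_cong)
   fix i assume i: "i <= Suc n"
   show "coface triv l n i (\<sigma> l n f) xs \<in>. ring_mod K"
    by (rule linear_map.closed[OF P linear_map.closed[OF T.linear_map_coface[OF l i] s]])
   have "\<sigma> l n f (omit i xs) = f (b0 l n (omit i xs))" if "keep i xs"
    using omit_tol[OF tol i that] by (simp add: \<sigma>_def tuples_of_length_def)
   then show "f (face0 l n i xs) = coface triv l n i (\<sigma> l n f) xs"
    unfolding MC0_face_eq[OF xs] triv_coface[OF xs i] using f.zero by (simp add: ring_mod_simps)
  qed
  also have "... = codel triv l n (\<sigma> l n f) xs"
   unfolding coMC_cobd_def by (rule linear_map.alt_sum[OF P, symmetric]) (rule linear_map.closed[OF T.linear_map_coface[OF l] s])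
  finally show ?thesis .
 qed
qed (simp add: \<sigma>_def)

section \<open>The right module of the trivial distance module is \<open>S\<close>\<close>

abbreviation "Sr \<equiv> S_right K G X d"

text \<open>The coefficients at the idempotents \<open>e_x\<close>: reduction modulo
  \<open>JX\<close> in coordinates.\<close>

definition "coef g a = (\<lambda>x\<in>X. if g = 0 then a (x, x) else zero K)"

definition "\<theta> g s = the_elem (coef g ` s)"

lemma coef_linear:
 assumes g: "g \<in> G" shows "linear_map K (Lam g) (gm_comp T.bar g) (coef g)"
proof (rule linear_mapI[OF module_ga T.bar_module[OF g]])
 interpret cring K by (rule cring_K)
 show "K_linear K (Lam g) (gm_comp T.bar g) (coef g)"
  unfolding K_linear_def ga_comp free_mod_def T.bar_comp sum_mod_finite[OF finite_X] prod_mod_simps sum_mod_simps coef_def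
  by (auto simp: triv_simps ring_mod_simps pairs_0 intro!: restrict_ext)
qed

lemma coef_ideal:
 assumes g: "g \<in> G" and j: "j \<in> JX g" shows "coef g j = zero (gm_comp T.bar g)"
proof (cases "g = 0")
 case True
 show ?thesis unfolding dist_ideal_0[OF g j True] by (rule linear_map.zero[OF coef_linear[OF g]])
qed (simp add: coef_def T.bar_comp sum_mod_simps triv_simps)

lemma quot_ideal: "g \<in> G ==> quotient_module K (Lam g) (JX g)"
 by (rule algebra_ideal.Lq[OF algebra_ideal])

lemma \<theta>_coset: "g \<in> G ==> a \<in>. Lam g ==> \<theta> g (JX g +>\<^bsub>Lam g\<^esub> a) = coef g a"
 unfolding \<theta>_def by (rule quot_lift(1)[OF quot_ideal coef_linear coef_ideal])

lemma Sr_comp: "gm_comp Sr g = quot_mod (Lam g) (JX g)"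
 by (simp add: right_quot_def)

lemma \<theta>_linear: "g \<in> G ==> linear_map K (gm_comp Sr g) (gm_comp T.bar g) (\<theta> g)"
 unfolding \<theta>_def[abs_def] Sr_comp by (rule quot_lift(2)[OF quot_ideal coef_linear coef_ideal])

text \<open>Checked on pairs: a product of two pairs has degree 0 only if both are of the form
  \<open>(x, x)\<close>, and the same pair at that; on the other side the trivial module lets only
  such pairs act nontrivially.\<close>

lemma coef_mult:
 assumes g: "g \<in> G" and h: "h \<in> G" and a: "a \<in>. Lam g" and b: "b \<in>. Lam h"
 shows "coef (g + h) (ga_mult \<Lambda> g h a b) = gm_act T.bar g h (coef g a) b"
proof -
 have gh: "g + h \<in> G" by (intro G_add g h)
 note c = linear_map.linear[OF coef_linear]
 note bm = T.bar_module[OF gh]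
 show ?thesis
 proof (rule free_module_pairs_eqI[OF bm _ _ _ b])
  show "K_linear K (Lam h) (gm_comp T.bar (g + h)) (%b. coef (g + h) (ga_mult \<Lambda> g h a b))"
   by (rule K_linear_comp[OF ga_mult_linear_r[OF a] c[OF gh]])
  show "K_linear K (Lam h) (gm_comp T.bar (g + h)) (%b. gm_act T.bar g h (coef g a) b)"
   by (rule T.bar_act_linear_r[OF g h linear_map.closed[OF coef_linear[OF g] a]])
  fix y' z assume yz: "y' \<in> X" "z \<in> X" "fin y' z" and he: "h = dr y' z"
  have e: "ee y' z \<in>. Lam h" unfolding he by (rule basis_ga[OF pairsI[OF yz]])
  show "coef (g + h) (ga_mult \<Lambda> g h a (ee y' z)) = gm_act T.bar g h (coef g a) (ee y' z)"
  proof (rule free_module_pairs_eqI[OF bm _ _ _ a])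
   show "K_linear K (Lam g) (gm_comp T.bar (g + h)) (%a. coef (g + h) (ga_mult \<Lambda> g h a (ee y' z)))"
    by (rule K_linear_comp[OF ga_mult_linear_l[OF e] c[OF gh]])
   show "K_linear K (Lam g) (gm_comp T.bar (g + h)) (%a. gm_act T.bar g h (coef g a) (ee y' z))"
    by (rule K_linear_comp[OF c[OF g] T.bar_act_linear_l[OF g h e]])
   fix x y assume xy: "x \<in> X" "y \<in> X" "fin x y" and ge: "g = dr x y"
   have cc: "coef g (ee x y) \<in>. gm_comp T.bar g"
    unfolding ge by (intro linear_map.closed[OF coef_linear] basis_ga pairsI xy dist_G)
   have z: "dr u v = 0 \<longleftrightarrow> u = v" if "u \<in> X" "v \<in> X" "fin u v" for u v
    using ee_dist_ideal(1)[OF that] that by (auto simp: dist_self)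
   have s: "dr x y + dr y' z = 0 \<longleftrightarrow> x = y & y' = z"
    using z[OF xy] z[OF yz] by (auto simp: add_nonneg_eq_0_iff)
   have L: "coef (g + h) (ga_mult \<Lambda> g h (ee x y) (ee y' z)) = (\<lambda>w\<in>X. if x = y & y' = z & y = y' & w = x then \<one>\<^bsub>K\<^esub> else zero K)"
    unfolding ge he ee_mult[OF xy yz] using between_refl s xy
    by (auto simp: coef_def basis_elt_def sum_incl_def ga_comp free_mod_def sum_mod_simps ring_mod_simps pairs_0 intro!: restrict_ext)
   have "gm_act T.bar g h (coef g (ee x y)) (ee y' z) = T.inj (g + h) z (dm_map triv y' z g (coef g (ee x y) y'))"
    using T.bar_act_ee[OF g cc yz] he by simp
   also have "... = (\<lambda>w\<in>X. if x = y & y' = z & y = y' & w = x then \<one>\<^bsub>K\<^esub> else zero K)"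
    using z[OF xy] yz xy unfolding ge
    by (auto simp: coef_def basis_elt_def sum_incl_def ring_mod_simps pairs_0 triv_simps dist_self intro!: restrict_ext)
   finally show "coef (g + h) (ga_mult \<Lambda> g h (ee x y) (ee y' z)) = gm_act T.bar g h (coef g (ee x y)) (ee y' z)" using L by simp
  qed
 qed
qed

lemma tensor_quotient_bar: "tensor_quotient K G \<Lambda> JX T.bar"
 by (rule right_mod.tensor_quotient[OF T.right_mod_bar])

lemma \<theta>_hom: "hom0 Sr T.bar \<theta>"
 unfolding graded_hom_0
proof (intro conjI ballI)
 fix g assume g: "g \<in> G"
 show "K_linear K (gm_comp Sr g) (gm_comp T.bar g) (\<theta> g)" by (rule linear_map.linear[OF \<theta>_linear[OF g]])
 fix h s b assume h: "h \<in> G" and s: "s \<in>. gm_comp Sr g" and b: "b \<in>. Lam h"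
 obtain a where a: "a \<in>. Lam g" "s = JX g +>\<^bsub>Lam g\<^esub> a"
  using tensor_quotient.S_cases[OF tensor_quotient_bar g s] .
 show "\<theta> (g + h) (gm_act Sr g h s b) = gm_act T.bar g h (\<theta> g s) b"
  unfolding a(2) algebra_ideal.right_act[OF algebra_ideal g h b a(1)] \<theta>_coset[OF G_add[OF g h] ga_mult_closed[OF a(1) b]] \<theta>_coset[OF g a(1)]
  by (rule coef_mult[OF g h a(1) b])
qed

text \<open>By \<open>dist_ideal_eq\<close> the kernel of \<open>coef\<close> is \<open>JX\<close>:
  in degree 0 the coefficients at the \<open>e_x\<close> are all there is, and in other degrees both
  quotients are zero.\<close>

lemma \<theta>_bij: assumes g: "g \<in> G" shows "bij_betw (\<theta> g) (carrier (gm_comp Sr g)) (carrier (gm_comp T.bar g))"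
 unfolding bij_betw_def
proof
 interpret cring K by (rule cring_K)
 show "inj_on (\<theta> g) (carrier (gm_comp Sr g))"
 proof (rule linear_map.inj_onI_kernel[OF \<theta>_linear[OF g]])
  fix s assume s: "s \<in>. gm_comp Sr g" and 0: "\<theta> g s = zero (gm_comp T.bar g)"
  obtain a where a: "a \<in>. Lam g" "s = JX g +>\<^bsub>Lam g\<^esub> a"
   using tensor_quotient.S_cases[OF tensor_quotient_bar g s] .
  have c: "coef g a = zero (gm_comp T.bar g)" using 0 \<theta>_coset[OF g a(1)] a(2) by simp
  have "a \<in> JX g"
  proof (cases "g = 0")
   case True
   have "a (x, x) = zero K" if "x \<in> X" for x
    using fun_cong[OF c, of x] that True by (simp add: coef_def T.bar_comp sum_mod_simps triv_simps)
   then have "a = zero (Lam 0)"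
    using a(1) True by (intro extensional_eqI[of _ "prs 0"]) (auto simp: ga_comp free_mod_def sum_mod_simps PiE_iff pairs_0 ring_mod_simps)
   then show ?thesis using dist_ideal_eq(1)[OF g] True by simp
  qed (use dist_ideal_eq(1)[OF g] a(1) in simp)
  then show "s = zero (gm_comp Sr g)" unfolding a(2) Sr_comp using quotient_module.coset_zero_iff[OF quot_ideal[OF g] a(1)] by simp
 qed
 show "\<theta> g ` carrier (gm_comp Sr g) = carrier (gm_comp T.bar g)"
 proof (intro subset_antisym subsetI)
  fix m assume m: "m \<in>. gm_comp T.bar g"
  \<comment> \<open>In degree 0 the family \<open>m\<close> is used as the coefficients of a
    combination of the idempotents.\<close>
  define a where "a = (\<lambda>p\<in>prs g. if g = 0 then m (fst p) else zero K)"
  have fin: "finite (prs g)" by (rule finite_subset[of _ "X \<times> X"]) (auto simp: pairs_def finite_X)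
  have a: "a \<in>. Lam g"
   unfolding ga_comp free_mod_def sum_mod_finite[OF fin] prod_mod_simps using m unfolding T.bar_carrier
   by (auto simp: a_def ring_mod_simps triv_simps pairs_0 PiE_iff)
  have "coef g a = m"
   using m unfolding T.bar_carrier
   by (intro extensional_eqI[of _ X]) (auto simp: coef_def a_def triv_simps PiE_iff pairs_0)
  then have "\<theta> g (JX g +>\<^bsub>Lam g\<^esub> a) = m" using \<theta>_coset[OF g a] by simp
  moreover have "JX g +>\<^bsub>Lam g\<^esub> a \<in>. gm_comp Sr g"
   unfolding Sr_comp algebra_ideal.co_carrier[OF algebra_ideal g] using a by blast
  ultimately show "m \<in> \<theta> g ` carrier (gm_comp Sr g)" by blast
 qed (use linear_map.closed[OF \<theta>_linear[OF g]] in blast)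
qed

lemma \<theta>_zero: "g \<in> G ==> s \<in>. gm_comp Sr g ==> \<theta> g s = zero (gm_comp T.bar g) \<longleftrightarrow> s = zero (gm_comp Sr g)"
proof -
 assume g: "g \<in> G" and s: "s \<in>. gm_comp Sr g"
 interpret t: linear_map K "gm_comp Sr g" "gm_comp T.bar g" "\<theta> g" by (rule \<theta>_linear[OF g])
 show ?thesis using inj_on_eq_iff[OF bij_betw_imp_inj_on[OF \<theta>_bij[OF g]] s t.dom.M.zero_closed] t.zero by simp
qed

text \<open>Only the augmentation changes: followed by an isomorphism it keeps its kernel and
  remains onto.\<close>

lemma projective_resolution_triv:
 assumes "projective_resolution K G \<Lambda> Sr P bd aug"
 shows "projective_resolution K G \<Lambda> T.bar P bd (%g p. \<theta> g (aug g p))"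
proof -
 have aug: "hom0 (P 0) Sr aug" and surj: "!!g. g \<in> G ==> aug g ` carrier (gm_comp (P 0) g) = carrier (gm_comp Sr g)"
  using assms by (simp_all add: projective_resolution_def)
 have c: "aug g p \<in>. gm_comp Sr g" if "g \<in> G" "p \<in>. gm_comp (P 0) g" for g p using surj that by blast
 have "(%p. \<theta> g (aug g p)) ` carrier (gm_comp (P 0) g) = carrier (gm_comp T.bar g)" if "g \<in> G" for g
  using surj[OF that] bij_betw_imp_surj_on[OF \<theta>_bij[OF that]] by (simp flip: image_image)
 moreover have "{p \<in> carrier (gm_comp (P 0) g). \<theta> g (aug g p) = zero (gm_comp T.bar g)} =
   {p \<in> carrier (gm_comp (P 0) g). aug g p = zero (gm_comp Sr g)}" if "g \<in> G" for g
  using \<theta>_zero[OF that c[OF that]] by blast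
 ultimately show ?thesis using assms graded_hom_comp[OF aug \<theta>_hom] by (simp add: projective_resolution_def)
qed

text \<open>The coaugmentation leaves \<open>S\<close>, so it is preceded by the inverse of
  \<open>\<theta>\<close>; its image stays the same.\<close>

lemma injective_resolution_triv:
 assumes "injective_resolution K G \<Lambda> Sr I cobd coaug"
 shows "injective_resolution K G \<Lambda> T.bar I cobd (%g m. coaug g (inv_into (carrier (gm_comp Sr g)) (\<theta> g) m))"
proof -
 let ?i = "%g. inv_into (carrier (gm_comp Sr g)) (\<theta> g)"
 have coaug: "hom0 Sr (I 0) coaug" and inj: "!!g. g \<in> G ==> inj_on (coaug g) (carrier (gm_comp Sr g))"
  using assms by (simp_all add: injective_resolution_def)
 have i: "hom0 T.bar Sr ?i"
  by (rule graded_hom_inv_into[OF \<theta>_hom \<theta>_bij tensor_quotient.S_module[OF tensor_quotient_bar] T.bar_module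
     tensor_quotient.S_act_closed[OF tensor_quotient_bar] G_add])
 note b = bij_betw_inv_into[OF \<theta>_bij]
 have "inj_on (%m. coaug g (?i g m)) (carrier (gm_comp T.bar g))" if "g \<in> G" for g
  using comp_inj_on[OF bij_betw_imp_inj_on[OF b[OF that]], of "coaug g"] inj[OF that] bij_betw_imp_surj_on[OF b[OF that]] by (simp add: comp_def)
 moreover have "(%m. coaug g (?i g m)) ` carrier (gm_comp T.bar g) = coaug g ` carrier (gm_comp Sr g)" if "g \<in> G" for g
  using bij_betw_imp_surj_on[OF b[OF that]] by (simp flip: image_image)
 ultimately show ?thesis using assms graded_hom_comp[OF i coaug] by (simp add: injective_resolution_def)
qed

theorem MH0_Tor:
 assumes "projective_resolution K G \<Lambda> Sr P bd aug" "l \<in> G"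
 shows "mod_iso K (MH0 K X d n l) (Tor_via K G \<Lambda> P bd (S_left K G X d) n l)"
 unfolding MH0_def
 by (rule T.homology_Tor[OF projective_resolution_triv[OF assms(1)] assms(2) \<rho>_linear[OF assms(2)] \<rho>_bij[OF assms(2)] linear_MC0_bd])
  (rule \<rho>_bd[OF assms(2)])

theorem coMH0_Ext:
 assumes "injective_resolution K G \<Lambda> Sr I cobd coaug" "l \<in> G"
 shows "mod_iso K (coMH0 K X d n l) (Ext_via K G \<Lambda> Sr I cobd n l)"
 unfolding coMH0_def
 by (rule T.cohomology_Ext[OF injective_resolution_triv[OF assms(1)] assms(2) \<sigma>_linear[OF assms(2)] \<sigma>_bij[OF assms(2)] linear_bd0])
  (rule \<sigma>_bd[OF assms(2)])

end

text \<open>The element types \<open>'p\<close>, \<open>'i\<close>, \<open>'q\<close> and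
  \<open>'j\<close> of the four resolutions are free type variables, so each clause holds for
  resolutions on any type.\<close>

theorem theorem5p3:
  fixes K :: "'k ring" and G :: "real set" and X :: "'x set"
    and d :: "'x \<Rightarrow> 'x \<Rightarrow> ennreal" and M :: "('x, 'k, 'm) dist_module"
    and n :: int and l :: real
  assumes "cring K"
    and "subgroup G real_group"
    and "finite X"
    and "quasimetric X d"
    and "\<forall>x\<in>X. \<forall>y\<in>X. d x y < \<infinity> \<longrightarrow> enn2real (d x y) \<in> G"
    and "distance_module K G X d M"
    and "l \<in> G"
  shows
    "(\<forall>(P :: nat \<Rightarrow> ('k, 'x \<times> 'x \<Rightarrow> 'k, 'p) graded_module) bd aug.
        projective_resolution K G (dist_algebra K X d) (bar_module K X d M) P bd aug \<longrightarrow>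
        mod_iso K (MH X d M n l)
          (Tor_via K G (dist_algebra K X d) P bd (S_left K G X d) n l)) \<and>
     (\<forall>(I :: nat \<Rightarrow> ('k, 'x \<times> 'x \<Rightarrow> 'k, 'i) graded_module) cobd coaug.
        injective_resolution K G (dist_algebra K X d) (bar_module K X d M) I cobd coaug \<longrightarrow>
        mod_iso K (coMH X d M n l)
          (Ext_via K G (dist_algebra K X d) (S_right K G X d) I cobd n l)) \<and>
     (\<forall>(P :: nat \<Rightarrow> ('k, 'x \<times> 'x \<Rightarrow> 'k, 'q) graded_module) bd aug.
        projective_resolution K G (dist_algebra K X d) (S_right K G X d) P bd aug \<longrightarrow>
        mod_iso K (MH0 K X d n l)
          (Tor_via K G (dist_algebra K X d) P bd (S_left K G X d) n l)) \<and>
     (\<forall>(I :: nat \<Rightarrow> ('k, 'x \<times> 'x \<Rightarrow> 'k, 'j) graded_module) cobd coaug.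
        injective_resolution K G (dist_algebra K X d) (S_right K G X d) I cobd coaug \<longrightarrow>
        mod_iso K (coMH0 K X d n l)
          (Ext_via K G (dist_algebra K X d) (S_right K G X d) I cobd n l))"
proof -
  interpret dist_space K G X d by (rule dist_space.intro) (use assms in auto)
  interpret M: dist_mod K G X d M by unfold_locales (rule assms(6))
  show ?thesis
  proof (intro conjI allI impI)
    fix P :: "nat \<Rightarrow> ('k, 'x \<times> 'x \<Rightarrow> 'k, 'p) graded_module" and bd aug
    assume res: "projective_resolution K G \<Lambda> M.bar P bd aug"
    show "mod_iso K (MH X d M n l) (Tor_via K G \<Lambda> P bd (S_left K G X d) n l)"
      \<comment> \<open>With coefficients the comparison bijection is the identity of the magnitude
        complex.\<close>
      unfolding MH_def
      by (rule M.homology_Tor[OF res assms(7), of "MC X d M l" "\<lambda>_ c. c"])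
        (use assms(7) M.module_MC M.linear_map_MC_bd in \<open>auto simp: bij_betw_def K_linear_def intro!: linear_mapI\<close>)
  next
    fix I :: "nat \<Rightarrow> ('k, 'x \<times> 'x \<Rightarrow> 'k, 'i) graded_module" and cobd coaug
    assume res: "injective_resolution K G \<Lambda> M.bar I cobd coaug"
    show "mod_iso K (coMH X d M n l) (Ext_via K G \<Lambda> (S_right K G X d) I cobd n l)"
      unfolding coMH_def
      by (rule M.cohomology_Ext[OF res assms(7), of "coMC X d M l" "\<lambda>_ c. c"])
        (use assms(7) M.module_coMC M.linear_map_coMC_cobd in \<open>auto simp: bij_betw_def K_linear_def intro!: linear_mapI\<close>)
  qed (use MH0_Tor coMH0_Ext assms(7) in blast)+
qed


end
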